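(* Let $K$ be an infinite field, let $E$ be a row-finite directed graph, and let $H=K^\times$. Letting $h\in K^\times$ act on $L_K(E)$ by the $K$-linear map determined by $h\cdot a=h^n a$ for $a\in L_K(E)$ homogeneous of degree $n$ defines a rational action of $H$ on $L_K(E)$ by $K$-algebra automorphisms, and this action induces the decomposition of $\mathrm{Spec}(L_K(E))$ into the strata $\mathrm{Spec}_M(L_K(E))$, $M\in\mathcal{M}(E)$, in the following sense: (a) the $H$-primes of $L_K(E)$ are exactly the graded prime ideals, and $P\mapsto E^0\setminus(P\cap E^0)$ is a bijection from the set of $H$-primes onto the set $\mathcal{M}(E)$ of maximal tails of $E$; (b) if $P$ is an $H$-prime and $M=E^0\setminus(P\cap E^0)$ is the corresponding maximal tail, then $\mathrm{Spec}_P(L_K(E))=\mathrm{Spec}_M(L_K(E))$; (c) an $H$-prime is primitive if and only if it is maximal (under inclusion) in its $H$-stratum, and the non-primitive $H$-primes are exactly those whose $H$-stratum is $1$-dimensional (that is, homeomorphic to $\mathrm{Spec}(K[x,x^{-1}])$).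
   Context: Directed graphs. A directed graph $E=(E^0,E^1,r,s)$ consists of a set $E^0$ of vertices, a set $E^1$ of edges, and maps $r,s:E^1\to E^0$ (range and source); loops and parallel edges are allowed. $E$ is row-finite if $s^{-1}(v)$ is finite for every $v\in E^0$. For $v,w\in E^0$ write $v\ge w$ if $v=w$ or there is a path (sequence of edges $e_1\cdots e_n$ with $r(e_i)=s(e_{i+1})$) with $s(e_1)=v$ and $r(e_n)=w$. Leavitt path algebras. For a row-finite graph $E$ and a field $K$, $L_K(E)$ is the (associative, possibly non-unital) $K$-algebra generated by a set $\{v\mid v\in E^0\}$ of pairwise orthogonal idempotents together with a set of variables $\{e,e^*\mid e\in E^1\}$, subject to the relations: (1) $s(e)e=er(e)=e$ for all $e\in E^1$; (2) $r(e)e^*=e^*s(e)=e^*$ for all $e\in E^1$; (3) $e^*e'=\delta_{e,e'}r(e)$ for all $e,e'\in E^1$; (4) $v=\sum_{e\in E^1,\, s(e)=v}ee^*$ for every $v\in E^0$ with $s^{-1}(v)\neq\emptyset$. $L_K(E)$ is $\mathbb{Z}$-graded with $v$, $e$, $e^*$ of degree $0$, $1$, $-1$ respectively; an ideal is graded if it is generated by (equivalently, is the sum of) its homogeneous components. Maximal tails. A nonempty subset $M\subseteq E^0$ is a maximal tail if: (1) $v\in E^0$, $w\in M$ and $v\ge w$ imply $v\in M$; (2) if $v\in M$ and $s^{-1}(v)\neq\emptyset$ then there is $e\in E^1$ with $s(e)=v$ and $r(e)\in M$; (3) if $v,w\in M$ then there is $y\in M$ with $v\ge y$ and $w\ge y$.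 $\mathcal{M}(E)$ is the set of maximal tails. Spectra and strata. $\mathrm{Spec}(A)$ is the set of (proper two-sided) prime ideals of $A$ with the Zariski topology. For $M\in\mathcal{M}(E)$, $\mathrm{Spec}_M(L_K(E))=\{P\in\mathrm{Spec}(L_K(E)) : P\cap E^0=E^0\setminus M\}$. An ideal is primitive if it is the annihilator of a simple right module. Rational actions. An action of an affine algebraic group $H$ over $K$ on a $K$-algebra $A$ by automorphisms is rational if there is a $K$-algebra homomorphism $\Delta:A\to A\otimes_K K[H]$, $a\mapsto\sum_i b_i\otimes f_i$, such that $h\cdot a=\sum_i f_i(h)b_i$ for all $h\in H$, where $K[H]$ is the algebra of regular functions on $H$ (for $H=K^\times$, $K[H]=K[x,x^{-1}]$). An $H$-prime of $L_K(E)$ means an $H$-invariant prime ideal. For an $H$-prime $P$, the $H$-stratum $\mathrm{Spec}_P(L_K(E))$ is the set of primes $Q$ of $L_K(E)$ such that $P$ is the largest $H$-prime contained in $Q$, with the subspace topology. *)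

theory Defs
  imports
    "HOL-Algebra.QuotRing"
    "HOL-Algebra.Module"
    "HOL-Library.Poly_Mapping"
    "HOL-Library.FuncSet"
    "HOL-Analysis.Abstract_Topology"
    "Graph_Theory.Digraph"
begin

section \<open>Rings and algebras without unit\<close>

text \<open>
  Associative rings that need not have a unit are represented by the ring records of HOL-Algebra,
  and algebras over a field \<open>'k\<close> by its module records, which add a scalar multiplication. The
  field \<^const>\<open>one\<close> of these records plays no role in any of the definitions below; in the
  non-unital examples it need not lie in the carrier.
\<close>

locale rng = abelian_group R for R (structure) +
  assumes rng_m_closed: "\<lbrakk>x \<in> carrier R; y \<in> carrier R\<rbrakk> \<Longrightarrow> x \<otimes> y \<in> carrier R"
    and rng_m_assoc: "\<lbrakk>x \<in> carrier R; y \<in> carrier R; z \<in> carrier R\<rbrakk>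
          \<Longrightarrow> (x \<otimes> y) \<otimes> z = x \<otimes> (y \<otimes> z)"
    and rng_l_distr: "\<lbrakk>x \<in> carrier R; y \<in> carrier R; z \<in> carrier R\<rbrakk>
          \<Longrightarrow> (x \<oplus> y) \<otimes> z = x \<otimes> z \<oplus> y \<otimes> z"
    and rng_r_distr: "\<lbrakk>x \<in> carrier R; y \<in> carrier R; z \<in> carrier R\<rbrakk>
          \<Longrightarrow> z \<otimes> (x \<oplus> y) = z \<otimes> x \<oplus> z \<otimes> y"

definition two_sided_ideal :: "'a set \<Rightarrow> ('a, 'm) ring_scheme \<Rightarrow> bool" where
  "two_sided_ideal I R \<longleftrightarrow> additive_subgroup I R \<and>
     (\<forall>a\<in>carrier R. \<forall>x\<in>I. a \<otimes>\<^bsub>R\<^esub> x \<in> I \<and> x \<otimes>\<^bsub>R\<^esub> a \<in> I)"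

text \<open>As \<open>P\<close> is closed under addition, the third conjunct says that \<open>I J \<subseteq> P\<close> implies
  \<open>I \<subseteq> P\<close> or \<open>J \<subseteq> P\<close>, for the product ideal \<open>I J\<close>.\<close>

definition prime_two_sided_ideal :: "('a, 'm) ring_scheme \<Rightarrow> 'a set \<Rightarrow> bool" where
  "prime_two_sided_ideal R P \<longleftrightarrow> two_sided_ideal P R \<and> P \<noteq> carrier R \<and>
     (\<forall>I J. two_sided_ideal I R \<longrightarrow> two_sided_ideal J R \<longrightarrow>
        (\<forall>x\<in>I. \<forall>y\<in>J. x \<otimes>\<^bsub>R\<^esub> y \<in> P) \<longrightarrow> I \<subseteq> P \<or> J \<subseteq> P)"

definition prime_spectrum :: "('a, 'm) ring_scheme \<Rightarrow> 'a set set" where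
  "prime_spectrum R = {P. prime_two_sided_ideal R P}"

definition zariski_open :: "('a, 'm) ring_scheme \<Rightarrow> 'a set set \<Rightarrow> bool" where
  "zariski_open R U \<longleftrightarrow>
     (\<exists>I. two_sided_ideal I R \<and> U = {P \<in> prime_spectrum R. \<not> I \<subseteq> P})"

definition zariski :: "('a, 'm) ring_scheme \<Rightarrow> 'a set topology" where
  "zariski R = topology (zariski_open R)"

lemma two_sided_idealD:
  assumes "two_sided_ideal I R"
  shows "additive_subgroup I R" "I \<subseteq> carrier R"
    and "\<And>a x. a \<in> carrier R \<Longrightarrow> x \<in> I \<Longrightarrow> a \<otimes>\<^bsub>R\<^esub> x \<in> I"
    and "\<And>a x. a \<in> carrier R \<Longrightarrow> x \<in> I \<Longrightarrow> x \<otimes>\<^bsub>R\<^esub> a \<in> I"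
  using assms additive_subgroup.a_subset by (auto simp: two_sided_ideal_def)

lemma two_sided_ideal_Inter:
  assumes "\<And>I. I \<in> \<I> \<Longrightarrow> two_sided_ideal I R" "\<I> \<noteq> {}"
  shows "two_sided_ideal (\<Inter>\<I>) R"
proof -
  have sub: "subgroup I (add_monoid R)" if "I \<in> \<I>" for I
    using assms(1)[OF that] by (simp add: two_sided_ideal_def additive_subgroup_def)
  have "subgroup (\<Inter>\<I>) (add_monoid R)"
    using sub assms(2)
    by (intro subgroup.intro InterI)
       (blast dest: subgroup.subset, (blast intro: subgroup.m_closed subgroup.one_closed subgroup.m_inv_closed)+)
  then show ?thesis
    using assms(1) unfolding two_sided_ideal_def additive_subgroup_def by blast
qed

lemma (in rng) istopology_zariski_open: "istopology (zariski_open R)"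
  unfolding istopology_def
proof (intro conjI allI impI)
  fix U V assume "zariski_open R U" "zariski_open R V"
  then obtain I J where I: "two_sided_ideal I R" "U = {P \<in> prime_spectrum R. \<not> I \<subseteq> P}"
    and J: "two_sided_ideal J R" "V = {P \<in> prime_spectrum R. \<not> J \<subseteq> P}"
    by (auto simp: zariski_open_def)
  have "two_sided_ideal (I \<inter> J) R"
    using two_sided_ideal_Inter[of "{I, J}" R] I(1) J(1) by auto
  moreover have "U \<inter> V = {P \<in> prime_spectrum R. \<not> I \<inter> J \<subseteq> P}"
  proof -
    have "I \<subseteq> P \<or> J \<subseteq> P" if "P \<in> prime_spectrum R" "I \<inter> J \<subseteq> P" for P
    proof -
      have "\<forall>x\<in>I. \<forall>y\<in>J. x \<otimes> y \<in> P"
        using two_sided_idealD(2,4)[OF I(1)] two_sided_idealD(2,3)[OF J(1)] that(2)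
        by (meson IntI subsetD)
      then show ?thesis
        using that(1) I(1) J(1) by (auto simp: prime_spectrum_def prime_two_sided_ideal_def)
    qed
    then show ?thesis using I(2) J(2) by auto
  qed
  ultimately show "zariski_open R (U \<inter> V)" by (auto simp: zariski_open_def)
next
  fix \<U> assume \<U>: "\<forall>U\<in>\<U>. zariski_open R U"
  define \<I> where "\<I> = {I. two_sided_ideal I R \<and> {P \<in> prime_spectrum R. \<not> I \<subseteq> P} \<in> \<U>}"
  define G where "G = \<Inter>{I. two_sided_ideal I R \<and> \<Union>\<I> \<subseteq> I}"
  have "two_sided_ideal (carrier R) R"
    using rng_m_closed add.subgroup_self by (simp add: two_sided_ideal_def additive_subgroup_def)
  moreover have "\<Union>\<I> \<subseteq> carrier R"
    using two_sided_idealD(2) by (auto simp: \<I>_def)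
  ultimately have G: "two_sided_ideal G R"
    unfolding G_def by (intro two_sided_ideal_Inter) auto
  have GP: "G \<subseteq> P \<longleftrightarrow> \<Union>\<I> \<subseteq> P" if "P \<in> prime_spectrum R" for P
  proof
    have "\<Union>\<I> \<subseteq> G" unfolding G_def by (rule Inter_greatest) simp
    then show "\<Union>\<I> \<subseteq> P" if "G \<subseteq> P" using that by (rule subset_trans)
    have "two_sided_ideal P R"
      using that by (simp add: prime_spectrum_def prime_two_sided_ideal_def)
    then show "G \<subseteq> P" if "\<Union>\<I> \<subseteq> P"
      unfolding G_def using that by (intro Inter_lower) simp
  qed
  have "\<Union>\<U> = {P \<in> prime_spectrum R. \<not> \<Union>\<I> \<subseteq> P}"
  proof (intro equalityI subsetI)
    fix P assume "P \<in> \<Union>\<U>"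
    then obtain U where U: "U \<in> \<U>" "P \<in> U" by auto
    have "zariski_open R U" using \<U> U(1) by blast
    then obtain I where "two_sided_ideal I R" "U = {P \<in> prime_spectrum R. \<not> I \<subseteq> P}"
      by (auto simp: zariski_open_def)
    with U show "P \<in> {P \<in> prime_spectrum R. \<not> \<Union>\<I> \<subseteq> P}"
      by (auto simp: \<I>_def)
  next
    fix P assume "P \<in> {P \<in> prime_spectrum R. \<not> \<Union>\<I> \<subseteq> P}"
    then obtain I where "I \<in> \<I>" "P \<in> {P \<in> prime_spectrum R. \<not> I \<subseteq> P}" by auto
    then show "P \<in> \<Union>\<U>" unfolding \<I>_def by (metis (mono_tags, lifting) UnionI mem_Collect_eq)
  qed
  also have "\<dots> = {P \<in> prime_spectrum R. \<not> G \<subseteq> P}"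
    using GP by auto
  finally show "zariski_open R (\<Union>\<U>)" using G by (auto simp: zariski_open_def)
qed

lemma (in rng) openin_zariski: "openin (zariski R) = zariski_open R"
  by (simp add: zariski_def istopology_zariski_open)

text \<open>In a module record \<open>M\<close> over the elements of \<open>R\<close>, the term \<open>a \<odot>\<^bsub>M\<^esub> m\<close> denotes the result
  \<open>m \<cdot> a\<close> of the action of \<open>a\<close> from the right; hence the order of the factors in the last axiom.\<close>

definition right_module :: "('a, 'm) ring_scheme \<Rightarrow> ('a, 'b) module \<Rightarrow> bool" where
  "right_module R M \<longleftrightarrow> abelian_group M \<and>
     (\<forall>a\<in>carrier R. \<forall>m\<in>carrier M. a \<odot>\<^bsub>M\<^esub> m \<in> carrier M) \<and>
     (\<forall>a\<in>carrier R. \<forall>m\<in>carrier M. \<forall>m'\<in>carrier M.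
        a \<odot>\<^bsub>M\<^esub> (m \<oplus>\<^bsub>M\<^esub> m') = a \<odot>\<^bsub>M\<^esub> m \<oplus>\<^bsub>M\<^esub> a \<odot>\<^bsub>M\<^esub> m') \<and>
     (\<forall>a\<in>carrier R. \<forall>b\<in>carrier R. \<forall>m\<in>carrier M.
        (a \<oplus>\<^bsub>R\<^esub> b) \<odot>\<^bsub>M\<^esub> m = a \<odot>\<^bsub>M\<^esub> m \<oplus>\<^bsub>M\<^esub> b \<odot>\<^bsub>M\<^esub> m) \<and>
     (\<forall>a\<in>carrier R. \<forall>b\<in>carrier R. \<forall>m\<in>carrier M.
        (a \<otimes>\<^bsub>R\<^esub> b) \<odot>\<^bsub>M\<^esub> m = b \<odot>\<^bsub>M\<^esub> (a \<odot>\<^bsub>M\<^esub> m))"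

definition right_submodule :: "('a, 'm) ring_scheme \<Rightarrow> ('a, 'b) module \<Rightarrow> 'b set \<Rightarrow> bool" where
  "right_submodule R M N \<longleftrightarrow> additive_subgroup N M \<and>
     (\<forall>a\<in>carrier R. \<forall>m\<in>N. a \<odot>\<^bsub>M\<^esub> m \<in> N)"

text \<open>As usual for rings without unit, a simple module has a non-zero action.\<close>

definition simple_right_module :: "('a, 'm) ring_scheme \<Rightarrow> ('a, 'b) module \<Rightarrow> bool" where
  "simple_right_module R M \<longleftrightarrow> right_module R M \<and>
     (\<exists>a\<in>carrier R. \<exists>m\<in>carrier M. a \<odot>\<^bsub>M\<^esub> m \<noteq> \<zero>\<^bsub>M\<^esub>) \<and>
     (\<forall>N. right_submodule R M N \<longrightarrow> N = {\<zero>\<^bsub>M\<^esub>} \<or> N = carrier M)"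

definition right_annihilator :: "('a, 'm) ring_scheme \<Rightarrow> ('a, 'b) module \<Rightarrow> 'a set" where
  "right_annihilator R M = {a \<in> carrier R. \<forall>m\<in>carrier M. a \<odot>\<^bsub>M\<^esub> m = \<zero>\<^bsub>M\<^esub>}"

text \<open>
  The quantifier over modules has to fix a type for their elements. Sets of ring elements suffice:
  a simple right module is \<open>m R\<close> for some \<open>m\<close>, so it is isomorphic to the quotient of \<open>R\<close> by a
  right ideal. Lemma \<open>primitive_ideal_annihilator\<close> below confirms that annihilators of simple
  modules over every other type are covered.
\<close>

definition primitive_ideal :: "('a, 'm) ring_scheme \<Rightarrow> 'a set \<Rightarrow> bool" where
  "primitive_ideal R P \<longleftrightarrow>
     (\<exists>M :: ('a, 'a set) module. simple_right_module R M \<and> P = right_annihilator R M)"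

lemma (in rng) primitive_ideal_annihilator:
  fixes M :: "('a, 'c) module"
  assumes "simple_right_module R M"
  shows "primitive_ideal R (right_annihilator R M)"
proof -
  interpret M: abelian_group M
    using assms by (simp add: simple_right_module_def right_module_def)
  have act: "a \<odot>\<^bsub>M\<^esub> m \<in> carrier M" if "a \<in> carrier R" "m \<in> carrier M" for a m
    using assms that by (simp add: simple_right_module_def right_module_def)
  have actr: "a \<odot>\<^bsub>M\<^esub> (m \<oplus>\<^bsub>M\<^esub> m') = a \<odot>\<^bsub>M\<^esub> m \<oplus>\<^bsub>M\<^esub> a \<odot>\<^bsub>M\<^esub> m'"
    if "a \<in> carrier R" "m \<in> carrier M" "m' \<in> carrier M" for a m m'
    using assms that by (simp add: simple_right_module_def right_module_def)
  have actl: "(a \<oplus> b) \<odot>\<^bsub>M\<^esub> m = a \<odot>\<^bsub>M\<^esub> m \<oplus>\<^bsub>M\<^esub> b \<odot>\<^bsub>M\<^esub> m"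
    if "a \<in> carrier R" "b \<in> carrier R" "m \<in> carrier M" for a b m
    using assms that by (simp add: simple_right_module_def right_module_def)
  have actm: "(a \<otimes> b) \<odot>\<^bsub>M\<^esub> m = b \<odot>\<^bsub>M\<^esub> (a \<odot>\<^bsub>M\<^esub> m)"
    if "a \<in> carrier R" "b \<in> carrier R" "m \<in> carrier M" for a b m
    using assms that by (simp add: simple_right_module_def right_module_def)
  obtain a0 m where m: "m \<in> carrier M" "a0 \<in> carrier R" "a0 \<odot>\<^bsub>M\<^esub> m \<noteq> \<zero>\<^bsub>M\<^esub>"
    using assms by (auto simp: simple_right_module_def)
  have zero_act: "\<zero> \<odot>\<^bsub>M\<^esub> m = \<zero>\<^bsub>M\<^esub>"
    using actl[of \<zero> \<zero> m] act[of \<zero> m] m(1) by (metis M.add.l_cancel_one' l_zero zero_closed)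
  have neg_act: "\<ominus>\<^bsub>M\<^esub> (a \<odot>\<^bsub>M\<^esub> m) = (\<ominus> a) \<odot>\<^bsub>M\<^esub> m" if "a \<in> carrier R" for a
    using actl[of "\<ominus> a" a m] act m(1) that zero_act
    by (metis M.minus_equality a_inv_closed l_neg)
  define N where "N = (\<lambda>a. a \<odot>\<^bsub>M\<^esub> m) ` carrier R"
  have "right_submodule R M N"
    unfolding right_submodule_def
  proof
    show "additive_subgroup N M"
    proof (rule additive_subgroup.intro, rule M.add.subgroupI)
      show "N \<subseteq> carrier M" "N \<noteq> {}" using act m by (auto simp: N_def)
      show "\<ominus>\<^bsub>M\<^esub> x \<in> N" if "x \<in> N" for x
        using that neg_act by (auto simp: N_def)
      show "x \<oplus>\<^bsub>M\<^esub> y \<in> N" if "x \<in> N" "y \<in> N" for x y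
        using that actl[OF _ _ m(1), symmetric] by (auto simp: N_def)
    qed
    show "\<forall>a\<in>carrier R. \<forall>x\<in>N. a \<odot>\<^bsub>M\<^esub> x \<in> N"
      using actm[OF _ _ m(1), symmetric] rng_m_closed by (auto simp: N_def)
  qed
  then have "N = {\<zero>\<^bsub>M\<^esub>} \<or> N = carrier M"
    using assms by (auto simp: simple_right_module_def)
  with m have N: "N = carrier M" by (auto simp: N_def)

  define \<phi> where "\<phi> y = {a \<in> carrier R. a \<odot>\<^bsub>M\<^esub> m = y}" for y
  have inj: "inj_on \<phi> (carrier M)"
  proof (rule inj_onI)
    fix x y assume "x \<in> carrier M" "y \<in> carrier M" "\<phi> x = \<phi> y"
    then show "x = y" unfolding N[symmetric] N_def \<phi>_def by blast
  qed
  define \<psi> where "\<psi> = inv_into (carrier M) \<phi>"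
  have psi_phi [simp]: "\<psi> (\<phi> x) = x" if "x \<in> carrier M" for x
    unfolding \<psi>_def using inj that by simp
  define M' :: "('a, 'a set) module" where
    "M' = \<lparr>carrier = \<phi> ` carrier M, mult = (\<lambda>X Y. X), one = {}, zero = \<phi> \<zero>\<^bsub>M\<^esub>,
       add = (\<lambda>X Y. \<phi> (\<psi> X \<oplus>\<^bsub>M\<^esub> \<psi> Y)), smult = (\<lambda>a X. \<phi> (a \<odot>\<^bsub>M\<^esub> \<psi> X))\<rparr>"
  have M'_simps [simp]: "carrier M' = \<phi> ` carrier M" "\<zero>\<^bsub>M'\<^esub> = \<phi> \<zero>\<^bsub>M\<^esub>"
    "X \<oplus>\<^bsub>M'\<^esub> Y = \<phi> (\<psi> X \<oplus>\<^bsub>M\<^esub> \<psi> Y)" "a \<odot>\<^bsub>M'\<^esub> X = \<phi> (a \<odot>\<^bsub>M\<^esub> \<psi> X)" for X Y a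
    by (simp_all add: M'_def)
  have phi_eq: "\<phi> x = \<phi> y \<longleftrightarrow> x = y" if "x \<in> carrier M" "y \<in> carrier M" for x y
    using inj that by (simp add: inj_on_eq_iff)
  interpret M': abelian_group M'
  proof (rule abelian_groupI)
    fix X assume "X \<in> carrier M'"
    then obtain x where "x \<in> carrier M" "X = \<phi> x" by auto
    then show "\<exists>Y\<in>carrier M'. Y \<oplus>\<^bsub>M'\<^esub> X = \<zero>\<^bsub>M'\<^esub>"
      by (intro bexI[of _ "\<phi> (\<ominus>\<^bsub>M\<^esub> x)"]) (auto simp: M.l_neg)
  qed (auto simp: M.a_assoc M.a_comm M.a_lcomm)
  have "right_module R M'"
    unfolding right_module_def using M'.abelian_group_axioms act actr actl actm by auto
  moreover have "\<exists>a\<in>carrier R. \<exists>x\<in>carrier M'. a \<odot>\<^bsub>M'\<^esub> x \<noteq> \<zero>\<^bsub>M'\<^esub>"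
    using m act by (auto simp: phi_eq intro!: bexI[of _ a0] bexI[of _ m])
  moreover have "N' = {\<zero>\<^bsub>M'\<^esub>} \<or> N' = carrier M'" if N': "right_submodule R M' N'" for N'
  proof -
    define K where "K = {x \<in> carrier M. \<phi> x \<in> N'}"
    interpret N': additive_subgroup N' M'
      using N' by (simp add: right_submodule_def)
    have N'_K: "N' = \<phi> ` K"
      using N'.a_subset by (auto simp: K_def)
    have "right_submodule R M K"
      unfolding right_submodule_def
    proof
      show "additive_subgroup K M"
      proof (rule additive_subgroup.intro, rule M.add.subgroupI)
        show "K \<subseteq> carrier M" by (auto simp: K_def)
        show "K \<noteq> {}" using N'.zero_closed by (auto simp: K_def)
        show "x \<oplus>\<^bsub>M\<^esub> y \<in> K" if "x \<in> K" "y \<in> K" for x y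
          using that N'.a_closed[of "\<phi> x" "\<phi> y"] by (auto simp: K_def)
        show "\<ominus>\<^bsub>M\<^esub> x \<in> K" if "x \<in> K" for x
        proof -
          have x: "x \<in> carrier M" "\<phi> x \<in> N'" using that by (auto simp: K_def)
          have "\<ominus>\<^bsub>M'\<^esub> \<phi> x = \<phi> (\<ominus>\<^bsub>M\<^esub> x)"
            using x by (intro M'.minus_equality) (auto simp: M.l_neg)
          then show ?thesis
            using x N'.a_inv_closed[of "\<phi> x"] M'.abelian_group_axioms by (auto simp: K_def)
        qed
      qed
      show "\<forall>a\<in>carrier R. \<forall>x\<in>K. a \<odot>\<^bsub>M\<^esub> x \<in> K"
      proof (intro ballI)
        fix a x assume ax: "a \<in> carrier R" "x \<in> K"
        then have "a \<odot>\<^bsub>M'\<^esub> \<phi> x \<in> N'"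
          using N' unfolding right_submodule_def K_def by blast
        then show "a \<odot>\<^bsub>M\<^esub> x \<in> K" using ax act by (simp add: K_def)
      qed
    qed
    then have "K = {\<zero>\<^bsub>M\<^esub>} \<or> K = carrier M"
      using assms by (auto simp: simple_right_module_def)
    then show ?thesis using N'_K by auto
  qed
  ultimately have "simple_right_module R M'"
    by (auto simp only: simple_right_module_def)
  moreover have "right_annihilator R M = right_annihilator R M'"
    using act by (auto simp: right_annihilator_def phi_eq)
  ultimately show ?thesis
    unfolding primitive_ideal_def by blast
qed

definition algebra_ideal :: "'a set \<Rightarrow> ('k, 'a) module \<Rightarrow> bool" where
  "algebra_ideal I A \<longleftrightarrow> two_sided_ideal I A \<and> (\<forall>c. \<forall>x\<in>I. c \<odot>\<^bsub>A\<^esub> x \<in> I)"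

definition generated_algebra_ideal :: "('k, 'a) module \<Rightarrow> 'a set \<Rightarrow> 'a set" where
  "generated_algebra_ideal A S = \<Inter>{I. algebra_ideal I A \<and> S \<subseteq> I}"

definition quotient_algebra :: "('k, 'a) module \<Rightarrow> 'a set \<Rightarrow> ('k, 'a set) module" where
  "quotient_algebra A I =
     \<lparr>carrier = carrier (A Quot I), mult = mult (A Quot I), one = one (A Quot I),
      zero = zero (A Quot I), add = add (A Quot I),
      smult = (\<lambda>c X. \<Union>x\<in>X. I +>\<^bsub>A\<^esub> (c \<odot>\<^bsub>A\<^esub> x))\<rparr>"

definition linear_map :: "('k, 'a) module \<Rightarrow> ('k, 'b) module \<Rightarrow> ('a \<Rightarrow> 'b) \<Rightarrow> bool" where
  "linear_map A B f \<longleftrightarrow> f \<in> carrier A \<rightarrow> carrier B \<and>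
     (\<forall>x\<in>carrier A. \<forall>y\<in>carrier A. f (x \<oplus>\<^bsub>A\<^esub> y) = f x \<oplus>\<^bsub>B\<^esub> f y) \<and>
     (\<forall>c. \<forall>x\<in>carrier A. f (c \<odot>\<^bsub>A\<^esub> x) = c \<odot>\<^bsub>B\<^esub> f x)"

definition algebra_hom :: "('k, 'a) module \<Rightarrow> ('k, 'b) module \<Rightarrow> ('a \<Rightarrow> 'b) \<Rightarrow> bool" where
  "algebra_hom A B f \<longleftrightarrow> linear_map A B f \<and>
     (\<forall>x\<in>carrier A. \<forall>y\<in>carrier A. f (x \<otimes>\<^bsub>A\<^esub> y) = f x \<otimes>\<^bsub>B\<^esub> f y)"

definition algebra_automorphism :: "('k, 'a) module \<Rightarrow> ('a \<Rightarrow> 'a) \<Rightarrow> bool" where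
  "algebra_automorphism A f \<longleftrightarrow> algebra_hom A A f \<and> bij_betw f (carrier A) (carrier A)"


section \<open>Free algebras, tensor products and Laurent polynomials\<close>

text \<open>The free monoid; with it as exponents, \<open>'g free_mon \<Rightarrow>\<^sub>0 'k\<close> carries the multiplication of
  the free unital algebra.\<close>

datatype 'g free_mon = FM (letters: "'g list")

instantiation free_mon :: (type) monoid_add
begin

definition zero_free_mon :: "'a free_mon" where
  "0 = FM []"

definition plus_free_mon :: "'a free_mon \<Rightarrow> 'a free_mon \<Rightarrow> 'a free_mon" where
  "u + w = FM (letters u @ letters w)"

instance
  by standard (auto simp: zero_free_mon_def plus_free_mon_def)

end

abbreviation pm_scale :: "'k \<Rightarrow> ('a \<Rightarrow>\<^sub>0 'k) \<Rightarrow> ('a \<Rightarrow>\<^sub>0 'k::field)" where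
  "pm_scale c p \<equiv> Poly_Mapping.map ((*) c) p"

text \<open>The free non-unital algebra on \<open>X\<close> is spanned by the non-empty words over \<open>X\<close>.\<close>

definition free_nonunital_algebra :: "'g set \<Rightarrow> ('k::field, 'g free_mon \<Rightarrow>\<^sub>0 'k) module" where
  "free_nonunital_algebra X =
     \<lparr>carrier = {p. \<forall>w\<in>Poly_Mapping.keys p. w \<noteq> 0 \<and> set (letters w) \<subseteq> X},
      mult = (*), one = 1, zero = 0, add = (+), smult = pm_scale\<rparr>"

text \<open>The tensor product of \<open>A\<close> and \<open>B\<close> is the algebra with basis the pairs in
  \<open>carrier A \<times> carrier B\<close>, multiplied componentwise, modulo bilinearity. (The linear span of the
  bilinearity relations is already an ideal.)\<close>

definition pairs_algebra :: "('k, 'a) module \<Rightarrow> ('k, 'b) module \<Rightarrow> ('k::field, ('a \<times> 'b) \<Rightarrow>\<^sub>0 'k) module"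
  where
  "pairs_algebra A B =
     \<lparr>carrier = {p. Poly_Mapping.keys p \<subseteq> carrier A \<times> carrier B},
      mult = (\<lambda>p q. \<Sum>(a, b)\<in>Poly_Mapping.keys p. \<Sum>(a', b')\<in>Poly_Mapping.keys q.
                Poly_Mapping.single (a \<otimes>\<^bsub>A\<^esub> a', b \<otimes>\<^bsub>B\<^esub> b')
                  (Poly_Mapping.lookup p (a, b) * Poly_Mapping.lookup q (a', b'))),
      one = Poly_Mapping.single (\<one>\<^bsub>A\<^esub>, \<one>\<^bsub>B\<^esub>) 1, zero = 0, add = (+), smult = pm_scale\<rparr>"

definition bilinear_relations ::
  "('k, 'a) module \<Rightarrow> ('k, 'b) module \<Rightarrow> (('a \<times> 'b) \<Rightarrow>\<^sub>0 'k::field) set" where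
  "bilinear_relations A B =
     {Poly_Mapping.single (a \<oplus>\<^bsub>A\<^esub> a', b) 1 - Poly_Mapping.single (a, b) 1
        - Poly_Mapping.single (a', b) 1 | a a' b.
        a \<in> carrier A \<and> a' \<in> carrier A \<and> b \<in> carrier B} \<union>
     {Poly_Mapping.single (a, b \<oplus>\<^bsub>B\<^esub> b') 1 - Poly_Mapping.single (a, b) 1
        - Poly_Mapping.single (a, b') 1 | a b b'.
        a \<in> carrier A \<and> b \<in> carrier B \<and> b' \<in> carrier B} \<union>
     {Poly_Mapping.single (c \<odot>\<^bsub>A\<^esub> a, b) 1 - Poly_Mapping.single (a, b) c | c a b.
        a \<in> carrier A \<and> b \<in> carrier B} \<union>
     {Poly_Mapping.single (a, c \<odot>\<^bsub>B\<^esub> b) 1 - Poly_Mapping.single (a, b) c | c a b.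
        a \<in> carrier A \<and> b \<in> carrier B}"

definition tensor_ideal ::
  "('k, 'a) module \<Rightarrow> ('k, 'b) module \<Rightarrow> (('a \<times> 'b) \<Rightarrow>\<^sub>0 'k::field) set" where
  "tensor_ideal A B = generated_algebra_ideal (pairs_algebra A B) (bilinear_relations A B)"

definition tensor_algebra ::
  "('k, 'a) module \<Rightarrow> ('k, 'b) module \<Rightarrow> ('k::field, (('a \<times> 'b) \<Rightarrow>\<^sub>0 'k) set) module" where
  "tensor_algebra A B = quotient_algebra (pairs_algebra A B) (tensor_ideal A B)"

definition pure_tensor ::
  "('k, 'a) module \<Rightarrow> ('k, 'b) module \<Rightarrow> 'a \<Rightarrow> 'b \<Rightarrow> (('a \<times> 'b) \<Rightarrow>\<^sub>0 'k::field) set" where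
  "pure_tensor A B a b =
     tensor_ideal A B +>\<^bsub>pairs_algebra A B\<^esub> Poly_Mapping.single (a, b) 1"

definition laurent_algebra :: "('k::field, int \<Rightarrow>\<^sub>0 'k) module" where
  "laurent_algebra =
     \<lparr>carrier = UNIV, mult = (*), one = 1, zero = 0, add = (+), smult = pm_scale\<rparr>"

definition laurent_eval :: "(int \<Rightarrow>\<^sub>0 'k::field) \<Rightarrow> 'k \<Rightarrow> 'k" where
  "laurent_eval f h = (\<Sum>n\<in>Poly_Mapping.keys f. Poly_Mapping.lookup f n * h powi n)"


section \<open>Actions of the multiplicative group of the field\<close>

text \<open>An action of \<open>K\<^sup>\<times>\<close> is a function on all of \<open>K\<close> whose value at \<open>0\<close> is irrelevant.\<close>

definition automorphism_action :: "('k::field, 'a) module \<Rightarrow> ('k \<Rightarrow> 'a \<Rightarrow> 'a) \<Rightarrow> bool" where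
  "automorphism_action A \<alpha> \<longleftrightarrow>
     (\<forall>h. h \<noteq> 0 \<longrightarrow> algebra_automorphism A (\<alpha> h)) \<and>
     (\<forall>a\<in>carrier A. \<alpha> 1 a = a) \<and>
     (\<forall>g h. g \<noteq> 0 \<longrightarrow> h \<noteq> 0 \<longrightarrow> (\<forall>a\<in>carrier A. \<alpha> (g * h) a = \<alpha> g (\<alpha> h a)))"

definition rational_action :: "('k::field, 'a) module \<Rightarrow> ('k \<Rightarrow> 'a \<Rightarrow> 'a) \<Rightarrow> bool" where
  "rational_action A \<alpha> \<longleftrightarrow> automorphism_action A \<alpha> \<and>
     (\<exists>\<Delta>. algebra_hom A (tensor_algebra A laurent_algebra) \<Delta> \<and>
        (\<forall>a\<in>carrier A. \<exists>(n::nat) b f.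
           b \<in> {..<n} \<rightarrow> carrier A \<and>
           \<Delta> a = (\<Oplus>\<^bsub>tensor_algebra A laurent_algebra\<^esub>i\<in>{..<n}.
                      pure_tensor A laurent_algebra (b i) (f i)) \<and>
           (\<forall>h. h \<noteq> 0 \<longrightarrow> \<alpha> h a = (\<Oplus>\<^bsub>A\<^esub>i\<in>{..<n}. laurent_eval (f i) h \<odot>\<^bsub>A\<^esub> b i))))"

definition H_prime :: "('k::field, 'a) module \<Rightarrow> ('k \<Rightarrow> 'a \<Rightarrow> 'a) \<Rightarrow> 'a set \<Rightarrow> bool" where
  "H_prime A \<alpha> P \<longleftrightarrow> prime_two_sided_ideal A P \<and> (\<forall>h. h \<noteq> 0 \<longrightarrow> \<alpha> h ` P \<subseteq> P)"

definition H_stratum :: "('k::field, 'a) module \<Rightarrow> ('k \<Rightarrow> 'a \<Rightarrow> 'a) \<Rightarrow> 'a set \<Rightarrow> 'a set set" where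
  "H_stratum A \<alpha> P =
     {Q \<in> prime_spectrum A. H_prime A \<alpha> P \<and> P \<subseteq> Q \<and>
        (\<forall>P'. H_prime A \<alpha> P' \<longrightarrow> P' \<subseteq> Q \<longrightarrow> P' \<subseteq> P)}"


section \<open>Directed graphs and Leavitt path algebras\<close>

text \<open>Source and range of an edge are its \<^const>\<open>tail\<close> and \<^const>\<open>head\<close>.\<close>

definition row_finite :: "('v, 'e) pre_digraph \<Rightarrow> bool" where
  "row_finite E \<longleftrightarrow> (\<forall>v\<in>verts E. finite (out_arcs E v))"

definition maximal_tail :: "('v, 'e) pre_digraph \<Rightarrow> 'v set \<Rightarrow> bool" where
  "maximal_tail E M \<longleftrightarrow> M \<noteq> {} \<and> M \<subseteq> verts E \<and>
     (\<forall>v\<in>verts E. \<forall>w\<in>M. v \<rightarrow>\<^sup>*\<^bsub>E\<^esub> w \<longrightarrow> v \<in> M) \<and>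
     (\<forall>v\<in>M. out_arcs E v \<noteq> {} \<longrightarrow> (\<exists>e\<in>out_arcs E v. head E e \<in> M)) \<and>
     (\<forall>v\<in>M. \<forall>w\<in>M. \<exists>y\<in>M. v \<rightarrow>\<^sup>*\<^bsub>E\<^esub> y \<and> w \<rightarrow>\<^sup>*\<^bsub>E\<^esub> y)"

datatype ('v, 'e) lpa_gen = Vertex 'v | Edge 'e | Ghost 'e

type_synonym ('v, 'e, 'k) lpa_free = "('v, 'e) lpa_gen free_mon \<Rightarrow>\<^sub>0 'k"
type_synonym ('v, 'e, 'k) lpa_elem = "('v, 'e, 'k) lpa_free set"

abbreviation lpa_vx :: "'v \<Rightarrow> ('v, 'e, 'k::field) lpa_free" where
  "lpa_vx v \<equiv> Poly_Mapping.single (FM [Vertex v]) 1"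

abbreviation lpa_ed :: "'e \<Rightarrow> ('v, 'e, 'k::field) lpa_free" where
  "lpa_ed e \<equiv> Poly_Mapping.single (FM [Edge e]) 1"

abbreviation lpa_gh :: "'e \<Rightarrow> ('v, 'e, 'k::field) lpa_free" where
  "lpa_gh e \<equiv> Poly_Mapping.single (FM [Ghost e]) 1"

definition lpa_relations :: "('v, 'e) pre_digraph \<Rightarrow> ('v, 'e, 'k::field) lpa_free set" where
  "lpa_relations E =
     {lpa_vx v * lpa_vx w - (if v = w then lpa_vx v else 0) | v w. v \<in> verts E \<and> w \<in> verts E} \<union>
     {lpa_vx (tail E e) * lpa_ed e - lpa_ed e | e. e \<in> arcs E} \<union>
     {lpa_ed e * lpa_vx (head E e) - lpa_ed e | e. e \<in> arcs E} \<union>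
     {lpa_vx (head E e) * lpa_gh e - lpa_gh e | e. e \<in> arcs E} \<union>
     {lpa_gh e * lpa_vx (tail E e) - lpa_gh e | e. e \<in> arcs E} \<union>
     {lpa_gh e * lpa_ed e' - (if e = e' then lpa_vx (head E e) else 0) | e e'.
        e \<in> arcs E \<and> e' \<in> arcs E} \<union>
     {lpa_vx v - (\<Sum>e\<in>out_arcs E v. lpa_ed e * lpa_gh e) | v.
        v \<in> verts E \<and> out_arcs E v \<noteq> {}}"

definition lpa_free_algebra ::
  "('v, 'e) pre_digraph \<Rightarrow> ('k::field, ('v, 'e, 'k) lpa_free) module" where
  "lpa_free_algebra E =
     free_nonunital_algebra (Vertex ` verts E \<union> Edge ` arcs E \<union> Ghost ` arcs E)"

definition lpa_ideal :: "('v, 'e) pre_digraph \<Rightarrow> ('v, 'e, 'k::field) lpa_free set" where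
  "lpa_ideal E = generated_algebra_ideal (lpa_free_algebra E) (lpa_relations E)"

definition leavitt_path_algebra ::
  "('v, 'e) pre_digraph \<Rightarrow> ('k::field, ('v, 'e, 'k) lpa_elem) module" where
  "leavitt_path_algebra E = quotient_algebra (lpa_free_algebra E) (lpa_ideal E)"

definition lpa_class ::
  "('v, 'e) pre_digraph \<Rightarrow> ('v, 'e, 'k::field) lpa_free \<Rightarrow> ('v, 'e, 'k) lpa_elem" where
  "lpa_class E p = lpa_ideal E +>\<^bsub>lpa_free_algebra E\<^esub> p"

fun gen_degree :: "('v, 'e) lpa_gen \<Rightarrow> int" where
  "gen_degree (Vertex v) = 0"
| "gen_degree (Edge e) = 1"
| "gen_degree (Ghost e) = -1"

definition word_degree :: "('v, 'e) lpa_gen free_mon \<Rightarrow> int" where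
  "word_degree w = sum_list (map gen_degree (letters w))"

definition lpa_component ::
  "('v, 'e) pre_digraph \<Rightarrow> int \<Rightarrow> ('v, 'e, 'k::field) lpa_elem set" where
  "lpa_component E n =
     lpa_class E ` {p \<in> carrier (lpa_free_algebra E). \<forall>w\<in>Poly_Mapping.keys p. word_degree w = n}"

definition lpa_graded_ideal ::
  "('v, 'e) pre_digraph \<Rightarrow> ('v, 'e, 'k::field) lpa_elem set \<Rightarrow> bool" where
  "lpa_graded_ideal E I \<longleftrightarrow> two_sided_ideal I (leavitt_path_algebra E) \<and>
     (\<forall>x\<in>I. \<exists>N f. finite N \<and> (\<forall>n\<in>N. f n \<in> I \<inter> lpa_component E n) \<and>
        x = (\<Oplus>\<^bsub>leavitt_path_algebra E\<^esub>n\<in>N. f n))"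

definition ideal_vertices ::
  "('v, 'e) pre_digraph \<Rightarrow> ('v, 'e, 'k::field) lpa_elem set \<Rightarrow> 'v set" where
  "ideal_vertices E P = {v \<in> verts E. lpa_class E (lpa_vx v) \<in> P}"

definition tail_stratum ::
  "('v, 'e) pre_digraph \<Rightarrow> 'v set \<Rightarrow> ('v, 'e, 'k::field) lpa_elem set set" where
  "tail_stratum E M =
     {P \<in> prime_spectrum (leavitt_path_algebra E). ideal_vertices E P = verts E - M}"

definition torus_map ::
  "('v, 'e) pre_digraph \<Rightarrow> 'k::field \<Rightarrow> (('v, 'e, 'k) lpa_elem \<Rightarrow> ('v, 'e, 'k) lpa_elem) \<Rightarrow> bool" where
  "torus_map E h f \<longleftrightarrow> f \<in> extensional (carrier (leavitt_path_algebra E)) \<and>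
     linear_map (leavitt_path_algebra E) (leavitt_path_algebra E) f \<and>
     (\<forall>n. \<forall>a\<in>lpa_component E n. f a = (h powi n) \<odot>\<^bsub>leavitt_path_algebra E\<^esub> a)"

definition torus_action ::
  "('v, 'e) pre_digraph \<Rightarrow> 'k::field \<Rightarrow> ('v, 'e, 'k) lpa_elem \<Rightarrow> ('v, 'e, 'k) lpa_elem" where
  "torus_action E h = (THE f. torus_map E h f)"

end

theory Submission
  imports Defs "HOL-Library.Sublist" "HOL-Library.Countable_Set" "HOL-Computational_Algebra.Polynomial"
begin

text \<open>
  A \<open>K\<^sup>\<times>\<close>-invariant ideal is graded because \<open>K\<close> is infinite, and a graded ideal is generated by the
  vertices it contains: a non-zero element modulo such an ideal can be multiplied from both sides into
  \<open>k v\<close> plus a combination of closed paths at \<open>v\<close>, with \<open>k \<noteq> 0\<close>, and its component of degree \<open>0\<close> is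
  \<open>k v\<close>. So each maximal tail \<open>M\<close> carries exactly one graded prime, the ideal \<open>I\<^sub>M\<close> generated by the
  vertices outside \<open>M\<close>, and this is the smallest prime of the stratum of \<open>M\<close>.

  Row-finiteness makes the set of vertices reachable from one vertex countable, so a maximal tail
  contains a maximal path \<open>p\<close> that is reached from all its vertices. The paths that have a common
  tail with \<open>p\<close> span a simple module, and the vertices that annihilate it are those outside \<open>M\<close>.

  If every cycle of \<open>M\<close> has an exit in \<open>M\<close>, the exits can be used to shorten \<open>k v\<close> plus closed paths
  to a multiple of a vertex. Hence \<open>I\<^sub>M\<close> is the only ideal with its set of vertices; it is the
  annihilator of the simple module, and the stratum has one element. Otherwise let \<open>v\<close> lie on a cycle
  \<open>c\<close> without exits in \<open>M\<close>. Modulo \<open>I\<^sub>M\<close> the corner at \<open>v\<close> is \<open>K[c, c\<^sup>*]\<close>, a Laurent polynomial ring,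
  and the stratum consists of the primes over \<open>I\<^sub>M\<close> that do not contain \<open>v\<close>; these correspond to the
  primes of the corner. As the corner is commutative but not a field, \<open>I\<^sub>M\<close> is not primitive.
\<close>

section \<open>Algebras of finitely supported functions and their quotients\<close>

text \<open>The obstacle is that a Leavitt path algebra is given only by relations, and no basis of
  it is established. All computations are therefore congruences between representatives in the free
  algebra. That a vertex lies outside an ideal is always shown by the action on a path module, which
  is how \<open>vx_PM\<close> obtains that \<open>PM\<close> contains no vertex of \<open>M\<close>.
  The independence of the powers of a cycle is reduced to this fact by comparing degrees. A second
  obstacle is the missing unit. Ring ideals are not assumed to be closed under scalars; sums of
  vertices act as local units and supply this. Afterwards the unital free algebra may multiply every
  ideal, so that primeness can be tested on products \<open>a * r * b\<close> with
  \<open>r = 1\<close> allowed. The infinitude of \<open>K\<close> enters through scalars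
  \<open>g\<close> with \<open>g powi j \<noteq> 1\<close> for finitely many given
  \<open>j \<noteq> 0\<close>. The lattice of ideals of the corner is compared with that of the
  Laurent polynomials by maps defined for all ideals, not only for primes, because the Zariski
  topology is described by arbitrary ideals.\<close>

lemma lookup_pm_scale [simp]:
  "Poly_Mapping.lookup (pm_scale c p) w = c * Poly_Mapping.lookup p w"
  by (simp add: Poly_Mapping.map.rep_eq when_def)

lemma pm_scale_add: "pm_scale c (p + q) = pm_scale c p + pm_scale c q"
  by (rule poly_mapping_eqI) (simp add: lookup_add algebra_simps)

lemma pm_scale_minus_one: "pm_scale (- 1) p = - p"
  by (rule poly_mapping_eqI) simp

lemma pm_scale_0 [simp]: "pm_scale c 0 = 0"
  by (rule poly_mapping_eqI) simp

text \<open>A form of the update induction whose step is an addition, so that additive maps can be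
  evaluated on it directly.\<close>

lemma poly_mapping_single_induct [case_names zero add]:
  assumes "P 0"
    and "\<And>p w c. \<lbrakk>P p; w \<notin> Poly_Mapping.keys p; c \<noteq> 0\<rbrakk> \<Longrightarrow> P (Poly_Mapping.single w c + p)"
  shows "P (p :: 'w \<Rightarrow>\<^sub>0 'k::field)"
proof (induction p rule: update_induct)
  case const then show ?case using assms(1) by simp
next
  case (update f a b)
  have "Poly_Mapping.update a b f = Poly_Mapping.single a b + f"
    using update(1) by (intro poly_mapping_eqI) (auto simp: lookup_update lookup_add lookup_single in_keys_iff when_def)
  then show ?case using assms(2) update by simp
qed

text \<open>The common frame of the free algebra, the Laurent polynomials and the algebra of pairs
  behind the tensor product. Their elements are finitely supported functions with the pointwise
  vector space structure; carrier and product remain abstract.\<close>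

locale pm_algebra =
  fixes A :: "('k::field, 'w \<Rightarrow>\<^sub>0 'k) module"
  assumes add_eq: "add A = (+)" and zero_eq: "zero A = 0" and smult_eq: "module.smult A = pm_scale"
    and zero_in: "0 \<in> carrier A"
    and add_in: "\<lbrakk>x \<in> carrier A; y \<in> carrier A\<rbrakk> \<Longrightarrow> x + y \<in> carrier A"
    and scale_in: "x \<in> carrier A \<Longrightarrow> pm_scale c x \<in> carrier A"
    and mult_in: "\<lbrakk>x \<in> carrier A; y \<in> carrier A\<rbrakk> \<Longrightarrow> x \<otimes>\<^bsub>A\<^esub> y \<in> carrier A"
    and distr_l: "\<lbrakk>x \<in> carrier A; y \<in> carrier A; z \<in> carrier A\<rbrakk>
          \<Longrightarrow> (x + y) \<otimes>\<^bsub>A\<^esub> z = x \<otimes>\<^bsub>A\<^esub> z + y \<otimes>\<^bsub>A\<^esub> z"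
    and distr_r: "\<lbrakk>x \<in> carrier A; y \<in> carrier A; z \<in> carrier A\<rbrakk>
          \<Longrightarrow> z \<otimes>\<^bsub>A\<^esub> (x + y) = z \<otimes>\<^bsub>A\<^esub> x + z \<otimes>\<^bsub>A\<^esub> y"
begin

lemma uminus_in: "x \<in> carrier A \<Longrightarrow> - x \<in> carrier A"
  using scale_in[of x "- 1"] by (simp add: pm_scale_minus_one)

lemma minus_in: "\<lbrakk>x \<in> carrier A; y \<in> carrier A\<rbrakk> \<Longrightarrow> x - y \<in> carrier A"
  using add_in[of x "- y"] uminus_in[of y] by simp

lemma sum_in: "(\<And>i. i \<in> S \<Longrightarrow> f i \<in> carrier A) \<Longrightarrow> sum f S \<in> carrier A"
  by (induction S rule: infinite_finite_induct) (auto intro: zero_in add_in)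

lemma abelian_group_A: "abelian_group A"
proof (rule abelian_groupI)
  show "\<And>x. x \<in> carrier A \<Longrightarrow> \<exists>y\<in>carrier A. y \<oplus>\<^bsub>A\<^esub> x = \<zero>\<^bsub>A\<^esub>"
    using uminus_in by (metis add_eq zero_eq ab_left_minus)
qed (simp_all add: add_eq zero_eq zero_in add_in algebra_simps)

lemma a_inv_eq: "x \<in> carrier A \<Longrightarrow> \<ominus>\<^bsub>A\<^esub> x = - x"
  using abelian_group_A uminus_in
  by (metis abelian_group.minus_equality ab_left_minus add_eq zero_eq)

lemma additive_subgroup_iff:
  "additive_subgroup I A \<longleftrightarrow> I \<subseteq> carrier A \<and> 0 \<in> I \<and> (\<forall>x\<in>I. \<forall>y\<in>I. x + y \<in> I) \<and> (\<forall>x\<in>I. - x \<in> I)"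
proof -
  have inv: "inv\<^bsub>add_monoid A\<^esub> x = - x" if "x \<in> carrier A" for x
    using a_inv_eq[OF that] by (simp add: a_inv_def)
  show ?thesis
    unfolding additive_subgroup_def subgroup_def using inv by (auto simp: add_eq zero_eq subset_iff)
qed

lemma two_sided_ideal_iff:
  "two_sided_ideal I A \<longleftrightarrow> I \<subseteq> carrier A \<and> 0 \<in> I \<and> (\<forall>x\<in>I. \<forall>y\<in>I. x + y \<in> I) \<and> (\<forall>x\<in>I. - x \<in> I) \<and>
     (\<forall>a\<in>carrier A. \<forall>x\<in>I. a \<otimes>\<^bsub>A\<^esub> x \<in> I \<and> x \<otimes>\<^bsub>A\<^esub> a \<in> I)"
  unfolding two_sided_ideal_def additive_subgroup_iff by blast

lemma algebra_ideal_iff: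
  "algebra_ideal I A \<longleftrightarrow> I \<subseteq> carrier A \<and> 0 \<in> I \<and> (\<forall>x\<in>I. \<forall>y\<in>I. x + y \<in> I) \<and>
     (\<forall>c. \<forall>x\<in>I. pm_scale c x \<in> I) \<and>
     (\<forall>a\<in>carrier A. \<forall>x\<in>I. a \<otimes>\<^bsub>A\<^esub> x \<in> I \<and> x \<otimes>\<^bsub>A\<^esub> a \<in> I)"
proof -
  have "- x \<in> I" if "\<forall>c. \<forall>x\<in>I. pm_scale c x \<in> I" "x \<in> I" for x
    using that by (metis pm_scale_minus_one)
  then show ?thesis unfolding algebra_ideal_def two_sided_ideal_iff smult_eq by blast
qed

lemma algebra_ideal_carrier: "algebra_ideal (carrier A) A"
  unfolding algebra_ideal_iff by (auto intro: zero_in add_in scale_in mult_in)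

lemma algebra_ideal_generated:
  assumes "S \<subseteq> carrier A"
  shows "algebra_ideal (generated_algebra_ideal A S) A"
proof -
  have "two_sided_ideal (generated_algebra_ideal A S) A"
    unfolding generated_algebra_ideal_def
    using algebra_ideal_carrier assms by (intro two_sided_ideal_Inter) (auto simp: algebra_ideal_def)
  then show ?thesis
    unfolding algebra_ideal_def generated_algebra_ideal_def by blast
qed

lemma generated_superset: "S \<subseteq> generated_algebra_ideal A S"
  unfolding generated_algebra_ideal_def by blast

lemma generated_least: "\<lbrakk>algebra_ideal I A; S \<subseteq> I\<rbrakk> \<Longrightarrow> generated_algebra_ideal A S \<subseteq> I"
  unfolding generated_algebra_ideal_def by blast

context
  fixes I assumes I: "algebra_ideal I A"
begin

lemma ideal_facts:
  "I \<subseteq> carrier A" "0 \<in> I" "\<And>x y. \<lbrakk>x \<in> I; y \<in> I\<rbrakk> \<Longrightarrow> x + y \<in> I"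
  "\<And>x. x \<in> I \<Longrightarrow> - x \<in> I" "\<And>x y. \<lbrakk>x \<in> I; y \<in> I\<rbrakk> \<Longrightarrow> x - y \<in> I" "\<And>x c. x \<in> I \<Longrightarrow> pm_scale c x \<in> I"
  "\<And>a x. \<lbrakk>a \<in> carrier A; x \<in> I\<rbrakk> \<Longrightarrow> a \<otimes>\<^bsub>A\<^esub> x \<in> I"
  "\<And>a x. \<lbrakk>a \<in> carrier A; x \<in> I\<rbrakk> \<Longrightarrow> x \<otimes>\<^bsub>A\<^esub> a \<in> I"
proof -
  show 1: "I \<subseteq> carrier A" "0 \<in> I" "\<And>x y. \<lbrakk>x \<in> I; y \<in> I\<rbrakk> \<Longrightarrow> x + y \<in> I"
    "\<And>x c. x \<in> I \<Longrightarrow> pm_scale c x \<in> I"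
  "\<And>a x. \<lbrakk>a \<in> carrier A; x \<in> I\<rbrakk> \<Longrightarrow> a \<otimes>\<^bsub>A\<^esub> x \<in> I"
  "\<And>a x. \<lbrakk>a \<in> carrier A; x \<in> I\<rbrakk> \<Longrightarrow> x \<otimes>\<^bsub>A\<^esub> a \<in> I"
    using I unfolding algebra_ideal_iff by blast+
  show 2: "\<And>x. x \<in> I \<Longrightarrow> - x \<in> I" using 1(4)[of _ "- 1"] by (simp add: pm_scale_minus_one)
  show "\<And>x y. \<lbrakk>x \<in> I; y \<in> I\<rbrakk> \<Longrightarrow> x - y \<in> I" using 1(3) 2 by (metis add_uminus_conv_diff)
qed

lemma coset_mem: "z \<in> I +>\<^bsub>A\<^esub> x \<longleftrightarrow> z - x \<in> I"
  unfolding a_r_coset_def r_coset_def by (force simp: add_eq)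

lemma coset_eq_iff: "I +>\<^bsub>A\<^esub> x = I +>\<^bsub>A\<^esub> y \<longleftrightarrow> x - y \<in> I"
proof
  assume "I +>\<^bsub>A\<^esub> x = I +>\<^bsub>A\<^esub> y"
  then show "x - y \<in> I" using coset_mem[of x x] coset_mem[of x y] ideal_facts(2) by simp
next
  assume xy: "x - y \<in> I"
  have "z - x \<in> I \<longleftrightarrow> z - y \<in> I" for z
    using ideal_facts(3)[OF _ xy, of "z - x"] ideal_facts(5)[OF _ xy, of "z - y"] by (auto simp: algebra_simps)
  then show "I +>\<^bsub>A\<^esub> x = I +>\<^bsub>A\<^esub> y" by (auto simp: coset_mem)
qed

lemma carrier_quotient: "carrier (quotient_algebra A I) = (\<lambda>x. I +>\<^bsub>A\<^esub> x) ` carrier A"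
  unfolding quotient_algebra_def FactRing_def A_RCOSETS_def' by auto

lemma zero_quotient: "\<zero>\<^bsub>quotient_algebra A I\<^esub> = I +>\<^bsub>A\<^esub> 0"
  unfolding quotient_algebra_def FactRing_def using coset_mem[of _ 0] by auto

lemma add_quotient:
  assumes "x \<in> carrier A" "y \<in> carrier A"
  shows "(I +>\<^bsub>A\<^esub> x) \<oplus>\<^bsub>quotient_algebra A I\<^esub> (I +>\<^bsub>A\<^esub> y) = I +>\<^bsub>A\<^esub> (x + y)"
proof -
  have "(I +>\<^bsub>A\<^esub> x) \<oplus>\<^bsub>quotient_algebra A I\<^esub> (I +>\<^bsub>A\<^esub> y) = {h + k | h k. h - x \<in> I \<and> k - y \<in> I}"
  proof -
    have c: "I +>\<^bsub>A\<^esub> z = {h. h - z \<in> I}" for z using coset_mem by blast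
    show ?thesis unfolding quotient_algebra_def FactRing_def set_add_defs c by (simp add: add_eq) blast
  qed
  also have "\<dots> = {z. z - (x + y) \<in> I}"
  proof (intro equalityI subsetI)
    fix z assume "z \<in> {z. z - (x + y) \<in> I}"
    then have "z = (z - y) + y" "(z - y) - x \<in> I" "y - y \<in> I" using ideal_facts(2) by (auto simp: algebra_simps)
    then show "z \<in> {h + k | h k. h - x \<in> I \<and> k - y \<in> I}" by blast
  next
    fix z assume "z \<in> {h + k | h k. h - x \<in> I \<and> k - y \<in> I}"
    then obtain h k where "z = h + k" "h - x \<in> I" "k - y \<in> I" by blast
    then show "z \<in> {z. z - (x + y) \<in> I}"
      using ideal_facts(3)[of "h - x" "k - y"] by (simp add: algebra_simps)
  qed
  finally show ?thesis using coset_mem by blast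
qed

text \<open>Telescoping: \<open>h k - x y = (h - x) k + x (k - y)\<close>. The elements
  \<open>h\<close> and \<open>k\<close> lie in the carrier because \<open>I\<close> does.\<close>

lemma mult_cong:
  assumes "x \<in> carrier A" "y \<in> carrier A" "h - x \<in> I" "k - y \<in> I"
  shows "h \<otimes>\<^bsub>A\<^esub> k - x \<otimes>\<^bsub>A\<^esub> y \<in> I"
proof -
  have c: "h - x \<in> carrier A" "k - y \<in> carrier A" using assms ideal_facts(1) by auto
  have h: "h \<in> carrier A" "k \<in> carrier A" using add_in[OF c(1) assms(1)] add_in[OF c(2) assms(2)] by auto
  have "h \<otimes>\<^bsub>A\<^esub> k = (h - x) \<otimes>\<^bsub>A\<^esub> k + x \<otimes>\<^bsub>A\<^esub> k"
    using distr_l[OF c(1) assms(1) h(2)] by simp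
  moreover have "x \<otimes>\<^bsub>A\<^esub> k = x \<otimes>\<^bsub>A\<^esub> (k - y) + x \<otimes>\<^bsub>A\<^esub> y"
    using distr_r[OF c(2) assms(2) assms(1)] by simp
  ultimately have "h \<otimes>\<^bsub>A\<^esub> k - x \<otimes>\<^bsub>A\<^esub> y = (h - x) \<otimes>\<^bsub>A\<^esub> k + x \<otimes>\<^bsub>A\<^esub> (k - y)" by simp
  then show ?thesis using ideal_facts(3,7,8) assms h by metis
qed

lemma mult_quotient:
  assumes "x \<in> carrier A" "y \<in> carrier A"
  shows "(I +>\<^bsub>A\<^esub> x) \<otimes>\<^bsub>quotient_algebra A I\<^esub> (I +>\<^bsub>A\<^esub> y) = I +>\<^bsub>A\<^esub> (x \<otimes>\<^bsub>A\<^esub> y)"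
proof -
  have "(I +>\<^bsub>A\<^esub> x) \<otimes>\<^bsub>quotient_algebra A I\<^esub> (I +>\<^bsub>A\<^esub> y)
      = (\<Union>h\<in>I +>\<^bsub>A\<^esub> x. \<Union>k\<in>I +>\<^bsub>A\<^esub> y. I +>\<^bsub>A\<^esub> (h \<otimes>\<^bsub>A\<^esub> k))"
    unfolding quotient_algebra_def FactRing_def rcoset_mult_def by simp
  also have "\<dots> = I +>\<^bsub>A\<^esub> (x \<otimes>\<^bsub>A\<^esub> y)"
  proof -
    have "I +>\<^bsub>A\<^esub> (h \<otimes>\<^bsub>A\<^esub> k) = I +>\<^bsub>A\<^esub> (x \<otimes>\<^bsub>A\<^esub> y)" if "h \<in> I +>\<^bsub>A\<^esub> x" "k \<in> I +>\<^bsub>A\<^esub> y" for h k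
      using that mult_cong[OF assms] by (simp add: coset_eq_iff coset_mem)
    moreover have "x \<in> I +>\<^bsub>A\<^esub> x" "y \<in> I +>\<^bsub>A\<^esub> y" using ideal_facts(2) by (auto simp: coset_mem)
    ultimately show ?thesis by blast
  qed
  finally show ?thesis .
qed

lemma smult_quotient:
  assumes "x \<in> carrier A"
  shows "c \<odot>\<^bsub>quotient_algebra A I\<^esub> (I +>\<^bsub>A\<^esub> x) = I +>\<^bsub>A\<^esub> (pm_scale c x)"
proof -
  have "c \<odot>\<^bsub>quotient_algebra A I\<^esub> (I +>\<^bsub>A\<^esub> x) = (\<Union>y\<in>I +>\<^bsub>A\<^esub> x. I +>\<^bsub>A\<^esub> (pm_scale c y))"
    unfolding quotient_algebra_def by (simp add: smult_eq)
  moreover have "I +>\<^bsub>A\<^esub> (pm_scale c y) = I +>\<^bsub>A\<^esub> (pm_scale c x)" if "y \<in> I +>\<^bsub>A\<^esub> x" for y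
  proof -
    have "pm_scale c y - pm_scale c x = pm_scale c (y - x)"
      by (rule poly_mapping_eqI) (simp add: lookup_minus algebra_simps)
    then show ?thesis using that ideal_facts(6) by (simp add: coset_eq_iff coset_mem)
  qed
  moreover have "x \<in> I +>\<^bsub>A\<^esub> x" using ideal_facts(2) by (auto simp: coset_mem)
  ultimately show ?thesis by blast
qed

lemma abelian_group_quotient: "abelian_group (quotient_algebra A I)"
proof (rule abelian_groupI)
  fix X assume "X \<in> carrier (quotient_algebra A I)"
  then obtain x where "x \<in> carrier A" "X = I +>\<^bsub>A\<^esub> x" by (auto simp: carrier_quotient)
  then show "\<exists>Y\<in>carrier (quotient_algebra A I). Y \<oplus>\<^bsub>quotient_algebra A I\<^esub> X = \<zero>\<^bsub>quotient_algebra A I\<^esub>"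
    by (intro bexI[of _ "I +>\<^bsub>A\<^esub> (- x)"]) (auto simp: carrier_quotient zero_quotient add_quotient uminus_in)
qed (auto simp: carrier_quotient zero_quotient add_quotient zero_in add_in algebra_simps)

lemma finsum_quotient:
  assumes "finite S" "\<And>i. i \<in> S \<Longrightarrow> f i \<in> carrier A"
  shows "(\<Oplus>\<^bsub>quotient_algebra A I\<^esub>i\<in>S. I +>\<^bsub>A\<^esub> (f i)) = I +>\<^bsub>A\<^esub> (sum f S)"
  using assms
proof (induction S rule: finite_induct)
  case empty
  interpret Q: abelian_group "quotient_algebra A I" by (rule abelian_group_quotient)
  show ?case by (simp add: zero_quotient)
next
  case (insert i S)
  interpret Q: abelian_group "quotient_algebra A I" by (rule abelian_group_quotient)
  show ?case using insert
    by (subst Q.finsum_insert) (auto simp: carrier_quotient add_quotient sum_in)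
qed

end

end

lemma pm_algebra_free:
  "pm_algebra (free_nonunital_algebra X :: ('k::field, 'g free_mon \<Rightarrow>\<^sub>0 'k) module)"
    (is "pm_algebra ?F")
proof
  have c: "x \<in> carrier ?F \<longleftrightarrow> (\<forall>w\<in>Poly_Mapping.keys x. w \<noteq> 0 \<and> set (letters w) \<subseteq> X)" for x
    by (simp add: free_nonunital_algebra_def)
  have m: "x \<otimes>\<^bsub>?F\<^esub> y = x * y" for x y by (simp add: free_nonunital_algebra_def)
  show "add ?F = (+)" "zero ?F = 0" "module.smult ?F = pm_scale" "0 \<in> carrier ?F"
    by (simp_all add: free_nonunital_algebra_def)
  fix x y z :: "'g free_mon \<Rightarrow>\<^sub>0 'k"
  show "x \<in> carrier ?F \<Longrightarrow> pm_scale c x \<in> carrier ?F" for c by (simp add: c in_keys_iff)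
  assume xy: "x \<in> carrier ?F" "y \<in> carrier ?F"
  show "x + y \<in> carrier ?F"
    using xy keys_add[of x y] unfolding c by blast
  show "x \<otimes>\<^bsub>?F\<^esub> y \<in> carrier ?F"
    unfolding c m
  proof
    fix w assume "w \<in> Poly_Mapping.keys (x * y)"
    then obtain u v where uv: "u \<in> Poly_Mapping.keys x" "v \<in> Poly_Mapping.keys y" "w = u + v"
      using keys_mult[of x y] by blast
    then have "u \<noteq> 0" "set (letters u) \<subseteq> X" "set (letters v) \<subseteq> X" using xy by (auto simp: c)
    then show "w \<noteq> 0 \<and> set (letters w) \<subseteq> X"
      unfolding uv(3) plus_free_mon_def zero_free_mon_def by (cases u) auto
  qed
  show "(x + y) \<otimes>\<^bsub>?F\<^esub> z = x \<otimes>\<^bsub>?F\<^esub> z + y \<otimes>\<^bsub>?F\<^esub> z" "z \<otimes>\<^bsub>?F\<^esub> (x + y) = z \<otimes>\<^bsub>?F\<^esub> x + z \<otimes>\<^bsub>?F\<^esub> y"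
    unfolding m by (simp_all add: distrib_left distrib_right)
qed

section \<open>Ideals of Leavitt path algebras inside the free algebra\<close>

text \<open>A scalar as a multiple of the empty word. Scalar multiplication thereby becomes
  multiplication by a central element, and linearity needs no separate rules.\<close>

abbreviation sc :: "'k::field \<Rightarrow> ('w::monoid_add \<Rightarrow>\<^sub>0 'k)" where
  "sc c \<equiv> Poly_Mapping.single 0 c"

lemma sc_commute: "x * sc c = sc c * (x :: 'w::monoid_add \<Rightarrow>\<^sub>0 'k::field)"
  by (induction x rule: poly_mapping_single_induct)
     (simp_all add: distrib_left distrib_right mult_single mult.commute)

lemma sc_mult: "sc c * sc d = (sc (c * d) :: 'w::monoid_add \<Rightarrow>\<^sub>0 'k::field)"
  by (simp add: mult_single)

lemma sc_left_commute: "x * (sc c * y) = sc c * (x * (y :: 'w::monoid_add \<Rightarrow>\<^sub>0 'k::field))"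
  by (metis mult.assoc sc_commute)

locale leavitt = wf_digraph E for E :: "('v, 'e) pre_digraph" +
  fixes K :: "'k::field itself"
  assumes rf: "row_finite E"
begin

definition gens :: "('v, 'e) lpa_gen set" where
  "gens = Vertex ` verts E \<union> Edge ` arcs E \<union> Ghost ` arcs E"

text \<open>The empty word is allowed here, in contrast to \<open>F0\<close>: this is the unital
  free algebra, and \<open>F0\<close> is an ideal of it. It serves as the set of
  multipliers.\<close>

definition U :: "('v, 'e, 'k) lpa_free set" where
  "U = {x. \<forall>w\<in>Poly_Mapping.keys x. set (letters w) \<subseteq> gens}"

definition F0 :: "('v, 'e, 'k) lpa_free set" where
  "F0 = {x. \<forall>w\<in>Poly_Mapping.keys x. w \<noteq> 0 \<and> set (letters w) \<subseteq> gens}"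

abbreviation N :: "('v, 'e, 'k) lpa_free set" where "N \<equiv> lpa_ideal E"

abbreviation vx :: "'v \<Rightarrow> ('v, 'e, 'k) lpa_free" where "vx \<equiv> lpa_vx"
abbreviation ed :: "'e \<Rightarrow> ('v, 'e, 'k) lpa_free" where "ed \<equiv> lpa_ed"
abbreviation gh :: "'e \<Rightarrow> ('v, 'e, 'k) lpa_free" where "gh \<equiv> lpa_gh"

lemma carrier_F: "carrier (lpa_free_algebra E) = F0"
  by (simp add: lpa_free_algebra_def free_nonunital_algebra_def F0_def gens_def)

lemma mult_F: "x \<otimes>\<^bsub>lpa_free_algebra E\<^esub> y = x * y"
  by (simp add: lpa_free_algebra_def free_nonunital_algebra_def)

sublocale FA: pm_algebra "lpa_free_algebra E :: ('k, ('v, 'e, 'k) lpa_free) module"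
  rewrites "carrier (lpa_free_algebra E) \<equiv> F0" and "\<And>x y. x \<otimes>\<^bsub>lpa_free_algebra E\<^esub> y \<equiv> x * y"
  using pm_algebra_free unfolding atomize_eq carrier_F mult_F
  by (simp_all add: lpa_free_algebra_def[symmetric]) (simp add: lpa_free_algebra_def)

lemma scale_sc: "pm_scale c x = sc c * (x :: ('v, 'e, 'k) lpa_free)"
  by (rule mult_map_scale_conv_mult)

lemma F0_U: "x \<in> F0 \<Longrightarrow> x \<in> U"
  by (simp add: F0_def U_def)

lemma U_0 [simp]: "0 \<in> U" and U_1 [simp]: "1 \<in> U" and U_sc [simp]: "sc c \<in> U"
  by (auto simp: U_def zero_free_mon_def in_keys_iff lookup_single when_def lookup_one)

lemma U_add [simp]: "\<lbrakk>x \<in> U; y \<in> U\<rbrakk> \<Longrightarrow> x + y \<in> U"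
  using keys_add[of x y] unfolding U_def by blast

lemma U_uminus [simp]: "x \<in> U \<Longrightarrow> - x \<in> U"
  by (simp add: U_def in_keys_iff)

lemma U_minus [simp]: "\<lbrakk>x \<in> U; y \<in> U\<rbrakk> \<Longrightarrow> x - y \<in> U"
  using U_add[of x "- y"] by simp

lemma letters_plus [simp]: "letters (u + w) = letters u @ letters w"
  by (simp add: plus_free_mon_def)

lemma U_mult [simp]: "\<lbrakk>x \<in> U; y \<in> U\<rbrakk> \<Longrightarrow> x * y \<in> U"
proof -
  assume x: "x \<in> U" and y: "y \<in> U"
  show ?thesis unfolding U_def
  proof (intro CollectI ballI)
    fix w assume "w \<in> Poly_Mapping.keys (x * y)"
    then obtain u v where "u \<in> Poly_Mapping.keys x" "v \<in> Poly_Mapping.keys y" "w = u + v"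
      using keys_mult[of x y] by blast
    then show "set (letters w) \<subseteq> gens" using x y by (auto simp: U_def)
  qed
qed

lemma free_mon_add_eq_0: "u + w = (0 :: 'g free_mon) \<longleftrightarrow> u = 0 \<and> w = 0"
  by (cases u; cases w) (auto simp: plus_free_mon_def zero_free_mon_def)

lemma F0_iff: "x \<in> F0 \<longleftrightarrow> x \<in> U \<and> 0 \<notin> Poly_Mapping.keys x"
  by (auto simp: F0_def U_def)

lemma F0_U_mult [simp]: "\<lbrakk>x \<in> F0; y \<in> U\<rbrakk> \<Longrightarrow> x * y \<in> F0"
  using keys_mult[of x y] by (auto simp: F0_iff free_mon_add_eq_0)

lemma U_F0_mult [simp]: "\<lbrakk>x \<in> F0; y \<in> U\<rbrakk> \<Longrightarrow> y * x \<in> F0"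
  using keys_mult[of y x] by (auto simp: F0_iff free_mon_add_eq_0)

lemma F0_0 [simp]: "0 \<in> F0" by (simp add: F0_def)

lemma F0_add [simp]: "\<lbrakk>x \<in> F0; y \<in> F0\<rbrakk> \<Longrightarrow> x + y \<in> F0"
  and F0_minus [simp]: "\<lbrakk>x \<in> F0; y \<in> F0\<rbrakk> \<Longrightarrow> x - y \<in> F0"
  by (rule FA.add_in FA.minus_in; assumption)+

lemma single_U: "set (letters w) \<subseteq> gens \<Longrightarrow> Poly_Mapping.single w c \<in> U"
  by (auto simp: U_def split: if_splits)

lemma single_F0: "set (letters w) \<subseteq> gens \<Longrightarrow> w \<noteq> 0 \<Longrightarrow> Poly_Mapping.single w c \<in> F0"
  by (auto simp: F0_def split: if_splits)

lemma gen_F0 [simp]: "v \<in> verts E \<Longrightarrow> vx v \<in> F0" "e \<in> arcs E \<Longrightarrow> ed e \<in> F0" "e \<in> arcs E \<Longrightarrow> gh e \<in> F0"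
  by (auto intro!: single_F0 simp: gens_def zero_free_mon_def)

lemma gen_U [simp]: "v \<in> verts E \<Longrightarrow> vx v \<in> U" "e \<in> arcs E \<Longrightarrow> ed e \<in> U" "e \<in> arcs E \<Longrightarrow> gh e \<in> U"
  by (simp_all add: F0_U)

lemma U_sum: "(\<And>i. i \<in> S \<Longrightarrow> f i \<in> U) \<Longrightarrow> sum f S \<in> U"
  by (induction S rule: infinite_finite_induct) auto

lemma F0_sum: "(\<And>i. i \<in> S \<Longrightarrow> f i \<in> F0) \<Longrightarrow> sum f S \<in> F0"
  by (induction S rule: infinite_finite_induct) auto

lemma finite_out_arcs_rf [simp]: "v \<in> verts E \<Longrightarrow> finite (out_arcs E v)"
  using rf by (simp add: row_finite_def)

lemma relations_F0: "lpa_relations E \<subseteq> F0"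
proof -
  have "(\<Sum>e\<in>out_arcs E v. ed e * gh e) \<in> F0" for v
    by (rule F0_sum) (auto intro: F0_U_mult)
  then show ?thesis
    unfolding lpa_relations_def by auto
qed

lemma U_decomp:
  assumes "x \<in> U"
  shows "\<exists>c. \<exists>y\<in>F0. x = sc c + y"
  using assms
proof (induction x rule: poly_mapping_single_induct)
  case zero
  show ?case by (intro exI[of _ 0] bexI[of _ 0]) auto
next
  case (add x w d)
  have k: "Poly_Mapping.keys (Poly_Mapping.single w d + x) = insert w (Poly_Mapping.keys x)"
    using add(2,3) by (auto simp: in_keys_iff lookup_add lookup_single when_def split: if_splits)
  then have "x \<in> U" and w: "set (letters w) \<subseteq> gens" using add.prems unfolding U_def by blast+
  then obtain c y where cy: "y \<in> F0" "x = sc c + y" using add by blast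
  show ?case
  proof (cases "w = 0")
    case True
    then show ?thesis using cy by (intro exI[of _ "d + c"] bexI[of _ y]) (auto simp: single_add)
  next
    case False
    then show ?thesis using cy single_F0[OF w False]
      by (intro exI[of _ c] bexI[of _ "Poly_Mapping.single w d + y"]) auto
  qed
qed

text \<open>The ideals of the Leavitt path algebra correspond to the ideals of the free algebra that
  contain \<open>N\<close>; the unital algebra \<open>U\<close> acts on them because the quotient has local units.\<close>

definition idl :: "('v, 'e, 'k) lpa_free set \<Rightarrow> bool" where
  "idl I \<longleftrightarrow> I \<subseteq> F0 \<and> N \<subseteq> I \<and> 0 \<in> I \<and> (\<forall>x\<in>I. \<forall>y\<in>I. x + y \<in> I) \<and>
     (\<forall>a\<in>U. \<forall>x\<in>I. a * x \<in> I \<and> x * a \<in> I)"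

text \<open>By \<open>U_decomp\<close> a multiplier from \<open>U\<close> is a scalar plus an
  element of \<open>F0\<close>, and an algebra ideal is closed under both.\<close>

lemma idl_algebra_ideal: "idl I \<longleftrightarrow> algebra_ideal I (lpa_free_algebra E) \<and> N \<subseteq> I"
proof
  assume "idl I"
  then show "algebra_ideal I (lpa_free_algebra E) \<and> N \<subseteq> I"
    unfolding FA.algebra_ideal_iff idl_def scale_sc using F0_U U_sc by blast
next
  assume I: "algebra_ideal I (lpa_free_algebra E) \<and> N \<subseteq> I"
  have "a * x \<in> I \<and> x * a \<in> I" if a: "a \<in> U" and x: "x \<in> I" for a x
  proof -
    obtain c y where cy: "y \<in> F0" "a = sc c + y" using U_decomp[OF a] by blast
    have "sc c * x \<in> I" "y * x \<in> I" "x * y \<in> I"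
      using I x cy unfolding FA.algebra_ideal_iff scale_sc by blast+
    then show ?thesis using I unfolding FA.algebra_ideal_iff cy(2)
      by (simp add: distrib_left distrib_right sc_commute)
  qed
  then show "idl I" using I unfolding FA.algebra_ideal_iff idl_def by blast
qed

lemma idl_N: "idl N"
  unfolding idl_algebra_ideal lpa_ideal_def using FA.algebra_ideal_generated relations_F0 by auto

context
  fixes I assumes I: "idl I"
begin

lemma idl_sub: "x \<in> I \<Longrightarrow> x \<in> F0" and idl_N_sub: "x \<in> N \<Longrightarrow> x \<in> I" and idl_0: "0 \<in> I"
  and idl_add: "x \<in> I \<Longrightarrow> y \<in> I \<Longrightarrow> x + y \<in> I"
  and idl_l: "x \<in> I \<Longrightarrow> a \<in> U \<Longrightarrow> a * x \<in> I" and idl_r: "x \<in> I \<Longrightarrow> a \<in> U \<Longrightarrow> x * a \<in> I"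
  using I unfolding idl_def by auto

lemma idl_uminus: "x \<in> I \<Longrightarrow> - x \<in> I"
  using idl_l[of x "- 1"] by simp

lemma idl_minus: "x \<in> I \<Longrightarrow> y \<in> I \<Longrightarrow> x - y \<in> I"
  using idl_add[of x "- y"] idl_uminus by simp

lemma idl_sum: "(\<And>i. i \<in> S \<Longrightarrow> f i \<in> I) \<Longrightarrow> sum f S \<in> I"
  by (induction S rule: infinite_finite_induct) (auto intro: idl_0 idl_add)

lemma idl_scD: "sc c * x \<in> I \<Longrightarrow> c \<noteq> 0 \<Longrightarrow> x \<in> I"
  using idl_l[of "sc c * x" "sc (inverse c)"] by (simp add: mult.assoc[symmetric] sc_mult)

end

text \<open>With \<open>I = N\<close> this is equality in the Leavitt path algebra; larger
  \<open>I\<close> give equality in its quotients.\<close>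

definition eqm :: "('v, 'e, 'k) lpa_free set \<Rightarrow> ('v, 'e, 'k) lpa_free \<Rightarrow> ('v, 'e, 'k) lpa_free \<Rightarrow> bool"
  where "eqm I x y \<longleftrightarrow> x - y \<in> I"

context
  fixes I assumes I: "idl I"
begin

lemma eqm_refl: "eqm I x x" using I by (simp add: eqm_def idl_0)

lemma eqm_sym: "eqm I x y \<Longrightarrow> eqm I y x" using idl_uminus[OF I, of "x - y"] by (simp add: eqm_def)

lemma eqm_trans: "eqm I x y \<Longrightarrow> eqm I y z \<Longrightarrow> eqm I x z"
  using idl_add[OF I, of "x - y" "y - z"] by (simp add: eqm_def)

lemma eqm_l: "eqm I x y \<Longrightarrow> a \<in> U \<Longrightarrow> eqm I (a * x) (a * y)"
  using idl_l[OF I, of "x - y" a] by (simp add: eqm_def algebra_simps)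

lemma eqm_r: "eqm I x y \<Longrightarrow> a \<in> U \<Longrightarrow> eqm I (x * a) (y * a)"
  using idl_r[OF I, of "x - y" a] by (simp add: eqm_def algebra_simps)

lemma eqm_lr: "eqm I x y \<Longrightarrow> a \<in> U \<Longrightarrow> b \<in> U \<Longrightarrow> eqm I (a * x * b) (a * y * b)"
  by (intro eqm_l eqm_r)

lemma eqm_mult: "\<lbrakk>eqm I x x'; eqm I y y'; x' \<in> U; y \<in> U\<rbrakk> \<Longrightarrow> eqm I (x * y) (x' * y')"
  by (rule eqm_trans[OF eqm_r eqm_l])

lemma eqm_add: "\<lbrakk>eqm I x x'; eqm I y y'\<rbrakk> \<Longrightarrow> eqm I (x + y) (x' + y')"
  using idl_add[OF I, of "x - x'" "y - y'"] by (simp add: eqm_def algebra_simps)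

lemma eqm_sum: "(\<And>i. i \<in> S \<Longrightarrow> eqm I (f i) (g i)) \<Longrightarrow> eqm I (sum f S) (sum g S)"
  using idl_sum[OF I, of S "\<lambda>i. f i - g i"] by (simp add: eqm_def sum_subtractf)

lemma eqm_mem: "eqm I x y \<Longrightarrow> x \<in> I \<longleftrightarrow> y \<in> I"
  using idl_add[OF I, of "x - y" y] idl_minus[OF I, of x "x - y"] by (auto simp: eqm_def)

lemma eqm_0: "eqm I x 0 \<longleftrightarrow> x \<in> I" by (simp add: eqm_def)

lemma eqm_N: "eqm N x y \<Longrightarrow> eqm I x y" using idl_N_sub[OF I] by (simp add: eqm_def)

end

lemma rel_in_N: "r \<in> lpa_relations E \<Longrightarrow> r \<in> N"
  unfolding lpa_ideal_def using FA.generated_superset by blast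

lemma rel_vv: "\<lbrakk>v \<in> verts E; w \<in> verts E\<rbrakk> \<Longrightarrow> eqm N (vx v * vx w) (if v = w then vx v else 0)"
  unfolding eqm_def by (rule rel_in_N) (auto simp only: lpa_relations_def)

lemma rel_se: "e \<in> arcs E \<Longrightarrow> eqm N (vx (tail E e) * ed e) (ed e)"
  unfolding eqm_def by (rule rel_in_N) (auto simp only: lpa_relations_def)

lemma rel_er: "e \<in> arcs E \<Longrightarrow> eqm N (ed e * vx (head E e)) (ed e)"
  unfolding eqm_def by (rule rel_in_N) (auto simp only: lpa_relations_def)

lemma rel_rg: "e \<in> arcs E \<Longrightarrow> eqm N (vx (head E e) * gh e) (gh e)"
  unfolding eqm_def by (rule rel_in_N) (auto simp only: lpa_relations_def)

lemma rel_gs: "e \<in> arcs E \<Longrightarrow> eqm N (gh e * vx (tail E e)) (gh e)"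
  unfolding eqm_def by (rule rel_in_N) (auto simp only: lpa_relations_def)

lemma rel_ge: "\<lbrakk>e \<in> arcs E; f \<in> arcs E\<rbrakk> \<Longrightarrow> eqm N (gh e * ed f) (if e = f then vx (head E e) else 0)"
  unfolding eqm_def by (rule rel_in_N) (auto simp only: lpa_relations_def)

lemma rel_ck: "\<lbrakk>v \<in> verts E; out_arcs E v \<noteq> {}\<rbrakk> \<Longrightarrow> eqm N (vx v) (\<Sum>e\<in>out_arcs E v. ed e * gh e)"
  unfolding eqm_def by (rule rel_in_N) (auto simp only: lpa_relations_def)

section \<open>Monomials and the reduction theorem\<close>

text \<open>Both ends are arguments because the empty edge list does not determine its
  vertex.\<close>

primrec path :: "'v \<Rightarrow> 'e list \<Rightarrow> 'v \<Rightarrow> bool" where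
  "path u [] w \<longleftrightarrow> u = w \<and> u \<in> verts E"
| "path u (e # p) w \<longleftrightarrow> e \<in> arcs E \<and> tail E e = u \<and> path (head E e) p w"

lemma path_verts: "path u p w \<Longrightarrow> u \<in> verts E \<and> w \<in> verts E"
  by (induction p arbitrary: u) auto

lemma path_append: "path u (p @ q) w \<longleftrightarrow> (\<exists>z. path u p z \<and> path z q w)"
  by (induction p arbitrary: u) (auto dest: path_verts)

lemma path_arcs: "path u p w \<Longrightarrow> set p \<subseteq> arcs E"
  by (induction p arbitrary: u) auto

lemma path_end_unique: "path u p w \<Longrightarrow> path u p w' \<Longrightarrow> w = w'"
  by (induction p arbitrary: u) auto

lemma path_start_unique: "path u p w \<Longrightarrow> path u' p w \<Longrightarrow> u = u'"
  by (cases p) auto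

lemma path_reachable: "path u p w \<Longrightarrow> u \<rightarrow>\<^sup>*\<^bsub>E\<^esub> w"
proof (induction p arbitrary: u)
  case (Cons e p)
  then have "u \<rightarrow>\<^bsub>E\<^esub> head E e" by (intro dominatesI[where a = e]) (auto simp: arc_to_ends_def)
  then show ?case using Cons by (auto intro: adj_reachable_trans)
qed simp

lemma reachable_path:
  assumes "u \<rightarrow>\<^sup>*\<^bsub>E\<^esub> w" shows "\<exists>p. path u p w"
  using assms
proof (induction rule: converse_reachable_induct)
  case base
  then show ?case by (intro exI[of _ "[]"]) auto
next
  case (step x y)
  then obtain e p where "e \<in> arcs E" "tail E e = x" "head E e = y" "path y p w" by blast
  then show ?case by (intro exI[of _ "e # p"]) auto
qed

definition Ed :: "'e list \<Rightarrow> ('v, 'e, 'k) lpa_free" where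
  "Ed p = Poly_Mapping.single (FM (map Edge p)) 1"

text \<open>The adjoint reverses products, so the ghost letters of a path appear in reverse
  order.\<close>

definition Gh :: "'e list \<Rightarrow> ('v, 'e, 'k) lpa_free" where
  "Gh p = Poly_Mapping.single (FM (rev (map Ghost p))) 1"

lemma plus_FM [simp]: "FM xs + FM ys = FM (xs @ ys)"
  by (simp add: plus_free_mon_def)

lemma FM_Nil: "FM [] = 0"
  by (simp add: zero_free_mon_def)

lemma letters_0 [simp]: "letters 0 = []"
  by (simp add: zero_free_mon_def)

text \<open>The empty path gives the unit of \<open>U\<close>, not a vertex. For this reason the end
  vertex of a path is carried along as an explicit factor in what follows.\<close>

lemma Ed_Nil [simp]: "Ed [] = 1" and Gh_Nil [simp]: "Gh [] = 1"
  by (simp_all add: Ed_def Gh_def FM_Nil)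

lemma Ed_Cons: "Ed (e # p) = ed e * Ed p" and Gh_Cons: "Gh (e # p) = Gh p * gh e"
  by (simp_all add: Ed_def Gh_def mult_single)

lemma Ed_append: "Ed (p @ q) = Ed p * Ed q" and Gh_append: "Gh (p @ q) = Gh q * Gh p"
  by (simp_all add: Ed_def Gh_def mult_single)

lemma Ed_U [simp]: "set p \<subseteq> arcs E \<Longrightarrow> Ed p \<in> U" and Gh_U [simp]: "set p \<subseteq> arcs E \<Longrightarrow> Gh p \<in> U"
  by (auto simp: Ed_def Gh_def gens_def subset_iff image_iff intro!: single_U)

lemma path_U [simp]: "path u p w \<Longrightarrow> Ed p \<in> U" "path u p w \<Longrightarrow> Gh p \<in> U"
  "path u p w \<Longrightarrow> vx u \<in> U" "path u p w \<Longrightarrow> vx w \<in> U" "path u p w \<Longrightarrow> vx u \<in> F0" "path u p w \<Longrightarrow> vx w \<in> F0"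
  using path_arcs path_verts by auto

lemmas eN_trans [trans] = eqm_trans[OF idl_N]
lemmas eN_refl = eqm_refl[OF idl_N]
lemmas eN_sym = eqm_sym[OF idl_N]
lemmas eN_l = eqm_l[OF idl_N]
lemmas eN_r = eqm_r[OF idl_N]
lemmas eN_lr = eqm_lr[OF idl_N]

lemma rel_vv_same: "v \<in> verts E \<Longrightarrow> eqm N (vx v * vx v) (vx v)"
  using rel_vv[of v v] by simp

lemma rel_vv_diff: "\<lbrakk>v \<in> verts E; w \<in> verts E; v \<noteq> w\<rbrakk> \<Longrightarrow> eqm N (vx v * vx w) 0"
  using rel_vv[of v w] by simp

text \<open>The trailing \<open>vx w\<close> makes the identity hold for the empty path as
  well.\<close>

lemma vx_Ed:
  assumes "path u p w"
  shows "eqm N (vx u * (Ed p * vx w)) (Ed p * vx w)"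
proof (cases p)
  case Nil
  then show ?thesis using assms rel_vv_same by auto
next
  case (Cons e p')
  then have e: "e \<in> arcs E" "u = tail E e" and p': "path (head E e) p' w" using assms by auto
  show ?thesis using eN_r[OF rel_se[OF e(1)], of "Ed p' * vx w"] p' e by (simp add: Cons Ed_Cons mult.assoc)
qed

lemma Gh_vx:
  assumes "path u q w"
  shows "eqm N (vx w * Gh q * vx u) (vx w * Gh q)"
proof (cases q)
  case Nil
  then show ?thesis using assms rel_vv_same by auto
next
  case (Cons e q')
  then have e: "e \<in> arcs E" "u = tail E e" and p': "path (head E e) q' w" using assms by auto
  show ?thesis using eN_l[OF rel_gs[OF e(1)], of "vx w * Gh q'"] p' e by (simp add: Cons Gh_Cons mult.assoc)
qed

lemma vx_Ed_diff:
  assumes "path u p w" "z \<in> verts E" "z \<noteq> u"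
  shows "eqm N (vx z * (Ed p * vx w)) 0"
proof -
  have "eqm N (vx z * (Ed p * vx w)) (vx z * (vx u * (Ed p * vx w)))"
    using assms by (intro eN_l[OF eN_sym[OF vx_Ed]]) auto
  also have "eqm N \<dots> 0"
    using eN_r[OF rel_vv_diff[of z u], of "Ed p * vx w"] assms path_verts[OF assms(1)] by (simp add: mult.assoc)
  finally show ?thesis .
qed

lemma Gh_vx_diff:
  assumes "path u q w" "z \<in> verts E" "z \<noteq> u"
  shows "eqm N (vx w * Gh q * vx z) 0"
proof -
  have "eqm N (vx w * Gh q * vx z) (vx w * Gh q * vx u * vx z)"
    using assms by (intro eN_r[OF eN_sym[OF Gh_vx]]) auto
  also have "eqm N \<dots> 0"
    using eN_l[OF rel_vv_diff[of u z], of "vx w * Gh q"] assms path_verts[OF assms(1)] by (simp add: mult.assoc)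
  finally show ?thesis .
qed

text \<open>The innermost pair, ghost edge times edge, collapses to a vertex, which
  \<open>vx_Ed\<close> absorbs into the rest of the path.\<close>

lemma Gh_Ed:
  assumes "path u p w"
  shows "eqm N (vx w * Gh p * (Ed p * vx w)) (vx w)"
  using assms
proof (induction p arbitrary: u)
  case Nil
  then show ?case using rel_vv_same by auto
next
  case (Cons e p)
  then have e: "e \<in> arcs E" and p: "path (head E e) p w" by auto
  have "vx w * Gh (e # p) * (Ed (e # p) * vx w) = vx w * Gh p * (gh e * ed e) * (Ed p * vx w)"
    by (simp add: Gh_Cons Ed_Cons mult.assoc)
  also have "eqm N \<dots> (vx w * Gh p * vx (head E e) * (Ed p * vx w))"
    using rel_ge[OF e e] p by (intro eN_lr) auto
  also have "eqm N \<dots> (vx w * Gh p * (Ed p * vx w))"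
    using eN_l[OF vx_Ed[OF p], of "vx w * Gh p"] p by (simp add: mult.assoc)
  also have "eqm N \<dots> (vx w)" using Cons.IH p by blast
  finally show ?case .
qed

text \<open>A list of quadruples \<open>(k, p, w, q)\<close> stands for the linear combination of the monomials
  \<open>p w q\<^sup>*\<close>, where \<open>p\<close> and \<open>q\<close> are paths ending at \<open>w\<close>; lists rather than finite
  sets avoid the collisions that occur when monomials are shortened.\<close>

fun mon :: "'k \<times> 'e list \<times> 'v \<times> 'e list \<Rightarrow> ('v, 'e, 'k) lpa_free" where
  "mon (k, p, w, q) = sc k * (Ed p * vx w * Gh q)"

definition ev :: "('k \<times> 'e list \<times> 'v \<times> 'e list) list \<Rightarrow> ('v, 'e, 'k) lpa_free" where
  "ev ts = sum_list (map mon ts)"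

lemma ev_simps [simp]: "ev [] = 0" "ev (t # ts) = mon t + ev ts" "ev (ts @ ts') = ev ts + ev ts'"
  by (simp_all add: ev_def)

text \<open>The ends \<open>u\<close> and \<open>v\<close> are the sources of the two paths, so that
  the monomial lies in the corner between \<open>vx u\<close> on the left and \<open>vx v\<close> on
  the right.\<close>

fun mpath :: "'v \<Rightarrow> 'v \<Rightarrow> 'k \<times> 'e list \<times> 'v \<times> 'e list \<Rightarrow> bool" where
  "mpath u v (k, p, w, q) \<longleftrightarrow> path u p w \<and> path v q w"

lemma mpath_F0: "mpath u v t \<Longrightarrow> mon t \<in> F0"
  by (cases t) (auto simp: mult.assoc)

lemma ev_F0: "(\<And>t. t \<in> set ts \<Longrightarrow> \<exists>u v. mpath u v t) \<Longrightarrow> ev ts \<in> F0"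
proof (induction ts)
  case (Cons t ts)
  then have "mon t \<in> F0" "ev ts \<in> F0" using mpath_F0 by (meson list.set_intros)+
  then show ?case by simp
qed simp

text \<open>Each term may turn into a list of terms; the empty list records that it
  vanishes.\<close>

lemma ev_map:
  assumes "idl I" and "\<And>t. t \<in> set ts \<Longrightarrow> eqm I (a * mon t * b) (ev (f t))"
  shows "eqm I (a * ev ts * b) (ev (concat (map f ts)))"
  using assms(2)
proof (induction ts)
  case (Cons t ts)
  then show ?case
    using eqm_add[OF assms(1), of "a * mon t * b" "ev (f t)" "a * ev ts * b" "ev (concat (map f ts))"]
    by (simp add: distrib_left distrib_right)
qed (simp add: eqm_refl[OF assms(1)])

lemma vx_mon: "mpath u v t \<Longrightarrow> eqm N (vx u * mon t) (mon t)"
  and mon_vx: "mpath u v t \<Longrightarrow> eqm N (mon t * vx v) (mon t)"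
proof -
  assume t: "mpath u v t"
  obtain k p w q where [simp]: "t = (k, p, w, q)" by (cases t)
  have [simp]: "Ed p \<in> U" "Gh q \<in> U" "vx w \<in> U" using t by auto
  have 1: "eqm N (vx u * (Ed p * vx w)) (Ed p * vx w)" "eqm N (vx w * Gh q * vx v) (vx w * Gh q)"
    using t vx_Ed Gh_vx by auto
  show "eqm N (vx u * mon t) (mon t)"
    using eN_lr[OF 1(1), of "sc k" "Gh q"] t by (simp add: mult.assoc sc_left_commute)
  show "eqm N (mon t * vx v) (mon t)"
    using eN_l[OF 1(2), of "sc k * Ed p"] t by (simp add: mult.assoc)
qed

lemma vx_mon_diff: "\<lbrakk>mpath u v t; z \<in> verts E; z \<noteq> u\<rbrakk> \<Longrightarrow> eqm N (vx z * mon t) 0"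
  and mon_vx_diff: "\<lbrakk>mpath u v t; z \<in> verts E; z \<noteq> v\<rbrakk> \<Longrightarrow> eqm N (mon t * vx z) 0"
proof -
  assume t: "mpath u v t" and z: "z \<in> verts E"
  obtain k p w q where [simp]: "t = (k, p, w, q)" by (cases t)
  have [simp]: "Ed p \<in> U" "Gh q \<in> U" "vx w \<in> U" using t by auto
  show "eqm N (vx z * mon t) 0" if "z \<noteq> u"
    using eN_lr[OF vx_Ed_diff[of u p w z], of "sc k" "Gh q"] t z that by (simp add: mult.assoc sc_left_commute)
  show "eqm N (mon t * vx z) 0" if "z \<noteq> v"
    using eN_l[OF Gh_vx_diff[of v q w z], of "sc k * Ed p"] t z that by (simp add: mult.assoc)
qed

text \<open>The first edge of the ghost path is the last letter of the monomial, so it is the one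
  that meets \<open>e\<close>: the two cancel or the product is zero. Without ghosts the path is
  prolonged by \<open>e\<close>.\<close>

fun times_ed :: "'e \<Rightarrow> 'k \<times> 'e list \<times> 'v \<times> 'e list \<Rightarrow> ('k \<times> 'e list \<times> 'v \<times> 'e list) list" where
  "times_ed e (k, p, w, []) = [(k, p @ [e], head E e, [])]"
| "times_ed e (k, p, w, f # q) = (if f = e then [(k, p, w, q)] else [])"

fun gh_times :: "'e \<Rightarrow> 'k \<times> 'e list \<times> 'v \<times> 'e list \<Rightarrow> ('k \<times> 'e list \<times> 'v \<times> 'e list) list" where
  "gh_times e (k, [], w, q) = [(k, [], head E e, q @ [e])]"
| "gh_times e (k, f # p, w, q) = (if f = e then [(k, p, w, q)] else [])"

lemma times_ed_mpath: "\<lbrakk>mpath u (tail E e) t; e \<in> arcs E; s \<in> set (times_ed e t)\<rbrakk> \<Longrightarrow> mpath u (head E e) s"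
  by (cases "(e, t)" rule: times_ed.cases) (auto simp: path_append split: if_splits)

lemma gh_times_mpath: "\<lbrakk>mpath (tail E e) v t; e \<in> arcs E; s \<in> set (gh_times e t)\<rbrakk> \<Longrightarrow> mpath (head E e) v s"
  by (cases "(e, t)" rule: gh_times.cases) (auto simp: path_append split: if_splits)

lemma mon_ed:
  assumes t: "mpath u (tail E e) t" and e: "e \<in> arcs E"
  shows "eqm N (mon t * ed e) (ev (times_ed e t))"
proof (cases "(e, t)" rule: times_ed.cases)
  case (1 e' k p w)
  then have t': "t = (k, p, tail E e, [])" "path u p (tail E e)" "w = tail E e" using t by auto
  have "eqm N (vx (tail E e) * ed e) (ed e * vx (head E e))"
    using eN_trans[OF rel_se[OF e] eN_sym[OF rel_er[OF e]]] .
  from eN_l[OF this, of "sc k * Ed p"] t'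
  show ?thesis by (simp add: Ed_append Ed_Cons mult.assoc)
next
  case (2 e' k p w f q)
  then have t': "t = (k, p, w, f # q)" "path u p w" "path (tail E e) (f # q) w" using t by auto
  then have f: "f \<in> arcs E" and q: "path (head E f) q w" by auto
  have "eqm N (sc k * Ed p * (vx w * Gh q) * (gh f * ed e))
      (sc k * Ed p * (vx w * Gh q) * (if f = e then vx (head E f) else 0))"
    using t'(2) q by (intro eN_l[OF rel_ge[OF f e]]) auto
  also have "eqm N \<dots> (ev (times_ed e t))"
  proof (cases "f = e")
    case True
    have "eqm N (sc k * Ed p * (vx w * Gh q * vx (head E f))) (sc k * Ed p * (vx w * Gh q))"
      using t'(2) q by (intro eN_l[OF Gh_vx]) auto
    then show ?thesis using t' True by (simp add: mult.assoc)
  qed (use t' in \<open>simp add: eN_refl\<close>)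
  finally show ?thesis using t' by (simp add: Gh_Cons mult.assoc)
qed

lemma gh_mon:
  assumes t: "mpath (tail E e) v t" and e: "e \<in> arcs E"
  shows "eqm N (gh e * mon t) (ev (gh_times e t))"
proof (cases "(e, t)" rule: gh_times.cases)
  case (1 e' k w q)
  then have t': "t = (k, [], tail E e, q)" "path v q (tail E e)" "w = tail E e" using t by auto
  have "eqm N (gh e * vx (tail E e)) (vx (head E e) * gh e)"
    using eN_trans[OF rel_gs[OF e] eN_sym[OF rel_rg[OF e]]] .
  from eN_lr[OF this, of "sc k" "Gh q"] t'
  show ?thesis by (simp add: Gh_append Gh_Cons mult.assoc sc_left_commute)
next
  case (2 e' k f p w q)
  then have t': "t = (k, f # p, w, q)" "path v q w" "path (tail E e) (f # p) w" using t by auto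
  then have f: "f \<in> arcs E" and p: "path (head E f) p w" by auto
  have "eqm N (sc k * (gh e * ed f) * (Ed p * vx w * Gh q))
      (sc k * (if e = f then vx (head E e) else 0) * (Ed p * vx w * Gh q))"
    using t'(2) p by (intro eN_lr[OF rel_ge[OF e f]]) auto
  also have "eqm N \<dots> (ev (gh_times e t))"
  proof (cases "f = e")
    case True
    have "eqm N (sc k * (vx (head E f) * (Ed p * vx w)) * Gh q) (sc k * (Ed p * vx w) * Gh q)"
      using t'(2) p by (intro eN_lr[OF vx_Ed]) auto
    then show ?thesis using t' True by (simp add: mult.assoc)
  qed (use t' in \<open>simp add: eN_refl\<close>)
  finally show ?thesis using t' by (simp add: Ed_Cons mult.assoc sc_left_commute)
qed

lemma ed_mon:
  assumes t: "mpath (head E e) v (k, p, w, q)" and e: "e \<in> arcs E"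
  shows "ed e * mon (k, p, w, q) = mon (k, e # p, w, q)" "mpath (tail E e) v (k, e # p, w, q)"
  using assms by (auto simp: Ed_Cons mult.assoc sc_left_commute)

section \<open>Local units and the spanning monomials\<close>

fun gsrc :: "('v, 'e) lpa_gen \<Rightarrow> 'v" where
  "gsrc (Vertex v) = v" | "gsrc (Edge e) = tail E e" | "gsrc (Ghost e) = head E e"

fun grng :: "('v, 'e) lpa_gen \<Rightarrow> 'v" where
  "grng (Vertex v) = v" | "grng (Edge e) = head E e" | "grng (Ghost e) = tail E e"

abbreviation letter :: "('v, 'e) lpa_gen \<Rightarrow> ('v, 'e, 'k) lpa_free" where
  "letter g \<equiv> Poly_Mapping.single (FM [g]) 1"

lemma gsrc_verts: "g \<in> gens \<Longrightarrow> gsrc g \<in> verts E" and grng_verts: "g \<in> gens \<Longrightarrow> grng g \<in> verts E"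
  by (auto simp: gens_def)

lemma letter_U: "g \<in> gens \<Longrightarrow> letter g \<in> U"
  by (intro single_U) auto

lemma gsrc_letter: "g \<in> gens \<Longrightarrow> eqm N (vx (gsrc g) * letter g) (letter g)"
  and letter_grng: "g \<in> gens \<Longrightarrow> eqm N (letter g * vx (grng g)) (letter g)"
  by (auto simp: gens_def rel_vv_same rel_se rel_er rel_gs rel_rg)

text \<open>By orthogonality only the summand at the source, respectively at the range, of the
  letter survives.\<close>

lemma sum_vx_letter:
  assumes g: "g \<in> gens" and T: "finite T" "T \<subseteq> verts E"
  shows "gsrc g \<in> T \<Longrightarrow> eqm N ((\<Sum>u\<in>T. vx u) * letter g) (letter g)"
    and "grng g \<in> T \<Longrightarrow> eqm N (letter g * (\<Sum>u\<in>T. vx u)) (letter g)"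
proof -
  have 1: "eqm N (vx u * letter g) (if u = gsrc g then letter g else 0)" if u: "u \<in> T" for u
  proof -
    have "eqm N (vx u * letter g) (vx u * (vx (gsrc g) * letter g))"
      using u T by (intro eN_l[OF eN_sym[OF gsrc_letter[OF g]]]) auto
    also have "eqm N (vx u * (vx (gsrc g) * letter g)) ((if u = gsrc g then vx u else 0) * letter g)"
      using eN_r[OF rel_vv[of u "gsrc g"] letter_U[OF g]] u T gsrc_verts[OF g] by (auto simp: mult.assoc)
    also have "eqm N \<dots> (if u = gsrc g then letter g else 0)"
      using gsrc_letter[OF g] eN_refl by auto
    finally show ?thesis .
  qed
  have 2: "eqm N (letter g * vx u) (if u = grng g then letter g else 0)" if u: "u \<in> T" for u
  proof -
    have "eqm N (letter g * vx u) (letter g * vx (grng g) * vx u)"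
      using u T by (intro eN_r[OF eN_sym[OF letter_grng[OF g]]]) auto
    also have "eqm N (letter g * vx (grng g) * vx u) (letter g * (if u = grng g then vx u else 0))"
      using eN_l[OF rel_vv[of "grng g" u] letter_U[OF g]] u T grng_verts[OF g] by (auto simp: mult.assoc)
    also have "eqm N \<dots> (if u = grng g then letter g else 0)"
      using letter_grng[OF g] eN_refl by auto
    finally show ?thesis .
  qed
  show "eqm N ((\<Sum>u\<in>T. vx u) * letter g) (letter g)" if "gsrc g \<in> T"
    using eqm_sum[OF idl_N 1, of T "\<lambda>x. x"] that T(1) by (simp add: sum_distrib_right)
  show "eqm N (letter g * (\<Sum>u\<in>T. vx u)) (letter g)" if "grng g \<in> T"
    using eqm_sum[OF idl_N 2, of T "\<lambda>x. x"] that T(1) by (simp add: sum_distrib_left)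
qed

lemma keys_single_add:
  assumes "w \<notin> Poly_Mapping.keys x" "c \<noteq> (0 :: 'k)"
  shows "Poly_Mapping.keys (Poly_Mapping.single w c + x) = insert w (Poly_Mapping.keys x)"
proof -
  have "u \<in> Poly_Mapping.keys (Poly_Mapping.single w c + x) \<longleftrightarrow> u \<in> insert w (Poly_Mapping.keys x)" for u
    using assms by (cases "u = w") (auto simp: in_keys_iff lookup_add lookup_single)
  then show ?thesis by blast
qed

text \<open>The coefficient is split off as \<open>sc c\<close>, so that linear statements need to
  be checked on plain words only.\<close>

lemma F0_induct [consumes 1, case_names zero add]:
  assumes "x \<in> F0" and "P 0"
    and "\<And>x c ls. \<lbrakk>x \<in> F0; P x; ls \<noteq> []; set ls \<subseteq> gens\<rbrakk> \<Longrightarrow> P (sc c * Poly_Mapping.single (FM ls) 1 + x)"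
  shows "P x"
  using assms(1)
proof (induction x rule: poly_mapping_single_induct)
  case (add x w d)
  have k: "Poly_Mapping.keys (Poly_Mapping.single w d + x) = insert w (Poly_Mapping.keys x)"
    by (rule keys_single_add[OF add(2,3)])
  have x: "x \<in> F0" and w: "w \<noteq> 0" "set (letters w) \<subseteq> gens"
    using add.prems unfolding F0_def k mem_Collect_eq ball_simps by (iprover)+
  have "letters w \<noteq> []" using w(1) by (metis FM_Nil free_mon.collapse)
  from assms(3)[OF x add(1)[OF x] this w(2), of d]
  have "P (Poly_Mapping.single (FM (letters w)) d + x)" by (simp add: mult_single)
  then show ?case by simp
qed (rule assms(2))

lemma word_split: "Poly_Mapping.single (FM (g # ls)) 1 = letter g * Poly_Mapping.single (FM ls) 1"
    "Poly_Mapping.single (FM (ls @ [g])) 1 = Poly_Mapping.single (FM ls) 1 * letter g"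
  by (simp_all add: mult_single)

text \<open>The statement covers all finite supersets \<open>T\<close> so that the sets found for
  two summands can be enlarged to a common one. For a single word the source of its first and the
  range of its last letter suffice.\<close>

lemma local_units:
  assumes "x \<in> F0"
  shows "\<exists>S. finite S \<and> S \<subseteq> verts E \<and> (\<forall>T. finite T \<longrightarrow> S \<subseteq> T \<longrightarrow> T \<subseteq> verts E \<longrightarrow>
    eqm N ((\<Sum>u\<in>T. vx u) * x) x \<and> eqm N (x * (\<Sum>u\<in>T. vx u)) x)"
  using assms
proof (induction x rule: F0_induct)
  case zero
  show ?case by (intro exI[of _ "{}"]) (auto simp: eN_refl)
next
  case (add x c ls)
  then obtain S where S: "finite S" "S \<subseteq> verts E" "\<And>T. \<lbrakk>finite T; S \<subseteq> T; T \<subseteq> verts E\<rbrakk> \<Longrightarrow>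
    eqm N ((\<Sum>u\<in>T. vx u) * x) x \<and> eqm N (x * (\<Sum>u\<in>T. vx u)) x" by blast
  let ?m = "Poly_Mapping.single (FM ls) 1 :: ('v, 'e, 'k) lpa_free"
  show ?case
  proof (intro exI[of _ "insert (gsrc (hd ls)) (insert (grng (last ls)) S)"] conjI allI impI)
    have g: "hd ls \<in> gens" "last ls \<in> gens" using add.hyps by auto
    then show "insert (gsrc (hd ls)) (insert (grng (last ls)) S) \<subseteq> verts E" "finite (insert (gsrc (hd ls)) (insert (grng (last ls)) S))"
      using S gsrc_verts grng_verts by auto
    fix T assume T: "finite T" "insert (gsrc (hd ls)) (insert (grng (last ls)) S) \<subseteq> T" "T \<subseteq> verts E"
    let ?T = "\<Sum>u\<in>T. vx u"
    have [simp]: "set (tl ls) \<subseteq> gens" using add.hyps by (cases ls) auto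
    have [simp]: "set (butlast ls) \<subseteq> gens" using add.hyps by (auto dest: in_set_butlastD)
    have "eqm N (sc c * (?T * letter (hd ls)) * Poly_Mapping.single (FM (tl ls)) 1)
        (sc c * letter (hd ls) * Poly_Mapping.single (FM (tl ls)) 1)"
      using add.hyps T g by (intro eN_lr[OF sum_vx_letter(1)] single_U) auto
    then have "eqm N (?T * (sc c * ?m)) (sc c * ?m)"
      using word_split(1)[of "hd ls" "tl ls"] add.hyps by (simp add: mult.assoc sc_left_commute)
    with S(3)[of T] T show "eqm N (?T * (sc c * ?m + x)) (sc c * ?m + x)"
      by (simp add: distrib_left eqm_add[OF idl_N])
    have "eqm N (sc c * Poly_Mapping.single (FM (butlast ls)) 1 * (letter (last ls) * ?T))
        (sc c * Poly_Mapping.single (FM (butlast ls)) 1 * letter (last ls))"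
      using add.hyps T g by (intro eN_l[OF sum_vx_letter(2)] U_mult single_U) auto
    then have "eqm N ((sc c * ?m) * ?T) (sc c * ?m)"
      using word_split(2)[of "butlast ls" "last ls"] add.hyps by (simp add: mult.assoc)
    with S(3)[of T] T show "eqm N ((sc c * ?m + x) * ?T) (sc c * ?m + x)"
      by (simp add: distrib_right eqm_add[OF idl_N])
  qed
qed

text \<open>Otherwise all products with vertices would lie in \<open>I\<close>, hence also their sum
  over a local unit, which is congruent to \<open>x\<close>.\<close>

lemma exists_vx:
  assumes I: "idl I" and x: "x \<in> F0" "x \<notin> I"
  shows "\<exists>u\<in>verts E. vx u * x \<notin> I" "\<exists>u\<in>verts E. x * vx u \<notin> I"
proof -
  obtain S where S: "S \<subseteq> verts E" "eqm N ((\<Sum>u\<in>S. vx u) * x) x" "eqm N (x * (\<Sum>u\<in>S. vx u)) x"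
    using local_units[OF x(1)] by blast
  show "\<exists>u\<in>verts E. vx u * x \<notin> I"
    using S x idl_sum[OF I, of S "\<lambda>u. vx u * x"] eqm_mem[OF I eqm_N[OF I S(2)]] by (auto simp: sum_distrib_right)
  show "\<exists>u\<in>verts E. x * vx u \<notin> I"
    using S x idl_sum[OF I, of S "\<lambda>u. x * vx u"] eqm_mem[OF I eqm_N[OF I S(3)]] by (auto simp: sum_distrib_left)
qed

lemma letter_mon:
  assumes g: "g \<in> gens" and t: "mpath u v t"
  shows "\<exists>ts u. eqm N (letter g * mon t) (ev ts) \<and> (\<forall>s\<in>set ts. mpath u v s)"
proof -
  obtain k p w q where teq: "t = (k, p, w, q)" by (cases t)
  consider z where "g = Vertex z" "z \<in> verts E" | e where "g = Edge e" "e \<in> arcs E" | e where "g = Ghost e" "e \<in> arcs E"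
    using g by (auto simp: gens_def)
  then show ?thesis
  proof cases
    case 1
    then show ?thesis
    proof (cases "z = u")
      case True
      then show ?thesis using 1 vx_mon[OF t] t by (intro exI[of _ "[t]"] exI[of _ u]) simp
    next
      case False
      then show ?thesis using 1 vx_mon_diff[OF t] t by (intro exI[of _ "[]"]) simp
    qed
  next
    case 2
    show ?thesis
    proof (cases "u = head E e")
      case True
      then show ?thesis using ed_mon[of e v k p w q] t 2
        by (intro exI[of _ "[(k, e # p, w, q)]"]) (auto simp: teq eN_refl)
    next
      case False
      have "eqm N (ed e * mon t) (ed e * (vx (head E e) * mon t))"
        using eN_r[OF eN_sym[OF rel_er[OF 2(2)]], of "mon t"] mpath_F0[OF t] by (simp add: mult.assoc F0_U)
      also have "eqm N \<dots> 0"
        using eN_l[OF vx_mon_diff[OF t, of "head E e"], of "ed e"] 2 False by auto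
      finally show ?thesis using 2 by (intro exI[of _ "[]"]) auto
    qed
  next
    case 3
    show ?thesis
    proof (cases "u = tail E e")
      case True
      then show ?thesis using gh_mon[of e v t] gh_times_mpath[of e v t] 3 t
        by (intro exI[of _ "gh_times e t"] exI[of _ "head E e"]) auto
    next
      case False
      have "eqm N (gh e * mon t) (gh e * (vx (tail E e) * mon t))"
        using eN_r[OF eN_sym[OF rel_gs[OF 3(2)]], of "mon t"] mpath_F0[OF t] by (simp add: mult.assoc F0_U)
      also have "eqm N \<dots> 0"
        using eN_l[OF vx_mon_diff[OF t, of "tail E e"], of "gh e"] 3 False by auto
      finally show ?thesis using 3 by (intro exI[of _ "[]"]) auto
    qed
  qed
qed

lemma word_mon:
  assumes "ls \<noteq> []" "set ls \<subseteq> gens"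
  shows "\<exists>ts. eqm N (Poly_Mapping.single (FM ls) 1) (ev ts) \<and> (\<forall>t\<in>set ts. \<exists>u v. mpath u v t)"
  using assms
proof (induction ls)
  case (Cons g ls)
  have g: "g \<in> gens" using Cons by simp
  show ?case
  proof (cases "ls = []")
    case True
    consider z where "g = Vertex z" "z \<in> verts E" | e where "g = Edge e" "e \<in> arcs E" | e where "g = Ghost e" "e \<in> arcs E"
      using g by (auto simp: gens_def)
    then show ?thesis
    proof cases
      case 1
      then show ?thesis using True by (intro exI[of _ "[(1, [], z, [])]"]) (auto simp: eN_refl)
    next
      case 2
      then show ?thesis using True rel_er[of e]
        by (intro exI[of _ "[(1, [e], head E e, [])]"]) (auto simp: eN_sym Ed_Cons)
    next
      case 3
      then show ?thesis using True rel_rg[of e]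
        by (intro exI[of _ "[(1, [], head E e, [e])]"]) (auto simp: eN_sym Gh_Cons)
    qed
  next
    case False
    then obtain ts where ts: "eqm N (Poly_Mapping.single (FM ls) 1) (ev ts)" "\<And>t. t \<in> set ts \<Longrightarrow> \<exists>u v. mpath u v t"
      using Cons.IH Cons.prems by (meson set_subset_Cons subset_trans)
    have "\<forall>t\<in>set ts. \<exists>ts'. eqm N (letter g * mon t * 1) (ev ts') \<and> (\<forall>s\<in>set ts'. \<exists>u v. mpath u v s)"
      using ts(2) letter_mon[OF g] by (metis mult.right_neutral)
    then obtain f where f: "\<And>t. t \<in> set ts \<Longrightarrow> eqm N (letter g * mon t * 1) (ev (f t))"
      "\<And>t s. t \<in> set ts \<Longrightarrow> s \<in> set (f t) \<Longrightarrow> \<exists>u v. mpath u v s" by metis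
    have "eqm N (letter g * Poly_Mapping.single (FM ls) 1) (letter g * ev ts)"
      by (rule eN_l[OF ts(1) letter_U[OF g]])
    also have "eqm N \<dots> (ev (concat (map f ts)))"
      using ev_map[OF idl_N f(1)] by simp
    finally show ?thesis unfolding word_split(1)[of g ls]
      using f(2) by (intro exI[of _ "concat (map f ts)"]) auto
  qed
qed simp

text \<open>A word is absorbed letter by letter from the left: edges prolong the path, ghosts cancel
  its first edge or prolong the ghost path, and ends that do not match give zero.\<close>

lemma spanning:
  assumes "x \<in> F0"
  shows "\<exists>ts. eqm N x (ev ts) \<and> (\<forall>t\<in>set ts. \<exists>u v. mpath u v t)"
  using assms
proof (induction x rule: F0_induct)
  case zero
  show ?case by (intro exI[of _ "[]"]) (auto simp: eN_refl)
next
  case (add x c ls)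
  then obtain ts where ts: "eqm N x (ev ts)" "\<forall>t\<in>set ts. \<exists>u v. mpath u v t" by blast
  obtain ss where ss: "eqm N (Poly_Mapping.single (FM ls) 1) (ev ss)" "\<forall>t\<in>set ss. \<exists>u v. mpath u v t"
    using word_mon add by blast
  have "\<exists>us. sc c * ev ss = ev us \<and> (\<forall>t\<in>set us. \<exists>u v. mpath u v t)"
    using ss(2)
  proof (induction ss)
    case Nil
    show ?case by (intro exI[of _ "[]"]) auto
  next
    case (Cons s ss)
    then obtain us where us: "sc c * ev ss = ev us" "\<forall>t\<in>set us. \<exists>u v. mpath u v t" by auto
    obtain k p w q where s: "s = (k, p, w, q)" by (cases s)
    show ?case using us Cons.prems
      by (intro exI[of _ "(c * k, p, w, q) # us"]) (auto simp: s distrib_left mult.assoc[symmetric] sc_mult)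
  qed
  then obtain us where us: "sc c * ev ss = ev us" "\<forall>t\<in>set us. \<exists>u v. mpath u v t" by blast
  have "eqm N (sc c * Poly_Mapping.single (FM ls) 1) (ev us)"
    using eN_l[OF ss(1), of "sc c"] us by simp
  then have "eqm N (sc c * Poly_Mapping.single (FM ls) 1 + x) (ev (us @ ts))"
    using ts(1) eqm_add[OF idl_N] by simp
  then show ?case using us ts by (intro exI[of _ "us @ ts"]) auto
qed

lemma spanning_corner:
  assumes x: "x \<in> F0" and uv: "u \<in> verts E" "v \<in> verts E"
  shows "\<exists>ts. eqm N (vx u * x * vx v) (ev ts) \<and> (\<forall>t\<in>set ts. mpath u v t)"
proof -
  obtain ts where ts: "eqm N x (ev ts)" "\<forall>t\<in>set ts. \<exists>u v. mpath u v t" using spanning[OF x] by blast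
  \<comment> \<open>The two vertices fix the monomials with the right ends and annihilate all
    others.\<close>
  define f where "f t = (if mpath u v t then [t] else [])" for t :: "'k \<times> 'e list \<times> 'v \<times> 'e list"
  have "eqm N (vx u * mon t * vx v) (ev (f t))" if "t \<in> set ts" for t
  proof -
    obtain a b where ab: "mpath a b t" using ts(2) \<open>t \<in> set ts\<close> by blast
    consider "a = u" "b = v" | "a \<noteq> u" | "a = u" "b \<noteq> v" by blast
    then show ?thesis
    proof cases
      case 1
      then have t: "mpath u v t" using ab by simp
      show ?thesis using eN_trans[OF eN_r[OF vx_mon[OF t]] mon_vx[OF t]] uv t by (simp add: f_def)
    next
      case 2
      then have "\<not> mpath u v t" using ab by (cases t) (auto dest: path_start_unique)
      then show ?thesis using eN_r[OF vx_mon_diff[OF ab uv(1)], of "vx v"] 2 uv by (simp add: f_def)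
    next
      case 3
      then have "\<not> mpath u v t" using ab by (cases t) (auto dest: path_start_unique)
      then show ?thesis using eN_l[OF mon_vx_diff[OF ab uv(2)], of "vx u"] 3 uv by (simp add: f_def mult.assoc)
    qed
  qed
  then have "eqm N (vx u * ev ts * vx v) (ev (concat (map f ts)))" by (intro ev_map[OF idl_N])
  then have "eqm N (vx u * x * vx v) (ev (concat (map f ts)))"
    using eN_trans[OF eN_lr[OF ts(1)]] uv by auto
  then show ?thesis by (intro exI[of _ "concat (map f ts)"]) (auto simp: f_def split: if_splits)
qed

section \<open>Reduction of an element to a vertex plus closed paths\<close>

lemma sandwich: "\<lbrakk>a \<in> U; b \<in> U; a' \<in> U; b' \<in> U; eqm N (a * x * b) y; eqm N (a' * y * b') z\<rbrakk>
    \<Longrightarrow> a' * a \<in> U \<and> b * b' \<in> U \<and> eqm N (a' * a * x * (b * b')) z"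
  using eN_trans[OF eN_lr[of "a * x * b" y a' b'], of z] by (simp add: mult.assoc)

text \<open>Writing \<open>v\<close> as the sum of all \<open>ed e * gh e\<close> shows that some
  product \<open>ev ts * ed e\<close> stays outside \<open>I\<close>. Multiplication by an edge
  removes one ghost from every term that has ghosts, or the whole term, and only prolongs the path
  of the others. The total length of the ghost paths is the measure.\<close>

lemma remove_ghosts:
  assumes I: "idl I" and "\<And>t. t \<in> set ts \<Longrightarrow> mpath u v t" "u \<in> verts E" "v \<in> verts E" "ev ts \<notin> I"
  shows "\<exists>b\<in>U. \<exists>ts'. eqm N (ev ts * b) (ev ts') \<and> ev ts' \<notin> I \<and>
     (\<forall>t\<in>set ts'. \<exists>k p w. t = (k, p, w, []) \<and> path u p w)"
  using assms(2-)
proof (induction "\<Sum>t\<leftarrow>ts. length (snd (snd (snd t)))" arbitrary: ts v rule: less_induct)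
  case less
  show ?case
  proof (cases "\<exists>t\<in>set ts. snd (snd (snd t)) \<noteq> []")
    case False
    have "\<exists>k p w. t = (k, p, w, []) \<and> path u p w" if "t \<in> set ts" for t
      using False less.prems(1)[OF that] that by (cases t) auto
    then show ?thesis using less.prems by (intro bexI[of _ 1] exI[of _ ts]) (auto simp: eN_refl)
  next
    case True
    then obtain k p w f q where t: "(k, p, w, f # q) \<in> set ts" by (metis neq_Nil_conv prod.collapse)
    then have "f \<in> arcs E" "tail E f = v" using less.prems(1) by force+
    \<comment> \<open>The vertex \<open>v\<close> is no sink because a ghost path starts there; so
      the last defining relation applies at \<open>v\<close>.\<close>
    then have "out_arcs E v \<noteq> {}" by auto
    have "eqm N (ev ts * vx v) (ev ts)"
      using ev_map[OF idl_N, of ts 1 "vx v" "\<lambda>t. [t]"] mon_vx[OF less.prems(1)] by (simp add: concat_map_singleton)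
    then have "eqm N (ev ts) (ev ts * vx v)" by (rule eN_sym)
    also have "eqm N \<dots> (ev ts * (\<Sum>e\<in>out_arcs E v. ed e * gh e))"
      by (rule eN_l[OF rel_ck F0_U[OF ev_F0]]) (use \<open>out_arcs E v \<noteq> {}\<close> less.prems in blast)+
    finally have 1: "eqm N (ev ts) (\<Sum>e\<in>out_arcs E v. ev ts * ed e * gh e)"
      by (simp add: sum_distrib_left mult.assoc)
    have "\<exists>e\<in>out_arcs E v. ev ts * ed e \<notin> I"
    proof (rule ccontr)
      assume "\<not> ?thesis"
      then have "(\<Sum>e\<in>out_arcs E v. ev ts * ed e * gh e) \<in> I" by (intro idl_sum[OF I]) (auto intro: idl_r[OF I])
      then show False using eqm_mem[OF I eqm_N[OF I 1]] less.prems(4) by simp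
    qed
    then obtain e where e: "e \<in> arcs E" "tail E e = v" "ev ts * ed e \<notin> I" by auto
    define us where "us = concat (map (times_ed e) ts)"
    have 2: "eqm N (ev ts * ed e) (ev us)"
      using ev_map[OF idl_N, of ts 1 "ed e" "times_ed e"] mon_ed[of u e] less.prems(1) e by (simp add: us_def)
    have l1: "(\<Sum>s\<leftarrow>times_ed e t. length (snd (snd (snd s)))) \<le> length (snd (snd (snd t)))" for t
      by (cases "(e, t)" rule: times_ed.cases) auto
    have l2: "(\<Sum>s\<leftarrow>times_ed e (k, p, w, f # q). length (snd (snd (snd s)))) < length (snd (snd (snd (k, p, w, f # q))))"
      by simp
    have "(\<Sum>s\<leftarrow>us. length (snd (snd (snd s)))) < (\<Sum>t\<leftarrow>ts. length (snd (snd (snd t))))"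
      using t unfolding us_def
    proof (induction ts)
      case (Cons t ts)
      have le: "(\<Sum>s\<leftarrow>concat (map (times_ed e) ts). length (snd (snd (snd s)))) \<le> (\<Sum>t\<leftarrow>ts. length (snd (snd (snd t))))"
        by (induction ts) (use l1 in \<open>auto intro: add_mono\<close>)
      show ?case
      proof (cases "t = (k, p, w, f # q)")
        case True
        then show ?thesis using le l2 by (simp add: add_less_le_mono)
      next
        case False
        then show ?thesis using Cons l1[of t] by (simp add: add_le_less_mono)
      qed
    qed simp
    moreover have "mpath u (head E e) s" if "s \<in> set us" for s
    proof -
      obtain t where "t \<in> set ts" "s \<in> set (times_ed e t)" using \<open>s \<in> set us\<close> unfolding us_def by auto
      then show ?thesis using less.prems(1)[of t] times_ed_mpath[of u e t s] e by simp
    qed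
    moreover have "ev us \<notin> I" using eqm_mem[OF I eqm_N[OF I 2]] e by simp
    ultimately obtain b ts' where b: "b \<in> U" "eqm N (ev us * b) (ev ts')" "ev ts' \<notin> I"
      "\<forall>t\<in>set ts'. \<exists>k p w. t = (k, p, w, []) \<and> path u p w"
      using less.hyps[of us "head E e"] less.prems(2) e by auto
    have "eqm N (ev ts * (ed e * b)) (ev ts')"
      using eN_trans[OF eN_r[OF 2 b(1)] b(2)] by (simp add: mult.assoc)
    then show ?thesis using b e by (intro bexI[of _ "ed e * b"] exI[of _ ts']) auto
  qed
qed

lemma ev_filter: "ev ts = ev (filter P ts) + ev (filter (\<lambda>t. \<not> P t) ts)"
  by (induction ts) auto

definition closed_term :: "'v \<Rightarrow> 'k \<times> 'e list \<times> 'v \<times> 'e list \<Rightarrow> bool" where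
  "closed_term v t \<longleftrightarrow> (\<exists>k p. t = (k, p, v, []) \<and> p \<noteq> [] \<and> path v p v)"

text \<open>If no path is empty, a suitable ghost edge on the left shortens or deletes every term
  without entering \<open>I\<close>. Otherwise the empty paths add up to \<open>k\<close> times
  \<open>vx u\<close>: for \<open>k = 0\<close> they are dropped, and for
  \<open>k \<noteq> 0\<close> multiplication by \<open>vx u\<close> on the right leaves only the
  closed paths besides this multiple of the vertex.\<close>

lemma reduce_paths:
  assumes I: "idl I" and "\<And>t. t \<in> set ts \<Longrightarrow> \<exists>k p w. t = (k, p, w, []) \<and> path u p w"
    "u \<in> verts E" "ev ts \<notin> I"
  shows "\<exists>a\<in>U. \<exists>b\<in>U. \<exists>k v ts'. k \<noteq> 0 \<and> v \<in> verts E \<and> vx v \<notin> I \<and>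
     eqm N (a * ev ts * b) (sc k * vx v + ev ts') \<and> (\<forall>t\<in>set ts'. closed_term v t)"
  using assms(2-)
\<comment> \<open>The \<open>Suc\<close> counts the terms as well, so that dropping empty paths
  whose coefficients cancel makes the measure smaller.\<close>
proof (induction "\<Sum>t\<leftarrow>ts. Suc (length (fst (snd t)))" arbitrary: ts u rule: less_induct)
  case less
  define P where "P t \<longleftrightarrow> fst (snd t) = []" for t :: "'k \<times> 'e list \<times> 'v \<times> 'e list"
  define rest where "rest = filter (\<lambda>t. \<not> P t) ts"
  have mp: "mpath u (fst (snd (snd t))) t" if "t \<in> set ts" for t
    using less.prems(1)[OF that(1)] path_verts by auto
  have evF: "ev ts \<in> U" by (rule F0_U[OF ev_F0]) (use mp in blast)
  have ux: "eqm N (vx u * ev ts) (ev ts)"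
    using ev_map[OF idl_N, of ts "vx u" 1 "\<lambda>t. [t]"] vx_mon[OF mp] by (simp add: concat_map_singleton)
  show ?case
  proof (cases "filter P ts = []")
    case True
    then have ne: "fst (snd t) \<noteq> []" if "t \<in> set ts" for t using that by (auto simp: filter_empty_conv P_def)
    have "ts \<noteq> []" using less.prems(3) idl_0[OF I] by auto
    then obtain k f p w where "(k, f # p, w, []) \<in> set ts" "path u (f # p) w"
      using ne less.prems(1) by (metis fst_conv list.set_intros(1) neq_Nil_conv snd_conv)
    then have "out_arcs E u \<noteq> {}" by auto
    have "eqm N (vx u * ev ts) ((\<Sum>e\<in>out_arcs E u. ed e * gh e) * ev ts)"
      using \<open>out_arcs E u \<noteq> {}\<close> less.prems evF by (intro eN_r[OF rel_ck]) auto
    then have 1: "eqm N (ev ts) (\<Sum>e\<in>out_arcs E u. ed e * (gh e * ev ts))"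
      using eN_trans[OF eN_sym[OF ux]] by (simp add: sum_distrib_right mult.assoc)
    have "\<exists>e\<in>out_arcs E u. gh e * ev ts \<notin> I"
    proof (rule ccontr)
      assume "\<not> ?thesis"
      then have "(\<Sum>e\<in>out_arcs E u. ed e * (gh e * ev ts)) \<in> I" by (intro idl_sum[OF I]) (auto intro: idl_l[OF I])
      then show False using eqm_mem[OF I eqm_N[OF I 1]] less.prems(3) by simp
    qed
    then obtain e where e: "e \<in> arcs E" "tail E e = u" "gh e * ev ts \<notin> I" by auto
    define us where "us = concat (map (gh_times e) ts)"
    have 2: "eqm N (gh e * ev ts) (ev us)"
      using ev_map[OF idl_N, of ts "gh e" 1 "gh_times e"] gh_mon[OF mp[folded e(2)] e(1)] by (simp add: us_def)
    have le: "(\<Sum>s\<leftarrow>gh_times e t. Suc (length (fst (snd s)))) < Suc (length (fst (snd t)))" if "fst (snd t) \<noteq> []" for t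
      using that by (cases "(e, t)" rule: gh_times.cases) auto
    have "(\<Sum>s\<leftarrow>concat (map (gh_times e) ts'). Suc (length (fst (snd s)))) < (\<Sum>t\<leftarrow>ts'. Suc (length (fst (snd t))))"
      if "ts' \<noteq> []" "\<And>t. t \<in> set ts' \<Longrightarrow> fst (snd t) \<noteq> []" for ts'
      using that
    proof (induction ts')
      case (Cons t ts')
      have t: "(\<Sum>s\<leftarrow>gh_times e t. Suc (length (fst (snd s)))) < Suc (length (fst (snd t)))" using Cons.prems le by auto
      show ?case
      proof (cases "ts' = []")
        case True
        then show ?thesis using t by simp
      next
        case False
        then have "(\<Sum>s\<leftarrow>concat (map (gh_times e) ts'). Suc (length (fst (snd s)))) < (\<Sum>t\<leftarrow>ts'. Suc (length (fst (snd t))))"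
          using Cons by auto
        from add_strict_mono[OF t this] show ?thesis by simp
      qed
    qed simp
    then have "(\<Sum>s\<leftarrow>us. Suc (length (fst (snd s)))) < (\<Sum>t\<leftarrow>ts. Suc (length (fst (snd t))))"
      using \<open>ts \<noteq> []\<close> ne unfolding us_def by blast
    moreover have "\<exists>k p w. s = (k, p, w, []) \<and> path (head E e) p w" if s: "s \<in> set us" for s
    proof -
      obtain t where t: "t \<in> set ts" "s \<in> set (gh_times e t)" using s unfolding us_def by auto
      obtain k p w where "t = (k, p, w, [])" "path u p w" using less.prems(1)[OF t(1)] by blast
      moreover from this have "p \<noteq> []" using ne[OF t(1)] by simp
      ultimately show ?thesis using t by (cases p) (auto split: if_splits)
    qed
    moreover have "ev us \<notin> I" using eqm_mem[OF I eqm_N[OF I 2]] e by simp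
    ultimately obtain a b k v ts' where ab: "a \<in> U" "b \<in> U" "k \<noteq> 0" "v \<in> verts E" "vx v \<notin> I"
      "eqm N (a * ev us * b) (sc k * vx v + ev ts')" "\<forall>t\<in>set ts'. closed_term v t"
      using less.hyps[of us "head E e"] e by (metis head_in_verts)
    have "a * gh e \<in> U \<and> 1 * b \<in> U \<and> eqm N (a * gh e * ev ts * (1 * b)) (sc k * vx v + ev ts')"
      using 2 ab e by (intro sandwich[where y = "ev us"]) auto
    then show ?thesis using ab by (metis mult_1)
  next
    case False
    define k where "k = (\<Sum>t\<leftarrow>filter P ts. fst t)"
    have evP: "ev (filter P ts) = sc k * vx u"
    proof -
      have "ev ss = sc (\<Sum>t\<leftarrow>ss. fst t) * vx u" if "\<And>t. t \<in> set ss \<Longrightarrow> t \<in> set ts \<and> P t" for ss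
        using that
      proof (induction ss)
        case (Cons t ss)
        then have "t \<in> set ts" "P t" by auto
        then have "mon t = sc (fst t) * vx u" using less.prems(1)[of t] by (auto simp: P_def)
        then show ?case using Cons by (simp add: single_add distrib_right)
      qed simp
      then show ?thesis unfolding k_def by (rule meta_mp) auto
    qed
    have split: "ev ts = sc k * vx u + ev rest"
      using ev_filter[of ts P] evP by (simp add: rest_def)
    show ?thesis
    proof (cases "k = 0")
      case True
      then have eq: "ev ts = ev rest" using split by simp
      have "(\<Sum>t\<leftarrow>filter P ss. Suc (length (fst (snd t)))) + (\<Sum>t\<leftarrow>filter (\<lambda>t. \<not> P t) ss. Suc (length (fst (snd t))))
         = (\<Sum>t\<leftarrow>ss. Suc (length (fst (snd t))))" for ss
        by (induction ss) auto
      moreover have "(\<Sum>t\<leftarrow>filter P ts. Suc (length (fst (snd t)))) > 0"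
        using False by (cases "filter P ts") auto
      ultimately have "(\<Sum>t\<leftarrow>rest. Suc (length (fst (snd t)))) < (\<Sum>t\<leftarrow>ts. Suc (length (fst (snd t))))"
        unfolding rest_def by (metis less_add_same_cancel2)
      then show ?thesis
        using less.hyps[of rest u] less.prems unfolding eq by (auto simp: rest_def)
    next
      case k: False
      \<comment> \<open>The element is fixed by \<open>vx u\<close> from the left and is not in
        \<open>I\<close>.\<close>
      have "vx u \<notin> I"
      proof
        assume "vx u \<in> I"
        then have "vx u * ev ts \<in> I" using evF by (rule idl_r[OF I])
        then show False using less.prems(3) eqm_mem[OF I eqm_N[OF I ux]] by simp
      qed
      define f where "f t = (if fst (snd (snd t)) = u then [t] else [])" for t :: "'k \<times> 'e list \<times> 'v \<times> 'e list"
      have "eqm N (1 * mon t * vx u) (ev (f t))" if "t \<in> set rest" for t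
      proof -
        have "t \<in> set ts" using that by (simp add: rest_def)
        then obtain k p w where t: "t = (k, p, w, [])" "path u p w" using less.prems(1) by blast
        then have "mpath u w t" using path_verts by auto
        then show ?thesis using mon_vx[of u w t] mon_vx_diff[of u w t u] less.prems(2) t(1)
          by (cases "w = u") (auto simp: f_def)
      qed
      from ev_map[OF idl_N this] have "eqm N (ev rest * vx u) (ev (concat (map f rest)))" by simp
      moreover have "eqm N (sc k * vx u * vx u) (sc k * vx u)"
        using eN_l[OF rel_vv_same[OF less.prems(2)], of "sc k"] by (simp add: mult.assoc)
      ultimately have "eqm N (1 * ev ts * vx u) (sc k * vx u + ev (concat (map f rest)))"
        unfolding split by (simp add: distrib_right eqm_add[OF idl_N])
      moreover have "closed_term u t" if "t \<in> set (concat (map f rest))" for t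
        using that less.prems(1)[of t] unfolding f_def rest_def P_def closed_term_def
        by (auto split: if_splits)
      ultimately show ?thesis using k \<open>vx u \<notin> I\<close> less.prems(2)
        by (intro bexI[of _ 1] bexI[of _ "vx u"] exI[of _ k] exI[of _ u] exI[of _ "concat (map f rest)"]) auto
    qed
  qed
qed

text \<open>The vertex is found outside \<open>I\<close>, but the congruence holds already modulo
  \<open>N\<close>. So the reduced element also lies in any ideal that contains \<open>x\<close>,
  which is used for ideals larger than \<open>I\<close>.\<close>

theorem reduction:
  assumes I: "idl I" and x: "x \<in> F0" "x \<notin> I"
  shows "\<exists>a\<in>U. \<exists>b\<in>U. \<exists>k v ts. k \<noteq> 0 \<and> v \<in> verts E \<and> vx v \<notin> I \<and>
     eqm N (a * x * b) (sc k * vx v + ev ts) \<and> (\<forall>t\<in>set ts. closed_term v t)"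
proof -
  obtain u where u: "u \<in> verts E" "vx u * x \<notin> I" using exists_vx[OF I x] by blast
  have "vx u * x \<in> F0" using u x by (auto simp: F0_U)
  then obtain v where v: "v \<in> verts E" "vx u * x * vx v \<notin> I" using exists_vx[OF I _ u(2)] by blast
  obtain ts where ts: "eqm N (vx u * x * vx v) (ev ts)" "\<forall>t\<in>set ts. mpath u v t"
    using spanning_corner[OF x(1) u(1) v(1)] by blast
  have "ev ts \<notin> I" using eqm_mem[OF I eqm_N[OF I ts(1)]] v by simp
  then obtain b ss where b: "b \<in> U" "eqm N (ev ts * b) (ev ss)" "ev ss \<notin> I"
     "\<forall>t\<in>set ss. \<exists>k p w. t = (k, p, w, []) \<and> path u p w"
    using remove_ghosts[OF I, of ts u v] ts u v by blast
  obtain a' b' k w us where r: "a' \<in> U" "b' \<in> U" "k \<noteq> 0" "w \<in> verts E" "vx w \<notin> I"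
    "eqm N (a' * ev ss * b') (sc k * vx w + ev us)" "\<forall>t\<in>set us. closed_term w t"
    using reduce_paths[OF I, of ss u] b u by blast
  have 1: "1 * vx u \<in> U \<and> vx v * b \<in> U \<and> eqm N (1 * vx u * x * (vx v * b)) (ev ss)"
    using ts b u v by (intro sandwich[where y = "ev ts"]) auto
  have "a' * (1 * vx u) \<in> U \<and> vx v * b * b' \<in> U \<and> eqm N (a' * (1 * vx u) * x * (vx v * b * b')) (sc k * vx w + ev us)"
    using 1 r by (intro sandwich[where y = "ev ss"]) auto
  with r show ?thesis by blast
qed

end

section \<open>Grading\<close>

text \<open>The component of degree \<open>n\<close> of a representative. It descends to the
  quotient because \<open>N\<close> is graded.\<close>

definition hc :: "int \<Rightarrow> ('v, 'e, 'k::field) lpa_free \<Rightarrow> ('v, 'e, 'k) lpa_free" where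
  "hc n x = Poly_Mapping.mapp (\<lambda>w c. if word_degree w = n then c else 0) x"

lemma lookup_hc: "Poly_Mapping.lookup (hc n x) w = (if word_degree w = n then Poly_Mapping.lookup x w else 0)"
  unfolding hc_def by (simp add: lookup_mapp when_def in_keys_iff)

lemma hc_0 [simp]: "hc n 0 = 0"
  and hc_add: "hc n (x + y) = hc n x + hc n y"
  and hc_minus: "hc n (x - y) = hc n x - hc n y"
  by (rule poly_mapping_eqI, simp add: lookup_hc lookup_add lookup_minus)+

lemma hc_sum: "hc n (sum f S) = (\<Sum>i\<in>S. hc n (f i))"
  by (induction S rule: infinite_finite_induct) (auto simp: hc_add)

lemma hc_single: "hc n (Poly_Mapping.single w c) = (if word_degree w = n then Poly_Mapping.single w c else 0)"
  by (rule poly_mapping_eqI) (auto simp: lookup_hc lookup_single when_def)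

lemma hc_hc: "hc m (hc n x) = (if m = n then hc n x else 0)"
  by (rule poly_mapping_eqI) (auto simp: lookup_hc)

lemma word_degree_plus [simp]: "word_degree (u + w) = word_degree u + word_degree w"
  by (simp add: word_degree_def plus_free_mon_def)

lemma word_degree_0 [simp]: "word_degree 0 = 0"
  by (simp add: word_degree_def zero_free_mon_def)

lemma hc_single_mult: "hc n (Poly_Mapping.single w c * x) = Poly_Mapping.single w c * hc (n - word_degree w) x"
  and hc_mult_single: "hc n (x * Poly_Mapping.single w c) = hc (n - word_degree w) x * Poly_Mapping.single w c"
  by (induction x rule: poly_mapping_single_induct)
     (auto simp: hc_add distrib_left distrib_right mult_single hc_single)

lemma hc_sc_mult: "hc n (sc c * x) = sc c * hc n x"
  by (simp add: hc_single_mult)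

lemma keys_hc: "Poly_Mapping.keys (hc n x) = {w \<in> Poly_Mapping.keys x. word_degree w = n}"
  by (auto simp: in_keys_iff lookup_hc split: if_splits)

lemma hc_id_iff: "hc n x = x \<longleftrightarrow> (\<forall>w\<in>Poly_Mapping.keys x. word_degree w = n)"
proof
  show "hc n x = x" if "\<forall>w\<in>Poly_Mapping.keys x. word_degree w = n"
    using that by (intro poly_mapping_eqI) (auto simp: lookup_hc in_keys_iff)
qed (use keys_hc[of n x] in auto)

lemma sum_hc:
  assumes "finite D" "word_degree ` Poly_Mapping.keys x \<subseteq> D"
  shows "(\<Sum>n\<in>D. hc n x) = x"
proof (rule poly_mapping_eqI)
  fix w
  have "(\<Sum>n\<in>D. Poly_Mapping.lookup (hc n x) w) = (if word_degree w \<in> D then Poly_Mapping.lookup x w else 0)"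
    using assms(1) by (simp add: lookup_hc)
  then show "Poly_Mapping.lookup (\<Sum>n\<in>D. hc n x) w = Poly_Mapping.lookup x w"
    using assms(2) by (cases "w \<in> Poly_Mapping.keys x") (auto simp: lookup_sum in_keys_iff)
qed

lemma hc_outside: "n \<notin> word_degree ` Poly_Mapping.keys x \<Longrightarrow> hc n x = 0"
  by (rule poly_mapping_eqI) (auto simp: lookup_hc in_keys_iff)

context leavitt
begin

lemma hc_F0 [simp]: "x \<in> F0 \<Longrightarrow> hc n x \<in> F0" and hc_U [simp]: "x \<in> U \<Longrightarrow> hc n x \<in> U"
  by (auto simp: F0_def U_def keys_hc)

definition graded :: "('v, 'e, 'k) lpa_free set \<Rightarrow> bool" where
  "graded I \<longleftrightarrow> (\<forall>x\<in>I. \<forall>n. hc n x \<in> I)"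

text \<open>The elements all of whose components lie in the generated ideal form an ideal that
  contains the generators. For products it is enough to multiply by words, which merely shift the
  degree.\<close>

lemma graded_generated:
  assumes S: "S \<subseteq> F0" "\<And>s n. s \<in> S \<Longrightarrow> hc n s \<in> {0, s}"
  shows "graded (generated_algebra_ideal (lpa_free_algebra E) S)" (is "graded ?I")
proof -
  have I: "algebra_ideal ?I (lpa_free_algebra E)" using FA.algebra_ideal_generated[OF S(1)] .
  note IF = FA.ideal_facts[OF I]
  define G where "G = {x \<in> ?I. \<forall>n. hc n x \<in> ?I}"
  have prod: "hc n (a * x) \<in> ?I \<and> hc n (x * a) \<in> ?I" if a: "a \<in> F0" and x: "x \<in> G" for a x n
    using a
  proof (induction a rule: F0_induct)
    case zero
    show ?case using IF(2) by simp
  next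
    case (add a c ls)
    let ?m = "Poly_Mapping.single (FM ls) c :: ('v, 'e, 'k) lpa_free"
    have "?m \<in> F0" using add.hyps by (intro single_F0) (auto simp: zero_free_mon_def)
    then have "?m * hc (n - word_degree (FM ls)) x \<in> ?I" "hc (n - word_degree (FM ls)) x * ?m \<in> ?I"
      using x IF(7,8) unfolding G_def by blast+
    then show ?case using add.IH IF(3)
      by (simp add: mult_single distrib_left distrib_right hc_add hc_single_mult hc_mult_single)
  qed
  have "algebra_ideal G (lpa_free_algebra E)"
    unfolding FA.algebra_ideal_iff
  proof (intro conjI allI ballI)
    show "G \<subseteq> F0" "0 \<in> G" using IF by (auto simp: G_def)
    show "x + y \<in> G" if "x \<in> G" "y \<in> G" for x y using that IF(3) by (auto simp: G_def hc_add)
    show "pm_scale c x \<in> G" if "x \<in> G" for c x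
      using that IF(6) unfolding G_def by (auto simp: scale_sc hc_sc_mult)
    show "a * x \<in> G" "x * a \<in> G" if "a \<in> F0" "x \<in> G" for a x
      using prod that IF(7,8) unfolding G_def by blast+
  qed
  moreover have "S \<subseteq> G"
  proof
    fix s assume "s \<in> S"
    then have "s \<in> ?I" using FA.generated_superset[of S] by blast
    moreover have "hc n s \<in> ?I" for n using S(2)[OF \<open>s \<in> S\<close>, of n] IF(2) calculation by auto
    ultimately show "s \<in> G" unfolding G_def by blast
  qed
  ultimately have "?I \<subseteq> G" by (rule FA.generated_least)
  then show ?thesis unfolding graded_def G_def by blast
qed

text \<open>Including the relations makes this the preimage, in the free algebra, of the ideal
  generated by the vertices of \<open>H\<close>.\<close>

definition vertex_ideal :: "'v set \<Rightarrow> ('v, 'e, 'k) lpa_free set" where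
  "vertex_ideal H = generated_algebra_ideal (lpa_free_algebra E) (lpa_relations E \<union> vx ` H)"

lemma relation_homogeneous: "r \<in> lpa_relations E \<Longrightarrow> hc n r \<in> {0, r}"
  unfolding lpa_relations_def
  by (elim UnE CollectE exE conjE; hypsubst)
     (simp_all add: hc_minus hc_sum mult_single hc_single word_degree_def)

context
  fixes H assumes H: "H \<subseteq> verts E"
begin

lemma vertex_ideal_idl: "idl (vertex_ideal H)"
proof -
  have I: "algebra_ideal (vertex_ideal H) (lpa_free_algebra E)"
    unfolding vertex_ideal_def using relations_F0 H by (intro FA.algebra_ideal_generated) auto
  moreover have "lpa_relations E \<subseteq> vertex_ideal H"
    unfolding vertex_ideal_def by (rule subset_trans[OF Un_upper1 FA.generated_superset])
  ultimately show ?thesis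
    unfolding idl_algebra_ideal lpa_ideal_def by (simp add: FA.generated_least)
qed

lemma vx_in_vertex_ideal: "v \<in> H \<Longrightarrow> vx v \<in> vertex_ideal H"
  unfolding vertex_ideal_def by (rule subsetD[OF FA.generated_superset]) (rule UnI2[OF imageI[where f = vx]])

lemma vertex_ideal_graded: "graded (vertex_ideal H)"
  unfolding vertex_ideal_def
proof (rule graded_generated)
  show "lpa_relations E \<union> vx ` H \<subseteq> F0" using relations_F0 H by auto
  show "hc n s \<in> {0, s}" if "s \<in> lpa_relations E \<union> vx ` H" for s n
    using that
  proof
    assume "s \<in> vx ` H"
    then show ?thesis by (elim imageE) (simp add: hc_single)
  qed (rule relation_homogeneous)
qed

end

lemma vertex_ideal_least: "idl J \<Longrightarrow> vx ` H \<subseteq> J \<Longrightarrow> vertex_ideal H \<subseteq> J"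
  unfolding vertex_ideal_def idl_algebra_ideal
  by (intro FA.generated_least) (use rel_in_N in auto)

lemma N_graded: "graded N"
  unfolding lpa_ideal_def using graded_generated relations_F0 relation_homogeneous by blast

section \<open>The simple module of an infinite path\<close>

text \<open>A sink \<open>v\<close> is given the virtual loop \<open>Inr v\<close>, so that every maximal path is an infinite sequence.\<close>

primrec lsrc :: "'e + 'v \<Rightarrow> 'v" where "lsrc (Inl e) = tail E e" | "lsrc (Inr v) = v"
primrec lrng :: "'e + 'v \<Rightarrow> 'v" where "lrng (Inl e) = head E e" | "lrng (Inr v) = v"
primrec step_ok :: "'e + 'v \<Rightarrow> bool" where
  "step_ok (Inl e) \<longleftrightarrow> e \<in> arcs E" | "step_ok (Inr v) \<longleftrightarrow> v \<in> verts E \<and> out_arcs E v = {}"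

definition ipath :: "(nat \<Rightarrow> 'e + 'v) \<Rightarrow> bool" where
  "ipath q \<longleftrightarrow> (\<forall>i. step_ok (q i) \<and> lsrc (q (Suc i)) = lrng (q i))"

abbreviation isrc :: "(nat \<Rightarrow> 'e + 'v) \<Rightarrow> 'v" where "isrc q \<equiv> lsrc (q 0)"

definition shift :: "(nat \<Rightarrow> 'e + 'v) \<Rightarrow> nat \<Rightarrow> 'e + 'v" where "shift q i = q (Suc i)"

definition icons :: "'e + 'v \<Rightarrow> (nat \<Rightarrow> 'e + 'v) \<Rightarrow> nat \<Rightarrow> 'e + 'v" where "icons l q = case_nat l q"

lemma icons_simps [simp]: "icons l q 0 = l" "icons l q (Suc i) = q i" "shift (icons l q) = q"
  by (auto simp: icons_def shift_def)

lemma icons_shift [simp]: "icons (q 0) (shift q) = q"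
  by (rule ext) (auto simp: icons_def shift_def split: nat.split)

lemma ipath_icons: "ipath (icons l q) \<longleftrightarrow> step_ok l \<and> isrc q = lrng l \<and> ipath q"
  unfolding ipath_def by (auto simp: icons_def split: nat.split)

lemma ipath_shift: "ipath q \<Longrightarrow> ipath (shift q)"
  by (simp add: ipath_def shift_def)

text \<open>From a sink only its virtual loop can be taken, so the sequence is constant.\<close>

lemma ipath_sink:
  assumes "ipath q" "q 0 = Inr v" shows "shift q = q"
proof -
  have s: "out_arcs E v = {}" using assms by (metis ipath_def step_ok.simps(2))
  have "q i = Inr v" for i
  proof (induction i)
    case (Suc i)
    then have "lsrc (q (Suc i)) = v" "step_ok (q (Suc i))" using assms(1) by (auto simp: ipath_def)
    then show ?case using s by (cases "q (Suc i)") auto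
  qed (rule assms(2))
  then show ?thesis by (auto simp: shift_def)
qed

lemma ipath_sink_iff:
  assumes "ipath q" "v \<in> verts E" "out_arcs E v = {}"
  shows "isrc q = v \<longleftrightarrow> q 0 = Inr v"
proof -
  have "step_ok (q 0)" using assms(1) by (simp add: ipath_def)
  then show ?thesis using assms(3) by (cases "q 0") auto
qed

text \<open>Words act on paths by partial maps from the left, hence on functions of paths, by composition,
  from the right.\<close>

primrec lact :: "('v, 'e) lpa_gen \<Rightarrow> (nat \<Rightarrow> 'e + 'v) \<Rightarrow> (nat \<Rightarrow> 'e + 'v) option" where
  "lact (Vertex v) q = (if isrc q = v then Some q else None)"
| "lact (Edge e) q = (if e \<in> arcs E \<and> isrc q = head E e then Some (icons (Inl e) q) else None)"
| "lact (Ghost e) q = (if e \<in> arcs E \<and> q 0 = Inl e \<and> lsrc (q 1) = head E e then Some (shift q) else None)"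

primrec wact :: "('v, 'e) lpa_gen list \<Rightarrow> (nat \<Rightarrow> 'e + 'v) \<Rightarrow> (nat \<Rightarrow> 'e + 'v) option" where
  "wact [] q = Some q"
| "wact (g # ls) q = Option.bind (wact ls q) (lact g)"

lemma wact_append: "wact (ls @ ms) q = Option.bind (wact ms q) (wact ls)"
proof (induction ls)
  case Nil
  then show ?case by (cases "wact ms q") auto
next
  case (Cons g ls)
  then show ?case by (cases "wact ms q") auto
qed

definition act :: "((nat \<Rightarrow> 'e + 'v) \<Rightarrow> 'k) \<Rightarrow> ('v, 'e, 'k) lpa_free \<Rightarrow> (nat \<Rightarrow> 'e + 'v) \<Rightarrow> 'k" where
  "act \<phi> x q = (\<Sum>w\<in>Poly_Mapping.keys x. Poly_Mapping.lookup x w * case_option 0 \<phi> (wact (letters w) q))"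

lemma act_add: "act \<phi> (x + y) q = act \<phi> x q + act \<phi> y q"
  unfolding act_def
  by (rule setsum_keys_plus_distrib) (auto simp: algebra_simps)

lemma act_0 [simp]: "act \<phi> 0 q = 0" by (simp add: act_def)

lemma act_single: "act \<phi> (Poly_Mapping.single w c) q = c * case_option 0 \<phi> (wact (letters w) q)"
  by (simp add: act_def)

lemma act_uminus: "act \<phi> (- x) q = - act \<phi> x q"
  using act_add[of \<phi> x "- x" q] by (simp add: eq_neg_iff_add_eq_0 add.commute)

lemma act_minus: "act \<phi> (x - y) q = act \<phi> x q - act \<phi> y q"
  using act_add[of \<phi> x "- y" q] by (simp add: act_uminus)

lemma act_sum: "act \<phi> (sum f S) q = (\<Sum>i\<in>S. act \<phi> (f i) q)"
  by (induction S rule: infinite_finite_induct) (auto simp: act_add)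

lemma act_plus: "act (\<lambda>q. \<phi> q + \<psi> q) x q = act \<phi> x q + act \<psi> x q"
  unfolding act_def by (auto simp: sum.distrib[symmetric] algebra_simps split: option.split intro!: sum.cong)

lemma act_scale: "act (\<lambda>q. c * \<phi> q) x q = c * act \<phi> x q"
  unfolding act_def by (auto simp: sum_distrib_left algebra_simps split: option.split intro!: sum.cong)

lemma act_zero [simp]: "act (\<lambda>q. 0) x q = 0"
  unfolding act_def by (auto split: option.split intro!: sum.neutral)

lemma act_mult: "act \<phi> (x * y) q = act (act \<phi> x) y q"
proof (induction y rule: poly_mapping_single_induct)
  case (add y u d)
  have "act \<phi> (x * Poly_Mapping.single u d) q = act (act \<phi> x) (Poly_Mapping.single u d) q"
  proof (induction x rule: poly_mapping_single_induct)
    case zero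
    show ?case by (simp add: act_single split: option.split)
  next
    case (add x w c)
    have "act \<phi> (Poly_Mapping.single w c * Poly_Mapping.single u d) q
        = act (act \<phi> (Poly_Mapping.single w c)) (Poly_Mapping.single u d) q"
      by (simp add: mult_single act_single wact_append bind_eq_Some_conv split: option.split Option.bind_split)
    with add show ?case
      by (simp add: distrib_right act_add act_plus)
  qed
  with add show ?case by (simp add: distrib_left act_add)
qed simp

lemma act_sc_mult: "act \<phi> (sc c * x) q = c * act \<phi> x q"
  unfolding act_mult using act_scale[of c \<phi> x q] by (simp add: act_single[abs_def])

text \<open>Tail equivalence up to a shift: the numbers \<open>m\<close> and \<open>n\<close> of
  discarded steps may differ.\<close>

definition tail_class :: "(nat \<Rightarrow> 'e + 'v) \<Rightarrow> (nat \<Rightarrow> 'e + 'v) set" where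
  "tail_class p = {q. ipath q \<and> (\<exists>m n. \<forall>i. q (i + m) = p (i + n))}"

text \<open>Finitely supported functions model the vector space with the tail class as basis. With
  the action by composition this is the simple module that Chen attaches to an infinite
  path.\<close>

definition chen :: "(nat \<Rightarrow> 'e + 'v) \<Rightarrow> ((nat \<Rightarrow> 'e + 'v) \<Rightarrow> 'k) set" where
  "chen p = {\<phi>. finite {q. \<phi> q \<noteq> 0} \<and> {q. \<phi> q \<noteq> 0} \<subseteq> tail_class p}"

lemma chenD: "\<phi> \<in> chen p \<Longrightarrow> \<phi> q \<noteq> 0 \<Longrightarrow> q \<in> tail_class p" "\<phi> \<in> chen p \<Longrightarrow> finite {q. \<phi> q \<noteq> 0}"
  by (auto simp: chen_def)

lemma chen_0 [simp]: "(\<lambda>q. 0) \<in> chen p" by (simp add: chen_def)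

lemma chen_subset:
  assumes "finite A" "\<And>q. \<phi> q \<noteq> 0 \<Longrightarrow> q \<in> A \<and> q \<in> tail_class p"
  shows "\<phi> \<in> chen p"
  using finite_subset[OF _ assms(1), of "{q. \<phi> q \<noteq> 0}"] assms(2) by (auto simp: chen_def)

lemma chen_add: "\<phi> \<in> chen p \<Longrightarrow> \<psi> \<in> chen p \<Longrightarrow> (\<lambda>q. \<phi> q + \<psi> q) \<in> chen p"
  by (rule chen_subset[of "{q. \<phi> q \<noteq> 0} \<union> {q. \<psi> q \<noteq> 0}"]) (auto simp: chen_def subset_iff, metis add.left_neutral)

lemma chen_scale: "\<phi> \<in> chen p \<Longrightarrow> (\<lambda>q. c * \<phi> q) \<in> chen p"
  by (rule chen_subset[of "{q. \<phi> q \<noteq> 0}"]) (auto simp: chen_def)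

lemma tail_class_shift: "q \<in> tail_class p \<Longrightarrow> shift q \<in> tail_class p"
proof -
  assume q: "q \<in> tail_class p"
  then obtain m n where "\<forall>i. q (i + m) = p (i + n)" by (auto simp: tail_class_def)
  then have "\<forall>i. shift q (i + m) = p (i + Suc n)" unfolding shift_def by (metis add_Suc add_Suc_right)
  then show ?thesis using q ipath_shift unfolding tail_class_def by blast
qed

lemma tail_class_icons: "\<lbrakk>q \<in> tail_class p; step_ok l; isrc q = lrng l\<rbrakk> \<Longrightarrow> icons l q \<in> tail_class p"
proof -
  assume q: "q \<in> tail_class p" "step_ok l" "isrc q = lrng l"
  then obtain m n where "\<forall>i. q (i + m) = p (i + n)" by (auto simp: tail_class_def)
  then have "\<forall>i. icons l q (i + Suc m) = p (i + n)" by simp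
  then show ?thesis using q ipath_icons unfolding tail_class_def by blast
qed

lemma tail_class_ipath: "q \<in> tail_class p \<Longrightarrow> ipath q"
  by (simp add: tail_class_def)

lemma act_letter: "act \<phi> (letter g) q = case_option 0 \<phi> (lact g q)"
  by (simp add: act_single)

lemma chen_letter:
  assumes \<phi>: "\<phi> \<in> chen p" and g: "g \<in> gens"
  shows "act \<phi> (letter g) \<in> chen p"
proof (cases g)
  case (Vertex v)
  show ?thesis using \<phi> by (intro chen_subset[of "{q. \<phi> q \<noteq> 0}"]) (auto simp: Vertex act_letter chen_def split: if_splits)
next
  case (Edge e)
  show ?thesis
  \<comment> \<open>The value at \<open>q\<close> is \<phi> at \<open>e\<close> followed by
    \<open>q\<close>, so the support arises by deleting first steps.\<close>
  proof (rule chen_subset[of "shift ` {q. \<phi> q \<noteq> 0}"])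
    fix q assume "act \<phi> (letter g) q \<noteq> 0"
    then have *: "\<phi> (icons (Inl e) q) \<noteq> 0" by (auto simp: Edge act_letter split: if_splits)
    then have "icons (Inl e) q \<in> tail_class p" using \<phi> chenD by blast
    then have "q \<in> tail_class p" using tail_class_shift by fastforce
    then show "q \<in> shift ` {q. \<phi> q \<noteq> 0} \<and> q \<in> tail_class p"
      using * by (auto intro!: image_eqI[of _ _ "icons (Inl e) q"])
  qed (use \<phi> in \<open>auto simp: chen_def\<close>)
next
  case (Ghost e)
  show ?thesis
  proof (rule chen_subset[of "icons (Inl e) ` {q. \<phi> q \<noteq> 0}"])
    fix q assume "act \<phi> (letter g) q \<noteq> 0"
    then have *: "\<phi> (shift q) \<noteq> 0" "e \<in> arcs E" "q 0 = Inl e" "lsrc (q 1) = head E e"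
      by (auto simp: Ghost act_letter split: if_splits)
    then have s: "shift q \<in> tail_class p" using \<phi> chenD by blast
    have "icons (Inl e) (shift q) \<in> tail_class p"
      using * by (intro tail_class_icons[OF s]) (auto simp: shift_def)
    then show "q \<in> icons (Inl e) ` {q. \<phi> q \<noteq> 0} \<and> q \<in> tail_class p"
      using * icons_shift[of q] by (auto intro!: image_eqI[of _ _ "shift q"])
  qed (use \<phi> in \<open>auto simp: chen_def\<close>)
qed

lemma chen_act:
  assumes \<phi>: "\<phi> \<in> chen p" and x: "x \<in> U"
  shows "act \<phi> x \<in> chen p"
proof -
  have w: "act \<phi> (Poly_Mapping.single (FM ls) 1) \<in> chen p" if "set ls \<subseteq> gens" for ls
    using that
  proof (induction ls rule: rev_induct)
    case Nil
    have "act \<phi> (Poly_Mapping.single (FM []) 1) = \<phi>" by (rule ext) (simp add: act_single)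
    then show ?case using \<phi> by simp
  next
    case (snoc g ls)
    then have "act (act \<phi> (Poly_Mapping.single (FM ls) 1)) (letter g) \<in> chen p"
      by (intro chen_letter) auto
    then show ?case unfolding word_split(2) by (simp add: act_mult[abs_def])
  qed
  obtain c y where cy: "y \<in> F0" "x = sc c + y" using U_decomp[OF x] by blast
  have "act \<phi> y \<in> chen p"
    using cy(1)
  proof (induction y rule: F0_induct)
    case zero
    have "act \<phi> 0 = (\<lambda>q. 0)" by (rule ext) simp
    then show ?case by simp
  next
    case (add y c ls)
    have "act \<phi> (sc c * Poly_Mapping.single (FM ls) 1 + y)
       = (\<lambda>q. c * act \<phi> (Poly_Mapping.single (FM ls) 1) q + act \<phi> y q)"
      by (rule ext) (simp add: act_add act_sc_mult del: mult_single)
    then show ?case using chen_add[OF chen_scale[OF w[OF add.hyps(3)]] add.IH] by simp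
  qed
  moreover have "act \<phi> x = (\<lambda>q. c * \<phi> q + act \<phi> y q)"
    by (rule ext) (simp add: cy(2) act_add act_single)
  ultimately show ?thesis using chen_add[OF chen_scale[OF \<phi>]] by simp
qed

text \<open>For the last relation, the product \<open>ed e * gh e\<close> tests whether a path
  starts with \<open>e\<close>, and a path from a vertex that is no sink starts with exactly one
  edge. At sequences that are not paths \<phi> vanishes; the other relations hold there too because
  \<open>lact\<close> checks all incidences explicitly.\<close>

lemma chen_relation:
  assumes \<phi>: "\<phi> \<in> chen p" and r: "r \<in> lpa_relations E"
  shows "act \<phi> r q = 0"
proof -
  have p2: "act \<phi> (letter g * letter h) q = case_option 0 \<phi> (Option.bind (lact h q) (lact g))" for g h
    by (simp add: mult_single act_single)
  have out: "\<phi> q' = 0" if "\<not> ipath q'" for q' using that \<phi> chenD(1) tail_class_ipath by blast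
  have ip: "e \<in> arcs E \<Longrightarrow> ipath q \<Longrightarrow> q 0 = Inl e \<Longrightarrow> lsrc (q 1) = head E e" for e
    by (metis One_nat_def ipath_def lrng.simps(1))
  have ck: "act \<phi> (vx v - (\<Sum>e\<in>out_arcs E v. ed e * gh e)) q = 0" if v: "v \<in> verts E" "out_arcs E v \<noteq> {}" for v
  proof -
    have t: "act \<phi> (ed e * gh e) q = (if q 0 = Inl e then \<phi> q else 0)" if e: "e \<in> arcs E" for e
    proof (cases "ipath q")
      case True
      have "icons (Inl e) (shift q) = q" if "q 0 = Inl e" using icons_shift[of q] that by simp
      then show ?thesis using ip[OF e True] e by (auto simp: p2 shift_def)
    next
      case False
      have "icons (Inl e) (shift q) = q" if "q 0 = Inl e" using icons_shift[of q] that by simp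
      then show ?thesis using out[OF False] by (auto simp: p2)
    qed
    have "(\<Sum>e\<in>out_arcs E v. act \<phi> (ed e * gh e) q) = (\<Sum>e\<in>out_arcs E v. if q 0 = Inl e then \<phi> q else 0)"
      by (intro sum.cong) (auto simp: t)
    also have "\<dots> = (if isrc q = v then \<phi> q else 0)"
    proof (cases "ipath q")
      case True
      then have "step_ok (q 0)" by (simp add: ipath_def)
      then show ?thesis using v by (cases "q 0") auto
    next
      case False
      then have "\<phi> q = 0" by (rule out)
      then show ?thesis by (auto intro!: sum.neutral)
    qed
    finally show ?thesis by (simp add: act_minus act_sum act_letter)
  qed
  have d: "act \<phi> (x - (if b then y else 0)) q = act \<phi> x q - (if b then act \<phi> y q else 0)" for x y b
    by (simp add: act_minus)
  have "r \<in> lpa_relations E \<Longrightarrow> act \<phi> r q = 0"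
    unfolding lpa_relations_def Un_iff mem_Collect_eq
    apply (elim disjE exE conjE)
    apply (simp_all only: d)
    apply (simp_all add: p2 act_minus act_letter shift_def)
    subgoal for v using ck[of v] by (auto simp: act_minus act_letter)
    done
  then show ?thesis using r .
qed

definition chen_ann :: "(nat \<Rightarrow> 'e + 'v) \<Rightarrow> ('v, 'e, 'k) lpa_free set" where
  "chen_ann p = {x \<in> F0. \<forall>\<phi>\<in>chen p. \<forall>q. act \<phi> x q = 0}"

lemma chen_ann_idl: "idl (chen_ann p)"
proof -
  have "algebra_ideal (chen_ann p) (lpa_free_algebra E)"
    unfolding FA.algebra_ideal_iff
  proof (intro conjI allI ballI)
    show "chen_ann p \<subseteq> F0" "0 \<in> chen_ann p" by (auto simp: chen_ann_def)
    show "x + y \<in> chen_ann p" if "x \<in> chen_ann p" "y \<in> chen_ann p" for x y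
      using that by (auto simp: chen_ann_def act_add)
    show "pm_scale c x \<in> chen_ann p" if "x \<in> chen_ann p" for c x
      using that FA.scale_in[of x c] by (auto simp: chen_ann_def scale_sc act_sc_mult)
    show "a * x \<in> chen_ann p" if "a \<in> F0" "x \<in> chen_ann p" for a x
      using that chen_act[OF _ F0_U, of _ p a] by (auto simp: chen_ann_def act_mult F0_U)
    show "x * a \<in> chen_ann p" if "a \<in> F0" "x \<in> chen_ann p" for a x
    proof -
      have "act \<phi> x = (\<lambda>q. 0)" if "\<phi> \<in> chen p" for \<phi> using that \<open>x \<in> chen_ann p\<close> by (auto simp: chen_ann_def)
      then show ?thesis using that by (auto simp: chen_ann_def act_mult F0_U)
    qed
  qed
  moreover have "lpa_relations E \<subseteq> chen_ann p"
    using chen_relation relations_F0 by (auto simp only: chen_ann_def)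
  ultimately show ?thesis
    unfolding idl_algebra_ideal lpa_ideal_def by (simp add: FA.generated_least)
qed

section \<open>Simplicity of the path module\<close>

abbreviation delta :: "(nat \<Rightarrow> 'e + 'v) \<Rightarrow> (nat \<Rightarrow> 'e + 'v) \<Rightarrow> 'k" where
  "delta q \<equiv> (\<lambda>q'. if q' = q then 1 else 0)"

lemma delta_chen: "q \<in> tail_class p \<Longrightarrow> delta q \<in> chen p"
  by (rule chen_subset[of "{q}"]) (auto split: if_splits)

lemma vx_chen_ann: "v \<in> verts E \<Longrightarrow> vx v \<in> chen_ann p \<longleftrightarrow> (\<forall>q\<in>tail_class p. isrc q \<noteq> v)"
proof
  assume v: "v \<in> verts E" "vx v \<in> chen_ann p"
  show "\<forall>q\<in>tail_class p. isrc q \<noteq> v"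
  proof (intro ballI notI)
    fix q assume q: "q \<in> tail_class p" "isrc q = v"
    have "act (delta q) (vx v) q = 0" using v delta_chen[OF q(1)] unfolding chen_ann_def by blast
    then show False using q by (simp add: act_letter)
  qed
next
  assume v: "v \<in> verts E" "\<forall>q\<in>tail_class p. isrc q \<noteq> v"
  then show "vx v \<in> chen_ann p"
    unfolding chen_ann_def using chenD(1) by (auto simp: act_letter)
qed

text \<open>A virtual loop is represented by the sink itself, which acts on the constant path in the
  same way. This makes initial segments of all paths uniform products of letters.\<close>

primrec lgen :: "'e + 'v \<Rightarrow> ('v, 'e) lpa_gen" where "lgen (Inl e) = Edge e" | "lgen (Inr v) = Vertex v"
primrec lgen' :: "'e + 'v \<Rightarrow> ('v, 'e) lpa_gen" where "lgen' (Inl e) = Ghost e" | "lgen' (Inr v) = Vertex v"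

lemma lgen_gens: "step_ok l \<Longrightarrow> lgen l \<in> gens \<and> lgen' l \<in> gens"
  by (cases l) (auto simp: gens_def)

lemma act_lgen:
  assumes "\<phi> \<in> chen p" "step_ok l"
  shows "act \<phi> (letter (lgen l)) q = (if q \<in> tail_class p \<and> isrc q = lrng l then \<phi> (icons l q) else 0)"
proof (cases "q \<in> tail_class p")
  case False
  then have "act \<phi> (letter (lgen l)) q = 0" using chen_letter[OF assms(1)] lgen_gens[OF assms(2)] chenD(1) by blast
  then show ?thesis using False by simp
next
  case q: True
  show ?thesis
  proof (cases l)
    case (Inl e)
    then show ?thesis using q assms(2) by (simp add: act_letter)
  next
    case (Inr v)
    have "icons (Inr v) q = q" if "isrc q = v"
    proof -
      have "q 0 = Inr v" using assms(2) Inr tail_class_ipath[OF q] that ipath_sink_iff by auto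
      then show ?thesis using ipath_sink[OF tail_class_ipath[OF q]] icons_shift[of q] by metis
    qed
    then show ?thesis using q Inr by (simp add: act_letter)
  qed
qed

text \<open>The first \<open>n\<close> steps of \<open>q\<close>, preceded by the source vertex so
  that the product lies in \<open>F0\<close> even for \<open>n = 0\<close>.\<close>

primrec path_front :: "nat \<Rightarrow> (nat \<Rightarrow> 'e + 'v) \<Rightarrow> ('v, 'e, 'k) lpa_free" where
  "path_front 0 q = vx (isrc q)"
| "path_front (Suc n) q = path_front n q * letter (lgen (q n))"

definition splice :: "nat \<Rightarrow> (nat \<Rightarrow> 'e + 'v) \<Rightarrow> (nat \<Rightarrow> 'e + 'v) \<Rightarrow> nat \<Rightarrow> 'e + 'v" where
  "splice n q q' i = (if i < n then q i else q' (i - n))"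

lemma isrc_verts: "ipath q \<Longrightarrow> lsrc (q i) \<in> verts E"
  unfolding ipath_def by (cases "q i") (metis lsrc.simps step_ok.simps tail_in_verts)+

lemma path_front_F0: "ipath q \<Longrightarrow> path_front n q \<in> F0"
  by (induction n) (auto simp: isrc_verts ipath_def intro!: F0_U_mult letter_U dest: lgen_gens)

lemma act_path_front:
  assumes \<phi>: "\<phi> \<in> chen p" and q: "ipath q"
  shows "act \<phi> (path_front n q) q' = (if q' \<in> tail_class p \<and> isrc q' = lsrc (q n) then \<phi> (splice n q q') else 0)"
proof (induction n arbitrary: q')
  case 0
  have "splice 0 q q' = q'" by (simp add: splice_def fun_eq_iff)
  then show ?case using chenD(1)[OF \<phi>, of q'] by (auto simp: act_letter)
next
  case (Suc n)
  have ok: "step_ok (q n)" "lsrc (q (Suc n)) = lrng (q n)" using q by (auto simp: ipath_def)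
  have "act \<phi> (path_front n q) \<in> chen p" using chen_act[OF \<phi> F0_U[OF path_front_F0[OF q]]] .
  from act_lgen[OF this ok(1), of q']
  have "act \<phi> (path_front (Suc n) q) q'
     = (if q' \<in> tail_class p \<and> isrc q' = lrng (q n) then act \<phi> (path_front n q) (icons (q n) q') else 0)"
    by (simp add: act_mult)
  moreover have "splice n q (icons (q n) q') = splice (Suc n) q q'"
    by (auto simp: splice_def fun_eq_iff icons_def less_Suc_eq split: nat.split)
      (rule arg_cong[where f = q'], arith)
  ultimately show ?case using tail_class_icons[OF _ ok(1)] ok(2) by (simp add: Suc.IH)
qed

lemma splice_self: "splice n q (\<lambda>i. q (i + n)) = q"
  by (auto simp: splice_def)

lemma ipath_drop: "q \<in> tail_class p \<Longrightarrow> (\<lambda>i. q (i + n)) \<in> tail_class p"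
proof (induction n)
  case (Suc n)
  then have "shift (\<lambda>i. q (i + n)) \<in> tail_class p" using tail_class_shift by blast
  then show ?case by (simp add: shift_def[abs_def])
qed simp

text \<open>Multiplication by the front selects the support points that begin with the first
  \<open>n\<close> steps of \<open>q\<close> and cuts these steps off. By \<open>sep\<close> only
  \<open>q\<close> is selected.\<close>

lemma act_front_delta:
  assumes \<phi>: "\<phi> \<in> chen p" and q: "q \<in> tail_class p"
    and sep: "\<And>q'. \<phi> q' \<noteq> 0 \<Longrightarrow> (\<forall>i<n. q' i = q i) \<Longrightarrow> q' = q"
  shows "act \<phi> (path_front n q) = (\<lambda>q'. \<phi> q * delta (\<lambda>i. q (i + n)) q')"
proof
  fix q'
  have a: "act \<phi> (path_front n q) q'
      = (if q' \<in> tail_class p \<and> isrc q' = lsrc (q n) then \<phi> (splice n q q') else 0)"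
    by (rule act_path_front[OF \<phi> tail_class_ipath[OF q]])
  show "act \<phi> (path_front n q) q' = \<phi> q * delta (\<lambda>i. q (i + n)) q'"
  proof (cases "q' = (\<lambda>i. q (i + n))")
    case True
    have "q' \<in> tail_class p" unfolding True by (rule ipath_drop[OF q])
    moreover have "isrc q' = lsrc (q n)" unfolding True by simp
    moreover have "splice n q q' = q" unfolding True by (rule splice_self)
    ultimately show ?thesis using a True by (simp only: if_True simp_thms mult_1_right)
  next
    case False
    have "\<phi> (splice n q q') = 0"
    proof (rule ccontr)
      assume "\<phi> (splice n q q') \<noteq> 0"
      then have e: "splice n q q' = q" by (rule sep) (simp add: splice_def)
      have "q' i = q (i + n)" for i using fun_cong[OF e, of "i + n"] by (simp add: splice_def)
      then show False using False by blast
    qed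
    then show ?thesis using a False by (simp only: if_False if_cancel mult_zero_right)
  qed
qed

lemma separate:
  assumes "finite S" "q \<in> S"
  shows "\<exists>n. \<forall>q'\<in>S. (\<forall>i<n. q' i = q i) \<longrightarrow> q' = (q :: nat \<Rightarrow> 'z)"
proof -
  \<comment> \<open>The first position of disagreement with \<open>q\<close>. At \<open>q\<close>
    itself the value is arbitrary, which can only enlarge the maximum.\<close>
  define d where "d q' = (LEAST i. q' i \<noteq> q i)" for q'
  have "q' = q" if "q' \<in> S" "\<forall>i<Suc (Max (d ` S)). q' i = q i" for q'
  proof (rule ccontr)
    assume "q' \<noteq> q"
    then have "\<exists>i. q' i \<noteq> q i" by auto
    then have "q' (d q') \<noteq> q (d q')" unfolding d_def by (rule LeastI_ex)
    moreover have "d q' \<le> Max (d ` S)" using that(1) assms(1) by (intro Max_ge) auto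
    ultimately show False using that(2) by simp
  qed
  then show ?thesis by blast
qed

lemma chen_to_delta:
  assumes \<phi>: "\<phi> \<in> chen p" "\<phi> q \<noteq> 0"
  shows "\<exists>x\<in>F0. \<exists>q'\<in>tail_class p. act \<phi> x = delta q'"
proof -
  have q: "q \<in> tail_class p" using \<phi> chenD by blast
  obtain n where "\<forall>q'\<in>{q. \<phi> q \<noteq> 0}. (\<forall>i<n. q' i = q i) \<longrightarrow> q' = q"
    using separate[of "{q. \<phi> q \<noteq> 0}" q] \<phi> chenD(2) by blast
  then have "act \<phi> (path_front n q) = (\<lambda>q'. \<phi> q * delta (\<lambda>i. q (i + n)) q')"
    using act_front_delta[OF \<phi>(1) q, of n] by blast
  then have "act \<phi> (sc (inverse (\<phi> q)) * path_front n q) = delta (\<lambda>i. q (i + n))"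
    using \<phi>(2) by (intro ext) (simp add: act_sc_mult)
  then show ?thesis using ipath_drop[OF q, of n] path_front_F0[OF tail_class_ipath[OF q], of n] by (metis U_F0_mult U_sc)
qed

lemma delta_drop:
  assumes "q \<in> tail_class p"
  shows "\<exists>x\<in>F0. act (delta q) x = delta (\<lambda>i. q (i + n))"
proof -
  have "act (delta q) (path_front n q) = (\<lambda>q'. delta q q * delta (\<lambda>i. q (i + n)) q')"
    using assms by (intro act_front_delta[OF delta_chen]) (auto split: if_splits)
  then show ?thesis using path_front_F0[OF tail_class_ipath[OF assms]] by auto
qed

text \<open>A ghost letter reinstates the step that was cut off, since it evaluates a function at
  the shifted path.\<close>

lemma delta_icons:
  assumes "q \<in> tail_class p"
  shows "act (delta (shift q)) (letter (lgen' (q 0))) = delta q"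
proof
  fix q'
  have ip: "ipath q" using tail_class_ipath[OF assms] .
  show "act (delta (shift q)) (letter (lgen' (q 0))) q' = delta q q'"
  proof (cases "q 0")
    case (Inl e)
    moreover have "step_ok (q 0)" "lsrc (q (Suc 0)) = lrng (q 0)" using ip by (simp_all add: ipath_def)
    moreover have "q' = q" if "q' 0 = Inl e" "shift q' = shift q"
      using that Inl icons_shift by metis
    ultimately show ?thesis by (simp add: act_letter)
  next
    case (Inr v)
    then show ?thesis using ipath_sink[OF ip] by (auto simp: act_letter)
  qed
qed

lemma delta_undrop:
  assumes "q \<in> tail_class p"
  shows "\<exists>x\<in>U. act (delta (\<lambda>i. q (i + n))) x = delta q"
proof (induction n)
  case 0
  show ?case by (intro bexI[of _ 1]) (auto simp: fun_eq_iff act_single simp flip: single_one)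
next
  case (Suc n)
  then obtain x where x: "x \<in> U" "act (delta (\<lambda>i. q (i + n))) x = delta q" by blast
  have "act (delta (\<lambda>i. q (i + Suc n))) (letter (lgen' (q n))) = delta (\<lambda>i. q (i + n))"
    using delta_icons[OF ipath_drop[OF assms, of n]] by (simp add: shift_def[abs_def])
  moreover have "step_ok (q n)" using tail_class_ipath[OF assms] by (simp add: ipath_def)
  ultimately show ?case
    using x lgen_gens by (intro bexI[of _ "letter (lgen' (q n)) * x"]) (auto simp: act_mult[abs_def] letter_U)
qed

text \<open>Both paths are cut back to a common tail: the edges of the first lead to it and the
  ghosts of the second lead away from it.\<close>

lemma delta_trans:
  assumes "q \<in> tail_class p" "q' \<in> tail_class p"
  shows "\<exists>x\<in>F0. act (delta q) x = delta q'"
proof -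
  obtain m n where mn: "\<And>i. q (i + m) = p (i + n)" using assms(1) by (auto simp: tail_class_def)
  obtain m' n' where mn': "\<And>i. q' (i + m') = p (i + n')" using assms(2) by (auto simp: tail_class_def)
  \<comment> \<open>Both sides equal \<open>p (i + n + n')\<close>.\<close>
  have "q (i + (m + n')) = q' (i + (m' + n))" for i
    using mn[of "i + n'"] mn'[of "i + n"] by (simp add: ac_simps)
  then have eq: "(\<lambda>i. q (i + (m + n'))) = (\<lambda>i. q' (i + (m' + n)))" by blast
  obtain x where x: "x \<in> F0" "act (delta q) x = delta (\<lambda>i. q (i + (m + n')))" using delta_drop[OF assms(1)] by blast
  obtain y where y: "y \<in> U" "act (delta (\<lambda>i. q' (i + (m' + n)))) y = delta q'" using delta_undrop[OF assms(2)] by blast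
  show ?thesis using x y unfolding eq by (intro bexI[of _ "x * y"]) (auto simp: act_mult[abs_def])
qed

text \<open>Simplicity in the form used later: a non-zero function is moved to a single path, from
  there to every path of the class, and the target is a finite combination of these.\<close>

lemma chen_transitive:
  assumes \<phi>: "\<phi> \<in> chen p" "\<phi> q \<noteq> 0" and \<psi>: "\<psi> \<in> chen p"
  shows "\<exists>x\<in>F0. act \<phi> x = \<psi>"
proof -
  obtain y q1 where y: "y \<in> F0" "q1 \<in> tail_class p" "act \<phi> y = delta q1" using chen_to_delta[OF \<phi>] by blast
  have "\<forall>q'\<in>tail_class p. \<exists>x\<in>F0. act \<phi> x = delta q'"
  proof
    fix q' assume "q' \<in> tail_class p"
    then obtain x where "x \<in> F0" "act (delta q1) x = delta q'" using delta_trans y by blast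
    then show "\<exists>x\<in>F0. act \<phi> x = delta q'"
      using y by (intro bexI[of _ "y * x"]) (auto simp: act_mult[abs_def] F0_U)
  qed
  then obtain f where f: "\<And>q'. q' \<in> tail_class p \<Longrightarrow> f q' \<in> F0 \<and> act \<phi> (f q') = delta q'" by metis
  define S where "S = {q. \<psi> q \<noteq> 0}"
  have S: "finite S" "S \<subseteq> tail_class p" using \<psi> by (auto simp: S_def chen_def)
  define x where "x = (\<Sum>s\<in>S. sc (\<psi> s) * f s)"
  have "x \<in> F0" unfolding x_def using f S(2) by (intro F0_sum U_F0_mult) auto
  moreover have "act \<phi> x q' = \<psi> q'" for q'
  proof -
    have "act \<phi> x q' = (\<Sum>s\<in>S. \<psi> s * delta s q')"
      unfolding x_def act_sum act_sc_mult using f S(2) by (intro sum.cong) auto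
    also have "\<dots> = (\<Sum>s\<in>S. if s = q' then \<psi> s else 0)" by (intro sum.cong) auto
    also have "\<dots> = \<psi> q'" using S(1) by (simp add: S_def)
    finally show ?thesis .
  qed
  ultimately show ?thesis by blast
qed

section \<open>Prime ideals and maximal tails\<close>

definition verts_of :: "('v, 'e, 'k) lpa_free set \<Rightarrow> 'v set" where
  "verts_of I = {v \<in> verts E. vx v \<in> I}"

text \<open>The elementwise form of primeness, matched with the ideal-wise one in
  \<open>prime_LA_iff\<close>.\<close>

definition prime_idl :: "('v, 'e, 'k) lpa_free set \<Rightarrow> bool" where
  "prime_idl I \<longleftrightarrow> idl I \<and> I \<noteq> F0 \<and>
     (\<forall>a\<in>F0. \<forall>b\<in>F0. (\<forall>r\<in>U. a * r * b \<in> I) \<longrightarrow> a \<in> I \<or> b \<in> I)"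

text \<open>The range of \<open>p\<close> is congruent to the ghost of \<open>p\<close> times
  \<open>vx u\<close> times \<open>p\<close>.\<close>

lemma idl_hereditary:
  assumes I: "idl I" and p: "path u p w" and u: "vx u \<in> I"
  shows "vx w \<in> I"
proof -
  have "eqm N (vx w * Gh p * (vx u * (Ed p * vx w))) (vx w * Gh p * (Ed p * vx w))"
    using p by (intro eN_l[OF vx_Ed]) auto
  also have "eqm N \<dots> (vx w)" by (rule Gh_Ed[OF p])
  finally have e: "eqm N (vx w * Gh p * (vx u * (Ed p * vx w))) (vx w)" .
  have "vx w * Gh p * (vx u * (Ed p * vx w)) \<in> I"
    using p by (intro idl_l[OF I idl_r[OF I u]]) auto
  then show ?thesis using eqm_mem[OF I eqm_N[OF I e]] by simp
qed

text \<open>The vertex \<open>v\<close> is congruent to the sum of all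
  \<open>ed e * vx (head E e) * gh e\<close>.\<close>

lemma idl_saturated:
  assumes I: "idl I" and v: "v \<in> verts E" "out_arcs E v \<noteq> {}"
    and h: "\<And>e. e \<in> out_arcs E v \<Longrightarrow> vx (head E e) \<in> I"
  shows "vx v \<in> I"
proof -
  have "ed e * gh e \<in> I" if e: "e \<in> out_arcs E v" for e
  proof -
    have "eqm N (ed e * vx (head E e) * gh e) (ed e * gh e)"
      using e by (intro eN_r[OF rel_er]) auto
    moreover have "ed e * vx (head E e) * gh e \<in> I"
      using e by (intro idl_r[OF I] idl_l[OF I] h) auto
    ultimately show ?thesis using eqm_mem[OF I eqm_N[OF I]] by blast
  qed
  then have "(\<Sum>e\<in>out_arcs E v. ed e * gh e) \<in> I" by (rule idl_sum[OF I])
  then show ?thesis using eqm_mem[OF I eqm_N[OF I rel_ck[OF v]]] by simp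
qed

lemma ev_mem: "idl I \<Longrightarrow> (\<And>t. t \<in> set ts \<Longrightarrow> mon t \<in> I) \<Longrightarrow> ev ts \<in> I"
  by (induction ts) (auto intro: idl_0 idl_add)

lemma exists_vx_notin: "idl I \<Longrightarrow> I \<noteq> F0 \<Longrightarrow> \<exists>v\<in>verts E. vx v \<notin> I"
proof -
  assume I: "idl I" "I \<noteq> F0"
  then obtain x where x: "x \<in> F0" "x \<notin> I" using idl_sub by blast
  then obtain v where "v \<in> verts E" "vx v * x \<notin> I" using exists_vx[OF I(1)] by blast
  then show ?thesis using idl_r[OF I(1), of "vx v" x] x F0_U by blast
qed

lemma mon_notin:
  assumes I: "idl I" and t: "mpath u v (k, p, z, q)" "mon (k, p, z, q) \<notin> I"
  shows "vx z \<notin> I"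
proof
  assume "vx z \<in> I"
  then have "sc k * (Ed p * vx z * Gh q) \<in> I" using t(1) by (intro idl_r[OF I] idl_l[OF I]) auto
  then show False using t(2) by simp
qed

text \<open>Closure under predecessors and the existence of edges are the contrapositives of
  \<open>idl_hereditary\<close> and \<open>idl_saturated\<close>. Primeness gives directedness: some
  \<open>vx v * r * vx w\<close> is outside \<open>I\<close>, hence so is a monomial of it, and the
  middle vertex of that monomial is reached from both \<open>v\<close> and \<open>w\<close>.\<close>

lemma prime_maximal_tail:
  assumes P: "prime_idl I"
  shows "maximal_tail E (verts E - verts_of I)" (is "maximal_tail E ?M")
proof -
  have I: "idl I" "I \<noteq> F0" using P by (auto simp: prime_idl_def)
  have dir: "\<exists>y\<in>?M. v \<rightarrow>\<^sup>*\<^bsub>E\<^esub> y \<and> w \<rightarrow>\<^sup>*\<^bsub>E\<^esub> y" if "v \<in> ?M" "w \<in> ?M" for v w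
  proof -
    have vw: "v \<in> verts E" "w \<in> verts E" "vx v \<notin> I" "vx w \<notin> I" using that by (auto simp: verts_of_def)
    then obtain r where r: "r \<in> U" "vx v * r * vx w \<notin> I" using P unfolding prime_idl_def by (meson gen_F0(1))
    have "eqm N (vx v * (r * vx w) * vx w) (vx v * r * vx w)"
      using eN_l[OF rel_vv_same[OF vw(2)], of "vx v * r"] vw r by (simp add: mult.assoc)
    moreover obtain ts where ts: "eqm N (vx v * (r * vx w) * vx w) (ev ts)" "\<forall>t\<in>set ts. mpath v w t"
      using spanning_corner[of "r * vx w" v w] vw r by auto
    ultimately have "ev ts \<notin> I" using eqm_mem[OF I(1) eqm_N[OF I(1)]] r by blast
    then obtain t where "t \<in> set ts" "mon t \<notin> I" using ev_mem[OF I(1)] by blast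
    then obtain k p z q where "mpath v w (k, p, z, q)" "mon (k, p, z, q) \<notin> I" using ts by (metis prod.collapse)
    then have "vx z \<notin> I" "path v p z" "path w q z" using mon_notin[OF I(1)] by auto
    then show ?thesis using path_reachable path_verts by (intro bexI[of _ z]) (auto simp: verts_of_def)
  qed
  show ?thesis
    unfolding maximal_tail_def
  proof (intro conjI ballI impI)
    show "?M \<noteq> {}" using exists_vx_notin[OF I] by (auto simp: verts_of_def)
    show "v \<in> ?M" if "v \<in> verts E" "w \<in> ?M" "v \<rightarrow>\<^sup>*\<^bsub>E\<^esub> w" for v w
      using that reachable_path idl_hereditary[OF I(1)] by (fastforce simp: verts_of_def)
    show "\<exists>e\<in>out_arcs E v. head E e \<in> ?M" if "v \<in> ?M" "out_arcs E v \<noteq> {}" for v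
      using that idl_saturated[OF I(1), of v] by (auto simp: verts_of_def)
  qed (use dir in blast)+
qed

text \<open>A lower bound rather than a fixed degree, because the closed paths in a combination have
  different lengths. Lower bounds add up in products.\<close>

definition dge :: "int \<Rightarrow> ('v, 'e, 'k) lpa_free \<Rightarrow> bool" where
  "dge n x \<longleftrightarrow> (\<forall>w\<in>Poly_Mapping.keys x. n \<le> word_degree w)"

lemma dge_mult: "dge m x \<Longrightarrow> dge n y \<Longrightarrow> dge (m + n) (x * y)"
  using keys_mult[of x y] by (fastforce simp: dge_def)

lemma dge_add: "dge n x \<Longrightarrow> dge n y \<Longrightarrow> dge n (x + y)"
  using keys_add[of x y] by (fastforce simp: dge_def)

lemma dge_hc: "dge n x \<Longrightarrow> m < n \<Longrightarrow> hc m x = 0"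
  by (intro hc_outside) (auto simp: dge_def)

lemma dge_mono: "dge n x \<Longrightarrow> m \<le> n \<Longrightarrow> dge m x"
  by (auto simp: dge_def)

lemma word_degree_Edge: "word_degree (FM (map Edge p)) = int (length p)"
  by (induction p) (auto simp: word_degree_def)

lemma word_degree_Ghost: "word_degree (FM (rev (map Ghost p))) = - int (length p)"
  by (induction p) (auto simp: word_degree_def)

lemma dge_simps: "dge (int (length p)) (Ed p)" "dge (- int (length p)) (Gh p)" "dge 0 (vx v)" "dge 0 (sc c)"
  by (auto simp: dge_def Ed_def Gh_def word_degree_Edge word_degree_Ghost) (auto simp: word_degree_def zero_free_mon_def split: if_splits)

lemma dge_closed:
  assumes "\<And>t. t \<in> set ts \<Longrightarrow> closed_term v t"
  shows "dge 1 (ev ts)"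
  using assms
proof (induction ts)
  case Nil
  show ?case by (simp add: dge_def)
next
  case (Cons t ts)
  have "closed_term v t" by (rule Cons.prems) simp
  then obtain k p where t: "t = (k, p, v, [])" "p \<noteq> []" unfolding closed_term_def by blast
  have "dge (0 + (int (length p) + 0)) (sc k * (Ed p * vx v))"
    by (rule dge_mult[OF dge_simps(4) dge_mult[OF dge_simps(1) dge_simps(3)]])
  moreover have "1 \<le> int (length p)" using t(2) by (cases p) auto
  ultimately have "dge 1 (mon t)" using dge_mono[of "int (length p)" "mon t" 1] by (simp add: t)
  moreover have "dge 1 (ev ts)" using Cons by simp
  ultimately show ?case by (simp add: dge_add)
qed

text \<open>Conjugation by a path transports a multiple of a vertex to any vertex reached from it,
  with the same coefficient.\<close>

lemma conjugate:
  assumes p: "path v p y"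
  shows "eqm N (vx y * Gh p * (sc k * vx v) * (Ed p * vx y)) (sc k * vx y)"
proof -
  have "eqm N (sc k * (vx y * Gh p) * (vx v * (Ed p * vx y))) (sc k * (vx y * Gh p) * (Ed p * vx y))"
    using p by (intro eN_l[OF vx_Ed]) auto
  also have "eqm N (sc k * (vx y * Gh p) * (Ed p * vx y)) (sc k * vx y)"
    using eN_l[OF Gh_Ed[OF p], of "sc k"] by (simp add: mult.assoc)
  finally show ?thesis by (simp add: mult.assoc sc_left_commute)
qed

definition reduces :: "('v, 'e, 'k) lpa_free \<Rightarrow> 'v \<Rightarrow> bool" where
  "reduces x y \<longleftrightarrow> (\<exists>a\<in>U. \<exists>b\<in>U. \<exists>k r. k \<noteq> 0 \<and> dge 1 r \<and> r \<in> U \<and> eqm N (a * x * b) (sc k * vx y + r))"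

lemma hc_vertex: "dge 1 r \<Longrightarrow> hc 0 (sc k * vx v + r) = sc k * vx v"
  by (simp add: hc_add dge_hc mult_single hc_single word_degree_def)

lemma Gh_Ed_prefix:
  assumes "path v \<gamma> w" "path w \<beta> z"
  shows "eqm N (vx w * Gh \<gamma> * (Ed (\<gamma> @ \<beta>) * vx z)) (Ed \<beta> * vx z)"
proof -
  have "eqm N (vx w * Gh \<gamma> * Ed \<gamma> * (Ed \<beta> * vx z)) (vx w * Gh \<gamma> * Ed \<gamma> * (vx w * (Ed \<beta> * vx z)))"
    using assms by (intro eN_l[OF eN_sym[OF vx_Ed]]) auto
  also have "eqm N \<dots> (vx w * (Ed \<beta> * vx z))"
    using eN_r[OF Gh_Ed[OF assms(1)], of "Ed \<beta> * vx z"] assms by (simp add: mult.assoc)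
  also have "eqm N \<dots> (Ed \<beta> * vx z)" using vx_Ed[OF assms(2)] .
  finally show ?thesis by (simp add: Ed_append mult.assoc)
qed

text \<open>Cancelling equal first edges leads to two different edges, whose product is zero. The
  bound on the lengths excludes that \<open>p\<close> is a proper prefix of the ghost path, where a
  ghost path would remain.\<close>

lemma Gh_Ed_diff:
  assumes "path v \<gamma> w" "path v p z" "length \<gamma> \<le> length p" "\<not> prefix \<gamma> p"
  shows "eqm N (vx w * Gh \<gamma> * (Ed p * vx z)) 0"
  using assms
proof (induction \<gamma> arbitrary: v p)
  case (Cons e \<gamma>)
  then obtain f p' where p: "p = f # p'" by (cases p) auto
  have e: "e \<in> arcs E" "path (head E e) \<gamma> w" and f: "f \<in> arcs E" "path (head E f) p' z" using Cons.prems p by auto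
  have "eqm N (vx w * Gh \<gamma> * (gh e * ed f) * (Ed p' * vx z)) (vx w * Gh \<gamma> * (if e = f then vx (head E e) else 0) * (Ed p' * vx z))"
    using e f by (intro eN_lr[OF rel_ge]) auto
  also have "eqm N \<dots> 0"
  proof (cases "e = f")
    case True
    have "eqm N (vx w * Gh \<gamma> * (vx (head E e) * (Ed p' * vx z))) (vx w * Gh \<gamma> * (Ed p' * vx z))"
      using e f True by (intro eN_l[OF vx_Ed]) auto
    also have "eqm N \<dots> 0" using Cons.IH[of "head E e" p'] Cons.prems p True e f by auto
    finally show ?thesis using True by (simp add: mult.assoc)
  qed (simp add: eN_refl)
  finally show ?case by (simp add: p Gh_Cons Ed_Cons mult.assoc)
qed simp

text \<open>Conjugating a closed path \<beta> by \<gamma> gives zero unless \<beta> followed by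
  \<gamma> begins with \<gamma>. In that case the remainder is a closed path at the end of \<gamma>,
  of the same length as \<beta> and hence again non-empty.\<close>

lemma kill_term:
  assumes \<gamma>: "path v \<gamma> w" and t: "closed_term v (c, \<beta>, z, q)"
  shows "prefix \<gamma> (\<beta> @ \<gamma>) \<Longrightarrow> \<exists>\<beta>'. closed_term w (c, \<beta>', w, []) \<and>
      eqm N (vx w * Gh \<gamma> * mon (c, \<beta>, z, q) * (Ed \<gamma> * vx w)) (mon (c, \<beta>', w, []))"
    and "\<not> prefix \<gamma> (\<beta> @ \<gamma>) \<Longrightarrow> eqm N (vx w * Gh \<gamma> * mon (c, \<beta>, z, q) * (Ed \<gamma> * vx w)) 0"
proof -
  have t': "z = v" "q = []" "\<beta> \<noteq> []" "path v \<beta> v" using t by (auto simp: closed_term_def)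
  have p: "path v (\<beta> @ \<gamma>) w" using t' \<gamma> by (auto simp: path_append)
  have "eqm N (vx w * Gh \<gamma> * (sc c * Ed \<beta>) * (vx v * (Ed \<gamma> * vx w))) (vx w * Gh \<gamma> * (sc c * Ed \<beta>) * (Ed \<gamma> * vx w))"
    using \<gamma> t' by (intro eN_l[OF vx_Ed]) auto
  then have 1: "eqm N (vx w * Gh \<gamma> * mon (c, \<beta>, z, q) * (Ed \<gamma> * vx w)) (sc c * (vx w * Gh \<gamma> * (Ed (\<beta> @ \<gamma>) * vx w)))"
    by (simp add: t' Ed_append mult.assoc sc_left_commute)
  show "\<exists>\<beta>'. closed_term w (c, \<beta>', w, []) \<and>
      eqm N (vx w * Gh \<gamma> * mon (c, \<beta>, z, q) * (Ed \<gamma> * vx w)) (mon (c, \<beta>', w, []))" if pre: "prefix \<gamma> (\<beta> @ \<gamma>)"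
  proof -
    obtain \<beta>' where b: "\<beta> @ \<gamma> = \<gamma> @ \<beta>'" using pre by (auto simp: prefix_def)
    then have "length \<beta>' = length \<beta>" by (metis add.commute add_left_cancel length_append)
    then have "\<beta>' \<noteq> []" using t'(3) by auto
    have "path w \<beta>' w" using p \<gamma> path_end_unique unfolding b path_append by blast
    have "eqm N (sc c * (vx w * Gh \<gamma> * (Ed (\<beta> @ \<gamma>) * vx w))) (sc c * (Ed \<beta>' * vx w))"
      unfolding b using \<gamma> \<open>path w \<beta>' w\<close> by (intro eN_l[OF Gh_Ed_prefix]) auto
    then show ?thesis using eN_trans[OF 1] \<open>\<beta>' \<noteq> []\<close> \<open>path w \<beta>' w\<close>
      by (intro exI[of _ \<beta>']) (auto simp: closed_term_def)
  qed
  show "eqm N (vx w * Gh \<gamma> * mon (c, \<beta>, z, q) * (Ed \<gamma> * vx w)) 0" if pre: "\<not> prefix \<gamma> (\<beta> @ \<gamma>)"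
    using eN_trans[OF 1] eN_l[OF Gh_Ed_diff[OF \<gamma> p _ pre], of "sc c"] by auto
qed

subsection \<open>A path that every vertex of a maximal tail reaches\<close>

lemma countable_reachable: "countable {w. v \<rightarrow>\<^sup>*\<^bsub>E\<^esub> w}"
proof -
  \<comment> \<open>The ends of the paths of length \<open>n\<close> from \<open>v\<close>;
    row-finiteness keeps each of these sets finite.\<close>
  define R where "R = rec_nat {v} (\<lambda>_ S. \<Union>u\<in>S. head E ` out_arcs E u)"
  have Suc: "R (Suc n) = (\<Union>u\<in>R n. head E ` out_arcs E u)" for n by (simp add: R_def)
  have fin: "finite (R n)" for n
  proof (induction n)
    case (Suc n)
    have "finite (out_arcs E u)" for u
    proof (cases "u \<in> verts E")
      case False
      then have "out_arcs E u = {}" by auto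
      then show ?thesis by simp
    qed simp
    then show ?case using Suc.IH by (simp add: \<open>R (Suc n) = _\<close>)
  qed (simp add: R_def)
  have "w \<in> R (length p)" if "path v p w" for p w
    using that
  proof (induction p arbitrary: w rule: rev_induct)
    case (snoc e p)
    then have p: "path v p (tail E e)" and e: "e \<in> arcs E" "w = head E e" by (auto simp: path_append)
    have "e \<in> out_arcs E (tail E e)" using e by simp
    then show ?case using snoc.IH[OF p] unfolding length_append_singleton Suc e(2) by blast
  qed (simp add: R_def)
  then have "{w. v \<rightarrow>\<^sup>*\<^bsub>E\<^esub> w} \<subseteq> (\<Union>n. R n)" by (auto dest!: reachable_path)
  then show ?thesis using fin by (meson countable_UN countable_finite countable_subset countableI_type)
qed

text \<open>Finite paths that may use virtual loops, so that the construction of an infinite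
  sequence can continue at a sink.\<close>

primrec spath :: "'v \<Rightarrow> ('e + 'v) list \<Rightarrow> 'v \<Rightarrow> bool" where
  "spath u [] w \<longleftrightarrow> u = w"
| "spath u (l # ls) w \<longleftrightarrow> step_ok l \<and> lsrc l = u \<and> spath (lrng l) ls w"

lemma spath_append: "spath u (ls @ ms) w \<longleftrightarrow> (\<exists>z. spath u ls z \<and> spath z ms w)"
  by (induction ls arbitrary: u) auto

lemma spath_path: "path u p w \<Longrightarrow> spath u (map Inl p) w"
  by (induction p arbitrary: u) auto

lemma spath_nth: "spath u ls w \<Longrightarrow> Suc i < length ls \<Longrightarrow> lsrc (ls ! Suc i) = lrng (ls ! i)"
proof (induction ls arbitrary: u i)
  case (Cons l ls)
  show ?case
  proof (cases i)
    case 0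
    then show ?thesis using Cons.prems by (cases ls) auto
  next
    case (Suc j)
    then show ?thesis using Cons.prems Cons.IH[of "lrng l" j] by simp
  qed
qed simp

lemma spath_ok: "spath u ls w \<Longrightarrow> l \<in> set ls \<Longrightarrow> step_ok l"
  by (induction ls arbitrary: u) auto

lemma step_reachable: "step_ok l \<Longrightarrow> lsrc l \<in> verts E \<and> lsrc l \<rightarrow>\<^sup>*\<^bsub>E\<^esub> lrng l"
proof (cases l)
  case (Inl e)
  assume "step_ok l"
  then have "path (tail E e) [e] (head E e)" using Inl by auto
  from path_reachable[OF this] path_verts[OF this] show ?thesis unfolding Inl lsrc.simps lrng.simps by blast
qed auto

lemma ipath_reachable: "ipath q \<Longrightarrow> lsrc (q 0) \<rightarrow>\<^sup>*\<^bsub>E\<^esub> lsrc (q n)"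
proof (induction n)
  case 0
  then show ?case using isrc_verts by auto
next
  case (Suc n)
  have "lsrc (q n) \<rightarrow>\<^sup>*\<^bsub>E\<^esub> lsrc (q (Suc n))" using Suc.prems step_reachable by (metis ipath_def)
  then show ?case using Suc reachable_trans by blast
qed

context
  fixes M assumes M: "maximal_tail E M"
begin

lemma tail_verts: "v \<in> M \<Longrightarrow> v \<in> verts E"
  and tail_up: "v \<in> verts E \<Longrightarrow> w \<in> M \<Longrightarrow> v \<rightarrow>\<^sup>*\<^bsub>E\<^esub> w \<Longrightarrow> v \<in> M"
  and tail_edge: "v \<in> M \<Longrightarrow> out_arcs E v \<noteq> {} \<Longrightarrow> \<exists>e\<in>out_arcs E v. head E e \<in> M"
  and tail_directed: "v \<in> M \<Longrightarrow> w \<in> M \<Longrightarrow> \<exists>y\<in>M. v \<rightarrow>\<^sup>*\<^bsub>E\<^esub> y \<and> w \<rightarrow>\<^sup>*\<^bsub>E\<^esub> y"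
  and tail_nonempty: "M \<noteq> {}" and tail_subset: "M \<subseteq> verts E"
  using M unfolding maximal_tail_def by blast+

lemma tail_path_up: "path u p w \<Longrightarrow> w \<in> M \<Longrightarrow> u \<in> M"
  using tail_up path_reachable path_verts by blast

lemma spath_in_tail: "spath u ls w \<Longrightarrow> w \<in> M \<Longrightarrow> u \<in> M \<and> (\<forall>l\<in>set ls. lsrc l \<in> M)"
proof (induction ls arbitrary: u)
  case (Cons l ls)
  then show ?case using step_reachable[of l] tail_up by auto
qed simp

lemma tail_step: "v \<in> M \<Longrightarrow> \<exists>l. step_ok l \<and> lsrc l = v \<and> lrng l \<in> M"
proof (cases "out_arcs E v = {}")
  case True
  assume "v \<in> M"
  then show ?thesis using True tail_verts by (intro exI[of _ "Inr v"]) auto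
next
  case False
  assume "v \<in> M"
  then obtain e where "e \<in> out_arcs E v" "head E e \<in> M" using tail_edge False by blast
  then show ?thesis by (intro exI[of _ "Inl e"]) auto
qed

text \<open>From \<open>u\<close> a common successor of \<open>u\<close> and \<open>w\<close> is
  reached; one further step inside \<open>M\<close>, possibly a virtual loop, makes the list
  non-empty.\<close>

lemma tail_advance:
  assumes "u \<in> M" "w \<in> M"
  shows "\<exists>ls u'. ls \<noteq> [] \<and> u' \<in> M \<and> spath u ls u' \<and> w \<rightarrow>\<^sup>*\<^bsub>E\<^esub> u'"
proof -
  obtain y where y: "y \<in> M" "u \<rightarrow>\<^sup>*\<^bsub>E\<^esub> y" "w \<rightarrow>\<^sup>*\<^bsub>E\<^esub> y" using tail_directed assms by blast
  obtain p where p: "path u p y" using reachable_path y(2) by blast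
  obtain l where l: "step_ok l" "lsrc l = y" "lrng l \<in> M" using tail_step y(1) by blast
  have "w \<rightarrow>\<^sup>*\<^bsub>E\<^esub> lrng l" using reachable_trans[OF y(3)] step_reachable[OF l(1)] l(2) by auto
  then show ?thesis using l spath_path[OF p]
    by (intro exI[of _ "map Inl p @ [l]"] exI[of _ "lrng l"]) (auto simp: spath_append)
qed

text \<open>The path is assembled from segments starting at a fixed vertex \<open>v0\<close>.
  Segment \<open>n\<close> ends at a vertex reached from the \<open>n\<close>-th vertex of an
  enumeration of the successors of \<open>v0\<close> in \<open>M\<close>. An arbitrary vertex of
  \<open>M\<close> has a common successor with \<open>v0\<close>, and this one is
  enumerated.\<close>

lemma cofinal_path:
  "\<exists>p. ipath p \<and> (\<forall>i. lsrc (p i) \<in> M) \<and> (\<forall>v\<in>M. \<exists>i. v \<rightarrow>\<^sup>*\<^bsub>E\<^esub> lsrc (p i))"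
proof -
  obtain v0 where v0: "v0 \<in> M" using tail_nonempty by blast
  \<comment> \<open>\<open>M\<close> itself may be uncountable; the successors of one vertex are
    not. A finite \<open>T\<close> is enumerated with repetitions.\<close>
  define T where "T = {w. v0 \<rightarrow>\<^sup>*\<^bsub>E\<^esub> w} \<inter> M"
  have "countable T" unfolding T_def using countable_reachable by blast
  moreover have "v0 \<in> T" using v0 tail_verts by (auto simp: T_def)
  ultimately have rT: "range (from_nat_into T) = T" by (intro range_from_nat_into) auto
  define w where "w = from_nat_into T"
  have w: "w n \<in> M" for n using rT by (auto simp: w_def T_def)
  have "\<forall>u\<in>M. \<forall>n. \<exists>r. fst r \<noteq> [] \<and> snd r \<in> M \<and> spath u (fst r) (snd r) \<and> w n \<rightarrow>\<^sup>*\<^bsub>E\<^esub> snd r"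
    using tail_advance w by simp
  then obtain f where f: "\<And>u n. u \<in> M \<Longrightarrow> fst (f u n) \<noteq> [] \<and> snd (f u n) \<in> M
      \<and> spath u (fst (f u n)) (snd (f u n)) \<and> w n \<rightarrow>\<^sup>*\<^bsub>E\<^esub> snd (f u n)" by metis
  define st where "st = rec_nat v0 (\<lambda>n u. snd (f u n))"
  have st0: "st 0 = v0" and stS: "st (Suc n) = snd (f (st n) n)" for n by (simp_all add: st_def)
  have stM: "st n \<in> M" for n by (induction n) (auto simp: st0 stS v0 f)
  define seg where "seg n = fst (f (st n) n)" for n
  define pref where "pref n = concat (map seg [0..<n])" for n
  have prefS: "pref (Suc n) = pref n @ seg n" for n by (simp add: pref_def)
  have seg: "seg n \<noteq> []" "spath (st n) (seg n) (st (Suc n))" for n using f[OF stM] by (auto simp: seg_def stS)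
  have sp: "spath v0 (pref n) (st n)" for n
  proof (induction n)
    case (Suc n)
    then show ?case using seg(2)[of n] by (auto simp: prefS spath_append)
  qed (simp add: pref_def st0)
  have len: "n \<le> length (pref n)" for n
  proof (induction n)
    case (Suc n)
    have "length (seg n) \<ge> 1" using seg(1)[of n] by (cases "seg n") auto
    then show ?case using Suc by (simp add: prefS)
  qed simp
  \<comment> \<open>Segments are non-empty, so the concatenation of the first \<open>i + 1\<close>
    of them has an entry at position \<open>i\<close>, and later concatenations extend it.\<close>
  define p where "p i = pref (Suc i) ! i" for i
  have ext: "pref (n + k) ! i = pref n ! i" if "i < length (pref n)" for n k i
  proof (induction k)
    case (Suc k)
    have "i < length (pref (n + k))"
      using that by (induction k) (auto simp: prefS)
    then show ?case using Suc by (simp add: prefS nth_append)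
  qed simp
  have p_eq: "p i = pref n ! i" if "i < length (pref n)" for n i
  proof (cases "n \<le> Suc i")
    case True
    then show ?thesis using ext[OF that, of "Suc i - n"] by (simp add: p_def)
  next
    case False
    have "i < length (pref (Suc i))" using len[of "Suc i"] by simp
    from ext[OF this, of "n - Suc i"] show ?thesis using False by (simp add: p_def)
  qed
  have "ipath p"
    unfolding ipath_def
  proof
    fix i
    have l: "Suc i < length (pref (Suc (Suc i)))" using len[of "Suc (Suc i)"] by simp
    then have e: "p i = pref (Suc (Suc i)) ! i" "p (Suc i) = pref (Suc (Suc i)) ! Suc i" using p_eq by simp_all
    show "step_ok (p i) \<and> lsrc (p (Suc i)) = lrng (p i)"
      unfolding e using spath_nth[OF sp l] spath_ok[OF sp] l by (metis Suc_lessD nth_mem)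
  qed
  moreover have "lsrc (p i) \<in> M" for i
  proof -
    have l: "i < length (pref (Suc i))" using len[of "Suc i"] by simp
    then show ?thesis using spath_in_tail[OF sp stM, of "Suc i"] nth_mem[OF l] unfolding p_eq[OF l] by blast
  qed
  moreover have "\<exists>i. v \<rightarrow>\<^sup>*\<^bsub>E\<^esub> lsrc (p i)" if v: "v \<in> M" for v
  proof -
    obtain y where y: "y \<in> M" "v \<rightarrow>\<^sup>*\<^bsub>E\<^esub> y" "v0 \<rightarrow>\<^sup>*\<^bsub>E\<^esub> y" using tail_directed[OF v v0] by blast
    then obtain n where n: "y = w n" using rT by (auto simp: T_def w_def)
    have "w n \<rightarrow>\<^sup>*\<^bsub>E\<^esub> st (Suc n)" using f[OF stM] by (simp add: stS)
    \<comment> \<open>This position is the beginning of the next segment, which starts at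
      \<open>st (Suc n)\<close>.\<close>
    moreover have "lsrc (p (length (pref (Suc n)))) = st (Suc n)"
    proof -
      have "length (pref (Suc n)) < length (pref (Suc (Suc n)))" using seg(1)[of "Suc n"] by (simp add: prefS)
      from p_eq[OF this] have "p (length (pref (Suc n))) = hd (seg (Suc n))"
        using seg(1)[of "Suc n"] unfolding prefS[of "Suc n"] by (simp add: hd_conv_nth nth_append)
      then show ?thesis using seg[of "Suc n"] by (cases "seg (Suc n)") auto
    qed
    ultimately show ?thesis using y n reachable_trans by metis
  qed
  ultimately show ?thesis by blast
qed

text \<open>A vertex acts non-trivially exactly if a path of the tail class starts at it. Such a
  vertex reaches a vertex of \<open>p\<close> and so lies in \<open>M\<close>; conversely a vertex
  of \<open>M\<close> reaches \<open>p\<close>, and the connecting path followed by the rest of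
  \<open>p\<close> is in the class.\<close>

lemma cofinal_chen_ann:
  "\<exists>p. ipath p \<and> verts_of (chen_ann p) = verts E - M"
proof -
  obtain p where p: "ipath p" "\<And>i. lsrc (p i) \<in> M" "\<And>v. v \<in> M \<Longrightarrow> \<exists>i. v \<rightarrow>\<^sup>*\<^bsub>E\<^esub> lsrc (p i)"
    using cofinal_path by blast
  have "v \<in> M" if q: "q \<in> tail_class p" "isrc q = v" for q v
  proof -
    obtain m n where "\<And>i. q (i + m) = p (i + n)" using q by (auto simp: tail_class_def)
    from this[of 0] have "lsrc (q m) \<in> M" using p(2) by simp
    moreover have "isrc q \<rightarrow>\<^sup>*\<^bsub>E\<^esub> lsrc (q m)" "isrc q \<in> verts E"
      using ipath_reachable isrc_verts tail_class_ipath[OF q(1)] by blast+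
    ultimately show ?thesis using q tail_up by blast
  qed
  moreover have "\<exists>q\<in>tail_class p. isrc q = v" if vM: "v \<in> M" for v
  proof -
    obtain i where i: "v \<rightarrow>\<^sup>*\<^bsub>E\<^esub> lsrc (p i)" using p(3)[OF vM] by (rule exE)
    obtain \<gamma> where \<gamma>: "path v \<gamma> (lsrc (p i))" using reachable_path[OF i] by (rule exE)
    have "p \<in> tail_class p" using p(1) by (auto simp: tail_class_def)
    from ipath_drop[OF this, of i] have "(\<lambda>j. p (j + i)) \<in> tail_class p" .
    moreover have "\<exists>q'\<in>tail_class p. isrc q' = u" if "path u \<gamma> w" "q \<in> tail_class p" "isrc q = w" for u \<gamma> w q
      using that
    proof (induction \<gamma> arbitrary: u)
      case (Cons e \<gamma>)
      then obtain q' where "q' \<in> tail_class p" "isrc q' = head E e" by auto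
      then show ?case using Cons.prems tail_class_icons[of q' p "Inl e"] by (intro bexI[of _ "icons (Inl e) q'"]) auto
    qed auto
    ultimately show ?thesis using \<gamma> by fastforce
  qed
  ultimately have "verts_of (chen_ann p) = verts E - M"
    unfolding verts_of_def using vx_chen_ann tail_verts by blast
  then show ?thesis using p(1) by blast
qed

section \<open>The graded prime of a maximal tail\<close>

abbreviation PM :: "('v, 'e, 'k) lpa_free set" where "PM \<equiv> vertex_ideal (verts E - M)"

lemma PM_idl: "idl PM" and PM_graded: "graded PM"
  by (auto intro: vertex_ideal_idl vertex_ideal_graded)

lemma PM_least: "idl J \<Longrightarrow> verts E - M \<subseteq> verts_of J \<Longrightarrow> PM \<subseteq> J"
  by (rule vertex_ideal_least) (auto simp: verts_of_def)

text \<open>The annihilator of the module of a cofinal path contains \<open>PM\<close> but no vertex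
  of \<open>M\<close>, which shows that the ideal generated by the other vertices does not grow into
  \<open>M\<close>.\<close>

lemma vx_PM: "v \<in> verts E \<Longrightarrow> vx v \<in> PM \<longleftrightarrow> v \<notin> M"
proof -
  assume v: "v \<in> verts E"
  obtain p where "verts_of (chen_ann p) = verts E - M" using cofinal_chen_ann by blast
  then have "PM \<subseteq> chen_ann p" "v \<in> M \<Longrightarrow> vx v \<notin> chen_ann p"
    using PM_least[OF chen_ann_idl] v by (auto simp: verts_of_def)
  then show ?thesis using vx_in_vertex_ideal[of "verts E - M" v] v by blast
qed

lemma verts_of_PM: "verts_of PM = verts E - M"
  using vx_PM by (auto simp: verts_of_def)

text \<open>Up to two-sided multiplication, an element outside \<open>PM\<close> is a vertex plus terms of positive
  degree; products of such elements have a non-zero component of degree \<open>0\<close>.\<close>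

lemma PM_reduction:
  assumes "x \<in> F0" "x \<notin> PM"
  shows "\<exists>v\<in>M. \<forall>y\<in>M. v \<rightarrow>\<^sup>*\<^bsub>E\<^esub> y \<longrightarrow> reduces x y"
proof -
  obtain a b k v ts where r: "a \<in> U" "b \<in> U" "k \<noteq> 0" "v \<in> verts E" "vx v \<notin> PM"
     "eqm N (a * x * b) (sc k * vx v + ev ts)" "\<forall>t\<in>set ts. closed_term v t"
    using reduction[OF PM_idl assms] by blast
  have tsU: "ev ts \<in> U"
    by (rule F0_U[OF ev_F0]) (use r(7) path_verts in \<open>force simp: closed_term_def\<close>)
  have "reduces x y"
    if y: "y \<in> M" "v \<rightarrow>\<^sup>*\<^bsub>E\<^esub> y" for y
  proof -
    obtain p where p: "path v p y" using reachable_path y(2) by blast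
    define r1 where "r1 = vx y * Gh p * ev ts * (Ed p * vx y)"
    have "dge 1 (ev ts)" using r(7) by (intro dge_closed) blast
    \<comment> \<open>Conjugation by \<open>p\<close> lowers and raises the degree by the same
      length, so positive degrees stay positive.\<close>
    then have "dge (0 + - int (length p) + 1 + (int (length p) + 0)) r1"
      unfolding r1_def by (rule dge_mult[OF dge_mult[OF dge_mult[OF dge_simps(3,2)]] dge_mult[OF dge_simps(1,3)]])
    then have "dge 1 r1" by simp
    have "eqm N (vx y * Gh p * (a * x * b) * (Ed p * vx y)) (vx y * Gh p * (sc k * vx v + ev ts) * (Ed p * vx y))"
      using r p by (intro eN_lr) auto
    also have "eqm N (vx y * Gh p * (sc k * vx v + ev ts) * (Ed p * vx y)) (sc k * vx y + r1)"
      using eqm_add[OF idl_N conjugate[OF p, of k] eN_refl[of r1]] by (simp add: r1_def distrib_left distrib_right)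
    finally have "eqm N (vx y * Gh p * a * x * (b * (Ed p * vx y))) (sc k * vx y + r1)" by (simp add: mult.assoc)
    moreover have "r1 \<in> U" using tsU p by (simp add: r1_def)
    ultimately show ?thesis using r p \<open>dge 1 r1\<close> unfolding reduces_def
      by (intro bexI[of _ "vx y * Gh p * a"] bexI[of _ "b * (Ed p * vx y)"] exI[of _ k] exI[of _ r1]) auto
  qed
  then show ?thesis using r vx_PM by blast
qed

text \<open>Directedness provides a vertex \<open>y\<close> at which both factors can be reduced.
  The product of the reduced elements then has \<open>k * l\<close> times \<open>vx y * vx y\<close>
  as its component of degree \<open>0\<close>, and \<open>PM\<close> is graded.\<close>

lemma PM_prime: "prime_idl PM"
  unfolding prime_idl_def
proof (intro conjI ballI impI PM_idl)
  show "PM \<noteq> F0" using tail_nonempty tail_verts vx_PM by (metis all_not_in_conv gen_F0(1))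
  fix x z assume xz: "x \<in> F0" "z \<in> F0" and h: "\<forall>r\<in>U. x * r * z \<in> PM"
  show "x \<in> PM \<or> z \<in> PM"
  proof (rule ccontr)
    assume "\<not> ?thesis"
    then have "x \<notin> PM" "z \<notin> PM" by auto
    obtain v where v: "v \<in> M" "\<forall>y\<in>M. v \<rightarrow>\<^sup>*\<^bsub>E\<^esub> y \<longrightarrow> reduces x y"
      using PM_reduction[OF xz(1) \<open>x \<notin> PM\<close>] by (rule bexE)
    obtain w where w: "w \<in> M" "\<forall>y\<in>M. w \<rightarrow>\<^sup>*\<^bsub>E\<^esub> y \<longrightarrow> reduces z y"
      using PM_reduction[OF xz(2) \<open>z \<notin> PM\<close>] by (rule bexE)
    obtain y where y: "y \<in> M" "v \<rightarrow>\<^sup>*\<^bsub>E\<^esub> y" "w \<rightarrow>\<^sup>*\<^bsub>E\<^esub> y" using tail_directed[OF v(1) w(1)] by blast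
    have yv: "y \<in> verts E" using tail_verts y by blast
    obtain a b k r where 1: "a \<in> U" "b \<in> U" "k \<noteq> 0" "dge 1 r" "r \<in> U" "eqm N (a * x * b) (sc k * vx y + r)"
      using v(2) y unfolding reduces_def by meson
    obtain c d l s where 2: "c \<in> U" "d \<in> U" "l \<noteq> 0" "dge 1 s" "s \<in> U" "eqm N (c * z * d) (sc l * vx y + s)"
      using w(2) y unfolding reduces_def by meson
    have e: "eqm N ((a * x * b) * (c * z * d)) ((sc k * vx y + r) * (sc l * vx y + s))"
      using 1 2 xz yv by (intro eqm_mult[OF idl_N]) (auto simp: F0_U)
    \<comment> \<open>The inner multipliers of the two reductions combine to one instance of the
      hypothesis.\<close>
    moreover have "x * (b * c) * z \<in> PM" using h 1 2 by simp
    then have "a * (x * (b * c) * z) * d \<in> PM"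
      by (rule idl_r[OF PM_idl idl_l[OF PM_idl _ 1(1)] 2(2)])
    then have "(a * x * b) * (c * z * d) \<in> PM" by (simp add: mult.assoc)
    then have "(sc k * vx y + r) * (sc l * vx y + s) \<in> PM"
      using eqm_mem[OF PM_idl eqm_N[OF PM_idl e]] by simp
    then have m: "hc 0 ((sc k * vx y + r) * (sc l * vx y + s)) \<in> PM" using PM_graded unfolding graded_def by blast
    \<comment> \<open>All products other than that of the two vertex terms; each has a factor of
      positive degree.\<close>
    define rest where "rest = (sc k * vx y) * s + r * (sc l * vx y + s)"
    have kv: "dge (0 + 0) (sc c * vx y)" for c by (rule dge_mult[OF dge_simps(4) dge_simps(3)])
    have "dge (0 + 0 + 1) ((sc k * vx y) * s)" by (rule dge_mult[OF kv 2(4)])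
    moreover have "dge 0 (sc l * vx y + s)" by (rule dge_add) (use kv dge_mono[OF 2(4), of 0] in auto)
    from dge_mult[OF 1(4) this] have "dge (1 + 0) (r * (sc l * vx y + s))" .
    ultimately have "dge 1 rest" unfolding rest_def by (intro dge_add) auto
    moreover have "(sc k * vx y + r) * (sc l * vx y + s) = sc (k * l) * (vx y * vx y) + rest"
    proof -
      have "sc k * vx y * (sc l * vx y) = sc (k * l) * (vx y * vx y)" by (simp add: mult_single)
      then show ?thesis by (simp only: rest_def distrib_left distrib_right ac_simps)
    qed
    moreover have "hc 0 (sc (k * l) * (vx y * vx y)) = sc (k * l) * (vx y * vx y)"
      by (simp add: mult_single hc_single word_degree_def)
    ultimately have "sc (k * l) * (vx y * vx y) \<in> PM" using m by (simp add: hc_add dge_hc)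
    then have "vx y * vx y \<in> PM" using idl_scD[OF PM_idl] 1(3) 2(3) by auto
    then have "vx y \<in> PM" using eqm_mem[OF PM_idl eqm_N[OF PM_idl rel_vv_same[OF yv]]] by simp
    then show False using vx_PM[OF yv] y(1) by simp
  qed
qed

text \<open>The reduction takes place modulo \<open>PM\<close> for an element of \<open>J\<close>
  outside \<open>PM\<close>: the vertex lies outside \<open>PM\<close> and hence in
  \<open>M\<close>, while the reduced element is still in \<open>J\<close>.\<close>

lemma reduce_in_ideal:
  assumes J: "idl J" "verts_of J = verts E - M" and ne: "J \<noteq> PM"
  shows "\<exists>k v ts. k \<noteq> 0 \<and> v \<in> M \<and> sc k * vx v + ev ts \<in> J \<and> (\<forall>t\<in>set ts. closed_term v t)"
proof -
  have "PM \<subseteq> J" using PM_least[OF J(1)] J(2) by simp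
  then obtain x where x: "x \<in> J" "x \<notin> PM" using ne by blast
  then obtain a b k v ts where r: "a \<in> U" "b \<in> U" "k \<noteq> 0" "v \<in> verts E" "vx v \<notin> PM"
     "eqm N (a * x * b) (sc k * vx v + ev ts)" "\<forall>t\<in>set ts. closed_term v t"
    using reduction[OF PM_idl idl_sub[OF J(1)]] by metis
  have "a * x * b \<in> J" using x r by (intro idl_r[OF J(1) idl_l[OF J(1)]])
  then have "sc k * vx v + ev ts \<in> J" using eqm_mem[OF J(1) eqm_N[OF J(1) r(6)]] by simp
  then show ?thesis using r vx_PM by blast
qed

lemma graded_unique:
  assumes J: "idl J" "verts_of J = verts E - M" "graded J"
  shows "J = PM"
proof (rule ccontr)
  assume "J \<noteq> PM"
  then obtain k v ts where r: "k \<noteq> 0" "v \<in> M" "sc k * vx v + ev ts \<in> J" "\<forall>t\<in>set ts. closed_term v t"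
    using reduce_in_ideal J by blast
  have "dge 1 (ev ts)" using r(4) dge_closed by blast
  then have "sc k * vx v \<in> J" using J(3) r(3) hc_vertex unfolding graded_def by metis
  then show False using idl_scD[OF J(1) _ r(1)] J(2) r(2) tail_verts by (auto simp: verts_of_def)
qed

subsection \<open>Cycles without exits\<close>

text \<open>The condition is imposed at all vertices of \<open>M\<close> reached from
  \<open>v\<close>, so it refers to no particular cycle; these vertices turn out to be those of the
  only cycle through \<open>v\<close> in \<open>M\<close>.\<close>

definition exitless :: "'v \<Rightarrow> bool" where
  "exitless v \<longleftrightarrow> v \<in> M \<and> (\<exists>p. p \<noteq> [] \<and> path v p v) \<and>
     (\<forall>p u. path v p u \<longrightarrow> u \<in> M \<longrightarrow> (\<exists>!e. e \<in> out_arcs E u \<and> head E e \<in> M))"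

text \<open>If every path \<gamma> from \<open>v\<close> that ends in \<open>M\<close> were a prefix
  of \<beta> followed by \<gamma>, iteration would make it a prefix of a power of \<beta>. Then at
  every vertex of \<open>M\<close> reached from \<open>v\<close> only one edge stays in
  \<open>M\<close>, and \<open>v\<close> would be exitless.\<close>

lemma exists_exit:
  assumes v: "v \<in> M" "\<not> exitless v" and \<beta>: "\<beta> \<noteq> []" "path v \<beta> v"
  shows "\<exists>\<gamma> w. path v \<gamma> w \<and> w \<in> M \<and> \<not> prefix \<gamma> (\<beta> @ \<gamma>)"
proof (rule ccontr)
  assume "\<not> ?thesis"
  then have pre: "prefix \<gamma> (\<beta> @ \<gamma>)" if "path v \<gamma> w" "w \<in> M" for \<gamma> w using that by blast
  define pow where "pow n = concat (replicate n \<beta>)" for n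
  have powS: "pow (Suc n) = \<beta> @ pow n" for n by (simp add: pow_def)
  have len: "n \<le> length (pow n)" for n
  proof (induction n)
    case (Suc n)
    have "1 \<le> length \<beta>" using \<beta>(1) by (cases \<beta>) auto
    then show ?case using Suc by (simp add: powS)
  qed simp
  have pth: "path v (pow n) v" for n
    using \<beta>(2) path_verts[OF \<beta>(2)] by (induction n) (auto simp: pow_def path_append)
  have pp: "prefix \<gamma> (pow n @ \<gamma>)" if "path v \<gamma> w" "w \<in> M" for \<gamma> w n
  proof (induction n)
    case (Suc n)
    then have "prefix (\<beta> @ \<gamma>) (\<beta> @ pow n @ \<gamma>)" by simp
    from prefix_order.trans[OF pre[OF that] this] show ?case by (simp add: powS)
  qed (simp add: pow_def)
  have ppow: "prefix \<gamma> (pow n)" if "path v \<gamma> w" "w \<in> M" "length \<gamma> \<le> n" for \<gamma> w n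
    using prefix_length_prefix[OF pp[OF that(1,2), of n], of "pow n"] len[of n] that(3) by simp
  have "\<exists>!e. e \<in> out_arcs E u \<and> head E e \<in> M" if p: "path v p u" "u \<in> M" for p u
  proof -
    \<comment> \<open>This power of \<beta> is longer than \<open>p\<close>, so it prescribes the
      edge that follows \<open>p\<close>.\<close>
    let ?n = "Suc (length p)"
    obtain q where q: "pow ?n = p @ q" using ppow[OF p, of ?n] by (auto simp: prefix_def)
    then have "q \<noteq> []" using len[of ?n] by auto
    then obtain e q' where q': "q = e # q'" by (cases q) auto
    have "path v (p @ e # q') v" using pth[of ?n] q q' by simp
    then have "path u (e # q') v" using p(1) path_end_unique by (auto simp: path_append)
    then have e: "e \<in> out_arcs E u" "head E e \<in> M" using tail_path_up[of "head E e" q' v] v(1) by auto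
    have "f = e" if f: "f \<in> out_arcs E u" "head E f \<in> M" for f
    proof -
      have "path v (p @ [f]) (head E f)" using p f by (auto simp: path_append)
      then have "prefix (p @ [f]) (pow ?n)" using ppow f(2) by fastforce
      then show ?thesis using q q' by simp
    qed
    then show ?thesis using e by blast
  qed
  then have "exitless v" unfolding exitless_def using v(1) \<beta> by blast
  then show False using v(2) by simp
qed

text \<open>Conjugation by the path of \<open>exists_exit\<close> deletes the first term, turns each
  other term into at most one closed term at the new vertex, and keeps the coefficient
  \<open>k\<close>. After finitely many rounds a non-zero multiple of a vertex of \<open>M\<close>
  lies in \<open>J\<close>.\<close>

lemma no_exitless_contradiction:
  assumes J: "idl J" "verts_of J = verts E - M" and no: "\<And>v. \<not> exitless v"
    and "k \<noteq> 0" "v \<in> M" "sc k * vx v + ev ts \<in> J" "\<And>t. t \<in> set ts \<Longrightarrow> closed_term v t"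
  shows False
  using assms(4-)
proof (induction "length ts" arbitrary: ts v rule: less_induct)
  case less
  show ?case
  proof (cases ts)
    case Nil
    then have "vx v \<in> J" using idl_scD[OF J(1) _ less.prems(1)] less.prems by simp
    then show ?thesis using J(2) less.prems(2) tail_verts by (auto simp: verts_of_def)
  next
    case (Cons t0 ts0)
    then obtain c0 \<beta> where t0: "t0 = (c0, \<beta>, v, [])" "\<beta> \<noteq> []" "path v \<beta> v"
      using less.prems(4)[of t0] by (auto simp: closed_term_def)
    obtain \<gamma> w where \<gamma>: "path v \<gamma> w" "w \<in> M" "\<not> prefix \<gamma> (\<beta> @ \<gamma>)"
      using exists_exit[OF less.prems(2) no t0(2,3)] by blast
    have "\<exists>l. eqm N (vx w * Gh \<gamma> * mon t * (Ed \<gamma> * vx w)) (ev l) \<and> length l \<le> 1 \<and> (\<forall>s\<in>set l. closed_term w s)"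
      if "t \<in> set ts" for t
    proof -
      obtain c b z q where t: "t = (c, b, z, q)" by (cases t)
      have cl: "closed_term v (c, b, z, q)" using less.prems(4)[OF that] t by simp
      show ?thesis
      proof (cases "prefix \<gamma> (b @ \<gamma>)")
        case True
        then obtain b' where "closed_term w (c, b', w, [])"
          "eqm N (vx w * Gh \<gamma> * mon t * (Ed \<gamma> * vx w)) (mon (c, b', w, []))"
          using kill_term(1)[OF \<gamma>(1) cl] t by blast
        then show ?thesis by (intro exI[of _ "[(c, b', w, [])]"]) auto
      next
        case False
        then show ?thesis using kill_term(2)[OF \<gamma>(1) cl] t by (intro exI[of _ "[]"]) auto
      qed
    qed
    then obtain f where f: "\<And>t. t \<in> set ts \<Longrightarrow> eqm N (vx w * Gh \<gamma> * mon t * (Ed \<gamma> * vx w)) (ev (f t))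
        \<and> length (f t) \<le> 1 \<and> (\<forall>s\<in>set (f t). closed_term w s)" by metis
    \<comment> \<open>The list \<open>f t0\<close> might be non-empty although its value is zero;
      the empty list is forced so that the number of terms drops.\<close>
    define g where "g t = (if t = t0 then [] else f t)" for t
    have "eqm N (vx w * Gh \<gamma> * mon t * (Ed \<gamma> * vx w)) (ev (g t))" if "t \<in> set ts" for t
      using f[OF that] kill_term(2)[OF \<gamma>(1), of c0 \<beta> v "[]"] less.prems(4)[OF that] \<gamma>(3) t0 by (auto simp: g_def)
    from ev_map[OF idl_N this]
    have 1: "eqm N (vx w * Gh \<gamma> * ev ts * (Ed \<gamma> * vx w)) (ev (concat (map g ts)))" .
    have "eqm N (vx w * Gh \<gamma> * (sc k * vx v + ev ts) * (Ed \<gamma> * vx w)) (sc k * vx w + ev (concat (map g ts)))"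
      using eqm_add[OF idl_N conjugate[OF \<gamma>(1), of k] 1] by (simp add: distrib_left distrib_right)
    moreover have "vx w * Gh \<gamma> * (sc k * vx v + ev ts) * (Ed \<gamma> * vx w) \<in> J"
      using less.prems(3) \<gamma>(1) by (intro idl_r[OF J(1) idl_l[OF J(1)]]) auto
    ultimately have 2: "sc k * vx w + ev (concat (map g ts)) \<in> J"
      using eqm_mem[OF J(1) eqm_N[OF J(1)]] by blast
    have "length (concat (map g l)) \<le> length l" if "set l \<subseteq> set ts" for l
      using that
    proof (induction l)
      case (Cons t l)
      then have "length (g t) \<le> 1" using f[of t] by (simp add: g_def)
      then show ?case using Cons by simp
    qed simp
    then have "length (concat (map g ts0)) \<le> length ts0" using Cons by (simp add: subset_insertI)
    then have "length (concat (map g ts)) < length ts" using Cons by (simp add: g_def)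
    then show False
    proof (rule less.hyps[OF _ less.prems(1) \<gamma>(2) 2])
      fix s assume "s \<in> set (concat (map g ts))"
      then obtain t where "t \<in> set ts" "s \<in> set (g t)" by auto
      then show "closed_term w s" using f[of t] by (simp add: g_def split: if_splits)
    qed
  qed
qed

lemma no_exitless_unique:
  assumes "idl J" "verts_of J = verts E - M" "\<And>v. \<not> exitless v"
  shows "J = PM"
  using reduce_in_ideal[OF assms(1,2)] no_exitless_contradiction[OF assms] by blast

end

subsection \<open>The corner at a cycle without exits is a Laurent polynomial ring\<close>

context
  fixes M assumes M: "maximal_tail E M"
  fixes v assumes v: "exitless M v"
begin

abbreviation IM :: "('v, 'e, 'k) lpa_free set" where "IM \<equiv> vertex_ideal (verts E - M)"

lemmas IM_idl = PM_idl[OF M]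
lemmas eQ_trans [trans] = eqm_trans[OF IM_idl]
lemmas eQ_sym = eqm_sym[OF IM_idl]
lemmas eQ_refl = eqm_refl[OF IM_idl]
lemmas eQ_N = eqm_N[OF IM_idl]
lemmas eQ_l = eqm_l[OF IM_idl]
lemmas eQ_r = eqm_r[OF IM_idl]
lemmas eQ_lr = eqm_lr[OF IM_idl]

lemma v_in: "v \<in> M" and v_verts: "v \<in> verts E"
  using v tail_verts[OF M] by (auto simp: exitless_def[OF M])

lemma unique_edge:
  assumes "path v p u" "e \<in> out_arcs E u" "head E e \<in> M" "f \<in> out_arcs E u" "head E f \<in> M"
  shows "e = f"
proof -
  have "u \<in> M" using assms(2,3) by (intro tail_path_up[OF M, of u "[e]" "head E e"]) auto
  then have "\<exists>!e. e \<in> out_arcs E u \<and> head E e \<in> M" using v assms(1) unfolding exitless_def[OF M] by simp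
  then show ?thesis using assms by blast
qed

text \<open>A path that ends in \<open>M\<close> stays in \<open>M\<close>, and from each vertex on
  it only one edge stays in \<open>M\<close>. So two such paths from \<open>v\<close> follow the
  same edges.\<close>

lemma tail_paths_prefix:
  assumes "path v p w" "path v q z" "w \<in> M" "z \<in> M" "length p \<le> length q"
  shows "prefix p q"
  using assms
proof (induction p arbitrary: w rule: rev_induct)
  case (snoc e p)
  then obtain u where u: "path v p u" "e \<in> arcs E" "tail E e = u" "head E e = w" by (auto simp: path_append)
  have "u \<in> M" using u snoc.prems(3) by (intro tail_path_up[OF M, of u "[e]" w]) auto
  then have "prefix p q" using snoc u by simp
  then obtain q' where q': "q = p @ q'" by (auto simp: prefix_def)
  then obtain f q2 where q2: "q' = f # q2" using snoc.prems(5) by (cases q') auto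
  have pu: "path u (f # q2) z" using snoc.prems(2) u(1) path_end_unique unfolding q' q2 path_append by blast
  then have "head E f \<in> M" using tail_path_up[OF M, of "head E f" q2 z] snoc.prems(4) by simp
  then have "e = f" using unique_edge[OF u(1), of e f] u snoc.prems(3) pu by simp
  then show ?case by (simp add: q' q2)
qed simp

text \<open>In the sum over the edges leaving a vertex of the path, every edge whose range is
  outside \<open>M\<close> vanishes modulo \<open>IM\<close>, and the one remaining edge is the next
  edge of the path. The path \<open>p\<close> only records that \<open>w\<close> is reached from
  \<open>v\<close>.\<close>

lemma vertex_as_projection:
  assumes "path v p w" "path w q z" "z \<in> M"
  shows "eqm IM (vx w) (Ed q * vx z * Gh q)"
  using assms(2,3)
proof (induction q arbitrary: z rule: rev_induct)
  case Nil
  then show ?case by (auto simp: eQ_refl)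
next
  case (snoc e q)
  then obtain u where u: "path w q u" "e \<in> arcs E" "tail E e = u" "head E e = z" by (auto simp: path_append)
  have uM: "u \<in> M" using u snoc.prems(2) by (intro tail_path_up[OF M, of u "[e]" z]) auto
  have pu: "path v (p @ q) u" using assms(1) u(1) by (auto simp: path_append)
  have out: "e \<in> out_arcs E u" using u by simp
  have ee: "eqm IM (vx u) (ed e * gh e)"
  proof -
    have uv: "u \<in> verts E" "out_arcs E u \<noteq> {}" using out path_verts[OF pu] by auto
    have "eqm IM (ed f * gh f) (if f = e then ed e * gh e else 0)" if f: "f \<in> out_arcs E u" for f
    proof (cases "f = e")
      case False
      have "head E f \<notin> M" using unique_edge[OF pu out _ f] u(4) snoc.prems(2) False by auto
      then have "vx (head E f) \<in> IM" using f vx_PM[OF M, of "head E f"] by auto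
      then have "ed f * vx (head E f) * gh f \<in> IM" using f by (intro idl_r[OF IM_idl idl_l[OF IM_idl]]) auto
      moreover have "eqm IM (ed f * vx (head E f) * gh f) (ed f * gh f)"
        using f by (intro eQ_N eN_r[OF rel_er]) auto
      ultimately have "ed f * gh f \<in> IM" using eqm_mem[OF IM_idl] by blast
      then show ?thesis using False by (simp add: eqm_0[OF IM_idl])
    qed (simp add: eQ_refl)
    then have "eqm IM (\<Sum>f\<in>out_arcs E u. ed f * gh f) (\<Sum>f\<in>out_arcs E u. if f = e then ed e * gh e else 0)"
      by (rule eqm_sum[OF IM_idl])
    also have "(\<Sum>f\<in>out_arcs E u. if f = e then ed e * gh e else 0) = ed e * gh e"
      using uv out by simp
    finally show ?thesis using eQ_trans[OF eQ_N[OF rel_ck[OF uv]]] by blast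
  qed
  have "eqm IM (vx w) (Ed q * vx u * Gh q)" using snoc.IH[OF u(1) uM] .
  also have "eqm IM \<dots> (Ed q * (ed e * gh e) * Gh q)" using u by (intro eQ_lr[OF ee]) auto
  also have "eqm IM \<dots> (Ed q * (ed e * vx z * gh e) * Gh q)"
    using u eQ_N[OF eN_r[OF eN_sym[OF rel_er[OF u(2)]], of "gh e"]] by (intro eQ_lr) auto
  finally show ?case by (simp add: Ed_append Gh_append Ed_Cons Gh_Cons mult.assoc)
qed

section \<open>The powers of the shortest closed path\<close>

definition cyc :: "'e list" where
  "cyc = (ARG_MIN length p. p \<noteq> [] \<and> path v p v)"

lemma cyc: "cyc \<noteq> []" "path v cyc v" and cyc_min: "p \<noteq> [] \<Longrightarrow> path v p v \<Longrightarrow> length cyc \<le> length p"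
proof -
  have ex: "\<exists>p. p \<noteq> [] \<and> path v p v" using v unfolding exitless_def[OF M] by blast
  then obtain p0 where p0: "p0 \<noteq> [] \<and> path v p0 v" by blast
  from arg_min_natI[where P = "\<lambda>p. p \<noteq> [] \<and> path v p v", OF p0, of length]
  show "cyc \<noteq> []" "path v cyc v" unfolding cyc_def by blast+
  show "p \<noteq> [] \<Longrightarrow> path v p v \<Longrightarrow> length cyc \<le> length p"
    unfolding cyc_def using arg_min_nat_le[where P = "\<lambda>p. p \<noteq> [] \<and> path v p v", of p length] by blast
qed

definition cp :: "nat \<Rightarrow> 'e list" where "cp n = concat (replicate n cyc)"

lemma cp_simps: "cp 0 = []" "cp (Suc n) = cyc @ cp n" "cp (m + n) = cp m @ cp n"
  by (simp_all add: cp_def replicate_add)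

lemma cp_path: "path v (cp n) v"
  using cyc(2) v_verts by (induction n) (auto simp: cp_simps path_append)

lemma cp_length: "length (cp n) = n * length cyc"
  by (induction n) (auto simp: cp_simps)

lemma cp_length_ge: "n \<le> length (cp n)"
  using cyc(1) by (cases "length cyc") (auto simp: cp_length)

text \<open>Since \<open>cyc\<close> is shortest, \<open>tail_paths_prefix\<close> makes it a prefix
  of every non-empty closed path at \<open>v\<close>; the remainder is closed and shorter.\<close>

lemma closed_is_cp: "path v p v \<Longrightarrow> \<exists>n. p = cp n"
proof (induction "length p" arbitrary: p rule: less_induct)
  case less
  show ?case
  proof (cases "p = []")
    case True
    then show ?thesis by (intro exI[of _ 0]) (simp add: cp_simps)
  next
    case False
    then have "prefix cyc p" using tail_paths_prefix[OF cyc(2) less.prems v_in v_in] cyc_min less.prems by blast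
    then obtain p' where p': "p = cyc @ p'" by (auto simp: prefix_def)
    have "path v p' v" using less.prems cyc(2) path_end_unique unfolding p' path_append by blast
    then obtain n where "p' = cp n" using less.hyps[of p'] cyc(1) p' by auto
    then show ?thesis using p' by (intro exI[of _ "Suc n"]) (simp add: cp_simps)
  qed
qed

text \<open>The integer powers of the cycle in the corner at \<open>v\<close>: negative powers are
  ghost paths, and the power \<open>0\<close> is \<open>vx v\<close>.\<close>

definition cpow :: "int \<Rightarrow> ('v, 'e, 'k) lpa_free" where
  "cpow n = (if n \<ge> 0 then Ed (cp (nat n)) * vx v else vx v * Gh (cp (nat (- n))))"

lemma cpow_int: "cpow (int n) = Ed (cp n) * vx v" and cpow_neg: "cpow (- int n) = vx v * Gh (cp n)"
  by (auto simp: cpow_def cp_simps)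

lemma vx_v [simp]: "vx v \<in> U" "vx v \<in> F0" and cp_U [simp]: "Ed (cp n) \<in> U" "Gh (cp n) \<in> U"
  using v_verts path_U(1,2)[OF cp_path] by simp_all

lemma cpow_F0 [simp]: "cpow n \<in> F0" and cpow_U [simp]: "cpow n \<in> U"
  by (auto simp: cpow_def F0_U)

lemma vv: "eqm IM (vx v * vx v) (vx v)"
  using eQ_N[OF rel_vv_same[OF v_verts]] .

lemma vEd: "eqm IM (vx v * (Ed (cp n) * vx v)) (Ed (cp n) * vx v)"
  using eQ_N[OF vx_Ed[OF cp_path]] .

lemma Ghv: "eqm IM (vx v * Gh (cp n) * vx v) (vx v * Gh (cp n))"
  using eQ_N[OF Gh_vx[OF cp_path]] .

lemma cancel1: "eqm IM (vx v * Gh (cp n) * (Ed (cp n) * vx v)) (vx v)"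
  using eQ_N[OF Gh_Ed[OF cp_path]] .

text \<open>The absence of exits enters here. In contrast, \<open>cancel1\<close> is a consequence
  of an identity modulo \<open>N\<close>.\<close>

lemma cancel2: "eqm IM (Ed (cp n) * vx v * Gh (cp n)) (vx v)"
  using eQ_sym[OF vertex_as_projection[OF _ cp_path v_in, of "[]"]] v_verts by simp

lemma cpow_pos_pos: "eqm IM (cpow (int m) * cpow (int n)) (cpow (int (m + n)))"
  using eQ_l[OF vEd, of "Ed (cp m)" n] by (simp add: cpow_int cp_simps Ed_append mult.assoc del: of_nat_add)

lemma cpow_neg_neg: "eqm IM (cpow (- int m) * cpow (- int n)) (cpow (- int (m + n)))"
  using eQ_r[OF Ghv, of "Gh (cp n)" m] cp_simps(3)[of n m]
  by (simp add: cpow_neg Gh_append mult.assoc add.commute del: of_nat_add)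

lemma cpow_neg_pos: "eqm IM (cpow (- int m) * cpow (int n)) (cpow (int n - int m))"
proof (cases "m \<le> n")
  case True
  then obtain k where n: "n = m + k" using le_Suc_ex by blast
  have "eqm IM (vx v * Gh (cp m) * (Ed (cp m @ cp k) * vx v)) (Ed (cp k) * vx v)"
    using eQ_N[OF Gh_Ed_prefix[OF cp_path cp_path]] .
  moreover have "int n - int m = int k" using n by simp
  ultimately show ?thesis unfolding \<open>int n - int m = int k\<close> by (simp add: cpow_int cpow_neg n cp_simps del: of_nat_add)
next
  case False
  then obtain k where m: "m = n + k" using le_Suc_ex nat_le_linear by blast
  have "eqm IM (vx v * Gh (cp k) * Gh (cp n) * (Ed (cp n) * vx v)) (vx v * Gh (cp k) * vx v * Gh (cp n) * (Ed (cp n) * vx v))"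
    using eQ_r[OF eQ_sym[OF Ghv], of "Gh (cp n) * (Ed (cp n) * vx v)" k] by (simp add: mult.assoc)
  also have "eqm IM \<dots> (vx v * Gh (cp k) * vx v)"
    using eQ_l[OF cancel1, of "vx v * Gh (cp k)" n] by (simp add: mult.assoc)
  also have "eqm IM \<dots> (vx v * Gh (cp k))" by (rule Ghv)
  finally have "eqm IM (vx v * Gh (cp m) * (Ed (cp n) * vx v)) (vx v * Gh (cp k))"
    by (simp add: m cp_simps Gh_append mult.assoc)
  moreover have e: "int n - int m = - int k" using m by simp
  ultimately show ?thesis unfolding e by (simp only: cpow_int cpow_neg)
qed

lemma cpow_pos_neg: "eqm IM (cpow (int m) * cpow (- int n)) (cpow (int m - int n))"
proof -
  have 1: "eqm IM (cpow (int m) * cpow (- int n)) (Ed (cp m) * vx v * Gh (cp n))"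
    using eQ_lr[OF vv, of "Ed (cp m)" "Gh (cp n)"] by (simp add: cpow_int cpow_neg mult.assoc)
  show ?thesis
  proof (cases "n \<le> m")
    case True
    then obtain k where m: "m = k + n" using le_Suc_ex by (metis add.commute)
    have "eqm IM (Ed (cp k) * (Ed (cp n) * vx v * Gh (cp n))) (Ed (cp k) * vx v)"
      by (rule eQ_l[OF cancel2]) simp
    then have "eqm IM (Ed (cp m) * vx v * Gh (cp n)) (Ed (cp k) * vx v)"
      by (simp add: m cp_simps Ed_append mult.assoc)
    moreover have e: "int m - int n = int k" using m by simp
    ultimately show ?thesis using eQ_trans[OF 1] unfolding e by (simp only: cpow_int)
  next
    case False
    then obtain k where n: "n = k + m" using le_Suc_ex nat_le_linear by (metis add.commute)
    have "eqm IM (Ed (cp m) * vx v * Gh (cp m) * Gh (cp k)) (vx v * Gh (cp k))"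
      by (rule eQ_r[OF cancel2]) simp
    then have "eqm IM (Ed (cp m) * vx v * Gh (cp n)) (vx v * Gh (cp k))"
      by (simp add: n cp_simps Gh_append mult.assoc)
    moreover have e: "int m - int n = - int k" using n by simp
    ultimately show ?thesis using eQ_trans[OF 1] unfolding e by (simp only: cpow_neg)
  qed
qed

lemma cpow_mult: "eqm IM (cpow m * cpow n) (cpow (m + n))"
proof -
  consider a b where "m = int a" "n = int b" | a b where "m = int a" "n = - int b"
    | a b where "m = - int a" "n = int b" | a b where "m = - int a" "n = - int b"
    by (metis int_cases2)
  then show ?thesis
  proof cases
    case 1
    then show ?thesis using cpow_pos_pos[of a b] by simp
  next
    case 2
    then show ?thesis using cpow_pos_neg[of a b] by simp
  next
    case 3
    then show ?thesis using cpow_neg_pos[of a b] by (simp add: add.commute)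
  next
    case 4
    then show ?thesis using cpow_neg_neg[of a b] by (simp add: add.commute)
  qed
qed

text \<open>As \<open>cyc\<close> is not empty, different powers have different degrees; this
  separates them in \<open>laurent_map_mem\<close>.\<close>

lemma cpow_degree: "hc (n * int (length cyc)) (cpow n) = cpow n"
proof -
  have "word_degree (FM (map Edge (cp k) @ [Vertex v])) = int k * int (length cyc)" for k
    using word_degree_Edge[of "cp k"] by (simp add: word_degree_def cp_length)
  moreover have "word_degree (FM (Vertex v # rev (map Ghost (cp k)))) = - (int k * int (length cyc))" for k
    using word_degree_Ghost[of "cp k"] by (simp add: word_degree_def cp_length)
  ultimately show ?thesis
    by (cases "n \<ge> 0") (auto simp: cpow_def Ed_def Gh_def mult_single hc_single)
qed

section \<open>Evaluation of Laurent polynomials at the cycle\<close>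

definition laurent_map :: "(int \<Rightarrow>\<^sub>0 'k) \<Rightarrow> ('v, 'e, 'k) lpa_free" where
  "laurent_map f = (\<Sum>n\<in>Poly_Mapping.keys f. sc (Poly_Mapping.lookup f n) * cpow n)"

lemma laurent_map_F0 [simp]: "laurent_map f \<in> F0" and laurent_map_U [simp]: "laurent_map f \<in> U"
  unfolding laurent_map_def by (auto intro!: F0_sum U_sum)

lemma laurent_map_add: "laurent_map (f + g) = laurent_map f + laurent_map g"
  unfolding laurent_map_def by (rule setsum_keys_plus_distrib) (auto simp: single_add distrib_right)

lemma laurent_map_0 [simp]: "laurent_map 0 = 0" and laurent_map_single: "laurent_map (Poly_Mapping.single n c) = sc c * cpow n"
  by (auto simp: laurent_map_def)

lemma laurent_map_1: "laurent_map 1 = vx v"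
  using laurent_map_single[of 0 1] cpow_int[of 0] by (simp add: cp_simps)

lemma laurent_map_mult: "eqm IM (laurent_map f * laurent_map g) (laurent_map (f * g))"
proof (induction f rule: poly_mapping_single_induct)
  case (add f m c)
  have "eqm IM (laurent_map (Poly_Mapping.single m c) * laurent_map g) (laurent_map (Poly_Mapping.single m c * g))"
  proof (induction g rule: poly_mapping_single_induct)
    case (add g n d)
    have "eqm IM (sc (c * d) * (cpow m * cpow n)) (sc (c * d) * cpow (m + n))" by (rule eQ_l[OF cpow_mult]) simp
    moreover have "sc c * cpow m * (sc d * cpow n) = sc (c * d) * (cpow m * cpow n)"
      unfolding sc_mult[symmetric] mult.assoc by (simp only: sc_left_commute[of "cpow m"])
    ultimately have "eqm IM (laurent_map (Poly_Mapping.single m c) * laurent_map (Poly_Mapping.single n d)) (laurent_map (Poly_Mapping.single m c * Poly_Mapping.single n d))"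
      by (simp add: laurent_map_single mult_single)
    from eqm_add[OF IM_idl this add.IH] show ?case by (simp only: distrib_left laurent_map_add)
  qed (simp add: eQ_refl)
  from eqm_add[OF IM_idl this add.IH] show ?case by (simp only: distrib_right laurent_map_add)
qed (simp add: eQ_refl)

text \<open>The ideal is graded, so each term of \<open>laurent_map f\<close> belongs to it. A
  non-zero coefficient would put some \<open>cpow n\<close> into the ideal, and multiplication by
  \<open>cpow (- n)\<close> would put \<open>vx v\<close> there.\<close>

lemma laurent_map_mem: "laurent_map f \<in> IM \<longleftrightarrow> f = 0"
proof
  assume f: "laurent_map f \<in> IM"
  have "Poly_Mapping.lookup f n = 0" for n
  proof (rule ccontr)
    assume n: "Poly_Mapping.lookup f n \<noteq> 0"
    let ?d = "int (length cyc)"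
    have d: "?d \<noteq> 0" using cyc(1) by simp
    have "hc (n * ?d) (sc a * cpow m) = (if m = n then sc a * cpow n else 0)" for m a
    proof -
      have "hc (n * ?d) (cpow m) = hc (n * ?d) (hc (m * ?d) (cpow m))" by (simp add: cpow_degree)
      also have "\<dots> = (if n * ?d = m * ?d then hc (m * ?d) (cpow m) else 0)"
        by (simp only: hc_hc)
      also have "\<dots> = (if m = n then cpow n else 0)" using d by (auto simp: cpow_degree)
      finally show ?thesis by (simp add: hc_sc_mult)
    qed
    then have "hc (n * ?d) (laurent_map f) = (\<Sum>m\<in>Poly_Mapping.keys f. if m = n then sc (Poly_Mapping.lookup f m) * cpow n else 0)"
      unfolding laurent_map_def hc_sum by (intro sum.cong) auto
    also have "\<dots> = sc (Poly_Mapping.lookup f n) * cpow n" using n by (simp add: in_keys_iff)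
    finally have "sc (Poly_Mapping.lookup f n) * cpow n \<in> IM" using f PM_graded[OF M] unfolding graded_def by metis
    then have "cpow n \<in> IM" using idl_scD[OF IM_idl _ n] by blast
    then have "cpow n * cpow (- n) \<in> IM" by (intro idl_r[OF IM_idl]) auto
    then have "cpow 0 \<in> IM" using eqm_mem[OF IM_idl cpow_mult[of n "- n"]] by simp
    then show False using cpow_int[of 0] vx_PM[OF M v_verts] v_in by (simp add: cp_simps)
  qed
  then show "f = 0" by (intro poly_mapping_eqI) simp
qed (simp add: idl_0[OF IM_idl])

text \<open>The path is a prefix of a sufficiently high power of the cycle; the rest of that power
  leads back to \<open>v\<close>.\<close>

lemma return_path:
  assumes p: "path v p w" and w: "w \<in> M"
  shows "\<exists>d. path w d v"
proof -
  have "prefix p (cp (length p))" using tail_paths_prefix[OF p cp_path w v_in] cp_length_ge by blast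
  then obtain d where d: "cp (length p) = p @ d" by (auto simp: prefix_def)
  have "path w d v" using cp_path[of "length p"] p path_end_unique unfolding d path_append by blast
  then show ?thesis ..
qed

text \<open>If the middle vertex is outside \<open>M\<close>, the monomial vanishes. Otherwise that
  vertex is replaced by a return path \<open>d\<close>, then \<open>vx v\<close>, then the ghost of
  \<open>d\<close>; both outer paths become closed and hence powers of the cycle.\<close>

lemma laurent_map_mon:
  assumes t: "mpath v v t"
  shows "\<exists>f. eqm IM (mon t) (laurent_map f)"
proof -
  obtain k p w q where teq: "t = (k, p, w, q)" by (cases t)
  then have p: "path v p w" and q: "path v q w" using t by auto
  show ?thesis
  proof (cases "w \<in> M")
    case False
    then have "vx w \<in> IM" using vx_PM[OF M, of w] path_verts[OF p] by simp
    then have "sc k * (Ed p * vx w * Gh q) \<in> IM" using p q by (intro idl_l[OF IM_idl] idl_r[OF IM_idl]) auto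
    then have "eqm IM (mon t) (laurent_map 0)" by (simp add: teq eqm_0[OF IM_idl])
    then show ?thesis ..
  next
    case True
    obtain d where dp: "path w d v" using return_path[OF p True] by blast
    have "path v (p @ d) v" "path v (q @ d) v" using p q dp by (auto simp: path_append)
    then obtain i j where ij: "p @ d = cp i" "q @ d = cp j" using closed_is_cp by metis
    have "eqm IM (sc k * Ed p * vx w * Gh q) (sc k * Ed p * (Ed d * vx v * Gh d) * Gh q)"
      using p q by (intro eQ_lr[OF vertex_as_projection[OF p dp v_in]]) auto
    then have "eqm IM (mon t) (sc k * (Ed (p @ d) * vx v * Gh (q @ d)))"
      by (simp add: teq Ed_append Gh_append mult.assoc)
    also have "eqm IM \<dots> (sc k * (Ed (cp i) * (vx v * vx v) * Gh (cp j)))"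
      unfolding ij by (intro eQ_l eQ_lr eQ_sym[OF vv]) auto
    also have "eqm IM \<dots> (sc k * cpow (int i + - int j))"
      using eQ_l[OF cpow_mult[of "int i" "- int j"], of "sc k"] by (simp only: cpow_int cpow_neg mult.assoc U_sc)
    finally have "eqm IM (mon t) (laurent_map (Poly_Mapping.single (int i + - int j) k))" by (simp only: laurent_map_single)
    then show ?thesis ..
  qed
qed

lemma laurent_map_surj:
  assumes x: "x \<in> U"
  shows "\<exists>f. eqm IM (vx v * x * vx v) (laurent_map f)"
proof -
  have "eqm IM (vx v * (x * vx v) * vx v) (vx v * x * vx v)"
    using eQ_l[OF vv, of "vx v * x"] x by (simp add: mult.assoc)
  then have 1: "eqm IM (vx v * x * vx v) (vx v * (x * vx v) * vx v)" by (rule eQ_sym)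
  obtain ts where ts: "eqm N (vx v * (x * vx v) * vx v) (ev ts)" "\<forall>t\<in>set ts. mpath v v t"
    using spanning_corner[of "x * vx v" v v] x v_verts by auto
  from ts(2) have "\<exists>f. eqm IM (ev ts) (laurent_map f)"
  proof (induction ts)
    case Nil
    show ?case by (intro exI[of _ 0]) (simp add: eQ_refl)
  next
    case (Cons t ts)
    then obtain f g where "eqm IM (mon t) (laurent_map f)" "eqm IM (ev ts) (laurent_map g)" using laurent_map_mon by (metis list.set_intros)
    from eqm_add[OF IM_idl this] show ?case by (intro exI[of _ "f + g"]) (simp add: laurent_map_add)
  qed
  then show ?thesis using eQ_trans[OF 1 eQ_trans[OF eQ_N[OF ts(1)]]] by blast
qed

end

text \<open>Expresses through representatives that the corner at \<open>e\<close>, modulo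
  \<open>I\<close>, is isomorphic as a ring to the Laurent polynomials. What follows about primes
  and primitivity uses this property alone and no longer the cycle.\<close>

definition corner_map :: "('v, 'e, 'k) lpa_free set \<Rightarrow> ('v, 'e, 'k) lpa_free \<Rightarrow> ((int \<Rightarrow>\<^sub>0 'k) \<Rightarrow> ('v, 'e, 'k) lpa_free) \<Rightarrow> bool" where
  "corner_map I e \<phi> \<longleftrightarrow> idl I \<and> e \<in> F0 \<and> (\<forall>f. \<phi> f \<in> F0) \<and> (\<forall>f g. \<phi> (f + g) = \<phi> f + \<phi> g) \<and>
     (\<forall>f g. eqm I (\<phi> f * \<phi> g) (\<phi> (f * g))) \<and> \<phi> 1 = e \<and> (\<forall>f. \<phi> f \<in> I \<longleftrightarrow> f = 0) \<and>
     (\<forall>x\<in>U. \<exists>f. eqm I (e * x * e) (\<phi> f))"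

lemma exitless_corner_map:
  assumes "maximal_tail E M" "exitless M v"
  shows "\<exists>\<phi>. corner_map (vertex_ideal (verts E - M)) (vx v) \<phi>"
  unfolding corner_map_def
  using PM_idl[OF assms(1)] vx_v(2)[OF assms] laurent_map_F0[OF assms] laurent_map_add[OF assms] laurent_map_mult[OF assms]
    laurent_map_1[OF assms] laurent_map_mem[OF assms] laurent_map_surj[OF assms]
  by (intro exI[of _ "laurent_map v"]) auto

end

section \<open>Laurent polynomials\<close>

lemma laurent_simps:
  "carrier laurent_algebra = UNIV" "f \<otimes>\<^bsub>laurent_algebra\<^esub> g = f * g"
  by (simp_all add: laurent_algebra_def)

lemma pm_algebra_laurent: "pm_algebra (laurent_algebra :: ('k::field, int \<Rightarrow>\<^sub>0 'k) module)"
  by standard (simp_all add: laurent_algebra_def distrib_left distrib_right)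

lemma laurent_ideal_iff:
  "two_sided_ideal J (laurent_algebra :: ('k::field, int \<Rightarrow>\<^sub>0 'k) module) \<longleftrightarrow>
     0 \<in> J \<and> (\<forall>x\<in>J. \<forall>y\<in>J. x + y \<in> J) \<and> (\<forall>a. \<forall>x\<in>J. a * x \<in> J)"
proof -
  have "- x \<in> J" if "\<forall>a. \<forall>x\<in>J. a * x \<in> J" "x \<in> J" for x using that by (metis mult_minus1)
  then show ?thesis
    unfolding pm_algebra.two_sided_ideal_iff[OF pm_algebra_laurent] laurent_simps
    by (auto simp: mult.commute)
qed

text \<open>By commutativity it is enough to apply the ideal-wise condition to principal
  ideals.\<close>

lemma laurent_prime_iff:
  "prime_two_sided_ideal (laurent_algebra :: ('k::field, int \<Rightarrow>\<^sub>0 'k) module) J \<longleftrightarrow>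
     two_sided_ideal J (laurent_algebra :: ('k, int \<Rightarrow>\<^sub>0 'k) module) \<and> J \<noteq> UNIV \<and> (\<forall>f g. f * g \<in> J \<longrightarrow> f \<in> J \<or> g \<in> J)"
    (is "?l \<longleftrightarrow> ?r")
proof
  assume l: ?l
  then have J: "two_sided_ideal J (laurent_algebra :: ('k, int \<Rightarrow>\<^sub>0 'k) module)" "J \<noteq> UNIV"
    by (auto simp: prime_two_sided_ideal_def laurent_simps)
  have "f \<in> J \<or> g \<in> J" if fg: "f * g \<in> J" for f g
  proof -
    have id: "two_sided_ideal (range (\<lambda>h. h * p)) (laurent_algebra :: ('k, int \<Rightarrow>\<^sub>0 'k) module)" for p
      unfolding laurent_ideal_iff
    proof (intro conjI ballI allI)
      show "0 \<in> range (\<lambda>h. h * p)" by (rule range_eqI[of _ _ 0]) simp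
      show "x + y \<in> range (\<lambda>h. h * p)" if "x \<in> range (\<lambda>h. h * p)" "y \<in> range (\<lambda>h. h * p)" for x y
        using that by (auto simp: distrib_right[symmetric])
      show "a * x \<in> range (\<lambda>h. h * p)" if "x \<in> range (\<lambda>h. h * p)" for a x
        using that by (auto simp: mult.assoc[symmetric])
    qed
    have "(a * f) * (b * g) \<in> J" for a b
    proof -
      have "(a * f) * (b * g) = (a * b) * (f * g)" by (simp add: ac_simps)
      then show ?thesis using fg J(1) unfolding laurent_ideal_iff by metis
    qed
    then have "range (\<lambda>h. h * f) \<subseteq> J \<or> range (\<lambda>h. h * g) \<subseteq> J"
      using l id[of f] id[of g] unfolding prime_two_sided_ideal_def laurent_simps by blast
    then show ?thesis by (metis mult_1 rangeI subsetD)
  qed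
  with J show ?r by blast
next
  assume ?r
  then show ?l unfolding prime_two_sided_ideal_def laurent_simps by blast
qed

text \<open>Evaluation at \<open>1\<close>, available over every field. Its kernel is a non-zero
  prime, and it shows that the polynomial \<open>x - 1\<close> has no inverse.\<close>

definition laurent_one :: "(int \<Rightarrow>\<^sub>0 'k::field) \<Rightarrow> 'k" where
  "laurent_one f = (\<Sum>n\<in>Poly_Mapping.keys f. Poly_Mapping.lookup f n)"

lemma laurent_one_simps:
  "laurent_one 0 = 0" "laurent_one (Poly_Mapping.single n c) = c" "laurent_one (f + g) = laurent_one f + laurent_one g"
  unfolding laurent_one_def using setsum_keys_plus_distrib[of "\<lambda>_ c. c" f g] by simp_all

lemma laurent_one_mult: "laurent_one (f * g) = laurent_one f * laurent_one g"
proof (induction f rule: poly_mapping_single_induct)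
  case (add f m c)
  have "laurent_one (Poly_Mapping.single m c * g) = c * laurent_one g"
    by (induction g rule: poly_mapping_single_induct) (auto simp: laurent_one_simps distrib_left mult_single)
  with add show ?case by (simp add: laurent_one_simps distrib_right)
qed (simp add: laurent_one_simps)

lemma laurent_one_1: "laurent_one 1 = 1"
  using laurent_one_simps(2)[of 0 1] by simp

lemma laurent_one_minus: "laurent_one (f - g) = laurent_one f - laurent_one g"
  using laurent_one_simps(3)[of "f - g" g] by simp

lemma laurent_prime_0: "prime_two_sided_ideal (laurent_algebra :: ('k::field, int \<Rightarrow>\<^sub>0 'k) module) {0}"
proof -
  have "(1 :: int \<Rightarrow>\<^sub>0 'k) \<notin> {0}" by simp
  then have "{0} \<noteq> (UNIV :: (int \<Rightarrow>\<^sub>0 'k) set)" by blast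
  then show ?thesis unfolding laurent_prime_iff laurent_ideal_iff by auto
qed

lemma laurent_prime_one:
  "prime_two_sided_ideal (laurent_algebra :: ('k::field, int \<Rightarrow>\<^sub>0 'k) module) {f. laurent_one f = 0}"
proof -
  have "(1 :: int \<Rightarrow>\<^sub>0 'k) \<notin> {f. laurent_one f = 0}" by (simp add: laurent_one_1)
  then have "{f. laurent_one f = (0 :: 'k)} \<noteq> UNIV" by blast
  then show ?thesis
    unfolding laurent_prime_iff laurent_ideal_iff by (auto simp: laurent_one_simps laurent_one_mult)
qed

definition laurent_X1 :: "int \<Rightarrow>\<^sub>0 'k::field" where "laurent_X1 = Poly_Mapping.single 1 1 - 1"

lemma laurent_X1: "laurent_one (laurent_X1 :: int \<Rightarrow>\<^sub>0 'k::field) = 0" "(laurent_X1 :: int \<Rightarrow>\<^sub>0 'k) \<noteq> 0"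
proof -
  show "laurent_one (laurent_X1 :: int \<Rightarrow>\<^sub>0 'k) = 0"
    by (simp add: laurent_X1_def laurent_one_minus laurent_one_simps laurent_one_1)
  have "Poly_Mapping.lookup laurent_X1 1 = (1 :: 'k)"
    by (simp add: laurent_X1_def lookup_minus lookup_single lookup_one)
  then show "laurent_X1 \<noteq> (0 :: int \<Rightarrow>\<^sub>0 'k)" by (metis lookup_zero zero_neq_one)
qed

context leavitt
begin

section \<open>Primes of a corner\<close>

context
  fixes I e \<phi> assumes cm: "corner_map I e \<phi>"
begin

lemma corner: "idl I" "e \<in> F0" "\<phi> f \<in> F0" "\<phi> (f + g) = \<phi> f + \<phi> g" "eqm I (\<phi> f * \<phi> g) (\<phi> (f * g))"
   "\<phi> 1 = e" "\<phi> f \<in> I \<longleftrightarrow> f = 0" "x \<in> U \<Longrightarrow> \<exists>f. eqm I (e * x * e) (\<phi> f)"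
  using cm unfolding corner_map_def by auto

lemma corner_U [simp]: "e \<in> U" "\<phi> f \<in> U"
  using corner F0_U by auto

lemma corner_minus: "\<phi> (f - g) = \<phi> f - \<phi> g"
  using corner(4)[of "f - g" g] by simp

lemma corner_0: "\<phi> 0 = 0" using corner_minus[of 0 0] by simp

lemma corner_e: "eqm I (e * \<phi> f) (\<phi> f)" "eqm I (\<phi> f * e) (\<phi> f)"
  using corner(5)[of 1 f] corner(5)[of f 1] by (auto simp: corner(6))

lemma corner_mult3: "eqm I (\<phi> f * \<phi> g * \<phi> h) (\<phi> (f * g * h))"
  by (rule eqm_trans[OF corner(1) eqm_r[OF corner(1) corner(5)] corner(5)]) simp

text \<open>As \<open>\<phi> f\<close> is fixed by \<open>e\<close> on both sides, the factors
  \<open>e * r * e\<close> and \<open>e * s * e\<close> can be formed, and these lie in the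
  corner.\<close>

lemma corner_expand:
  assumes "r \<in> U" "s \<in> U"
  shows "\<exists>a b. \<forall>f. eqm I (e * r * \<phi> f * s * e) (\<phi> (a * f * b))"
proof -
  obtain a where a: "eqm I (e * r * e) (\<phi> a)" using corner(8) assms by blast
  obtain b where b: "eqm I (e * s * e) (\<phi> b)" using corner(8) assms by blast
  have "eqm I (e * r * \<phi> f * s * e) (\<phi> (a * f * b))" for f
  proof -
    have 1: "eqm I (e * r * \<phi> f * (s * e)) (e * r * (e * \<phi> f * e) * (s * e))"
    proof (rule eqm_lr[OF corner(1)])
      show "eqm I (\<phi> f) (e * \<phi> f * e)"
        using eqm_sym[OF corner(1) eqm_trans[OF corner(1) eqm_r[OF corner(1) corner_e(1)[of f]] corner_e(2)[of f]]] by simp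
    qed (use assms in auto)
    have 2: "eqm I ((e * r * e) * \<phi> f * (e * s * e)) (\<phi> a * \<phi> f * \<phi> b)"
      using a b assms by (intro eqm_mult[OF corner(1)] eqm_refl[OF corner(1)]) auto
    show ?thesis
      using eqm_trans[OF corner(1) 1, of "\<phi> (a * f * b)"] eqm_trans[OF corner(1) 2 corner_mult3] by (simp add: mult.assoc)
  qed
  then show ?thesis by blast
qed

text \<open>The trace of \<open>A + I\<close> on the corner. The congruence, in place of membership
  of \<open>\<phi> f\<close> in \<open>A\<close>, covers ideals that do not contain
  \<open>I\<close>, as they occur in Zariski open sets.\<close>

definition dn :: "('v, 'e, 'k) lpa_free set \<Rightarrow> (int \<Rightarrow>\<^sub>0 'k) set" where
  "dn A = {f. \<exists>x\<in>A. eqm I (\<phi> f) x}"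

text \<open>For an ideal \<open>J\<close> this is the largest ideal whose trace on the corner is
  contained in \<open>J\<close>.\<close>

definition up :: "(int \<Rightarrow>\<^sub>0 'k) set \<Rightarrow> ('v, 'e, 'k) lpa_free set" where
  "up J = {x \<in> F0. \<forall>r\<in>U. \<forall>s\<in>U. \<exists>f\<in>J. eqm I (e * r * x * s * e) (\<phi> f)}"

abbreviation lideal :: "(int \<Rightarrow>\<^sub>0 'k) set \<Rightarrow> bool" where
  "lideal J \<equiv> two_sided_ideal J (laurent_algebra :: ('k, int \<Rightarrow>\<^sub>0 'k) module)"

abbreviation lprime :: "(int \<Rightarrow>\<^sub>0 'k) set \<Rightarrow> bool" where
  "lprime J \<equiv> prime_two_sided_ideal (laurent_algebra :: ('k, int \<Rightarrow>\<^sub>0 'k) module) J"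

lemma dn_super: "\<lbrakk>idl A; I \<subseteq> A\<rbrakk> \<Longrightarrow> dn A = {f. \<phi> f \<in> A}"
proof -
  assume A: "idl A" "I \<subseteq> A"
  have "\<phi> f \<in> A" if "x \<in> A" "eqm I (\<phi> f) x" for f x
    using that eqm_mem[OF A(1), of "\<phi> f" x] A(2) unfolding eqm_def by blast
  then show ?thesis unfolding dn_def using eqm_refl[OF corner(1)] by blast
qed

lemma dn_ideal:
  assumes A: "idl A"
  shows "lideal (dn A)"
  unfolding laurent_ideal_iff
proof (intro conjI ballI allI)
  show "0 \<in> dn A" unfolding dn_def using idl_0[OF A] corner_0 eqm_refl[OF corner(1), of 0] by force
  fix f assume "f \<in> dn A"
  then obtain x where x: "x \<in> A" "eqm I (\<phi> f) x" by (auto simp: dn_def)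
  show "f + g \<in> dn A" if gA: "g \<in> dn A" for g
  proof -
    obtain y where y: "y \<in> A" "eqm I (\<phi> g) y" using gA by (auto simp: dn_def)
    have "eqm I (\<phi> (f + g)) (x + y)" using eqm_add[OF corner(1) x(2) y(2)] by (simp add: corner(4))
    then show ?thesis using idl_add[OF A x(1) y(1)] by (auto simp: dn_def)
  qed
  show "g * f \<in> dn A" for g
  proof -
    have "eqm I (\<phi> (g * f)) (\<phi> g * x)"
      using eqm_trans[OF corner(1) eqm_sym[OF corner(1) corner(5)] eqm_l[OF corner(1) x(2)]] by simp
    then show ?thesis using idl_l[OF A x(1)] by (auto simp: dn_def)
  qed
qed

lemma up_ideal:
  assumes J: "lideal J"
  shows "idl (up J)" "I \<subseteq> up J"
proof -
  note Jf = J[unfolded laurent_ideal_iff]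
  show sub: "I \<subseteq> up J"
  proof
    fix x assume x: "x \<in> I"
    have "eqm I (e * r * x * s * e) (\<phi> 0)" if "r \<in> U" "s \<in> U" for r s
    proof -
      have "(e * r) * x * (s * e) \<in> I" using that by (intro idl_r[OF corner(1) idl_l[OF corner(1) x]]) auto
      then have "e * r * x * s * e \<in> I" by (simp only: mult.assoc)
      then show ?thesis by (simp add: corner_0 eqm_0[OF corner(1)])
    qed
    then show "x \<in> up J" unfolding up_def using Jf idl_sub[OF corner(1) x] by blast
  qed
  show "idl (up J)"
    unfolding idl_def
  proof (intro conjI ballI)
    show "up J \<subseteq> F0" by (auto simp: up_def)
    show "N \<subseteq> up J" using sub idl_N_sub[OF corner(1)] by blast
    show "0 \<in> up J" using sub idl_0[OF corner(1)] by blast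
    fix x assume x: "x \<in> up J"
    show "x + y \<in> up J" if y: "y \<in> up J" for y
      unfolding up_def
    proof (intro CollectI conjI ballI)
      show "x + y \<in> F0" using x y by (auto simp: up_def)
      fix r s assume rs: "r \<in> U" "s \<in> U"
      then obtain f g where "f \<in> J" "eqm I (e * r * x * s * e) (\<phi> f)" "g \<in> J" "eqm I (e * r * y * s * e) (\<phi> g)"
        using x y unfolding up_def by blast
      then have "f + g \<in> J" "eqm I (e * r * (x + y) * s * e) (\<phi> (f + g))"
        using Jf eqm_add[OF corner(1), of "e * r * x * s * e" "\<phi> f" "e * r * y * s * e" "\<phi> g"]
        by (auto simp: distrib_left distrib_right corner(4))
      then show "\<exists>f\<in>J. eqm I (e * r * (x + y) * s * e) (\<phi> f)" by blast
    qed
    fix a assume a: "a \<in> U"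
    show "a * x \<in> up J"
      unfolding up_def
    proof (intro CollectI conjI ballI)
      show "a * x \<in> F0" using x a by (auto simp: up_def)
      fix r s assume "r \<in> U" "s \<in> U"
      then have "\<exists>f\<in>J. eqm I (e * (r * a) * x * s * e) (\<phi> f)" using x a U_mult unfolding up_def by blast
      then show "\<exists>f\<in>J. eqm I (e * r * (a * x) * s * e) (\<phi> f)" by (simp add: mult.assoc)
    qed
    show "x * a \<in> up J"
      unfolding up_def
    proof (intro CollectI conjI ballI)
      show "x * a \<in> F0" using x a by (auto simp: up_def)
      fix r s assume "r \<in> U" "s \<in> U"
      then have "\<exists>f\<in>J. eqm I (e * r * x * (a * s) * e) (\<phi> f)" using x a U_mult unfolding up_def by blast
      then show "\<exists>f\<in>J. eqm I (e * r * (x * a) * s * e) (\<phi> f)" by (simp add: mult.assoc)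
    qed
  qed
qed

text \<open>The multipliers \<open>r = s = 1\<close> recover \<open>\<phi> f\<close> itself, and
  \<phi> is injective modulo \<open>I\<close>. The converse is \<open>corner_expand\<close>, because
  \<open>a * f * b\<close> stays in \<open>J\<close>.\<close>

lemma dn_up:
  assumes J: "lideal J"
  shows "dn (up J) = J"
proof -
  have "f \<in> J" if f: "\<phi> f \<in> up J" for f
  proof -
    obtain g where g: "g \<in> J" "eqm I (e * 1 * \<phi> f * 1 * e) (\<phi> g)" using f U_1 unfolding up_def by blast
    have "eqm I (e * \<phi> f * e) (\<phi> f)"
      by (rule eqm_trans[OF corner(1) eqm_r[OF corner(1) corner_e(1)] corner_e(2)]) simp
    from eqm_sym[OF corner(1) this] have "eqm I (\<phi> f) (e * 1 * \<phi> f * 1 * e)" by simp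
    then have "eqm I (\<phi> f) (\<phi> g)" by (rule eqm_trans[OF corner(1) _ g(2)])
    then have "\<phi> (f - g) \<in> I" by (simp add: corner_minus eqm_def)
    then have "f = g" by (simp add: corner(7))
    then show ?thesis using g by simp
  qed
  moreover have "\<phi> f \<in> up J" if f: "f \<in> J" for f
    unfolding up_def
  proof (intro CollectI conjI ballI)
    fix r s assume "r \<in> U" "s \<in> U"
    then obtain a b where "eqm I (e * r * \<phi> f * s * e) (\<phi> (a * f * b))" using corner_expand by blast
    moreover have "a * f * b \<in> J" using f J unfolding laurent_ideal_iff by (metis mult.commute)
    ultimately show "\<exists>f'\<in>J. eqm I (e * r * \<phi> f * s * e) (\<phi> f')" by blast
  qed (rule corner(3))
  ultimately show ?thesis using dn_super[OF up_ideal[OF J]] by blast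
qed

definition corner_primes :: "('v, 'e, 'k) lpa_free set set" where
  "corner_primes = {A. prime_idl A \<and> I \<subseteq> A \<and> e \<notin> A}"

text \<open>Primeness is applied twice, each time with \<open>e\<close> as the factor that is not in
  \<open>A\<close>.\<close>

lemma corner_prime_mem:
  assumes A: "A \<in> corner_primes" and x: "x \<in> F0" and h: "\<And>r s. \<lbrakk>r \<in> U; s \<in> U\<rbrakk> \<Longrightarrow> e * r * x * s * e \<in> A"
  shows "x \<in> A"
proof -
  have P: "prime_idl A" "e \<notin> A" using A by (auto simp: corner_primes_def)
  have pr: "a \<in> A \<or> b \<in> A" if "a \<in> F0" "b \<in> F0" "\<And>r. r \<in> U \<Longrightarrow> a * r * b \<in> A" for a b
    using P that unfolding prime_idl_def by blast
  have "e * r * x \<in> A" if r: "r \<in> U" for r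
    using pr[of "e * r * x" e] h[OF r] P(2) corner(2) x r by auto
  then show ?thesis using pr[of e x] P(2) corner(2) x by auto
qed

lemma up_dn:
  assumes A: "A \<in> corner_primes"
  shows "up (dn A) = A"
proof -
  have i: "idl A" "I \<subseteq> A" using A by (auto simp: corner_primes_def prime_idl_def)
  have emem: "x \<in> A \<longleftrightarrow> y \<in> A" if "eqm I x y" for x y
    using eqm_mem[OF i(1), of x y] i(2) that unfolding eqm_def by blast
  show ?thesis
  proof (intro equalityI subsetI)
    fix x assume x: "x \<in> A"
    show "x \<in> up (dn A)" unfolding up_def
    proof (intro CollectI conjI ballI)
      show xF: "x \<in> F0" using idl_sub[OF i(1) x] .
      fix r s assume rs: "r \<in> U" "s \<in> U"
      then obtain f where f: "eqm I (e * (r * x * s) * e) (\<phi> f)" using corner(8)[of "r * x * s"] F0_U[OF xF] by auto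
      have "e * (r * x * s) * e \<in> A" using rs by (intro idl_r[OF i(1) idl_l[OF i(1) idl_r[OF i(1) idl_l[OF i(1) x]]]]) auto
      then have "f \<in> dn A" using emem[OF f] dn_super[OF i] by simp
      then show "\<exists>f\<in>dn A. eqm I (e * r * x * s * e) (\<phi> f)" using f by (auto simp: mult.assoc)
    qed
  next
    fix x assume x: "x \<in> up (dn A)"
    show "x \<in> A"
    proof (rule corner_prime_mem[OF A])
      fix r s assume "r \<in> U" "s \<in> U"
      then obtain f where "f \<in> dn A" "eqm I (e * r * x * s * e) (\<phi> f)" using x unfolding up_def by blast
      then show "e * r * x * s * e \<in> A" using emem dn_super[OF i] by blast
    qed (use x in \<open>auto simp: up_def\<close>)
  qed
qed

text \<open>The Laurent polynomials are commutative: a product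
  \<open>\<phi> f * r * \<phi> g\<close> is congruent to \<open>\<phi> (f * a * g)\<close>, which is
  a multiple of \<open>f * g\<close>.\<close>

lemma dn_prime:
  assumes A: "A \<in> corner_primes"
  shows "lprime (dn A)"
proof -
  have i: "idl A" "I \<subseteq> A" "e \<notin> A" "prime_idl A" using A by (auto simp: corner_primes_def prime_idl_def)
  have emem: "x \<in> A \<longleftrightarrow> y \<in> A" if "eqm I x y" for x y
    using eqm_mem[OF i(1), of x y] i(2) that unfolding eqm_def by blast
  note d = dn_super[OF i(1,2)]
  show ?thesis
    unfolding laurent_prime_iff
  proof (intro conjI allI impI dn_ideal[OF i(1)])
    show "dn A \<noteq> UNIV" using i(3) corner(6) unfolding d by blast
    fix f g assume fg: "f * g \<in> dn A"
    have "\<phi> f * r * \<phi> g \<in> A" if r: "r \<in> U" for r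
    proof -
      obtain a where a: "eqm I (e * r * e) (\<phi> a)" using corner(8)[OF r] by blast
      have m1: "eqm I ((\<phi> f * e) * r * (e * \<phi> g)) (\<phi> f * r * \<phi> g)"
        using r by (intro eqm_mult[OF corner(1)] corner_e eqm_refl[OF corner(1)]) auto
      have m2: "eqm I (\<phi> f * (e * r * e) * \<phi> g) (\<phi> (f * a * g))"
        using eqm_trans[OF corner(1) eqm_lr[OF corner(1) a] corner_mult3] by simp
      have "f * a * g = a * (f * g)" by (simp add: ac_simps)
      then have "f * a * g \<in> dn A" using fg dn_ideal[OF i(1)] unfolding laurent_ideal_iff by metis
      then have "\<phi> f * (e * r * e) * \<phi> g \<in> A" using emem[OF m2] unfolding d by blast
      then have "(\<phi> f * e) * r * (e * \<phi> g) \<in> A" by (simp add: mult.assoc)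
      then show ?thesis using emem[OF m1] by blast
    qed
    then show "f \<in> dn A \<or> g \<in> dn A" using i(4) corner(3) unfolding d prime_idl_def by blast
  qed
qed

text \<open>Elements outside \<open>up J\<close> have translates in the corner given by polynomials
  \<open>f\<close> and \<open>g\<close> outside \<open>J\<close>. If all \<open>a * r * b\<close>
  were in \<open>up J\<close>, the product of the two translates would be too, and
  \<open>f * g\<close> would lie in \<open>J\<close>.\<close>

lemma up_prime:
  assumes J: "lprime J"
  shows "up J \<in> corner_primes"
proof -
  have l: "lideal J" "J \<noteq> UNIV" "\<And>f g. f * g \<in> J \<Longrightarrow> f \<in> J \<or> g \<in> J"
    using J unfolding laurent_prime_iff by blast+
  note i = up_ideal[OF l(1)]
  note d = dn_super[OF i]
  have emem: "x \<in> up J \<longleftrightarrow> y \<in> up J" if "eqm I x y" for x y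
    using eqm_mem[OF i(1), of x y] i(2) that unfolding eqm_def by blast
  have "1 \<notin> J"
  proof
    assume "1 \<in> J"
    then have "f \<in> J" for f using l(1) unfolding laurent_ideal_iff by (metis mult.right_neutral)
    then show False using l(2) by blast
  qed
  then have e: "e \<notin> up J" using dn_up[OF l(1)] corner(6) unfolding d by blast
  have out: "\<exists>r\<in>U. \<exists>s\<in>U. \<exists>f. f \<notin> J \<and> eqm I (e * r * x * s * e) (\<phi> f)" if x: "x \<in> F0" "x \<notin> up J" for x
  proof -
    obtain r s where rs: "r \<in> U" "s \<in> U" "\<And>f. f \<in> J \<Longrightarrow> \<not> eqm I (e * r * x * s * e) (\<phi> f)"
      using x unfolding up_def by blast
    obtain f where "eqm I (e * (r * x * s) * e) (\<phi> f)" using corner(8)[of "r * x * s"] F0_U[OF x(1)] rs by auto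
    then have "eqm I (e * r * x * s * e) (\<phi> f)" by (simp add: mult.assoc)
    then show ?thesis using rs by blast
  qed
  have "a \<in> up J \<or> b \<in> up J" if ab: "a \<in> F0" "b \<in> F0" "\<And>r. r \<in> U \<Longrightarrow> a * r * b \<in> up J" for a b
  proof (rule ccontr)
    assume "\<not> ?thesis"
    then obtain r s f where 1: "r \<in> U" "s \<in> U" "f \<notin> J" "eqm I (e * r * a * s * e) (\<phi> f)" using out ab by blast
    from \<open>\<not> ?thesis\<close> obtain r' s' g where 2: "r' \<in> U" "s' \<in> U" "g \<notin> J" "eqm I (e * r' * b * s' * e) (\<phi> g)" using out ab by blast
    have "e * r * (a * (s * e * (e * r')) * b) * (s' * e) \<in> up J"
      using 1 2 ab by (intro idl_r[OF i(1) idl_l[OF i(1) ab(3)]]) auto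
    moreover have "eqm I ((e * r * a * s * e) * (e * r' * b * s' * e)) (\<phi> f * \<phi> g)"
      using 1 2 ab F0_U by (intro eqm_mult[OF corner(1)]) auto
    ultimately have "\<phi> f * \<phi> g \<in> up J" using emem by (simp add: mult.assoc)
    then have "\<phi> (f * g) \<in> up J" using emem[OF corner(5)] by simp
    then have "f * g \<in> J" using dn_up[OF l(1)] unfolding d by blast
    then show False using l(3) 1 2 by blast
  qed
  then have "prime_idl (up J)" unfolding prime_idl_def using i(1) e corner(2) by blast
  then show ?thesis unfolding corner_primes_def using i(2) e by blast
qed

text \<open>The ideal \<open>B\<close> is arbitrary, so this translates the defining condition of
  every Zariski open set from the algebra to the corner.\<close>

lemma subset_iff_dn:
  assumes A: "A \<in> corner_primes" and B: "idl B"
  shows "B \<subseteq> A \<longleftrightarrow> dn B \<subseteq> dn A"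
proof
  show "B \<subseteq> A \<Longrightarrow> dn B \<subseteq> dn A" unfolding dn_def by blast
  assume d: "dn B \<subseteq> dn A"
  have i: "idl A" "I \<subseteq> A" using A by (auto simp: corner_primes_def prime_idl_def)
  have emem: "x \<in> A \<longleftrightarrow> y \<in> A" if "eqm I x y" for x y
    using eqm_mem[OF i(1), of x y] i(2) that unfolding eqm_def by blast
  show "B \<subseteq> A"
  proof
    fix x assume x: "x \<in> B"
    show "x \<in> A"
    proof (rule corner_prime_mem[OF A idl_sub[OF B x]])
      fix r s assume rs: "r \<in> U" "s \<in> U"
      obtain f where f: "eqm I (e * (r * x * s) * e) (\<phi> f)"
        using corner(8)[of "r * x * s"] F0_U[OF idl_sub[OF B x]] rs by auto
      have "e * (r * x * s) * e \<in> B" using rs by (intro idl_r[OF B idl_l[OF B idl_r[OF B idl_l[OF B x]]]]) auto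
      then have "f \<in> dn B" using eqm_sym[OF corner(1) f] unfolding dn_def by blast
      then have "\<phi> f \<in> A" using d dn_super[OF i] by blast
      then show "e * r * x * s * e \<in> A" using emem[OF f] by (simp add: mult.assoc)
    qed
  qed
qed

lemma up_subset_iff:
  assumes A: "A \<in> corner_primes" and J: "lideal J"
  shows "up J \<subseteq> A \<longleftrightarrow> J \<subseteq> dn A"
  using subset_iff_dn[OF A up_ideal(1)[OF J]] dn_up[OF J] by simp

end
end

section \<open>Scalars that avoid finitely many roots of unity conditions\<close>

lemma finite_powi_eq_one:
  assumes "(j :: int) \<noteq> 0" shows "finite {g :: 'k::field. g \<noteq> 0 \<and> g powi j = 1}"
proof -
  have pos: "finite {g :: 'k. g ^ n = 1}" if "n > 0" for n
  proof -
    let ?p = "Polynomial.monom (1 :: 'k) n - 1"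
    have "poly.coeff ?p n = 1" using that by simp
    then have "?p \<noteq> 0" by (metis coeff_0 zero_neq_one)
    moreover have "{g. g ^ n = 1} = {g. poly ?p g = 0}" by (auto simp: poly_monom)
    ultimately show ?thesis using poly_roots_finite[of ?p] by simp
  qed
  have "g ^ nat \<bar>j\<bar> = 1" if "g \<noteq> 0" "g powi j = 1" for g :: 'k
    using that by (cases "j \<ge> 0") (auto simp: power_int_def power_inverse)
  then have "{g :: 'k. g \<noteq> 0 \<and> g powi j = 1} \<subseteq> {g. g ^ nat \<bar>j\<bar> = 1}" by auto
  then show ?thesis using pos[of "nat \<bar>j\<bar>"] assms finite_subset by auto
qed

lemma exists_generic_scalar:
  assumes "infinite (UNIV :: 'k::field set)" "finite J" "(0::int) \<notin> J"
  shows "\<exists>g :: 'k. g \<noteq> 0 \<and> (\<forall>j\<in>J. g powi j \<noteq> 1)"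
proof -
  have "finite (insert 0 (\<Union>j\<in>J. {g :: 'k. g \<noteq> 0 \<and> g powi j = 1}))"
  proof -
    have "finite {g :: 'k. g \<noteq> 0 \<and> g powi j = 1}" if "j \<in> J" for j
      using that assms(3) by (intro finite_powi_eq_one) auto
    then show ?thesis using assms(2) by simp
  qed
  then obtain g where "g \<notin> insert 0 (\<Union>j\<in>J. {g :: 'k. g \<noteq> 0 \<and> g powi j = 1})"
    using ex_new_if_finite[OF assms(1)] by blast
  then show ?thesis by auto
qed

context leavitt
begin

section \<open>Ideals of the quotient\<close>

abbreviation LA :: "('k, ('v, 'e, 'k) lpa_elem) module" where "LA \<equiv> leavitt_path_algebra E"
abbreviation cls :: "('v, 'e, 'k) lpa_free \<Rightarrow> ('v, 'e, 'k) lpa_elem" where "cls \<equiv> lpa_class E"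

lemma N_algebra_ideal: "algebra_ideal N (lpa_free_algebra E)"
  using idl_N by (simp add: idl_algebra_ideal)

lemma cls_eq_iff: "cls x = cls y \<longleftrightarrow> eqm N x y"
  unfolding lpa_class_def eqm_def by (rule FA.coset_eq_iff[OF N_algebra_ideal])

lemma carrier_LA: "carrier LA = cls ` F0"
  unfolding leavitt_path_algebra_def lpa_class_def by (rule FA.carrier_quotient[OF N_algebra_ideal])

lemma zero_LA: "\<zero>\<^bsub>LA\<^esub> = cls 0"
  unfolding leavitt_path_algebra_def lpa_class_def by (rule FA.zero_quotient[OF N_algebra_ideal])

lemma add_LA: "\<lbrakk>x \<in> F0; y \<in> F0\<rbrakk> \<Longrightarrow> cls x \<oplus>\<^bsub>LA\<^esub> cls y = cls (x + y)"
  unfolding leavitt_path_algebra_def lpa_class_def by (rule FA.add_quotient[OF N_algebra_ideal])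

lemma mult_LA: "\<lbrakk>x \<in> F0; y \<in> F0\<rbrakk> \<Longrightarrow> cls x \<otimes>\<^bsub>LA\<^esub> cls y = cls (x * y)"
  unfolding leavitt_path_algebra_def lpa_class_def by (rule FA.mult_quotient[OF N_algebra_ideal])

lemma smult_LA: "x \<in> F0 \<Longrightarrow> c \<odot>\<^bsub>LA\<^esub> cls x = cls (sc c * x)"
  unfolding leavitt_path_algebra_def lpa_class_def scale_sc[symmetric] by (rule FA.smult_quotient[OF N_algebra_ideal])

lemma finsum_LA: "finite S \<Longrightarrow> (\<And>i. i \<in> S \<Longrightarrow> f i \<in> F0) \<Longrightarrow> (\<Oplus>\<^bsub>LA\<^esub>i\<in>S. cls (f i)) = cls (sum f S)"
  unfolding leavitt_path_algebra_def lpa_class_def by (rule FA.finsum_quotient[OF N_algebra_ideal])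

lemma abelian_group_LA: "abelian_group LA"
  unfolding leavitt_path_algebra_def by (rule FA.abelian_group_quotient[OF N_algebra_ideal])

lemma rng_LA: "rng LA"
proof (intro rng.intro abelian_group_LA rng_axioms.intro)
qed (auto simp: carrier_LA add_LA mult_LA F0_U algebra_simps)

lemma minus_LA: "x \<in> F0 \<Longrightarrow> \<ominus>\<^bsub>LA\<^esub> cls x = cls (- x)"
  using abelian_group.minus_equality[OF abelian_group_LA, of "cls (- x)" "cls x"]
  by (simp add: add_LA FA.uminus_in carrier_LA zero_LA)

definition preimage :: "('v, 'e, 'k) lpa_elem set \<Rightarrow> ('v, 'e, 'k) lpa_free set" where
  "preimage P = {x \<in> F0. cls x \<in> P}"

lemma cls_mem: "idl I \<Longrightarrow> x \<in> F0 \<Longrightarrow> cls x \<in> cls ` I \<longleftrightarrow> x \<in> I"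
proof
  assume I: "idl I" and "cls x \<in> cls ` I"
  then obtain y where y: "y \<in> I" "eqm N x y" by (auto simp: cls_eq_iff)
  show "x \<in> I" using eqm_mem[OF I eqm_N[OF I y(2)]] y(1) by simp
qed (rule imageI)

lemma preimage_image: "idl I \<Longrightarrow> preimage (cls ` I) = I"
  using cls_mem idl_sub by (auto simp: preimage_def)

lemma image_preimage: "P \<subseteq> carrier LA \<Longrightarrow> cls ` preimage P = P"
  by (auto simp: preimage_def carrier_LA)

text \<open>Closure under scalars does not come with a ring ideal. With a sum of vertices that acts
  on \<open>x\<close> as a unit, \<open>c\<close> times \<open>x\<close> becomes the product of an
  algebra element with \<open>x\<close>.\<close>

lemma preimage_idl:
  assumes P: "two_sided_ideal P LA"
  shows "idl (preimage P)"
proof -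
  have ag: "additive_subgroup P LA" using P by (simp add: two_sided_ideal_def)
  have 0: "cls 0 \<in> P" using additive_subgroup.zero_closed[OF ag] by (simp add: zero_LA)
  have N: "N \<subseteq> preimage P"
  proof
    fix x assume "x \<in> N"
    then have "x \<in> F0" "cls x = cls 0" using idl_sub[OF idl_N] by (auto simp: cls_eq_iff eqm_def)
    then show "x \<in> preimage P" using 0 by (simp add: preimage_def)
  qed
  have m: "y * x \<in> preimage P" "x * y \<in> preimage P" if "y \<in> F0" "x \<in> preimage P" for x y
    using that two_sided_idealD(3,4)[OF P, of "cls y" "cls x"]
    by (auto simp: preimage_def carrier_LA mult_LA F0_U)
  have a: "x + y \<in> preimage P" if "x \<in> preimage P" "y \<in> preimage P" for x y
    using that additive_subgroup.a_closed[OF ag, of "cls x" "cls y"] by (auto simp: preimage_def add_LA)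
  have c: "sc c * x \<in> preimage P" if x: "x \<in> preimage P" for c x
  proof -
    have xF: "x \<in> F0" using x by (simp add: preimage_def)
    obtain S where S: "S \<subseteq> verts E" "eqm N ((\<Sum>u\<in>S. vx u) * x) x" using local_units[OF xF] by blast
    have "(\<Sum>u\<in>S. vx u) \<in> F0" using S by (intro F0_sum) auto
    then have "sc c * (\<Sum>u\<in>S. vx u) * x \<in> preimage P" by (intro m x) auto
    then have "cls (sc c * (\<Sum>u\<in>S. vx u) * x) \<in> P" by (simp add: preimage_def)
    moreover have "cls (sc c * (\<Sum>u\<in>S. vx u) * x) = cls (sc c * x)"
      unfolding cls_eq_iff using eN_l[OF S(2), of "sc c"] by (simp add: mult.assoc)
    ultimately show ?thesis using xF by (simp add: preimage_def)
  qed
  have "algebra_ideal (preimage P) (lpa_free_algebra E)"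
    unfolding FA.algebra_ideal_iff scale_sc using m a c 0 by (auto simp: preimage_def)
  then show ?thesis using N by (simp add: idl_algebra_ideal)
qed

lemma image_ideal:
  assumes I: "idl I"
  shows "two_sided_ideal (cls ` I) LA"
  unfolding two_sided_ideal_def
proof (intro conjI ballI)
  interpret L: abelian_group LA by (rule abelian_group_LA)
  note s = idl_sub[OF I]
  show "additive_subgroup (cls ` I) LA"
  proof (rule additive_subgroup.intro, rule L.add.subgroupI)
    show "cls ` I \<subseteq> carrier LA" using s by (auto simp: carrier_LA)
    show "cls ` I \<noteq> {}" using idl_0[OF I] by blast
    show "\<ominus>\<^bsub>LA\<^esub> a \<in> cls ` I" if "a \<in> cls ` I" for a
      using that s idl_uminus[OF I] by (auto simp: minus_LA)
    show "a \<oplus>\<^bsub>LA\<^esub> b \<in> cls ` I" if "a \<in> cls ` I" "b \<in> cls ` I" for a b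
      using that s idl_add[OF I] by (auto simp: add_LA)
  qed
  fix a x assume "a \<in> carrier LA" "x \<in> cls ` I"
  then show "a \<otimes>\<^bsub>LA\<^esub> x \<in> cls ` I" "x \<otimes>\<^bsub>LA\<^esub> a \<in> cls ` I"
    using s idl_l[OF I] idl_r[OF I] F0_U by (auto simp: carrier_LA mult_LA)
qed

lemma two_sided_ideal_LA_iff: "two_sided_ideal P LA \<longleftrightarrow> (\<exists>I. idl I \<and> P = cls ` I)"
  using preimage_idl image_ideal image_preimage two_sided_idealD(2) by metis

lemma cls_image_subset_iff: "\<lbrakk>idl I; idl J\<rbrakk> \<Longrightarrow> cls ` I \<subseteq> cls ` J \<longleftrightarrow> I \<subseteq> J"
proof -
  assume I: "idl I" "idl J"
  have "x \<in> J" if "cls ` I \<subseteq> cls ` J" "x \<in> I" for x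
    using that cls_mem[OF I(2) idl_sub[OF I(1) that(2)]] by (simp add: image_subset_iff)
  then show ?thesis by (auto intro: imageI)
qed

lemma cls_image_eq_iff: "\<lbrakk>idl I; idl J\<rbrakk> \<Longrightarrow> cls ` I = cls ` J \<longleftrightarrow> I = J"
  using preimage_image by metis

lemma idl_F0: "idl F0"
  unfolding idl_def using idl_sub[OF idl_N] by auto

text \<open>For the direction from ideals to elements, two ideals containing \<open>a\<close> and
  \<open>b\<close> are needed whose product lies in \<open>I\<close>; they are defined as
  annihilators modulo \<open>I\<close>, which avoids describing generated ideals.\<close>

lemma prime_LA_iff: "prime_two_sided_ideal LA P \<longleftrightarrow> (\<exists>I. prime_idl I \<and> P = cls ` I)"
proof
  assume P: "prime_two_sided_ideal LA P"
  then obtain I where I: "idl I" "P = cls ` I"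
    unfolding prime_two_sided_ideal_def two_sided_ideal_LA_iff by blast
  have "a \<in> I \<or> b \<in> I" if ab: "a \<in> F0" "b \<in> F0" "\<And>r. r \<in> U \<Longrightarrow> a * r * b \<in> I" for a b
  proof -
    \<comment> \<open>All elements that can take the place of \<open>a\<close>; then
      \<open>I2\<close> consists of all elements that can take the place of \<open>b\<close> against
      every element of \<open>I1\<close>.\<close>
    define I1 where "I1 = {x \<in> F0. \<forall>r\<in>U. x * r * b \<in> I}"
    define I2 where "I2 = {y \<in> F0. \<forall>x\<in>I1. \<forall>r\<in>U. x * r * y \<in> I}"
    have NI: "x \<in> N \<Longrightarrow> r \<in> U \<Longrightarrow> s \<in> U \<Longrightarrow> r * x * s \<in> I" for x r s
      using idl_N_sub[OF I(1)] idl_l[OF I(1)] idl_r[OF I(1)] by blast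
    have i1: "idl I1"
      unfolding idl_def
    proof (intro conjI ballI subsetI)
      show "x \<in> I1" if "x \<in> N" for x
        using that NI[of x 1] idl_sub[OF idl_N that] ab(2) F0_U by (auto simp: I1_def mult.assoc)
      show "x + y \<in> I1" if "x \<in> I1" "y \<in> I1" for x y
        using that idl_add[OF I(1)] by (auto simp: I1_def distrib_right)
      fix c x assume c: "c \<in> U" "x \<in> I1"
      then show "c * x \<in> I1" using idl_l[OF I(1)] by (auto simp: I1_def mult.assoc)
      show "x * c \<in> I1"
        unfolding I1_def
      proof (intro CollectI conjI ballI)
        fix r assume "r \<in> U"
        then have "x * (c * r) * b \<in> I" using c unfolding I1_def by simp
        then show "x * c * r * b \<in> I" by (simp add: mult.assoc)
      qed (use c in \<open>auto simp: I1_def\<close>)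
    qed (auto simp: I1_def idl_0[OF I(1)])
    have i2: "idl I2"
      unfolding idl_def
    proof (intro conjI ballI subsetI)
      show "x \<in> I2" if "x \<in> N" for x
        using that NI[of x _ 1] idl_sub[OF idl_N that] F0_U by (auto simp: I2_def I1_def)
      show "x + y \<in> I2" if "x \<in> I2" "y \<in> I2" for x y
        using that idl_add[OF I(1)] by (auto simp: I2_def distrib_left)
      fix c y assume c: "c \<in> U" "y \<in> I2"
      show "c * y \<in> I2"
        unfolding I2_def
      proof (intro CollectI conjI ballI)
        fix x r assume "x \<in> I1" "r \<in> U"
        then have "x * (r * c) * y \<in> I" using c unfolding I2_def by simp
        then show "x * r * (c * y) \<in> I" by (simp add: mult.assoc)
      qed (use c in \<open>auto simp: I2_def\<close>)
      show "y * c \<in> I2"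
        unfolding I2_def
      proof (intro CollectI conjI ballI)
        fix x r assume "x \<in> I1" "r \<in> U"
        then have "x * r * y * c \<in> I" using c idl_r[OF I(1)] unfolding I2_def by blast
        then show "x * r * (y * c) \<in> I" by (simp add: mult.assoc)
      qed (use c in \<open>auto simp: I2_def\<close>)
    qed (auto simp: I2_def idl_0[OF I(1)])
    have "\<forall>x\<in>cls ` I1. \<forall>y\<in>cls ` I2. x \<otimes>\<^bsub>LA\<^esub> y \<in> P"
    proof (intro ballI)
      fix X Y assume "X \<in> cls ` I1" "Y \<in> cls ` I2"
      then obtain x y where xy: "x \<in> I1" "y \<in> I2" "X = cls x" "Y = cls y" by blast
      then have "x * 1 * y \<in> I" using U_1 unfolding I2_def by blast
      then show "X \<otimes>\<^bsub>LA\<^esub> Y \<in> P" using xy by (auto simp: I(2) I1_def I2_def mult_LA)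
    qed
    moreover have "(\<forall>x\<in>cls ` I1. \<forall>y\<in>cls ` I2. x \<otimes>\<^bsub>LA\<^esub> y \<in> P) \<longrightarrow> cls ` I1 \<subseteq> P \<or> cls ` I2 \<subseteq> P"
      using P image_ideal[OF i1] image_ideal[OF i2] unfolding prime_two_sided_ideal_def by simp
    ultimately have "I1 \<subseteq> I \<or> I2 \<subseteq> I"
      unfolding I(2) cls_image_subset_iff[OF i1 I(1)] cls_image_subset_iff[OF i2 I(1)] by (rule rev_mp)
    moreover have a1: "a \<in> I1" using ab by (auto simp: I1_def)
    moreover have "b \<in> I2" using ab by (auto simp: I2_def I1_def)
    ultimately show ?thesis by blast
  qed
  moreover have "I \<noteq> F0" using P I(2) by (auto simp: prime_two_sided_ideal_def carrier_LA)
  ultimately have "prime_idl I" unfolding prime_idl_def using I(1) by simp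
  then show "\<exists>I. prime_idl I \<and> P = cls ` I" using I(2) by (intro exI conjI)
next
  assume "\<exists>I. prime_idl I \<and> P = cls ` I"
  then obtain I where I: "prime_idl I" "idl I" "P = cls ` I" by (auto simp: prime_idl_def)
  show "prime_two_sided_ideal LA P"
    unfolding prime_two_sided_ideal_def
  proof (intro conjI allI impI)
    show "two_sided_ideal P LA" using image_ideal I by simp
    show "P \<noteq> carrier LA" using cls_image_eq_iff[OF I(2) idl_F0] I(1,3) by (simp add: carrier_LA prime_idl_def)
    fix A B assume AB: "two_sided_ideal A LA" "two_sided_ideal B LA" "\<forall>x\<in>A. \<forall>y\<in>B. x \<otimes>\<^bsub>LA\<^esub> y \<in> P"
    obtain A' where A: "idl A'" "A = cls ` A'" using AB(1) two_sided_ideal_LA_iff by blast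
    obtain B' where B: "idl B'" "B = cls ` B'" using AB(2) two_sided_ideal_LA_iff by blast
    have ab: "a \<in> I \<or> b \<in> I" if "a \<in> A'" "b \<in> B'" for a b
    proof -
      have "a * r * b \<in> I" if r: "r \<in> U" for r
      proof -
        have ar: "a * r \<in> A'" using idl_r[OF A(1) \<open>a \<in> A'\<close> r] .
        then have "cls (a * r) \<otimes>\<^bsub>LA\<^esub> cls b \<in> P" using AB(3) A B \<open>b \<in> B'\<close> by blast
        then show ?thesis
          using cls_mem[OF I(2), of "a * r * b"] idl_sub[OF A(1) ar] idl_sub[OF B(1) \<open>b \<in> B'\<close>]
          by (simp add: mult_LA I(3) F0_U)
      qed
      then show ?thesis using I(1) idl_sub[OF A(1) that(1)] idl_sub[OF B(1) that(2)] unfolding prime_idl_def by blast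
    qed
    show "A \<subseteq> P \<or> B \<subseteq> P"
      unfolding A(2) B(2) I(3) cls_image_subset_iff[OF A(1) I(2)] cls_image_subset_iff[OF B(1) I(2)] using ab by blast
  qed
qed

lemma prime_spectrum_LA: "prime_spectrum LA = (\<lambda>I. cls ` I) ` {I. prime_idl I}"
  unfolding prime_spectrum_def prime_LA_iff by blast

lemma ideal_vertices_image: "idl I \<Longrightarrow> ideal_vertices E (cls ` I) = verts_of I"
  unfolding ideal_vertices_def verts_of_def
  by (intro Collect_cong conj_cong refl cls_mem) auto

lemma tail_stratum_LA: "tail_stratum E M = (\<lambda>I. cls ` I) ` {I. prime_idl I \<and> verts_of I = verts E - M}"
  unfolding tail_stratum_def prime_spectrum_LA using ideal_vertices_image by (auto simp: prime_idl_def)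

lemma component_LA: "lpa_component E n = cls ` {x \<in> F0. hc n x = x}"
  unfolding lpa_component_def carrier_F hc_id_iff by blast

lemma cls_hc_component: "x \<in> F0 \<Longrightarrow> cls (hc n x) \<in> lpa_component E n"
  unfolding component_LA by (auto simp: hc_hc)

lemma eqm_hc: "eqm N x y \<Longrightarrow> eqm N (hc n x) (hc n y)"
  using N_graded unfolding eqm_def graded_def by (metis hc_minus)

lemma cls_sum_hc:
  assumes x: "x \<in> F0"
  shows "cls x = (\<Oplus>\<^bsub>LA\<^esub>n\<in>word_degree ` Poly_Mapping.keys x. cls (hc n x))"
  using finsum_LA[of "word_degree ` Poly_Mapping.keys x" "\<lambda>n. hc n x"] sum_hc[of _ x] x by simp

text \<open>Components of a class are unique because \<open>N\<close> is graded. So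
  \<open>hc m x\<close> is congruent to the summand of degree \<open>m\<close> in any decomposition
  of the class into homogeneous elements of the ideal.\<close>

lemma graded_ideal_LA_iff:
  assumes I: "idl I"
  shows "lpa_graded_ideal E (cls ` I) \<longleftrightarrow> graded I"
proof
  assume g: "lpa_graded_ideal E (cls ` I)"
  show "graded I"
    unfolding graded_def
  proof (intro ballI allI)
    fix x m assume x: "x \<in> I"
    have xF: "x \<in> F0" using idl_sub[OF I x] .
    have "\<exists>D f. finite D \<and> (\<forall>n\<in>D. f n \<in> cls ` I \<inter> lpa_component E n) \<and> cls x = (\<Oplus>\<^bsub>LA\<^esub>n\<in>D. f n)"
      using g imageI[OF x, of cls] unfolding lpa_graded_ideal_def by (elim conjE) (erule bspec)
    then obtain D f where D: "finite D" "\<forall>n\<in>D. f n \<in> cls ` I \<inter> lpa_component E n" "cls x = (\<Oplus>\<^bsub>LA\<^esub>n\<in>D. f n)"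
      by (elim exE conjE)
    have "\<forall>n\<in>D. \<exists>y\<in>F0. f n = cls y \<and> hc n y = y" using D(2) unfolding component_LA by blast
    then obtain y where y: "\<And>n. n \<in> D \<Longrightarrow> y n \<in> F0 \<and> f n = cls (y n) \<and> hc n (y n) = y n" by metis
    interpret L: abelian_group LA by (rule abelian_group_LA)
    have "(\<Oplus>\<^bsub>LA\<^esub>n\<in>D. f n) = (\<Oplus>\<^bsub>LA\<^esub>n\<in>D. cls (y n))"
      using y by (intro L.finsum_cong') (auto simp: carrier_LA)
    also have "\<dots> = cls (sum y D)" using finsum_LA[OF D(1)] y by blast
    finally have "eqm N x (sum y D)" using D(3) by (simp add: cls_eq_iff)
    then have 1: "eqm I (hc m x) (hc m (sum y D))" using eqm_N[OF I eqm_hc] by blast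
    have "hc m (y n) = (if n = m then y n else 0)" if "n \<in> D" for n
      using y[OF that] hc_hc[of m n "y n"] by (auto split: if_splits)
    then have "hc m (sum y D) = (if m \<in> D then y m else 0)"
      using D(1) by (simp add: hc_sum)
    moreover have "y n \<in> I" if "n \<in> D" for n using bspec[OF D(2) that] y[OF that] cls_mem[OF I] by auto
    ultimately have "hc m (sum y D) \<in> I" using idl_0[OF I] by simp
    then show "hc m x \<in> I" using eqm_mem[OF I 1] by simp
  qed
next
  assume g: "graded I"
  show "lpa_graded_ideal E (cls ` I)"
    unfolding lpa_graded_ideal_def
  proof (intro conjI ballI image_ideal[OF I])
    fix X assume "X \<in> cls ` I"
    then obtain x where x: "x \<in> I" "X = cls x" by blast
    have xF: "x \<in> F0" using idl_sub[OF I x(1)] .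
    show "\<exists>D f. finite D \<and> (\<forall>n\<in>D. f n \<in> cls ` I \<inter> lpa_component E n) \<and> X = (\<Oplus>\<^bsub>LA\<^esub>n\<in>D. f n)"
    proof (intro exI conjI ballI)
      show "X = (\<Oplus>\<^bsub>LA\<^esub>n\<in>word_degree ` Poly_Mapping.keys x. cls (hc n x))"
        unfolding x(2) by (rule cls_sum_hc[OF xF])
      show "cls (hc n x) \<in> cls ` I \<inter> lpa_component E n" for n
        using g x(1) cls_hc_component[OF xF] unfolding graded_def by blast
    qed simp
  qed
qed

section \<open>The torus action\<close>

definition torus :: "'k \<Rightarrow> ('v, 'e, 'k) lpa_free \<Rightarrow> ('v, 'e, 'k) lpa_free" where
  "torus h x = Poly_Mapping.mapp (\<lambda>w c. h powi (word_degree w) * c) x"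

lemma lookup_torus: "Poly_Mapping.lookup (torus h x) w = h powi (word_degree w) * Poly_Mapping.lookup x w"
  unfolding torus_def by (simp add: lookup_mapp when_def in_keys_iff)

lemma torus_add: "torus h (x + y) = torus h x + torus h y"
  and torus_minus: "torus h (x - y) = torus h x - torus h y"
  and torus_0 [simp]: "torus h 0 = 0"
  and torus_single: "torus h (Poly_Mapping.single w c) = Poly_Mapping.single w (h powi (word_degree w) * c)"
  by (rule poly_mapping_eqI, simp add: lookup_torus lookup_add lookup_minus lookup_single when_def algebra_simps)+

lemma torus_hc: "torus h (hc n x) = sc (h powi n) * hc n x"
  unfolding mult_map_scale_conv_mult[symmetric]
  by (rule poly_mapping_eqI) (simp add: lookup_torus lookup_hc)

lemma torus_sc: "torus h (sc c * x) = sc c * torus h x"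
  unfolding mult_map_scale_conv_mult[symmetric]
  by (rule poly_mapping_eqI) (simp add: lookup_torus)

lemma torus_mult: "h \<noteq> 0 \<Longrightarrow> torus h (x * y) = torus h x * torus h y"
proof (induction x rule: poly_mapping_single_induct)
  case (add x w c)
  have "torus h (Poly_Mapping.single w c * y) = torus h (Poly_Mapping.single w c) * torus h y"
    by (induction y rule: poly_mapping_single_induct)
      (auto simp: distrib_left torus_add torus_single mult_single power_int_add add.prems mult.assoc mult.left_commute)
  with add show ?case by (simp add: distrib_right torus_add)
qed simp

lemma torus_torus: "g \<noteq> 0 \<Longrightarrow> h \<noteq> 0 \<Longrightarrow> torus (g * h) x = torus g (torus h x)"
  by (rule poly_mapping_eqI) (simp add: lookup_torus power_int_mult_distrib mult.assoc)

lemma torus_1: "torus 1 x = x"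
  by (rule poly_mapping_eqI) (simp add: lookup_torus)

lemma torus_F0 [simp]: "x \<in> F0 \<Longrightarrow> torus h x \<in> F0"
  unfolding F0_def by (auto simp: in_keys_iff lookup_torus)

lemma torus_sum: "torus h x = (\<Sum>n\<in>word_degree ` Poly_Mapping.keys x. sc (h powi n) * hc n x)"
proof -
  have s: "torus h (sum f S) = (\<Sum>i\<in>S. torus h (f i))" for f :: "int \<Rightarrow> _" and S
    by (induction S rule: infinite_finite_induct) (auto simp: torus_add)
  have "torus h x = torus h (\<Sum>n\<in>word_degree ` Poly_Mapping.keys x. hc n x)" by (simp add: sum_hc)
  then show ?thesis by (simp add: s torus_hc)
qed

lemma torus_graded: "\<lbrakk>idl I; graded I; x \<in> I\<rbrakk> \<Longrightarrow> torus h x \<in> I"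
  unfolding torus_sum graded_def by (intro idl_sum idl_l) auto

lemma torus_eqm: "eqm N x y \<Longrightarrow> eqm N (torus h x) (torus h y)"
  using torus_graded[OF idl_N N_graded] unfolding eqm_def by (metis torus_minus)

text \<open>The choice of a representative is immaterial by \<open>torus_eqm\<close>; the
  restriction to the carrier matches the extensionality required in
  \<open>torus_map\<close>.\<close>

definition torus_LA :: "'k \<Rightarrow> ('v, 'e, 'k) lpa_elem \<Rightarrow> ('v, 'e, 'k) lpa_elem" where
  "torus_LA h = restrict (\<lambda>X. cls (torus h (SOME x. x \<in> F0 \<and> cls x = X))) (carrier LA)"

lemma torus_LA_cls: "x \<in> F0 \<Longrightarrow> torus_LA h (cls x) = cls (torus h x)"
proof -
  assume x: "x \<in> F0"
  let ?y = "SOME y. y \<in> F0 \<and> cls y = cls x"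
  have "?y \<in> F0 \<and> cls ?y = cls x" by (rule someI[of _ x]) (simp add: x)
  then have "cls (torus h ?y) = cls (torus h x)" unfolding cls_eq_iff by (intro torus_eqm) blast
  then show ?thesis using x by (simp add: torus_LA_def carrier_LA)
qed

lemma torus_map_LA: "torus_map E h (torus_LA h)"
  unfolding torus_map_def linear_map_def
proof (intro conjI allI ballI)
  show "torus_LA h \<in> extensional (carrier LA)" by (simp add: torus_LA_def)
  show "torus_LA h \<in> carrier LA \<rightarrow> carrier LA" by (auto simp: carrier_LA torus_LA_cls)
  fix X assume "X \<in> carrier LA"
  then obtain x where x: "x \<in> F0" "X = cls x" by (auto simp: carrier_LA)
  show "torus_LA h (X \<oplus>\<^bsub>LA\<^esub> Y) = torus_LA h X \<oplus>\<^bsub>LA\<^esub> torus_LA h Y" if "Y \<in> carrier LA" for Y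
    using that x by (auto simp: carrier_LA add_LA torus_LA_cls torus_add)
  show "torus_LA h (c \<odot>\<^bsub>LA\<^esub> X) = c \<odot>\<^bsub>LA\<^esub> torus_LA h X" for c
    using x by (auto simp: smult_LA torus_LA_cls torus_sc)
next
  fix n and X :: "('v, 'e, 'k) lpa_elem" assume "X \<in> lpa_component E n"
  then obtain x where x: "x \<in> F0" "X = cls x" "hc n x = x" unfolding component_LA by blast
  then have "torus h x = sc (h powi n) * x" using torus_hc[of h n x] by simp
  then show "torus_LA h X = (h powi n) \<odot>\<^bsub>LA\<^esub> X" using x by (simp add: torus_LA_cls smult_LA)
qed

text \<open>Every class is a finite sum of homogeneous ones, on which the map is prescribed. That
  \<open>0\<close> goes to \<open>0\<close> follows from compatibility with the scalar
  \<open>0\<close>.\<close>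

lemma torus_map_unique:
  assumes f: "torus_map E h f"
  shows "f = torus_LA h"
proof (rule extensionalityI)
  show "f \<in> extensional (carrier LA)" "torus_LA h \<in> extensional (carrier LA)"
    using f torus_map_LA unfolding torus_map_def by blast+
  fix X assume "X \<in> carrier LA"
  then obtain x where x: "x \<in> F0" "X = cls x" by (auto simp: carrier_LA)
  have add: "f (cls y \<oplus>\<^bsub>LA\<^esub> cls z) = f (cls y) \<oplus>\<^bsub>LA\<^esub> f (cls z)" if "y \<in> F0" "z \<in> F0" for y z
    using f that unfolding torus_map_def linear_map_def carrier_LA by blast
  have smul: "f (c \<odot>\<^bsub>LA\<^esub> cls y) = c \<odot>\<^bsub>LA\<^esub> f (cls y)" if "y \<in> F0" for c y
    using f that unfolding torus_map_def linear_map_def carrier_LA by blast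
  have car: "f (cls y) \<in> carrier LA" if "y \<in> F0" for y
    using f that unfolding torus_map_def linear_map_def carrier_LA by blast
  have 0: "f (cls 0) = cls 0"
  proof -
    obtain y where "y \<in> F0" "f (cls 0) = cls y" using car[of 0] by (auto simp: carrier_LA)
    then show ?thesis using smul[of 0 0] smult_LA[of 0 0] smult_LA[of y 0] by simp
  qed
  have "f (cls (\<Sum>n\<in>S. hc n x)) = cls (\<Sum>n\<in>S. sc (h powi n) * hc n x)" for S
  proof (induction S rule: infinite_finite_induct)
    case (insert n S)
    have "f (cls (hc n x)) = (h powi n) \<odot>\<^bsub>LA\<^esub> cls (hc n x)"
      using f cls_hc_component[OF x(1)] unfolding torus_map_def by blast
    then have "f (cls (hc n x)) = cls (sc (h powi n) * hc n x)" using x(1) by (simp add: smult_LA)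
    moreover have "(\<Sum>n\<in>S. hc n x) \<in> F0" "(\<Sum>n\<in>S. sc (h powi n) * hc n x) \<in> F0" using x(1) by (auto intro!: F0_sum)
    ultimately show ?case using insert x(1) add[of "hc n x" "\<Sum>n\<in>S. hc n x"]
      by (simp add: add_LA)
  qed (simp_all add: 0)
  from this[of "word_degree ` Poly_Mapping.keys x"] show "f X = torus_LA h X"
    using x by (simp add: sum_hc torus_LA_cls torus_sum)
qed

lemma torus_map_ex1: "\<exists>!f. torus_map E (h :: 'k) f"
  using torus_map_LA torus_map_unique by (intro ex1I[of _ "torus_LA h"])

lemma torus_action_eq: "torus_action E h = torus_LA h"
  unfolding torus_action_def using torus_map_LA torus_map_unique by (intro the_equality)

lemma automorphism_action_torus: "automorphism_action LA (torus_action E)"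
  unfolding automorphism_action_def torus_action_eq
proof (intro conjI allI impI ballI)
  fix h :: 'k assume h: "h \<noteq> 0"
  have hom: "algebra_hom LA LA (torus_LA h)"
    using torus_map_LA h unfolding algebra_hom_def torus_map_def
    by (auto simp: carrier_LA mult_LA torus_LA_cls torus_mult F0_U)
  have inv: "torus_LA g (torus_LA h X) = X" if "g * h = 1" "X \<in> carrier LA" for g h :: 'k and X
  proof -
    have "g \<noteq> 0" "h \<noteq> 0" using that by auto
    then show ?thesis using that torus_torus[of g h] by (auto simp: carrier_LA torus_LA_cls torus_1)
  qed
  have "bij_betw (torus_LA h) (carrier LA) (carrier LA)"
    using h inv[of "inverse h" h] inv[of h "inverse h"]
    by (intro bij_betw_byWitness[where f' = "torus_LA (inverse h)"]) (auto simp: carrier_LA torus_LA_cls)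
  with hom show "algebra_automorphism LA (torus_LA h)" by (simp add: algebra_automorphism_def)
qed (auto simp: carrier_LA torus_LA_cls torus_1 torus_torus)

text \<open>A Vandermonde argument without determinants: acting with \<open>g\<close> and subtracting \<open>g\<^sup>m\<close> times the
  given sum removes the component of degree \<open>m\<close>.\<close>

lemma components_from_torus:
  assumes inf: "infinite (UNIV :: 'k set)" and I: "idl I"
    and "finite D" "\<And>n. n \<in> D \<Longrightarrow> y n \<in> F0" "\<And>h. h \<noteq> 0 \<Longrightarrow> (\<Sum>n\<in>D. sc (h powi n) * y n) \<in> I" "n \<in> D"
  shows "y n \<in> I"
  using assms(3-)
proof (induction D arbitrary: y n rule: finite_induct)
  case (insert m D)
  obtain g :: 'k where g: "g \<noteq> 0" "\<And>n. n \<in> D \<Longrightarrow> g powi (n - m) \<noteq> 1"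
  proof -
    have "(0::int) \<notin> (\<lambda>n. n - m) ` D" using insert.hyps by auto
    then show ?thesis using exists_generic_scalar[OF inf, of "(\<lambda>n. n - m) ` D"] insert.hyps that by auto
  qed
  have gm: "g powi n - g powi m \<noteq> 0" if "n \<in> D" for n
    using g(2)[OF that] g(1) by (auto simp: power_int_diff)
  define z where "z n = sc (g powi n - g powi m) * y n" for n
  have "(\<Sum>n\<in>D. sc (h powi n) * z n) \<in> I" if h: "h \<noteq> 0" for h
  proof -
    let ?S = "\<lambda>h. \<Sum>n\<in>insert m D. sc (h powi n) * y n"
    have "?S (g * h) - sc (g powi m) * ?S h \<in> I"
      using insert.prems(2) g(1) h by (intro idl_minus[OF I] idl_l[OF I]) auto
    also have "?S (g * h) - sc (g powi m) * ?S h = (\<Sum>n\<in>insert m D. sc (h powi n) * z n)"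
      unfolding sum_distrib_left sum_subtractf[symmetric] z_def
    proof (rule sum.cong[OF refl])
      fix n
      have "sc ((g * h) powi n) * y n - sc (g powi m) * (sc (h powi n) * y n)
          = sc ((g * h) powi n - g powi m * h powi n) * y n"
        by (simp add: single_diff left_diff_distrib mult.assoc[symmetric] sc_mult)
      also have "(g * h) powi n - g powi m * h powi n = h powi n * (g powi n - g powi m)"
        using g(1) h by (simp add: power_int_mult_distrib algebra_simps)
      finally show "sc ((g * h) powi n) * y n - sc (g powi m) * (sc (h powi n) * y n)
          = sc (h powi n) * (sc (g powi n - g powi m) * y n)"
        by (simp add: mult.assoc[symmetric] sc_mult)
    qed
    also have "\<dots> = (\<Sum>n\<in>D. sc (h powi n) * z n)"
      using insert.hyps by (simp add: z_def)
    finally show ?thesis .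
  qed
  then have "z n \<in> I" if "n \<in> D" for n
    using insert.IH[of z] insert.prems(1) that by (auto simp: z_def)
  then have yD: "y n \<in> I" if "n \<in> D" for n
    using idl_scD[OF I _ gm[OF that], of "y n"] that unfolding z_def by blast
  \<comment> \<open>The scalar \<open>h = 1\<close> gives the plain sum; removing the components
    already found leaves \<open>y m\<close>.\<close>
  have "(\<Sum>n\<in>insert m D. y n) \<in> I" using insert.prems(2)[of 1] by simp
  then have "(\<Sum>n\<in>insert m D. y n) - (\<Sum>n\<in>D. y n) \<in> I"
    by (rule idl_minus[OF I _ idl_sum[OF I yD]])
  then have "y m \<in> I" using insert.hyps by simp
  then show ?case using insert.prems(3) yD by blast
qed simp

lemma H_prime_LA_iff:
  assumes inf: "infinite (UNIV :: 'k set)"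
  shows "H_prime LA (torus_action E) P \<longleftrightarrow> (\<exists>I. prime_idl I \<and> graded I \<and> P = cls ` I)"
proof
  assume H: "H_prime LA (torus_action E) P"
  then have "\<exists>I. prime_idl I \<and> P = cls ` I" by (simp add: H_prime_def prime_LA_iff)
  then obtain I where I: "prime_idl I" "P = cls ` I" by blast
  then have I: "prime_idl I" "idl I" "P = cls ` I" by (auto simp: prime_idl_def)
  have t: "torus h x \<in> I" if "h \<noteq> 0" "x \<in> I" for h x
  proof -
    have "torus_LA h (cls x) \<in> cls ` I" using H that unfolding H_prime_def torus_action_eq I(3) by blast
    then show ?thesis using cls_mem[OF I(2)] idl_sub[OF I(2) that(2)] by (simp add: torus_LA_cls)
  qed
  have "hc n x \<in> I" if x: "x \<in> I" for n x
  proof (cases "n \<in> word_degree ` Poly_Mapping.keys x")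
    case True
    show ?thesis
      by (rule components_from_torus[OF inf I(2), where D = "word_degree ` Poly_Mapping.keys x"])
        (use True x t idl_sub[OF I(2) x] in \<open>auto simp: torus_sum[symmetric]\<close>)
  next
    case False
    then show ?thesis using idl_0[OF I(2)] by (simp add: hc_outside)
  qed
  then show "\<exists>I. prime_idl I \<and> graded I \<and> P = cls ` I" using I unfolding graded_def by blast
next
  assume "\<exists>I. prime_idl I \<and> graded I \<and> P = cls ` I"
  then obtain I where I: "prime_idl I" "graded I" "P = cls ` I" by blast
  have i: "idl I" using I(1) by (simp add: prime_idl_def)
  have "prime_two_sided_ideal LA P" using I prime_LA_iff by blast
  moreover have "torus_action E h ` P \<subseteq> P" for h
  proof
    fix X assume "X \<in> torus_action E h ` P"
    then obtain x where x: "x \<in> I" "X = torus_LA h (cls x)" unfolding torus_action_eq I(3) by blast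
    then show "X \<in> P" using torus_graded[OF i I(2) x(1)] idl_sub[OF i x(1)] I(3) by (simp add: torus_LA_cls)
  qed
  ultimately show "H_prime LA (torus_action E) P" unfolding H_prime_def by blast
qed

section \<open>Primitive ideals\<close>

text \<open>A class acts through a chosen representative; \<open>chen_smult\<close> shows
  independence of the choice, as \<open>N\<close> annihilates the functions in
  \<open>chen p\<close>.\<close>

definition chen_module :: "(nat \<Rightarrow> 'e + 'v) \<Rightarrow> (('v, 'e, 'k) lpa_elem, (nat \<Rightarrow> 'e + 'v) \<Rightarrow> 'k) module" where
  "chen_module p = \<lparr>carrier = chen p, monoid.mult = (\<lambda>\<phi> \<psi>. \<phi>), one = (\<lambda>q. 0), zero = (\<lambda>q. 0),
     add = (\<lambda>\<phi> \<psi> q. \<phi> q + \<psi> q), module.smult = (\<lambda>X \<phi>. act \<phi> (SOME x. x \<in> F0 \<and> cls x = X))\<rparr>"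

lemma chen_module_simps [simp]: "carrier (chen_module p) = chen p" "\<zero>\<^bsub>chen_module p\<^esub> = (\<lambda>q. 0)"
  "\<phi> \<oplus>\<^bsub>chen_module p\<^esub> \<psi> = (\<lambda>q. \<phi> q + \<psi> q)"
  by (simp_all add: chen_module_def)

lemma chen_smult:
  assumes "x \<in> F0" "\<phi> \<in> chen p"
  shows "cls x \<odot>\<^bsub>chen_module p\<^esub> \<phi> = act \<phi> x"
proof -
  let ?y = "SOME y. y \<in> F0 \<and> cls y = cls x"
  have "?y \<in> F0 \<and> cls ?y = cls x" by (rule someI[of _ x]) (simp add: assms)
  then have "?y - x \<in> chen_ann p" using idl_N_sub[OF chen_ann_idl] by (simp add: cls_eq_iff eqm_def)
  then have "act \<phi> ?y q = act \<phi> x q" for q using assms(2) by (auto simp: chen_ann_def act_minus)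
  then show ?thesis by (auto simp: chen_module_def)
qed

lemma chen_abelian_group: "abelian_group (chen_module p)"
proof (rule abelian_groupI)
  fix \<phi> assume "\<phi> \<in> carrier (chen_module p)"
  then show "\<exists>\<psi>\<in>carrier (chen_module p). \<psi> \<oplus>\<^bsub>chen_module p\<^esub> \<phi> = \<zero>\<^bsub>chen_module p\<^esub>"
    using chen_scale[of \<phi> p "- 1"] by (intro bexI[of _ "\<lambda>q. - 1 * \<phi> q"]) auto
qed (auto simp: chen_add algebra_simps)

lemma chen_right_module: "right_module LA (chen_module p)"
  unfolding right_module_def
proof (intro conjI ballI chen_abelian_group)
  fix X \<phi> assume "X \<in> carrier LA" and \<phi>: "\<phi> \<in> carrier (chen_module p)"
  then obtain x where x: "x \<in> F0" "X = cls x" by (auto simp: carrier_LA)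
  show "X \<odot>\<^bsub>chen_module p\<^esub> \<phi> \<in> carrier (chen_module p)"
    using x \<phi> chen_act[OF _ F0_U] by (simp add: chen_smult)
  show "X \<odot>\<^bsub>chen_module p\<^esub> (\<phi> \<oplus>\<^bsub>chen_module p\<^esub> \<psi>) = X \<odot>\<^bsub>chen_module p\<^esub> \<phi> \<oplus>\<^bsub>chen_module p\<^esub> X \<odot>\<^bsub>chen_module p\<^esub> \<psi>"
    if "\<psi> \<in> carrier (chen_module p)" for \<psi>
    using x \<phi> that by (auto simp: chen_smult chen_add act_plus)
next
  fix X Y \<phi> assume "X \<in> carrier LA" "Y \<in> carrier LA" and \<phi>: "\<phi> \<in> carrier (chen_module p)"
  then obtain x y where x: "x \<in> F0" "X = cls x" "y \<in> F0" "Y = cls y" by (auto simp: carrier_LA)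
  show "(X \<oplus>\<^bsub>LA\<^esub> Y) \<odot>\<^bsub>chen_module p\<^esub> \<phi> = X \<odot>\<^bsub>chen_module p\<^esub> \<phi> \<oplus>\<^bsub>chen_module p\<^esub> Y \<odot>\<^bsub>chen_module p\<^esub> \<phi>"
    using x \<phi> by (auto simp: chen_smult add_LA act_add)
  show "(X \<otimes>\<^bsub>LA\<^esub> Y) \<odot>\<^bsub>chen_module p\<^esub> \<phi> = Y \<odot>\<^bsub>chen_module p\<^esub> (X \<odot>\<^bsub>chen_module p\<^esub> \<phi>)"
    using x \<phi> by (auto simp: chen_smult mult_LA F0_U chen_act act_mult)
qed

lemma chen_simple:
  assumes p: "ipath p"
  shows "simple_right_module LA (chen_module p)"
  unfolding simple_right_module_def
proof (intro conjI allI impI chen_right_module)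
  have t: "p \<in> tail_class p" using p by (auto simp: tail_class_def)
  have v: "isrc p \<in> verts E" using isrc_verts[OF p] by blast
  have "act (delta p) (vx (isrc p)) p = 1" by (simp add: act_letter)
  then have "cls (vx (isrc p)) \<odot>\<^bsub>chen_module p\<^esub> delta p \<noteq> (\<lambda>q. 0)"
    unfolding chen_smult[OF gen_F0(1)[OF v] delta_chen[OF t]] by (metis zero_neq_one)
  then show "\<exists>a\<in>carrier LA. \<exists>m\<in>carrier (chen_module p). a \<odot>\<^bsub>chen_module p\<^esub> m \<noteq> \<zero>\<^bsub>chen_module p\<^esub>"
    using v delta_chen[OF t] by (auto simp: carrier_LA)
  fix W assume W: "right_submodule LA (chen_module p) W"
  show "W = {\<zero>\<^bsub>chen_module p\<^esub>} \<or> W = carrier (chen_module p)"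
  proof (cases "W \<subseteq> {\<lambda>q. 0}")
    case True
    have "(\<lambda>q. 0) \<in> W" using W additive_subgroup.zero_closed unfolding right_submodule_def by fastforce
    then show ?thesis using True by auto
  next
    case False
    then obtain \<phi> where \<phi>: "\<phi> \<in> W" "\<phi> \<noteq> (\<lambda>q. 0)" by blast
    then obtain q where q: "\<phi> q \<noteq> 0" by auto
    have sub: "W \<subseteq> chen p" using W additive_subgroup.a_subset unfolding right_submodule_def by fastforce
    have "\<psi> \<in> W" if \<psi>: "\<psi> \<in> chen p" for \<psi>
    proof -
      obtain x where x: "x \<in> F0" "act \<phi> x = \<psi>" using chen_transitive[OF subsetD[OF sub \<phi>(1)] q \<psi>] by blast
      then have "cls x \<odot>\<^bsub>chen_module p\<^esub> \<phi> \<in> W" using W \<phi>(1) unfolding right_submodule_def carrier_LA by blast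
      then show ?thesis using x \<phi>(1) sub chen_smult[OF x(1), of \<phi> p] by auto
    qed
    then show ?thesis using sub by auto
  qed
qed

lemma chen_annihilator: "right_annihilator LA (chen_module p) = cls ` chen_ann p"
proof (intro equalityI subsetI)
  fix X assume X: "X \<in> right_annihilator LA (chen_module p)"
  then obtain x where x: "x \<in> F0" "X = cls x" by (auto simp: right_annihilator_def carrier_LA)
  have "act \<phi> x q = 0" if "\<phi> \<in> chen p" for \<phi> q
  proof -
    have "X \<odot>\<^bsub>chen_module p\<^esub> \<phi> = (\<lambda>q. 0)" using X that by (simp add: right_annihilator_def)
    then show ?thesis using chen_smult[OF x(1) that] x(2) by simp
  qed
  then show "X \<in> cls ` chen_ann p" using x by (auto simp: chen_ann_def)
next
  fix X assume "X \<in> cls ` chen_ann p"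
  then obtain x where x: "x \<in> chen_ann p" "X = cls x" by blast
  have xF: "x \<in> F0" using x by (simp add: chen_ann_def)
  have "X \<odot>\<^bsub>chen_module p\<^esub> \<phi> = (\<lambda>q. 0)" if "\<phi> \<in> chen p" for \<phi>
    unfolding x(2) chen_smult[OF xF that] using x(1) that by (auto simp: chen_ann_def)
  then show "X \<in> right_annihilator LA (chen_module p)"
    using xF x(2) by (auto simp: right_annihilator_def carrier_LA)
qed

lemma chen_ann_primitive: "ipath p \<Longrightarrow> primitive_ideal LA (cls ` chen_ann p)"
  using rng.primitive_ideal_annihilator[OF rng_LA chen_simple] by (simp add: chen_annihilator)

text \<open>A simple faithful module over a ring with corner \<open>\<phi>(K[x, x\<inverse>])\<close> would give a simple faithful
  module over \<open>K[x, x\<inverse>]\<close>, in which \<open>x - 1\<close> is not invertible.\<close>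

lemma corner_not_primitive:
  assumes cm: "corner_map I e \<phi>"
  shows "\<not> primitive_ideal LA (cls ` I)"
proof
  assume "primitive_ideal LA (cls ` I)"
  then obtain W :: "(('v, 'e, 'k) lpa_elem, ('v, 'e, 'k) lpa_elem set) module"
    where W: "simple_right_module LA W" "cls ` I = right_annihilator LA W"
    unfolding primitive_ideal_def by blast
  note c = corner[OF cm]
  have eF [simp]: "e \<in> F0" "\<phi> f \<in> F0" "e \<in> U" "\<phi> f \<in> U" for f using c F0_U by auto
  interpret W: abelian_group W using W by (simp add: simple_right_module_def right_module_def)
  define star where "star n x = cls x \<odot>\<^bsub>W\<^esub> n" for n x
  have st_in [simp]: "star n x \<in> carrier W" if "x \<in> F0" "n \<in> carrier W" for x n
    using W(1) that by (simp add: simple_right_module_def right_module_def star_def carrier_LA)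
  have st_add: "star n (x + y) = star n x \<oplus>\<^bsub>W\<^esub> star n y" if "x \<in> F0" "y \<in> F0" "n \<in> carrier W" for x y n
    using W(1) that by (simp add: simple_right_module_def right_module_def star_def carrier_LA add_LA[symmetric])
  have st_mult: "star n (x * y) = star (star n x) y" if "x \<in> F0" "y \<in> F0" "n \<in> carrier W" for x y n
    using W(1) that by (simp add: simple_right_module_def right_module_def star_def carrier_LA mult_LA[symmetric])
  have st_ann: "x \<in> I \<longleftrightarrow> (\<forall>n\<in>carrier W. star n x = \<zero>\<^bsub>W\<^esub>)" if "x \<in> F0" for x
    using cls_mem[OF c(1) that] that unfolding W(2) by (simp add: right_annihilator_def star_def carrier_LA)
  have st_zero: "star n 0 = \<zero>\<^bsub>W\<^esub>" if "n \<in> carrier W" for n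
    using st_ann[of 0] idl_0[OF c(1)] that by simp
  have st_minus: "star n (x - y) = \<zero>\<^bsub>W\<^esub> \<Longrightarrow> star n x = star n y" if "x \<in> F0" "y \<in> F0" "n \<in> carrier W" for x y n
    using st_add[of "x - y" y n] that by simp
  have st_cong: "star n x = star n y" if "eqm I x y" "x \<in> F0" "y \<in> F0" "n \<in> carrier W" for x y n
    using that st_ann[of "x - y"] by (intro st_minus) (auto simp: eqm_def)
  have zero_star: "star \<zero>\<^bsub>W\<^esub> x = \<zero>\<^bsub>W\<^esub>" if "x \<in> F0" for x
    using st_mult[of 0 x "\<zero>\<^bsub>W\<^esub>"] that st_zero by simp
  \<comment> \<open>The multiples of \<open>m\<close> form a submodule, which is non-zero because of
    \<open>y0\<close> and therefore everything.\<close>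
  have cyclic: "\<exists>y\<in>F0. n = star m y" if m: "m \<in> carrier W" "y0 \<in> F0" "star m y0 \<noteq> \<zero>\<^bsub>W\<^esub>" and n: "n \<in> carrier W" for m y0 n
  proof -
    have "right_submodule LA W (star m ` F0)"
      unfolding right_submodule_def
    proof (intro conjI ballI)
      show "additive_subgroup (star m ` F0) W"
      proof (rule additive_subgroup.intro, rule W.add.subgroupI)
        show "star m ` F0 \<subseteq> carrier W" "star m ` F0 \<noteq> {}" using m by auto
        show "\<ominus>\<^bsub>W\<^esub> a \<in> star m ` F0" if a: "a \<in> star m ` F0" for a
        proof -
          obtain y where y: "y \<in> F0" "a = star m y" using a by blast
          have "star m (- y) \<oplus>\<^bsub>W\<^esub> star m y = \<zero>\<^bsub>W\<^esub>"
            using st_add[of "- y" y m] m y st_zero FA.uminus_in by simp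
          then have "\<ominus>\<^bsub>W\<^esub> a = star m (- y)" using W.minus_equality m y FA.uminus_in by simp
          then show ?thesis using y FA.uminus_in by blast
        qed
        show "a \<oplus>\<^bsub>W\<^esub> b \<in> star m ` F0" if "a \<in> star m ` F0" "b \<in> star m ` F0" for a b
          using that m by (auto simp: st_add[symmetric])
      qed
      fix X a assume "X \<in> carrier LA" "a \<in> star m ` F0"
      then obtain x y where "x \<in> F0" "X = cls x" "y \<in> F0" "a = star m y" by (auto simp: carrier_LA)
      then have "X \<odot>\<^bsub>W\<^esub> a = star m (y * x)" using st_mult[of y x m] m by (simp add: star_def)
      then show "X \<odot>\<^bsub>W\<^esub> a \<in> star m ` F0" using \<open>x \<in> F0\<close> \<open>y \<in> F0\<close> F0_U by auto
    qed
    then have "star m ` F0 = {\<zero>\<^bsub>W\<^esub>} \<or> star m ` F0 = carrier W"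
      using W(1) unfolding simple_right_module_def by blast
    then show ?thesis using m n by blast
  qed
  \<comment> \<open>The image of \<open>x - 1\<close>; it is not in the annihilator because \<phi>
    is injective modulo \<open>I\<close>.\<close>
  define d where "d = \<phi> laurent_X1"
  have d: "d \<in> F0" "d \<notin> I" using c(7) laurent_X1(2) by (auto simp: d_def)
  have ed: "eqm I (e * d) d" "eqm I (d * e) d" using corner_e[OF cm] by (auto simp: d_def)
  have ee: "eqm I (e * e) e" using c(5)[of 1 1] by (simp add: c(6))
  obtain n0 where n0: "n0 \<in> carrier W" "star n0 d \<noteq> \<zero>\<^bsub>W\<^esub>" using st_ann[OF d(1)] d(2) by blast
  \<comment> \<open>Passing to \<open>n1\<close> moves the vector into the part of the module fixed
    by \<open>e\<close>, on which the corner acts, without changing its image under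
    \<open>d\<close>.\<close>
  define n1 where "n1 = star n0 e"
  have n1: "n1 \<in> carrier W" using n0 by (simp add: n1_def)
  have n1d: "star n1 d = star n0 d"
    using st_mult[of e d n0] st_cong[OF ed(1)] d n0 F0_U by (simp add: n1_def)
  have n1e: "star n1 e = n1"
    using st_mult[of e e n0] st_cong[OF ee] n0 by (simp add: n1_def)
  have m: "star n1 d \<in> carrier W" "star n1 d \<noteq> \<zero>\<^bsub>W\<^esub>" using n1 d n0 n1d by auto
  have me: "star (star n1 d) e = star n1 d"
    using st_mult[of d e n1] st_cong[OF ed(2)] d n1 F0_U by simp
  \<comment> \<open>Simplicity inverts \<open>d\<close> at \<open>n1\<close>; after cutting to the
    corner the inverse is given by a Laurent polynomial \<open>g\<close>.\<close>
  obtain y where y: "y \<in> F0" "n1 = star (star n1 d) y"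
    using cyclic[OF m(1) eF(1) _ n1] me m(2) by auto
  obtain g where g: "eqm I (e * y * e) (\<phi> g)" using c(8) y F0_U by blast
  have "n1 = star (star (star n1 d) y) e" using n1e y(2) by simp
  also have "\<dots> = star (star (star n1 d) (e * y)) e" using st_mult[of e y "star n1 d"] me m y F0_U by simp
  also have "\<dots> = star (star n1 d) (e * y * e)" using st_mult[of "e * y" e "star n1 d"] m y F0_U by simp
  also have "\<dots> = star (star n1 d) (\<phi> g)" using st_cong[OF g] m y F0_U by simp
  also have "\<dots> = star n1 (d * \<phi> g)" using st_mult[of d "\<phi> g" n1] n1 d by simp
  also have "\<dots> = star n1 (\<phi> (laurent_X1 * g))" using st_cong[OF c(5)] n1 by (simp add: d_def)
  finally have n1X: "star n1 (\<phi> 1) = star n1 (\<phi> (laurent_X1 * g))" using n1e by (simp add: c(6))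
  \<comment> \<open>This polynomial annihilates \<open>n1\<close>. Since \<open>n1\<close> generates
    the module and the corner is commutative, it annihilates every vector, so it must be zero;
    evaluation at \<open>1\<close> contradicts that.\<close>
  define h where "h = 1 - laurent_X1 * g"
  have "star n1 (\<phi> h) \<oplus>\<^bsub>W\<^esub> star n1 (\<phi> (laurent_X1 * g)) = star n1 (\<phi> (laurent_X1 * g))"
    using st_add[of "\<phi> h" "\<phi> (laurent_X1 * g)" n1] n1 n1X c(4)[of h "laurent_X1 * g"]
    by (simp add: h_def)
  then have n1h: "star n1 (\<phi> h) = \<zero>\<^bsub>W\<^esub>" using n1 W.add.r_cancel_one[of "star n1 (\<phi> (laurent_X1 * g))" "star n1 (\<phi> h)"] by simp
  have "star n (\<phi> h) = \<zero>\<^bsub>W\<^esub>" if n: "n \<in> carrier W" for n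
  proof -
    obtain b where b: "b \<in> F0" "n = star n1 b" using cyclic[OF n1 d(1) m(2) n] by blast
    obtain b' where b': "eqm I (e * b * e) (\<phi> b')" using c(8) b F0_U by blast
    have "star n e = star (star (star n1 e) b) e" using b n1e by simp
    also have "\<dots> = star n1 (e * b * e)" using b n1 F0_U by (simp add: st_mult)
    also have "\<dots> = star n1 (\<phi> b')" using st_cong[OF b'] n1 b F0_U by simp
    finally have ne: "star n e = star n1 (\<phi> b')" .
    have "star n (\<phi> h) = star n (e * \<phi> h)" using st_cong[OF corner_e(1)[OF cm]] n by simp
    also have "\<dots> = star (star n e) (\<phi> h)" using n by (simp add: st_mult)
    also have "\<dots> = star n1 (\<phi> b' * \<phi> h)" using n1 by (simp add: ne st_mult)
    also have "\<dots> = star n1 (\<phi> (h * b'))" using st_cong[OF c(5)[of b' h]] n1 by (simp add: mult.commute)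
    also have "\<dots> = star n1 (\<phi> h * \<phi> b')" using st_cong[OF c(5)[of h b']] n1 by simp
    also have "\<dots> = \<zero>\<^bsub>W\<^esub>" using n1 by (simp add: st_mult n1h zero_star)
    finally show ?thesis .
  qed
  then have "\<phi> h \<in> I" using st_ann by simp
  then have "h = 0" by (simp add: c(7))
  moreover have "laurent_one h = 1"
    by (simp add: h_def laurent_one_minus laurent_one_mult laurent_one_1 laurent_X1)
  ultimately show False by (simp add: laurent_one_simps)
qed

end

section \<open>Tensor products\<close>

locale tensor_setup =
  fixes A :: "('k::field, 'a) module" and B :: "('k, 'b) module"
  assumes multA: "\<lbrakk>a \<in> carrier A; a' \<in> carrier A\<rbrakk> \<Longrightarrow> a \<otimes>\<^bsub>A\<^esub> a' \<in> carrier A"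
    and multB: "\<lbrakk>b \<in> carrier B; b' \<in> carrier B\<rbrakk> \<Longrightarrow> b \<otimes>\<^bsub>B\<^esub> b' \<in> carrier B"
    and addA: "\<lbrakk>a \<in> carrier A; a' \<in> carrier A\<rbrakk> \<Longrightarrow> a \<oplus>\<^bsub>A\<^esub> a' \<in> carrier A"
    and addB: "\<lbrakk>b \<in> carrier B; b' \<in> carrier B\<rbrakk> \<Longrightarrow> b \<oplus>\<^bsub>B\<^esub> b' \<in> carrier B"
    and smultA: "a \<in> carrier A \<Longrightarrow> c \<odot>\<^bsub>A\<^esub> a \<in> carrier A"
    and smultB: "b \<in> carrier B \<Longrightarrow> c \<odot>\<^bsub>B\<^esub> b \<in> carrier B"
begin

lemma pairs_mult: "p \<otimes>\<^bsub>pairs_algebra A B\<^esub> q = (\<Sum>u\<in>Poly_Mapping.keys p. \<Sum>w\<in>Poly_Mapping.keys q.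
    Poly_Mapping.single (fst u \<otimes>\<^bsub>A\<^esub> fst w, snd u \<otimes>\<^bsub>B\<^esub> snd w) (Poly_Mapping.lookup p u * Poly_Mapping.lookup q w))"
  by (simp add: pairs_algebra_def case_prod_unfold)

lemma pairs_mult_single:
  "Poly_Mapping.single (a, b) c \<otimes>\<^bsub>pairs_algebra A B\<^esub> Poly_Mapping.single (a', b') d
   = Poly_Mapping.single (a \<otimes>\<^bsub>A\<^esub> a', b \<otimes>\<^bsub>B\<^esub> b') (c * d)"
  by (cases "c = 0"; cases "d = 0") (simp_all add: pairs_mult)

lemma carrier_pairs: "p \<in> carrier (pairs_algebra A B) \<longleftrightarrow> Poly_Mapping.keys p \<subseteq> carrier A \<times> carrier B"
  by (simp add: pairs_algebra_def)

lemma pairs_pm_algebra: "pm_algebra (pairs_algebra A B)"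
proof
  show "add (pairs_algebra A B) = (+)" "zero (pairs_algebra A B) = 0" "module.smult (pairs_algebra A B) = pm_scale"
    by (simp_all add: pairs_algebra_def)
  show "0 \<in> carrier (pairs_algebra A B)" by (simp add: carrier_pairs)
  fix p q r :: "('a \<times> 'b) \<Rightarrow>\<^sub>0 'k"
  show "p \<in> carrier (pairs_algebra A B) \<Longrightarrow> pm_scale c p \<in> carrier (pairs_algebra A B)" for c
    by (auto simp: carrier_pairs in_keys_iff subset_iff)
  assume p: "p \<in> carrier (pairs_algebra A B)" and q: "q \<in> carrier (pairs_algebra A B)"
  show "p + q \<in> carrier (pairs_algebra A B)"
    using p q keys_add[of p q] unfolding carrier_pairs by blast
  show "p \<otimes>\<^bsub>pairs_algebra A B\<^esub> q \<in> carrier (pairs_algebra A B)"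
    unfolding carrier_pairs pairs_mult
  proof (rule subset_trans[OF keys_sum], rule UN_least, rule subset_trans[OF keys_sum], rule UN_least)
    fix u w assume "u \<in> Poly_Mapping.keys p" "w \<in> Poly_Mapping.keys q"
    then have "u \<in> carrier A \<times> carrier B" "w \<in> carrier A \<times> carrier B" using p q by (auto simp: carrier_pairs)
    then show "Poly_Mapping.keys (Poly_Mapping.single (fst u \<otimes>\<^bsub>A\<^esub> fst w, snd u \<otimes>\<^bsub>B\<^esub> snd w)
        (Poly_Mapping.lookup p u * Poly_Mapping.lookup q w)) \<subseteq> carrier A \<times> carrier B"
      using multA multB by (cases u; cases w) (simp add: keys_single)
  qed
  show "(p + q) \<otimes>\<^bsub>pairs_algebra A B\<^esub> r = p \<otimes>\<^bsub>pairs_algebra A B\<^esub> r + q \<otimes>\<^bsub>pairs_algebra A B\<^esub> r"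
    unfolding pairs_mult
    by (rule setsum_keys_plus_distrib) (simp_all add: distrib_right single_add sum.distrib)
  have "(\<Sum>w\<in>Poly_Mapping.keys (p + q). Poly_Mapping.single (fst u \<otimes>\<^bsub>A\<^esub> fst w, snd u \<otimes>\<^bsub>B\<^esub> snd w) (c * Poly_Mapping.lookup (p + q) w))
     = (\<Sum>w\<in>Poly_Mapping.keys p. Poly_Mapping.single (fst u \<otimes>\<^bsub>A\<^esub> fst w, snd u \<otimes>\<^bsub>B\<^esub> snd w) (c * Poly_Mapping.lookup p w))
     + (\<Sum>w\<in>Poly_Mapping.keys q. Poly_Mapping.single (fst u \<otimes>\<^bsub>A\<^esub> fst w, snd u \<otimes>\<^bsub>B\<^esub> snd w) (c * Poly_Mapping.lookup q w))" for u c
    by (rule setsum_keys_plus_distrib) (simp_all add: distrib_left single_add)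
  then show "r \<otimes>\<^bsub>pairs_algebra A B\<^esub> (p + q) = r \<otimes>\<^bsub>pairs_algebra A B\<^esub> p + r \<otimes>\<^bsub>pairs_algebra A B\<^esub> q"
    unfolding pairs_mult by (simp add: sum.distrib)
qed

sublocale PA: pm_algebra "pairs_algebra A B"
  by (rule pairs_pm_algebra)

lemma single_pairs: "\<lbrakk>a \<in> carrier A; b \<in> carrier B\<rbrakk> \<Longrightarrow> Poly_Mapping.single (a, b) c \<in> carrier (pairs_algebra A B)"
  by (simp add: carrier_pairs)

lemma bilinear_carrier: "bilinear_relations A B \<subseteq> carrier (pairs_algebra A B)"
  unfolding bilinear_relations_def
  using single_pairs addA addB smultA smultB by (auto intro!: PA.minus_in)

lemma tensor_ideal_algebra_ideal: "algebra_ideal (tensor_ideal A B) (pairs_algebra A B)"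
  unfolding tensor_ideal_def by (rule PA.algebra_ideal_generated[OF bilinear_carrier])

lemmas TI = PA.ideal_facts[OF tensor_ideal_algebra_ideal]

lemma tensor_rel_add:
  assumes "a \<in> carrier A" "a' \<in> carrier A" "b \<in> carrier B"
  shows "Poly_Mapping.single (a \<oplus>\<^bsub>A\<^esub> a', b) 1 - (Poly_Mapping.single (a, b) 1 + Poly_Mapping.single (a', b) 1) \<in> tensor_ideal A B"
proof -
  have "Poly_Mapping.single (a \<oplus>\<^bsub>A\<^esub> a', b) 1 - Poly_Mapping.single (a, b) 1 - Poly_Mapping.single (a', b) 1 \<in> bilinear_relations A B"
    unfolding bilinear_relations_def using assms by blast
  then show ?thesis unfolding tensor_ideal_def using PA.generated_superset by (auto simp: diff_diff_add)
qed

lemma tensor_rel_scale: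
  assumes "a \<in> carrier A" "b \<in> carrier B"
  shows "Poly_Mapping.single (c \<odot>\<^bsub>A\<^esub> a, b) 1 - Poly_Mapping.single (a, b) c \<in> tensor_ideal A B"
proof -
  have "Poly_Mapping.single (c \<odot>\<^bsub>A\<^esub> a, b) 1 - Poly_Mapping.single (a, b) c \<in> bilinear_relations A B"
    unfolding bilinear_relations_def using assms by blast
  then show ?thesis unfolding tensor_ideal_def using PA.generated_superset by blast
qed

definition eqt :: "('a \<times> 'b \<Rightarrow>\<^sub>0 'k) \<Rightarrow> ('a \<times> 'b \<Rightarrow>\<^sub>0 'k) \<Rightarrow> bool" where
  "eqt p q \<longleftrightarrow> p - q \<in> tensor_ideal A B"

abbreviation tcls :: "('a \<times> 'b \<Rightarrow>\<^sub>0 'k) \<Rightarrow> ('a \<times> 'b \<Rightarrow>\<^sub>0 'k) set" where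
  "tcls p \<equiv> tensor_ideal A B +>\<^bsub>pairs_algebra A B\<^esub> p"

lemma tcls_eq_iff: "tcls p = tcls q \<longleftrightarrow> eqt p q"
  unfolding eqt_def by (rule PA.coset_eq_iff[OF tensor_ideal_algebra_ideal])

lemma eqt_refl: "eqt p p" and eqt_sym: "eqt p q \<Longrightarrow> eqt q p"
  and eqt_trans [trans]: "eqt p q \<Longrightarrow> eqt q r \<Longrightarrow> eqt p r"
  unfolding tcls_eq_iff[symmetric] by auto

lemma eqt_add: "eqt p p' \<Longrightarrow> eqt q q' \<Longrightarrow> eqt (p + q) (p' + q')"
  using TI(3)[of "p - p'" "q - q'"] by (simp add: eqt_def algebra_simps)

lemma eqt_sum: "(\<And>i. i \<in> S \<Longrightarrow> eqt (f i) (g i)) \<Longrightarrow> eqt (sum f S) (sum g S)"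
  by (induction S rule: infinite_finite_induct) (auto intro: eqt_add eqt_refl)

lemmas eqt_mult = PA.mult_cong[OF tensor_ideal_algebra_ideal, folded eqt_def]
lemmas tensor_quotient =
  PA.carrier_quotient[OF tensor_ideal_algebra_ideal, folded tensor_algebra_def]
  PA.add_quotient[OF tensor_ideal_algebra_ideal, folded tensor_algebra_def]
  PA.mult_quotient[OF tensor_ideal_algebra_ideal, folded tensor_algebra_def]
  PA.smult_quotient[OF tensor_ideal_algebra_ideal, folded tensor_algebra_def]
  PA.finsum_quotient[OF tensor_ideal_algebra_ideal, folded tensor_algebra_def]

end

context leavitt
begin

section \<open>The torus action is rational\<close>

abbreviation LK :: "('k, int \<Rightarrow>\<^sub>0 'k) module" where "LK \<equiv> laurent_algebra"

sublocale T: tensor_setup LA LK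
  by standard (auto simp: carrier_LA mult_LA add_LA smult_LA F0_U laurent_algebra_def)

text \<open>Represents the pure tensor of the component of degree \<open>n\<close> with the Laurent
  monomial of exponent \<open>n\<close>. Summed over \<open>n\<close>, these give the coaction
  belonging to the grading.\<close>

definition homog :: "int \<Rightarrow> ('v, 'e, 'k) lpa_free \<Rightarrow> (('v, 'e, 'k) lpa_elem \<times> (int \<Rightarrow>\<^sub>0 'k)) \<Rightarrow>\<^sub>0 'k" where
  "homog n x = Poly_Mapping.single (cls (hc n x), Poly_Mapping.single n 1) 1"

definition codiag :: "('v, 'e, 'k) lpa_free \<Rightarrow> (('v, 'e, 'k) lpa_elem \<times> (int \<Rightarrow>\<^sub>0 'k)) \<Rightarrow>\<^sub>0 'k" where
  "codiag x = (\<Sum>n\<in>word_degree ` Poly_Mapping.keys x. homog n x)"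

lemma cls_carrier [simp]: "x \<in> F0 \<Longrightarrow> cls x \<in> carrier LA"
  by (simp add: carrier_LA)

lemma LK_carrier [simp]: "f \<in> carrier LK"
  by (simp add: laurent_simps)

lemma homog_carrier [simp]: "x \<in> F0 \<Longrightarrow> homog n x \<in> carrier (pairs_algebra LA LK)"
  by (simp add: homog_def T.single_pairs)

lemma codiag_carrier [simp]: "x \<in> F0 \<Longrightarrow> codiag x \<in> carrier (pairs_algebra LA LK)"
  unfolding codiag_def by (intro T.PA.sum_in) simp

lemma homog_scale: "x \<in> F0 \<Longrightarrow> T.eqt (homog n (sc c * x)) (pm_scale c (homog n x))"
  using T.tensor_rel_scale[of "cls (hc n x)" "Poly_Mapping.single n 1" c]
  by (simp add: homog_def T.eqt_def hc_sc_mult smult_LA)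

lemma homog_zero: "hc n x = 0 \<Longrightarrow> T.eqt (homog n x) 0"
  using T.tensor_rel_scale[of "cls 0" "Poly_Mapping.single n 1" 0]
  by (simp add: homog_def T.eqt_def smult_LA)

lemma homog_add: "\<lbrakk>x \<in> F0; y \<in> F0\<rbrakk> \<Longrightarrow> T.eqt (homog n (x + y)) (homog n x + homog n y)"
  using T.tensor_rel_add[of "cls (hc n x)" "cls (hc n y)" "Poly_Mapping.single n 1"]
  by (simp add: homog_def T.eqt_def hc_add add_LA)

text \<open>A pair whose first entry is the zero class is not zero among the pairs. It lies in the
  tensor ideal by the scalar relation with factor \<open>0\<close>, so additional degrees change
  nothing modulo that ideal.\<close>

lemma codiag_superset:
  assumes "finite D" "word_degree ` Poly_Mapping.keys x \<subseteq> D"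
  shows "T.eqt (codiag x) (\<Sum>n\<in>D. homog n x)"
proof -
  have "T.eqt (\<Sum>n\<in>D - word_degree ` Poly_Mapping.keys x. homog n x) (\<Sum>n\<in>D - word_degree ` Poly_Mapping.keys x. 0)"
    by (intro T.eqt_sum homog_zero hc_outside) auto
  from T.eqt_add[OF T.eqt_refl this, of "codiag x"] show ?thesis
    using sum.subset_diff[OF assms(2,1), of "\<lambda>n. homog n x"]
    by (simp add: codiag_def add.commute T.eqt_sym)
qed

lemma codiag_cong:
  assumes "x \<in> F0" "y \<in> F0" "eqm N x y"
  shows "T.eqt (codiag x) (codiag y)"
proof -
  let ?D = "word_degree ` Poly_Mapping.keys x \<union> word_degree ` Poly_Mapping.keys y"
  have "homog n x = homog n y" for n
  proof -
    have "cls (hc n x) = cls (hc n y)" unfolding cls_eq_iff by (rule eqm_hc[OF assms(3)])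
    then show ?thesis by (simp add: homog_def)
  qed
  then have eq: "(\<Sum>n\<in>?D. homog n x) = (\<Sum>n\<in>?D. homog n y)" by (intro sum.cong refl)
  have x: "T.eqt (codiag x) (\<Sum>n\<in>?D. homog n x)" by (rule codiag_superset) auto
  have y: "T.eqt (codiag y) (\<Sum>n\<in>?D. homog n y)" by (rule codiag_superset) auto
  show ?thesis by (rule T.eqt_trans[OF x[unfolded eq] T.eqt_sym[OF y]])
qed

lemma codiag_add:
  assumes "x \<in> F0" "y \<in> F0"
  shows "T.eqt (codiag (x + y)) (codiag x + codiag y)"
proof -
  let ?D = "word_degree ` Poly_Mapping.keys x \<union> word_degree ` Poly_Mapping.keys y"
  have "word_degree ` Poly_Mapping.keys (x + y) \<subseteq> ?D" using keys_add[of x y] by blast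
  then have "T.eqt (codiag (x + y)) (\<Sum>n\<in>?D. homog n (x + y))" by (intro codiag_superset) auto
  also have "T.eqt \<dots> (\<Sum>n\<in>?D. homog n x + homog n y)" using assms by (intro T.eqt_sum homog_add)
  also have "(\<Sum>n\<in>?D. homog n x + homog n y) = (\<Sum>n\<in>?D. homog n x) + (\<Sum>n\<in>?D. homog n y)"
    by (rule sum.distrib)
  also have "T.eqt \<dots> (codiag x + codiag y)"
    by (intro T.eqt_add T.eqt_sym[OF codiag_superset]) auto
  finally show ?thesis .
qed

lemma codiag_scale:
  assumes "x \<in> F0"
  shows "T.eqt (codiag (sc c * x)) (pm_scale c (codiag x))"
proof -
  let ?D = "word_degree ` Poly_Mapping.keys x"
  have s: "pm_scale c (sum f S) = (\<Sum>i\<in>S. pm_scale c (f i))" for f :: "int \<Rightarrow> (('v, 'e, 'k) lpa_elem \<times> (int \<Rightarrow>\<^sub>0 'k)) \<Rightarrow>\<^sub>0 'k" and S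
    by (induction S rule: infinite_finite_induct) (auto simp: pm_scale_add)
  have "Poly_Mapping.keys (sc c * x) \<subseteq> Poly_Mapping.keys x"
    unfolding mult_map_scale_conv_mult[symmetric] by (auto simp: in_keys_iff)
  then have "T.eqt (codiag (sc c * x)) (\<Sum>n\<in>?D. homog n (sc c * x))" by (intro codiag_superset) auto
  also have "T.eqt \<dots> (\<Sum>n\<in>?D. pm_scale c (homog n x))" using assms by (intro T.eqt_sum homog_scale)
  also have "(\<Sum>n\<in>?D. pm_scale c (homog n x)) = pm_scale c (codiag x)" by (simp add: codiag_def s)
  finally show ?thesis .
qed

lemma codiag_0: "codiag 0 = 0"
  by (simp add: codiag_def)

lemma codiag_homogeneous:
  assumes "hc n x = x"
  shows "T.eqt (codiag x) (Poly_Mapping.single (cls x, Poly_Mapping.single n 1) 1)"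
  using codiag_superset[of "{n}" x] assms by (auto simp: homog_def hc_id_iff)

text \<open>For homogeneous factors both sides are a single pure tensor, since degrees and exponents
  add. Additivity extends this to an arbitrary second factor and then to an arbitrary first
  one.\<close>

lemma codiag_mult:
  assumes "x \<in> F0" "y \<in> F0"
  shows "T.eqt (codiag (x * y)) (codiag x \<otimes>\<^bsub>pairs_algebra LA LK\<^esub> codiag y)"
proof -
  let ?P = "pairs_algebra LA LK"
  have word: "T.eqt (codiag (x * y)) (codiag x \<otimes>\<^bsub>?P\<^esub> codiag y)"
    if x: "x \<in> F0" "hc m x = x" and y: "y \<in> F0" "hc n y = y" for x y m n
  proof -
    have "hc (m + n) (x * y) = x * y"
      using x(2) y(2) keys_mult[of x y] unfolding hc_id_iff by fastforce
    then have "T.eqt (codiag (x * y)) (Poly_Mapping.single (cls (x * y), Poly_Mapping.single (m + n) 1) 1)"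
      by (rule codiag_homogeneous)
    also have "Poly_Mapping.single (cls (x * y), Poly_Mapping.single (m + n) 1) 1
       = Poly_Mapping.single (cls x, Poly_Mapping.single m 1) 1 \<otimes>\<^bsub>?P\<^esub> Poly_Mapping.single (cls y, Poly_Mapping.single n 1) (1 :: 'k)"
      using x y by (simp add: T.pairs_mult_single mult_LA laurent_simps mult_single)
    also have "T.eqt \<dots> (codiag x \<otimes>\<^bsub>?P\<^esub> codiag y)"
      using x y by (intro T.eqt_mult codiag_carrier T.eqt_sym[OF codiag_homogeneous])
    finally show ?thesis .
  qed
  have single: "sc c * Poly_Mapping.single (FM ls) 1 \<in> F0"
    "hc (word_degree (FM ls)) (sc c * Poly_Mapping.single (FM ls) 1) = (sc c * Poly_Mapping.single (FM ls) 1 :: ('v, 'e, 'k) lpa_free)"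
    if "ls \<noteq> []" "set ls \<subseteq> gens" for c ls
    using that single_F0[of "FM ls" c] by (auto simp: mult_single hc_single zero_free_mon_def)
  have right: "T.eqt (codiag (x * y)) (codiag x \<otimes>\<^bsub>?P\<^esub> codiag y)"
    if x: "x \<in> F0" "hc m x = x" and y: "y \<in> F0" for x y m
    using y
  proof (induction y rule: F0_induct)
    case zero
    have "codiag x \<otimes>\<^bsub>?P\<^esub> 0 = 0" by (simp add: T.pairs_mult)
    then show ?case by (simp add: codiag_0 T.eqt_refl)
  next
    case (add y c ls)
    let ?w = "sc c * Poly_Mapping.single (FM ls) 1 :: ('v, 'e, 'k) lpa_free"
    note w = single[OF add.hyps(2,3), of c]
    have "T.eqt (codiag (x * (?w + y))) (codiag (x * ?w) + codiag (x * y))"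
      unfolding distrib_left using x w add.hyps(1) F0_U by (intro codiag_add) auto
    also have "T.eqt \<dots> (codiag x \<otimes>\<^bsub>?P\<^esub> codiag ?w + codiag x \<otimes>\<^bsub>?P\<^esub> codiag y)"
      by (intro T.eqt_add word[OF x w] add.IH)
    also have "codiag x \<otimes>\<^bsub>?P\<^esub> codiag ?w + codiag x \<otimes>\<^bsub>?P\<^esub> codiag y = codiag x \<otimes>\<^bsub>?P\<^esub> (codiag ?w + codiag y)"
      using x w add.hyps(1) by (simp add: T.PA.distr_r)
    also have "T.eqt \<dots> (codiag x \<otimes>\<^bsub>?P\<^esub> codiag (?w + y))"
      using x w add.hyps(1) by (intro T.eqt_mult T.eqt_refl T.eqt_sym[OF codiag_add]) auto
    finally show ?case .
  qed
  show ?thesis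
    using assms(1)
  proof (induction x rule: F0_induct)
    case zero
    have "0 \<otimes>\<^bsub>?P\<^esub> codiag y = 0" by (simp add: T.pairs_mult)
    then show ?case by (simp add: codiag_0 T.eqt_refl)
  next
    case (add x c ls)
    let ?w = "sc c * Poly_Mapping.single (FM ls) 1 :: ('v, 'e, 'k) lpa_free"
    note w = single[OF add.hyps(2,3), of c]
    have "T.eqt (codiag ((?w + x) * y)) (codiag (?w * y) + codiag (x * y))"
      unfolding distrib_right using assms(2) w add.hyps(1) F0_U by (intro codiag_add) auto
    also have "T.eqt \<dots> (codiag ?w \<otimes>\<^bsub>?P\<^esub> codiag y + codiag x \<otimes>\<^bsub>?P\<^esub> codiag y)"
      by (intro T.eqt_add right[OF w assms(2)] add.IH)
    also have "codiag ?w \<otimes>\<^bsub>?P\<^esub> codiag y + codiag x \<otimes>\<^bsub>?P\<^esub> codiag y = (codiag ?w + codiag x) \<otimes>\<^bsub>?P\<^esub> codiag y"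
      using assms(2) w add.hyps(1) by (simp add: T.PA.distr_l)
    also have "T.eqt \<dots> (codiag (?w + x) \<otimes>\<^bsub>?P\<^esub> codiag y)"
      using assms(2) w add.hyps(1) by (intro T.eqt_mult T.eqt_refl T.eqt_sym[OF codiag_add]) auto
    finally show ?case .
  qed
qed

definition coaction :: "('v, 'e, 'k) lpa_elem \<Rightarrow> ((('v, 'e, 'k) lpa_elem \<times> (int \<Rightarrow>\<^sub>0 'k)) \<Rightarrow>\<^sub>0 'k) set" where
  "coaction X = T.tcls (codiag (SOME x. x \<in> F0 \<and> cls x = X))"

lemma coaction_cls: "x \<in> F0 \<Longrightarrow> coaction (cls x) = T.tcls (codiag x)"
proof -
  assume x: "x \<in> F0"
  let ?y = "SOME y. y \<in> F0 \<and> cls y = cls x"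
  have "?y \<in> F0 \<and> cls ?y = cls x" by (rule someI[of _ x]) (simp add: x)
  then show ?thesis unfolding coaction_def T.tcls_eq_iff using x by (intro codiag_cong) (auto simp: cls_eq_iff)
qed

lemma coaction_hom: "algebra_hom LA (tensor_algebra LA LK) coaction"
  unfolding algebra_hom_def linear_map_def
proof (intro conjI ballI allI)
  show "coaction \<in> carrier LA \<rightarrow> carrier (tensor_algebra LA LK)"
    by (auto simp: carrier_LA coaction_cls T.tensor_quotient)
  fix X assume "X \<in> carrier LA"
  then obtain x where x: "x \<in> F0" "X = cls x" by (auto simp: carrier_LA)
  show "coaction (c \<odot>\<^bsub>LA\<^esub> X) = c \<odot>\<^bsub>tensor_algebra LA LK\<^esub> coaction X" for c
    using x codiag_scale by (simp add: smult_LA coaction_cls T.tensor_quotient T.tcls_eq_iff)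
  fix Y assume "Y \<in> carrier LA"
  then obtain y where y: "y \<in> F0" "Y = cls y" by (auto simp: carrier_LA)
  show "coaction (X \<oplus>\<^bsub>LA\<^esub> Y) = coaction X \<oplus>\<^bsub>tensor_algebra LA LK\<^esub> coaction Y"
    using x y codiag_add by (simp add: add_LA coaction_cls T.tensor_quotient T.tcls_eq_iff)
  show "coaction (X \<otimes>\<^bsub>LA\<^esub> Y) = coaction X \<otimes>\<^bsub>tensor_algebra LA LK\<^esub> coaction Y"
    using x y codiag_mult by (simp add: mult_LA coaction_cls T.tensor_quotient T.tcls_eq_iff F0_U)
qed

lemma rational_action_torus: "rational_action LA (torus_action E)"
  unfolding rational_action_def
proof (intro conjI automorphism_action_torus exI[of _ coaction] coaction_hom ballI)
  fix X assume "X \<in> carrier LA"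
  then obtain x where x: "x \<in> F0" "X = cls x" by (auto simp: carrier_LA)
  let ?D = "word_degree ` Poly_Mapping.keys x"
  \<comment> \<open>An enumeration of the degrees that occur, as the definition of a rational action
    indexes the tensors by numbers. The tensors are the components with the monomials of the same
    degree, and such a monomial evaluates at \<open>h\<close> to the matching power of
    \<open>h\<close>.\<close>
  obtain e where "bij_betw e {0..<card ?D} ?D" using ex_bij_betw_nat_finite[of ?D] by auto
  then have e: "bij_betw e {..<card ?D} ?D" by (simp add: atLeast0LessThan)
  define b where "b i = cls (hc (e i) x)" for i
  define f where "f i = (Poly_Mapping.single (e i) 1 :: int \<Rightarrow>\<^sub>0 'k)" for i
  have "(\<Oplus>\<^bsub>tensor_algebra LA LK\<^esub>i\<in>{..<card ?D}. pure_tensor LA LK (b i) (f i))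
      = T.tcls (\<Sum>i\<in>{..<card ?D}. homog (e i) x)"
    unfolding pure_tensor_def b_def f_def homog_def using x
    by (intro T.tensor_quotient(5)) (auto intro: T.single_pairs)
  also have "(\<Sum>i\<in>{..<card ?D}. homog (e i) x) = codiag x"
    unfolding codiag_def by (rule sum.reindex_bij_betw[OF e])
  finally have 1: "coaction X = (\<Oplus>\<^bsub>tensor_algebra LA LK\<^esub>i\<in>{..<card ?D}. pure_tensor LA LK (b i) (f i))"
    using x by (simp add: coaction_cls)
  have 2: "torus_action E h X = (\<Oplus>\<^bsub>LA\<^esub>i\<in>{..<card ?D}. laurent_eval (f i) h \<odot>\<^bsub>LA\<^esub> b i)" for h
  proof -
    have "laurent_eval (f i) h \<odot>\<^bsub>LA\<^esub> b i = cls (sc (h powi e i) * hc (e i) x)" for i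
      using x by (simp add: laurent_eval_def f_def b_def smult_LA)
    then have "(\<Oplus>\<^bsub>LA\<^esub>i\<in>{..<card ?D}. laurent_eval (f i) h \<odot>\<^bsub>LA\<^esub> b i)
        = (\<Oplus>\<^bsub>LA\<^esub>i\<in>{..<card ?D}. cls (sc (h powi e i) * hc (e i) x))" by simp
    also have "\<dots> = cls (\<Sum>i\<in>{..<card ?D}. sc (h powi e i) * hc (e i) x)"
      using x by (intro finsum_LA) auto
    also have "(\<Sum>i\<in>{..<card ?D}. sc (h powi e i) * hc (e i) x) = torus h x"
      unfolding torus_sum by (rule sum.reindex_bij_betw[OF e])
    finally show ?thesis using x by (simp add: torus_action_eq torus_LA_cls)
  qed
  show "\<exists>(n::nat) b f. b \<in> {..<n} \<rightarrow> carrier LA \<and>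
       coaction X = (\<Oplus>\<^bsub>tensor_algebra LA LK\<^esub>i\<in>{..<n}. pure_tensor LA LK (b i) (f i)) \<and>
       (\<forall>h. h \<noteq> 0 \<longrightarrow> torus_action E h X = (\<Oplus>\<^bsub>LA\<^esub>i\<in>{..<n}. laurent_eval (f i) h \<odot>\<^bsub>LA\<^esub> b i))"
    using 1 2 x by (intro exI[of _ "card ?D"] exI[of _ b] exI[of _ f]) (auto simp: b_def)
qed

end

section \<open>Strata\<close>

lemma (in rng) topspace_zariski: "topspace (zariski R) = prime_spectrum R"
proof -
  have "two_sided_ideal (carrier R) R"
    using rng_m_closed add.subgroup_self by (simp add: two_sided_ideal_def additive_subgroup_def)
  moreover have "\<not> carrier R \<subseteq> P" if "P \<in> prime_spectrum R" for P
    using that two_sided_idealD(2) by (fastforce simp: prime_spectrum_def prime_two_sided_ideal_def)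
  ultimately have "zariski_open R (prime_spectrum R)"
    unfolding zariski_open_def by blast
  moreover have "zariski_open R V \<Longrightarrow> V \<subseteq> prime_spectrum R" for V by (auto simp: zariski_open_def)
  ultimately show ?thesis unfolding topspace_def openin_zariski by blast
qed

lemma rng_laurent: "rng (laurent_algebra :: ('k::field, int \<Rightarrow>\<^sub>0 'k) module)"
  by (intro rng.intro pm_algebra.abelian_group_A[OF pm_algebra_laurent] rng_axioms.intro)
    (simp_all add: laurent_algebra_def algebra_simps)

context leavitt
begin

lemma vertex_ideal_subset_stratum:
  assumes M: "maximal_tail E M" and I: "prime_idl I" "verts_of I = verts E - M"
  shows "vertex_ideal (verts E - M) \<subseteq> I"
  using PM_least[OF M, of I] I by (auto simp: prime_idl_def)

text \<open>A prime over \<open>IM\<close> that contained some \<open>u\<close> of \<open>M\<close>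
  would contain \<open>v\<close>: a common successor of \<open>u\<close> and \<open>v\<close> in
  \<open>M\<close> leads back to \<open>v\<close> along the cycle, so \<open>u\<close> reaches
  \<open>v\<close>.\<close>

lemma stratum_corner_primes:
  assumes M: "maximal_tail E M" and v: "exitless M v" and cm: "corner_map (vertex_ideal (verts E - M)) (vx v) \<phi>"
  shows "{I. prime_idl I \<and> verts_of I = verts E - M} = corner_primes (vertex_ideal (verts E - M)) (vx v)"
proof (intro equalityI subsetI)
  fix I assume "I \<in> {I. prime_idl I \<and> verts_of I = verts E - M}"
  then have I: "prime_idl I" "verts_of I = verts E - M" by auto
  have "vx v \<notin> I" using I(2) v_in[OF M v] v_verts[OF M v] by (auto simp: verts_of_def)
  then show "I \<in> corner_primes (vertex_ideal (verts E - M)) (vx v)"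
    unfolding corner_primes_def[OF cm] using I vertex_ideal_subset_stratum[OF M] by blast
next
  fix I assume "I \<in> corner_primes (vertex_ideal (verts E - M)) (vx v)"
  then have I: "prime_idl I" "idl I" "vertex_ideal (verts E - M) \<subseteq> I" "vx v \<notin> I"
    unfolding corner_primes_def[OF cm] by (auto simp: prime_idl_def)
  have "verts E - M \<subseteq> verts_of I"
    using I(3) vx_PM[OF M] by (auto simp: verts_of_def)
  moreover have "u \<notin> M" if u: "u \<in> verts_of I" for u
  proof
    assume "u \<in> M"
    then obtain y where y: "y \<in> M" "v \<rightarrow>\<^sup>*\<^bsub>E\<^esub> y" "u \<rightarrow>\<^sup>*\<^bsub>E\<^esub> y"
      using tail_directed[OF M v_in[OF M v]] by (metis (no_types))
    obtain p where p: "path v p y" using reachable_path[OF y(2)] by (rule exE)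
    obtain q where q: "path u q y" using reachable_path[OF y(3)] by (rule exE)
    obtain d where d: "path y d v" using return_path[OF M v p y(1)] by (rule exE)
    have "path u (q @ d) v" using q d path_append by auto
    then have "vx v \<in> I" using idl_hereditary[OF I(2)] u by (auto simp: verts_of_def)
    then show False using I(4) by simp
  qed
  ultimately show "I \<in> {I. prime_idl I \<and> verts_of I = verts E - M}"
    using I(1) by (auto simp: verts_of_def)
qed

text \<open>The maps \<open>dn\<close> and \<open>up\<close> are mutually inverse between the
  stratum and the Laurent spectrum. The open set of an ideal \<open>J\<close> is pulled back to that
  of \<open>up J\<close>, and the open set of an ideal \<open>B\<close> of the algebra to that of
  \<open>dn B\<close>.\<close>

lemma stratum_homeomorphic:
  assumes M: "maximal_tail E M" and v: "exitless M v"
  shows "subtopology (zariski LA) (tail_stratum E M) homeomorphic_space zariski LK"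
proof -
  obtain \<phi> where cm: "corner_map (vertex_ideal (verts E - M)) (vx v) \<phi>" using exitless_corner_map[OF M v] by blast
  let ?I = "vertex_ideal (verts E - M)"
  define S where "S = corner_primes ?I (vx v)"
  define down where "down = dn ?I \<phi>"
  define upw where "upw = up ?I (vx v) \<phi>"
  have S: "tail_stratum E M = (\<lambda>I. cls ` I) ` S"
    unfolding tail_stratum_LA S_def stratum_corner_primes[OF M v cm] ..
  have Sid: "idl I" "prime_idl I" if "I \<in> S" for I
    using that unfolding S_def corner_primes_def[OF cm] by (auto simp: prime_idl_def)
  have spec: "(\<lambda>I. cls ` I) ` S \<subseteq> prime_spectrum LA" using Sid(2) by (auto simp: prime_spectrum_LA)
  have lspec: "J \<in> prime_spectrum LK \<longleftrightarrow> prime_two_sided_ideal LK J" for J by (simp add: prime_spectrum_def)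
  have lid: "two_sided_ideal J LK" if "J \<in> prime_spectrum LK" for J
    using that by (simp add: prime_spectrum_def prime_two_sided_ideal_def)
  have down: "down I \<in> prime_spectrum LK" if "I \<in> S" for I
    using dn_prime[OF cm] that by (simp add: lspec down_def S_def)
  have upw: "upw J \<in> S" if "J \<in> prime_spectrum LK" for J
    using up_prime[OF cm] that by (simp add: lspec upw_def S_def)
  have du: "down (upw J) = J" if "two_sided_ideal J LK" for J using dn_up[OF cm that] by (simp add: down_def upw_def)
  have ud: "upw (down I) = I" if "I \<in> S" for I using up_dn[OF cm] that by (simp add: down_def upw_def S_def)
  have topS: "topspace (subtopology (zariski LA) (tail_stratum E M)) = (\<lambda>I. cls ` I) ` S"
    using spec by (auto simp: rng.topspace_zariski[OF rng_LA] S)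
  have topL: "topspace (zariski LK) = prime_spectrum LK" by (rule rng.topspace_zariski[OF rng_laurent])
  define f where "f P = down (preimage P)" for P
  define g where "g J = cls ` upw J" for J
  have f: "f (cls ` I) = down I" if "I \<in> S" for I using preimage_image[OF Sid(1)[OF that]] by (simp add: f_def)
  have cont_f: "continuous_map (subtopology (zariski LA) (tail_stratum E M)) (zariski LK) f"
    unfolding continuous_map topS topL
  proof (intro conjI allI impI)
    show "f ` (\<lambda>I. cls ` I) ` S \<subseteq> prime_spectrum LK" using down f by auto
    fix V assume "openin (zariski LK) V"
    then obtain J where J: "two_sided_ideal J LK" "V = {Q \<in> prime_spectrum LK. \<not> J \<subseteq> Q}"
      unfolding rng.openin_zariski[OF rng_laurent] zariski_open_def by blast
    have ui: "idl (upw J)" using up_ideal(1)[OF cm J(1)] by (simp add: upw_def)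
    have "f (cls ` I) \<in> V \<longleftrightarrow> \<not> cls ` upw J \<subseteq> cls ` I" if I: "I \<in> S" for I
      using up_subset_iff[OF cm _ J(1), of I] I down[OF I] f[OF I] cls_image_subset_iff[OF ui Sid(1)[OF I]]
      by (simp add: J(2) S_def down_def upw_def)
    then have eq: "{P \<in> (\<lambda>I. cls ` I) ` S. f P \<in> V} = {P \<in> prime_spectrum LA. \<not> cls ` upw J \<subseteq> P} \<inter> (\<lambda>I. cls ` I) ` S"
      using spec by auto
    show "openin (subtopology (zariski LA) (tail_stratum E M)) {P \<in> (\<lambda>I. cls ` I) ` S. f P \<in> V}"
      unfolding openin_subtopology rng.openin_zariski[OF rng_LA] zariski_open_def S eq
      by (intro exI[of _ "{P \<in> prime_spectrum LA. \<not> cls ` upw J \<subseteq> P}"] exI[of _ "cls ` upw J"]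
            conjI image_ideal[OF ui] refl)
  qed
  have cont_g: "continuous_map (zariski LK) (subtopology (zariski LA) (tail_stratum E M)) g"
    unfolding continuous_map topS topL
  proof (intro conjI allI impI)
    show "g ` prime_spectrum LK \<subseteq> (\<lambda>I. cls ` I) ` S" using upw by (auto simp: g_def)
    fix V assume "openin (subtopology (zariski LA) (tail_stratum E M)) V"
    then obtain A where A: "two_sided_ideal A LA" "V = {P \<in> prime_spectrum LA. \<not> A \<subseteq> P} \<inter> tail_stratum E M"
      unfolding openin_subtopology rng.openin_zariski[OF rng_LA] zariski_open_def by blast
    then obtain B where B: "idl B" "A = cls ` B" using two_sided_ideal_LA_iff by blast
    have "g J \<in> V \<longleftrightarrow> \<not> down B \<subseteq> J" if J: "J \<in> prime_spectrum LK" for J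
    proof -
      have "cls ` upw J \<in> (\<lambda>I. cls ` I) ` S" using upw[OF J] by blast
      then have "g J \<in> V \<longleftrightarrow> \<not> B \<subseteq> upw J"
        using spec cls_image_subset_iff[OF B(1) Sid(1)[OF upw[OF J]]] by (auto simp: g_def A(2) B(2) S)
      also have "\<dots> \<longleftrightarrow> \<not> down B \<subseteq> down (upw J)"
        using subset_iff_dn[OF cm _ B(1)] upw[OF J] by (simp add: S_def down_def)
      finally show ?thesis by (simp add: du lid[OF J])
    qed
    then have "{J \<in> prime_spectrum LK. g J \<in> V} = {J \<in> prime_spectrum LK. \<not> down B \<subseteq> J}" by blast
    moreover have "two_sided_ideal (down B) LK" using dn_ideal[OF cm B(1)] by (simp add: down_def)
    ultimately show "openin (zariski LK) {J \<in> prime_spectrum LK. g J \<in> V}"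
      unfolding rng.openin_zariski[OF rng_laurent] zariski_open_def by blast
  qed
  have "homeomorphic_maps (subtopology (zariski LA) (tail_stratum E M)) (zariski LK) f g"
    unfolding homeomorphic_maps_def topS topL
  proof (intro conjI cont_f cont_g ballI)
    show "g (f P) = P" if "P \<in> (\<lambda>I. cls ` I) ` S" for P using that ud f by (auto simp: g_def)
    show "f (g J) = J" if "J \<in> prime_spectrum LK" for J using f[OF upw[OF that]] du[OF lid[OF that]] by (simp add: g_def)
  qed
  then show ?thesis unfolding homeomorphic_space_def by blast
qed

lemma laurent_primes: "{0} \<in> prime_spectrum LK" "{f. laurent_one f = 0} \<in> prime_spectrum LK" "{0} \<noteq> {f. laurent_one f = (0 :: 'k)}"
  using laurent_prime_0 laurent_prime_one laurent_X1 by (auto simp: prime_spectrum_def)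

text \<open>The Laurent polynomials have the two primes \<open>0\<close> and the kernel of
  evaluation at \<open>1\<close>. This alone separates the two kinds of strata.\<close>

lemma homeomorphic_laurent_two:
  assumes "subtopology (zariski LA) S homeomorphic_space zariski LK" "S \<subseteq> prime_spectrum LA"
  shows "\<exists>P\<in>S. \<exists>Q\<in>S. P \<noteq> Q"
proof -
  obtain f g where h: "homeomorphic_maps (subtopology (zariski LA) S) (zariski LK) f g"
    using assms(1) unfolding homeomorphic_space_def by blast
  have "g J \<in> S" "f (g J) = J" if "J \<in> prime_spectrum LK" for J
    using h that unfolding homeomorphic_maps_def continuous_map
    by (auto simp: rng.topspace_zariski[OF rng_laurent])
  then show ?thesis using laurent_primes by metis
qed

lemma vertex_ideal_H_prime:
  assumes "infinite (UNIV :: 'k set)" "maximal_tail E M"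
  shows "H_prime LA (torus_action E) (cls ` vertex_ideal (verts E - M))"
  unfolding H_prime_LA_iff[OF assms(1)] using PM_prime[OF assms(2)] PM_graded[OF assms(2)] by blast

lemma H_prime_vertex_ideal:
  assumes inf: "infinite (UNIV :: 'k set)"
  shows "H_prime LA (torus_action E) P \<longleftrightarrow> (\<exists>M. maximal_tail E M \<and> P = cls ` vertex_ideal (verts E - M))"
proof
  assume "H_prime LA (torus_action E) P"
  then obtain I where I: "prime_idl I" "graded I" "P = cls ` I" using H_prime_LA_iff[OF inf] by blast
  have M: "maximal_tail E (verts E - verts_of I)" using prime_maximal_tail[OF I(1)] .
  have "I = vertex_ideal (verts E - (verts E - verts_of I))"
    using I by (intro graded_unique[OF M]) (auto simp: prime_idl_def verts_of_def)
  then show "\<exists>M. maximal_tail E M \<and> P = cls ` vertex_ideal (verts E - M)" using M I(3) by blast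
qed (use vertex_ideal_H_prime[OF inf] in blast)

lemma ideal_vertices_vertex_ideal:
  assumes "maximal_tail E M"
  shows "ideal_vertices E (cls ` vertex_ideal (verts E - M)) = verts E - M"
    "verts E - ideal_vertices E (cls ` vertex_ideal (verts E - M)) = M"
  using verts_of_PM[OF assms] ideal_vertices_image[OF PM_idl[OF assms]] tail_subset[OF assms] by auto

lemma vertex_ideal_in_stratum:
  assumes "maximal_tail E M"
  shows "cls ` vertex_ideal (verts E - M) \<in> tail_stratum E M"
  unfolding tail_stratum_LA using PM_prime[OF assms] verts_of_PM[OF assms] by blast

lemma stratum_superset:
  assumes "maximal_tail E M" "Q \<in> tail_stratum E M"
  shows "cls ` vertex_ideal (verts E - M) \<subseteq> Q"
  using assms vertex_ideal_subset_stratum unfolding tail_stratum_LA by blast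

text \<open>The graded primes are ordered like their vertex sets, so a prime with the vertices of
  \<open>M\<close> contains no graded prime beyond that of \<open>M\<close>. Conversely, a prime of
  the stratum lies over the graded prime of its own tail \<open>M'\<close>; maximality and inclusion
  compare the vertex sets in both directions, so that \<open>M' = M\<close>.\<close>

lemma H_stratum_eq:
  assumes inf: "infinite (UNIV :: 'k set)" and M: "maximal_tail E M"
  shows "H_stratum LA (torus_action E) (cls ` vertex_ideal (verts E - M)) = tail_stratum E M"
proof (intro equalityI subsetI)
  let ?P = "\<lambda>M. cls ` vertex_ideal (verts E - M)"
  fix Q :: "('v, 'e, 'k) lpa_elem set" assume Q: "Q \<in> tail_stratum E M"
  have "P' \<subseteq> ?P M" if P': "H_prime LA (torus_action E) P'" "P' \<subseteq> Q" for P'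
  proof -
    obtain M' where M': "maximal_tail E M'" "P' = ?P M'" using P'(1) H_prime_vertex_ideal[OF inf] by blast
    have "ideal_vertices E P' \<subseteq> ideal_vertices E Q" using P'(2) by (auto simp: ideal_vertices_def)
    moreover have "ideal_vertices E Q = verts E - M" using Q by (simp add: tail_stratum_def)
    ultimately have "verts E - M' \<subseteq> verts E - M" using ideal_vertices_vertex_ideal(1)[OF M'(1)] M'(2) by simp
    then have "vertex_ideal (verts E - M') \<subseteq> vertex_ideal (verts E - M)"
      using PM_least[OF M'(1) PM_idl[OF M]] verts_of_PM[OF M] by simp
    then show ?thesis unfolding M'(2) by (rule image_mono)
  qed
  then show "Q \<in> H_stratum LA (torus_action E) (?P M)"
    unfolding H_stratum_def using Q stratum_superset[OF M Q] vertex_ideal_H_prime[OF inf M]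
    by (simp add: tail_stratum_def)
next
  let ?P = "\<lambda>M. cls ` vertex_ideal (verts E - M)"
  fix Q assume "Q \<in> H_stratum LA (torus_action E) (?P M)"
  then have Q: "Q \<in> prime_spectrum LA" "?P M \<subseteq> Q" "\<And>P'. H_prime LA (torus_action E) P' \<Longrightarrow> P' \<subseteq> Q \<Longrightarrow> P' \<subseteq> ?P M"
    unfolding H_stratum_def by blast+
  obtain I where I: "prime_idl I" "Q = cls ` I" using Q(1) by (auto simp: prime_spectrum_LA)
  have i: "idl I" using I(1) by (simp add: prime_idl_def)
  define M' where "M' = verts E - verts_of I"
  have M': "maximal_tail E M'" "verts_of I = verts E - M'" using prime_maximal_tail[OF I(1)] by (auto simp: M'_def verts_of_def)
  have QM': "Q \<in> tail_stratum E M'" unfolding tail_stratum_LA using I M' by blast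
  have "?P M' \<subseteq> ?P M" using Q(3) vertex_ideal_H_prime[OF inf M'(1)] stratum_superset[OF M'(1) QM'] by blast
  then have "ideal_vertices E (?P M') \<subseteq> ideal_vertices E (?P M)" unfolding ideal_vertices_def by blast
  then have "verts E - M' \<subseteq> verts E - M" unfolding ideal_vertices_vertex_ideal(1)[OF M] ideal_vertices_vertex_ideal(1)[OF M'(1)] .
  moreover have "ideal_vertices E (?P M) \<subseteq> ideal_vertices E Q" using Q(2) unfolding ideal_vertices_def by blast
  then have "verts E - M \<subseteq> verts E - M'"
    unfolding ideal_vertices_vertex_ideal(1)[OF M] using QM' by (simp add: tail_stratum_def)
  ultimately show "Q \<in> tail_stratum E M" using QM' by (simp add: tail_stratum_def)
qed

text \<open>Both equivalences of (c) are read off from these alternatives: either the stratum is a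
  point, or it contains a prime strictly above \<open>P\<close>.\<close>

lemma stratum_dichotomy:
  assumes inf: "infinite (UNIV :: 'k set)" and M: "maximal_tail E M"
  defines "P \<equiv> cls ` vertex_ideal (verts E - M)"
  shows "(primitive_ideal LA P \<and> tail_stratum E M = {P}) \<or>
    (\<not> primitive_ideal LA P \<and> (\<exists>Q\<in>tail_stratum E M. P \<subseteq> Q \<and> Q \<noteq> P) \<and>
     subtopology (zariski LA) (tail_stratum E M) homeomorphic_space zariski LK)"
proof (cases "\<exists>v. exitless M v")
  case False
  then have no: "\<not> exitless M v" for v by blast
  obtain p where p: "ipath p" "verts_of (chen_ann p) = verts E - M" using cofinal_chen_ann[OF M] by blast
  have "chen_ann p = vertex_ideal (verts E - M)" using no_exitless_unique[OF M chen_ann_idl p(2) no] .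
  then have "primitive_ideal LA P" using chen_ann_primitive[OF p(1)] by (simp add: P_def)
  moreover have "tail_stratum E M = {P}"
  proof -
    have "I = vertex_ideal (verts E - M)" if "prime_idl I" "verts_of I = verts E - M" for I
      using no_exitless_unique[OF M _ that(2) no] that(1) by (simp add: prime_idl_def)
    then show ?thesis using vertex_ideal_in_stratum[OF M] unfolding tail_stratum_LA P_def by blast
  qed
  ultimately show ?thesis by blast
next
  case True
  then obtain v where v: "exitless M v" by blast
  obtain \<phi> where cm: "corner_map (vertex_ideal (verts E - M)) (vx v) \<phi>" using exitless_corner_map[OF M v] by blast
  have np: "\<not> primitive_ideal LA P" unfolding P_def by (rule corner_not_primitive[OF cm])
  have h: "subtopology (zariski LA) (tail_stratum E M) homeomorphic_space zariski LK"
    by (rule stratum_homeomorphic[OF M v])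
  have "tail_stratum E M \<subseteq> prime_spectrum LA" by (auto simp: tail_stratum_def)
  then obtain Q where "Q \<in> tail_stratum E M" "Q \<noteq> P" using homeomorphic_laurent_two[OF h] by metis
  then show ?thesis using np h stratum_superset[OF M, of Q] unfolding P_def by blast
qed

lemma stratum_singleton_not_laurent:
  assumes "P \<in> prime_spectrum LA"
  shows "\<not> subtopology (zariski LA) {P} homeomorphic_space zariski LK"
  using homeomorphic_laurent_two[of "{P}"] assms by blast

end

theorem mainTheorem3:
  fixes E :: "('v, 'e) pre_digraph"
    and L :: "('k::field, ('v, 'e, 'k) lpa_elem) module"
    and \<alpha> :: "'k \<Rightarrow> ('v, 'e, 'k) lpa_elem \<Rightarrow> ('v, 'e, 'k) lpa_elem"
  assumes "infinite (UNIV :: 'k set)"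
    and "wf_digraph E" and "row_finite E"
    and "L = leavitt_path_algebra E"
    and "\<alpha> = torus_action E"
  shows "(\<forall>h::'k. h \<noteq> 0 \<longrightarrow> (\<exists>!f. torus_map E h f)) \<and>
    rational_action L \<alpha> \<and>
    prime_spectrum L = (\<Union>M\<in>{M. maximal_tail E M}. tail_stratum E M) \<and>
    (\<forall>M N. maximal_tail E M \<longrightarrow> maximal_tail E N \<longrightarrow> M \<noteq> N \<longrightarrow>
       (tail_stratum E M :: ('v, 'e, 'k) lpa_elem set set) \<inter> tail_stratum E N = {}) \<and>
    {P. H_prime L \<alpha> P} = {P. prime_two_sided_ideal L P \<and> lpa_graded_ideal E P} \<and>
    bij_betw (\<lambda>P. verts E - ideal_vertices E P) {P. H_prime L \<alpha> P} {M. maximal_tail E M} \<and>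
    (\<forall>P. H_prime L \<alpha> P \<longrightarrow> H_stratum L \<alpha> P = tail_stratum E (verts E - ideal_vertices E P)) \<and>
    (\<forall>P. H_prime L \<alpha> P \<longrightarrow>
       (primitive_ideal L P \<longleftrightarrow> (\<forall>Q\<in>H_stratum L \<alpha> P. P \<subseteq> Q \<longrightarrow> Q = P))) \<and>
    (\<forall>P. H_prime L \<alpha> P \<longrightarrow>
       (\<not> primitive_ideal L P \<longleftrightarrow>
        subtopology (zariski L) (H_stratum L \<alpha> P) homeomorphic_space
          zariski (laurent_algebra :: ('k, int \<Rightarrow>\<^sub>0 'k) module)))"
proof -
  interpret G: leavitt E "TYPE('k)"
    using assms(2,3) by (simp add: leavitt_def leavitt_axioms_def)
  note inf = assms(1) and L = assms(4) and al = assms(5)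
  let ?P = "\<lambda>M. lpa_class E ` G.vertex_ideal (verts E - M)"
  have H: "H_prime L \<alpha> P \<longleftrightarrow> (\<exists>M. maximal_tail E M \<and> P = ?P M)" for P
    unfolding L al by (rule G.H_prime_vertex_ideal[OF inf])
  note iv = G.ideal_vertices_vertex_ideal(2)
  have str: "H_stratum L \<alpha> (?P M) = tail_stratum E M" if "maximal_tail E M" for M
    unfolding L al by (rule G.H_stratum_eq[OF inf that])
  have spec: "prime_spectrum L = (\<Union>M\<in>{M. maximal_tail E M}. tail_stratum E M)"
  proof (intro equalityI subsetI)
    fix Q assume "Q \<in> prime_spectrum L"
    then obtain I where I: "G.prime_idl I" "Q = lpa_class E ` I" unfolding L G.prime_spectrum_LA by blast
    have "maximal_tail E (verts E - G.verts_of I)" by (rule G.prime_maximal_tail[OF I(1)])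
    moreover have "Q \<in> tail_stratum E (verts E - G.verts_of I)"
      unfolding G.tail_stratum_LA using I by (auto simp: G.verts_of_def)
    ultimately show "Q \<in> (\<Union>M\<in>{M. maximal_tail E M}. tail_stratum E M)" by blast
  qed (auto simp: tail_stratum_def L)
  have disj: "(tail_stratum E M :: ('v, 'e, 'k) lpa_elem set set) \<inter> tail_stratum E N = {}"
    if "maximal_tail E M" "maximal_tail E N" "M \<noteq> N" for M N
  proof -
    have "verts E - M \<noteq> verts E - N"
      using G.tail_subset[OF that(1)] G.tail_subset[OF that(2)] that(3) by blast
    then show ?thesis by (auto simp: tail_stratum_def)
  qed
  have gr: "{P. H_prime L \<alpha> P} = {P. prime_two_sided_ideal L P \<and> lpa_graded_ideal E P}"
  proof (rule Collect_cong)
    fix P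
    have "(\<exists>I. G.prime_idl I \<and> G.graded I \<and> P = lpa_class E ` I)
      \<longleftrightarrow> (\<exists>I. G.prime_idl I \<and> P = lpa_class E ` I) \<and> lpa_graded_ideal E P"
    proof -
      have "G.graded I \<longleftrightarrow> lpa_graded_ideal E (lpa_class E ` I)" if "G.prime_idl I" for I
        using G.graded_ideal_LA_iff that by (simp add: G.prime_idl_def)
      then show ?thesis by auto
    qed
    then show "H_prime L \<alpha> P \<longleftrightarrow> prime_two_sided_ideal L P \<and> lpa_graded_ideal E P"
      unfolding L al G.H_prime_LA_iff[OF inf] G.prime_LA_iff .
  qed
  \<comment> \<open>The inverse sends \<open>M\<close> to the ideal generated by the vertices
    outside \<open>M\<close>.\<close>
  have bij: "bij_betw (\<lambda>P. verts E - ideal_vertices E P) {P. H_prime L \<alpha> P} {M. maximal_tail E M}"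
    by (rule bij_betw_byWitness[where f' = ?P]) (auto simp: H iv)
  have prim: "primitive_ideal L P \<longleftrightarrow> (\<forall>Q\<in>H_stratum L \<alpha> P. P \<subseteq> Q \<longrightarrow> Q = P)"
    and npr: "\<not> primitive_ideal L P \<longleftrightarrow> subtopology (zariski L) (H_stratum L \<alpha> P) homeomorphic_space
          zariski (laurent_algebra :: ('k, int \<Rightarrow>\<^sub>0 'k) module)" if P: "H_prime L \<alpha> P" for P
  proof -
    obtain M where M: "maximal_tail E M" "P = ?P M" using P H by blast
    note d = G.stratum_dichotomy[OF inf M(1), folded M(2) L]
    have s: "H_stratum L \<alpha> P = tail_stratum E M" using str[OF M(1)] M(2) by simp
    have "P \<in> prime_spectrum L" using P by (simp add: H_prime_def prime_spectrum_def)
    then have n: "\<not> subtopology (zariski L) {P} homeomorphic_space zariski (laurent_algebra :: ('k, int \<Rightarrow>\<^sub>0 'k) module)"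
      using G.stratum_singleton_not_laurent by (simp add: L)
    show "primitive_ideal L P \<longleftrightarrow> (\<forall>Q\<in>H_stratum L \<alpha> P. P \<subseteq> Q \<longrightarrow> Q = P)"
      unfolding s using d by blast
    show "\<not> primitive_ideal L P \<longleftrightarrow> subtopology (zariski L) (H_stratum L \<alpha> P) homeomorphic_space
          zariski (laurent_algebra :: ('k, int \<Rightarrow>\<^sub>0 'k) module)"
      unfolding s using d n by auto
  qed
  have tor: "\<forall>h::'k. h \<noteq> 0 \<longrightarrow> (\<exists>!f. torus_map E h f)" by (simp add: G.torus_map_ex1)
  have rat: "rational_action L \<alpha>" unfolding L al by (rule G.rational_action_torus)
  have strat: "\<forall>P. H_prime L \<alpha> P \<longrightarrow> H_stratum L \<alpha> P = tail_stratum E (verts E - ideal_vertices E P)"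
    using H str iv by auto
  show ?thesis
    by (intro conjI tor rat spec gr bij strat allI impI disj prim npr)
qed

end
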